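(* Let $r\ge 2$, let $\mathbf t$ be a type of order $r-1$ and let $\phi_r(x)$ be a representative of $\mathbf t$. Let $f(x)\in\mathcal O[x]$ be a monic polynomial such that $\omega_r(f)>0$. Suppose that $N_r^-(f)$ has exactly $g$ sides $S_1,\dots,S_g$, with pairwise different slopes $\lambda_{r,1},\dots,\lambda_{r,g}$ (one of which may be $-\infty$). Then $f_{\mathbf t}(x)$ admits a factorization $f_{\mathbf t}(x)=F_1(x)\cdots F_g(x)$ as a product of $g$ monic polynomials of $\mathcal O[x]$ satisfying, for all $1\le i\le g$: (1) $N_r(F_i)$ is equal to $S_i$ up to a translation; (2) if $S_i$ has finite slope, then $R_{\lambda_{r,i}}(F_i)(y)\sim R_{\lambda_{r,i}}(f)(y)$; (3) for any root $\theta\in\overline{\mathbb Q}_p$ of $F_i(x)$, $v(\phi_r(\theta))=(v_r(\phi_r)+|\lambda_{r,i}|)/(e_1\cdots e_{r-1})$.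
   Context: Setting. $p$ is a prime, $\overline{\mathbb Q}_p$ an algebraic closure of $\mathbb Q_p$, $K\subset\overline{\mathbb Q}_p$ a finite extension of $\mathbb Q_p$ with ring of integers $\mathcal O$, maximal ideal $\mathfrak m$, fixed prime element $\pi$, residue field $\mathbb F$; $v\colon\overline{\mathbb Q}_p\to\mathbb Q\cup\{\infty\}$ is the valuation with $v(K^* )=\mathbb Z$. Put $v(\sum_j b_jx^j)=\min_j v(b_j)$ on $\mathcal O[x]$. A bar denotes reduction to the residue field. For polynomials over a field, $\varphi\sim\psi$ means $\varphi=c\psi$ with a nonzero constant $c$. Empty products are $1$. Principal polygons. A side of slope $\lambda=-h/e$ ($h,e$ positive coprime integers) is a segment of slope $\lambda$ whose end points have nonnegative integer coordinates (a single such point is allowed); its length $\ell(S)$ and height $H(S)$ are the lengths of its horizontal and vertical projections and its degree is $d(S)=\ell(S)/e$. A side of slope $-\infty$ has a positive integer length $\ell$, height $\infty$, degree $1$, a finite end point $(s,u)$, and is thought of as starting at $(s-\ell,\infty)$. A principal polygon $N$ consists of at most one side of slope $-\infty$ followed by a finite part that is a point or a chain of sides of positive length with strictly increasing finite negative slopes; "the sides of $N$" are these sides of positive length, and $\ell(N)$ is the sum of their lengths. For $\lambda\in\mathbb Q_{<0}$, $S_\lambda(N)$ is the set of points $(x,y)$ of the finite part of $N$ at which $y+|\lambda|x$ is minimal: a side of slope $\lambda$, possibly a single point. Types. A type of order $0$ is a monic irreducible polynomial $\mathbf t=\psi_0(y)\in\mathbb F[y]$. A type of order $n\ge1$ is a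 sequence $\mathbf t=(\phi_1(x);\lambda_1,\phi_2(x);\dots;\lambda_{n-1},\phi_n(x);\lambda_n,\psi_n(y))$ with $\phi_i\in\mathcal O[x]$ monic, $\lambda_i=-h_i/e_i$ negative rationals ($h_i,e_i$ positive coprime integers), such that: $\phi_1$ is irreducible modulo $\mathfrak m$, with reduction $\psi_0$; for $1\le i<n$, $N_i(\phi_{i+1})$ has a single side, of positive length and slope $\lambda_i$, $R_i(\phi_{i+1})\sim\psi_i$ with $\psi_i\in\mathbb F_i[y]$ monic irreducible, and $\deg\phi_{i+1}=m_ie_if_i$; and $\psi_n\in\mathbb F_n[y]$ is monic irreducible, $\psi_n\ne y$. Here $\mathbb F_0=\mathbb F$, $\mathbb F_{i+1}=\mathbb F_i[y]/(\psi_i)$, $z_i\in\mathbb F_{i+1}$ is the class of $y$, $f_i=\deg\psi_i$, $m_i=\deg\phi_i$ for $1\le i\le n$, $m_{n+1}=m_ne_nf_n$, $m_1=f_0$, and $\ell_i,\ell_i'$ are fixed integers with $\ell_ih_i-\ell_i'e_i=1$. Operators attached to $\mathbf t$, recursively, for nonzero $P\in\mathcal O[x]$. $v_1=v$, $\omega_1(P)=\mathrm{ord}_{\psi_0}(\overline{P(y)/\pi^{v(P)}})$. For $i\ge1$ let $P=\sum_j a_j\phi_i^j$, $\deg a_j<m_i$, be the $\phi_i$-adic development and $u_j=v_i(a_j\phi_i^j)$ ($=\infty$ if $a_j=0$). $N_i(P)$ is the lower convex hull of the points $(j,u_j)$ with $a_j\ne0$, preceded by a side of slope $-\infty$ of length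 $\mathrm{ord}_{\phi_i}(P)$ if $\phi_i\mid P$; $N_i^-(P)$ is the principal polygon formed by its sides of negative slope, including $-\infty$ (its finite part is the first vertex alone if there is no finite negative slope). For an integer abscissa $j$ of the finite part of $N_i^-(P)$, the residual coefficient $c_j\in\mathbb F_i$ is $0$ if $(j,u_j)$ lies strictly above $N_i^-(P)$; if $(j,u_j)$ lies on it, $c_j$ is the class of $a_j/\pi^{u_j}$ in $\mathcal O[x]/(\pi,\phi_1)=\mathbb F_1$ when $i=1$, and $c_j=z_{i-1}^{t(j)}R_{i-1}(a_j)(z_{i-1})$ with $t(j)=(s_{i-1}(a_j)-\ell_{i-1}u_j)/e_{i-1}\in\mathbb Z$ when $i\ge2$. For a negative rational $\lambda=-h/e$ in lowest terms, $S_\lambda(P)=S_\lambda(N_i^-(P))$ and, if $s$ is its initial abscissa and $d$ its degree, $R_\lambda(P)(y)=\sum_{k=0}^d c_{s+ke}y^k\in\mathbb F_i[y]$ (residual polynomial of order $i$). For $i\le n$: $S_i=S_{\lambda_i}$, $s_i(P)$ is the initial abscissa of $S_i(P)$, $R_i=R_{\lambda_i}$, $v_{i+1}(P)$ is $e_i$ times the ordinate at the origin of the line of slope $\lambda_i$ containing $S_i(P)$, and $\omega_{i+1}(P)=\mathrm{ord}_{\psi_i}(R_i(P))$. A monic $P$ has type $\mathbf t$ if $P\equiv\phi_1^{a_0}\pmod{\mathfrak m}$ with $a_0\ge1$ and, for $1\le i\le n$, $N_i(P)$ has a single side, of slope $\lambda_i$, and $R_i(P)\sim\psi_i^{a_i}$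 with $a_i\ge1$. A representative of $\mathbf t$ is a monic $\phi_{n+1}\in\mathcal O[x]$ of type $\mathbf t$ with $R_n(\phi_{n+1})\sim\psi_n$ (for $n=0$: monic with reduction $\psi_0$). Once it is fixed, for nonzero $P\in\mathcal O[x]$ with $\phi_{n+1}$-adic development $P=\sum_j a_j\phi_{n+1}^j$, $\deg a_j<m_{n+1}$, put $u_j=v_{n+1}(a_j\phi_{n+1}^j)$ ($=\infty$ if $a_j=0$). Then $N_{n+1}(P)$ is the lower convex hull of the points $(j,u_j)$ with $a_j\ne0$, preceded by a side of slope $-\infty$ of length $\mathrm{ord}_{\phi_{n+1}}(P)$ if $\phi_{n+1}\mid P$; $N_{n+1}^-(P)$ is the principal polygon formed by its sides of negative slope, including $-\infty$ (its finite part is the first vertex alone if there is no finite negative slope). For an integer abscissa $j$ of the finite part of $N_{n+1}^-(P)$, the residual coefficient $c_j\in\mathbb F_{n+1}$ is $0$ if $(j,u_j)$ lies strictly above $N_{n+1}^-(P)$; if $(j,u_j)$ lies on it, $c_j$ is the class of $a_j/\pi^{u_j}$ in $\mathcal O[x]/(\pi,\phi_1)=\mathbb F_1$ when $n=0$, and $c_j=z_n^{t(j)}R_n(a_j)(z_n)$ with $t(j)=(s_n(a_j)-\ell_nu_j)/e_n\in\mathbb Z$ when $n\ge1$. For a negative rational $\lambda=-h/e$ in lowest terms, $S_\lambda(P)=S_\lambda(N_{n+1}^-(P))$ and, if $s$ is its initial abscissa and $d$ its degree, $R_\lambda(P)(y)=\sum_{k=0}^d c_{s+ke}y^k\in\mathbb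 F_{n+1}[y]$ (residual polynomial of order $n+1$). If $P$ is monic with $\omega_{n+1}(P)>0$, $P_{\mathbf t}$ denotes the monic divisor of $P$ in $\mathcal O[x]$ of greatest degree that has type $\mathbf t$. In the claim $\mathbf t$ has order $n=r-1$, and $N_r^-$, $R_{\lambda_{r,i}}$ are taken in order $r$ with respect to $\phi_r$. By convention $|-\infty|=\infty$. *)

theory Defs
  imports "HOL-Analysis.Analysis"
begin

section \<open>The base field\<close>

text \<open>
  The type \<open>'a\<close> plays the role of an algebraic closure of the p-adic numbers, the type \<open>'k\<close> that of
  an algebraically closed field containing the residue field of the finite extension
  \<open>fld\<close> of \<open>qp\<close>. The map \<open>red\<close> is meaningful on the valuation ring of \<open>fld\<close> only; its image there is the residue field.
\<close>

record ('a, 'k) padic_data =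
  qp :: "'a set"
  fld :: "'a set"
  valn :: "'a \<Rightarrow> ereal"
  unif :: 'a
  red :: "'a \<Rightarrow> 'k"

definition is_subfield :: "'a::field set \<Rightarrow> bool" where
  "is_subfield A \<longleftrightarrow> 0 \<in> A \<and> 1 \<in> A \<and>
     (\<forall>x\<in>A. \<forall>y\<in>A. x - y \<in> A \<and> x * y \<in> A) \<and> (\<forall>x\<in>A. inverse x \<in> A)"

definition polys_over :: "'a::zero set \<Rightarrow> 'a poly set" where
  "polys_over A = {P. \<forall>j. coeff P j \<in> A}"

definition is_valuation :: "('a::field \<Rightarrow> ereal) \<Rightarrow> bool" where
  "is_valuation w \<longleftrightarrow>
     (\<forall>x. w x = \<infinity> \<longleftrightarrow> x = 0) \<and>
     (\<forall>x. x \<noteq> 0 \<longrightarrow> (\<exists>q::rat. w x = ereal (of_rat q))) \<and>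
     (\<forall>x y. w (x * y) = w x + w y) \<and>
     (\<forall>x y. min (w x) (w y) \<le> w (x + y))"

text \<open>
  \<open>A\<close> is a completion of the rationals with respect to the restriction of \<open>w\<close>, and this restriction
  is a positive multiple of the p-adic valuation: \<open>A\<close> is the field of p-adic numbers.
\<close>

definition is_padic_numbers :: "nat \<Rightarrow> ('a::field_char_0 \<Rightarrow> ereal) \<Rightarrow> 'a set \<Rightarrow> bool" where
  "is_padic_numbers p w A \<longleftrightarrow>
     is_subfield A \<and>
     0 < w (of_nat p) \<and>
     (\<forall>k::int. k \<noteq> 0 \<longrightarrow> w (of_int k) = ereal (of_nat (multiplicity (int p) k)) * w (of_nat p)) \<and>
     (\<forall>x\<in>A. \<forall>M::real. \<exists>q::rat. ereal M < w (x - of_rat q)) \<and>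
     (\<forall>X::nat \<Rightarrow> 'a. (\<forall>n. X n \<in> A) \<and>
        (\<forall>M::real. \<exists>n0. \<forall>m\<ge>n0. \<forall>n\<ge>n0. ereal M < w (X m - X n)) \<longrightarrow>
        (\<exists>x\<in>A. \<forall>M::real. \<exists>n0. \<forall>n\<ge>n0. ereal M < w (X n - x)))"

definition int_ring :: "('a::field, 'k) padic_data \<Rightarrow> 'a set" where
  "int_ring D = {x \<in> fld D. 0 \<le> valn D x}"

definition max_ideal :: "('a::field, 'k) padic_data \<Rightarrow> 'a set" where
  "max_ideal D = {x \<in> fld D. 0 < valn D x}"

definition padic_setting ::
  "nat \<Rightarrow> ('a::{alg_closed_field,field_char_0}, 'k::alg_closed_field) padic_data \<Rightarrow> bool" where
  "padic_setting p D \<longleftrightarrow>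
     prime p \<and>
     is_valuation (valn D) \<and>
     is_padic_numbers p (valn D) (qp D) \<and>
     (\<forall>x. \<exists>P\<in>polys_over (qp D). P \<noteq> 0 \<and> poly P x = 0) \<and>
     is_subfield (fld D) \<and> qp D \<subseteq> fld D \<and>
     (\<exists>B. finite B \<and> (\<forall>x\<in>fld D. \<exists>c. (\<forall>b\<in>B. c b \<in> qp D) \<and> x = (\<Sum>b\<in>B. c b * b))) \<and>
     valn D ` (fld D - {0}) = range (\<lambda>k::int. ereal (of_int k)) \<and>
     unif D \<in> fld D \<and> valn D (unif D) = 1 \<and>
     red D 1 = 1 \<and>
     (\<forall>x\<in>int_ring D. \<forall>y\<in>int_ring D.
        red D (x + y) = red D x + red D y \<and> red D (x * y) = red D x * red D y) \<and>
     (\<forall>x\<in>int_ring D. red D x = 0 \<longleftrightarrow> x \<in> max_ideal D)"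

definition monic :: "'a::comm_semiring_1 poly \<Rightarrow> bool" where
  "monic P \<longleftrightarrow> lead_coeff P = 1"

definition sim_over :: "'k::field set \<Rightarrow> 'k poly \<Rightarrow> 'k poly \<Rightarrow> bool" where
  "sim_over A \<phi> \<psi> \<longleftrightarrow> (\<exists>c\<in>A. c \<noteq> 0 \<and> \<phi> = smult c \<psi>)"

definition irreducible_over :: "'k::field set \<Rightarrow> 'k poly \<Rightarrow> bool" where
  "irreducible_over A \<psi> \<longleftrightarrow> \<psi> \<in> polys_over A \<and> 0 < degree \<psi> \<and>
     (\<forall>g\<in>polys_over A. \<forall>h\<in>polys_over A. \<psi> = g * h \<longrightarrow> degree g = 0 \<or> degree h = 0)"

text \<open>
  For a nonconstant \<open>\<phi>\<close> and \<open>P \<noteq> 0\<close>. If both have coefficients in a subfield, divisibility over the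
  subfield and over the ambient field agree.
\<close>

definition ord_at :: "'a::field poly \<Rightarrow> 'a poly \<Rightarrow> nat" where
  "ord_at \<phi> P = Max {n. \<phi> ^ n dvd P}"

section \<open>Polygons\<close>

text \<open>
  \<open>inf_len\<close> is the length of the side of slope \<open>-\<infinity>\<close>, or 0 if there is no such side;
  \<open>fin\<close> is the set of points of the finite part. A single side is regarded as a polygon as well:
  a finite side has \<open>inf_len = 0\<close>, and the side of slope \<open>-\<infinity>\<close> has its finite end point as its
  finite part.
\<close>

record polygon =
  inf_len :: nat
  fin :: "(real \<times> real) set"

definition lower_hull :: "(real \<times> real) set \<Rightarrow> (real \<times> real) set" where
  "lower_hull A = {(x, y) \<in> convex hull A. \<forall>y'. (x, y') \<in> convex hull A \<longrightarrow> y \<le> y'}"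

text \<open>For \<open>\<mu> < 0\<close> the quantity \<open>y - \<mu> x\<close> below is \<open>y + \<bar>\<mu>\<bar> x\<close>.\<close>

definition face :: "real \<Rightarrow> (real \<times> real) set \<Rightarrow> (real \<times> real) set" where
  "face \<mu> A = {(x, y) \<in> A. \<forall>(x', y') \<in> A. y - \<mu> * x \<le> y' - \<mu> * x'}"

definition init_absc :: "(real \<times> real) set \<Rightarrow> real" where
  "init_absc S = Inf (fst ` S)"

definition seg_length :: "(real \<times> real) set \<Rightarrow> real" where
  "seg_length S = Sup (fst ` S) - Inf (fst ` S)"

definition intercept :: "real \<Rightarrow> (real \<times> real) set \<Rightarrow> real" where
  "intercept \<mu> S = (THE c. \<forall>(x, y) \<in> S. y = c + \<mu> * x)"

definition first_vertex :: "(real \<times> real) set \<Rightarrow> (real \<times> real) set" where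
  "first_vertex A = {(x, y) \<in> A. \<forall>(x', y') \<in> A. x \<le> x'}"

text \<open>Only sides of positive length count as sides of a polygon.\<close>

definition finite_slopes :: "polygon \<Rightarrow> real set" where
  "finite_slopes N = {\<mu>. 0 < seg_length (face \<mu> (fin N))}"

definition slopes :: "polygon \<Rightarrow> ereal set" where
  "slopes N = (if 0 < inf_len N then {-\<infinity>} else {}) \<union> ereal ` finite_slopes N"

definition side :: "polygon \<Rightarrow> ereal \<Rightarrow> polygon" where
  "side N \<mu> = (if \<mu> = -\<infinity> then \<lparr>inf_len = inf_len N, fin = first_vertex (fin N)\<rparr>
               else \<lparr>inf_len = 0, fin = face (real_of_ereal \<mu>) (fin N)\<rparr>)"

definition principal_part :: "polygon \<Rightarrow> polygon" where
  "principal_part N = \<lparr>inf_len = inf_len N,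
     fin = (if \<exists>\<mu>\<in>finite_slopes N. \<mu> < 0
            then \<Union>\<mu>\<in>{\<mu> \<in> finite_slopes N. \<mu> < 0}. face \<mu> (fin N)
            else first_vertex (fin N))\<rparr>"

definition translate_of :: "polygon \<Rightarrow> polygon \<Rightarrow> bool" where
  "translate_of N M \<longleftrightarrow> inf_len N = inf_len M \<and> (\<exists>w. fin N = (\<lambda>q. w + q) ` fin M)"

section \<open>Newton polygon and residual polynomial with respect to one key polynomial\<close>

definition adic :: "'a::field poly \<Rightarrow> 'a poly \<Rightarrow> nat \<Rightarrow> 'a poly" where
  "adic \<phi> P j = (P div \<phi> ^ j) mod \<phi>"

text \<open>The argument \<open>V\<close> is the valuation \<open>v\<^sub>i\<close> of nonzero polynomials.\<close>

definition newton_polygon :: "('a::field poly \<Rightarrow> int) \<Rightarrow> 'a poly \<Rightarrow> 'a poly \<Rightarrow> polygon" where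
  "newton_polygon V \<phi> P = \<lparr>inf_len = ord_at \<phi> P,
     fin = lower_hull {(real j, real_of_int (V (adic \<phi> P j * \<phi> ^ j))) | j. adic \<phi> P j \<noteq> 0}\<rparr>"

text \<open>For a slope \<open>\<mu> = -h/e\<close> in lowest terms: \<open>h\<close> and \<open>e\<close>.\<close>

definition slope_num :: "rat \<Rightarrow> int" where
  "slope_num \<mu> = - fst (quotient_of \<mu>)"

definition slope_den :: "rat \<Rightarrow> int" where
  "slope_den \<mu> = snd (quotient_of \<mu>)"

definition segment :: "('a::field poly \<Rightarrow> int) \<Rightarrow> 'a poly \<Rightarrow> rat \<Rightarrow> 'a poly \<Rightarrow> (real \<times> real) set" where
  "segment V \<phi> \<mu> P = face (of_rat \<mu>) (fin (principal_part (newton_polygon V \<phi> P)))"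

text \<open>
  \<open>C a u\<close> is the residual coefficient attached to a point \<open>(j, u)\<close> of the principal polygon that comes
  from the coefficient \<open>a\<close> of the development.
\<close>

definition residual_coeff ::
  "('a::field poly \<Rightarrow> int) \<Rightarrow> ('a poly \<Rightarrow> int \<Rightarrow> 'k::field) \<Rightarrow> 'a poly \<Rightarrow> 'a poly \<Rightarrow> nat \<Rightarrow> 'k" where
  "residual_coeff V C \<phi> P j =
     (let a = adic \<phi> P j; u = V (a * \<phi> ^ j)
      in if a \<noteq> 0 \<and> (real j, real_of_int u) \<in> fin (principal_part (newton_polygon V \<phi> P))
         then C a u else 0)"

definition residual_poly ::
  "('a::field poly \<Rightarrow> int) \<Rightarrow> ('a poly \<Rightarrow> int \<Rightarrow> 'k::field) \<Rightarrow> 'a poly \<Rightarrow> rat \<Rightarrow> 'a poly \<Rightarrow> 'k poly" where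
  "residual_poly V C \<phi> \<mu> P =
     (let S = segment V \<phi> \<mu> P; e = nat (slope_den \<mu>);
          s = nat \<lfloor>init_absc S\<rfloor>; d = nat \<lfloor>seg_length S / real e\<rfloor>
      in \<Sum>k\<le>d. monom (residual_coeff V C \<phi> P (s + k * e)) k)"

section \<open>Types and their operators\<close>

text \<open>
  The data of a type of order \<open>n\<close> are \<open>phi i\<close>, \<open>lam i\<close>, \<open>ell i\<close>, \<open>ell' i\<close> for \<open>1 \<le> i \<le> n\<close>
  and \<open>psi i\<close>, \<open>zee i\<close> for \<open>0 \<le> i \<le> n\<close>; \<open>phi (n + 1)\<close> is reserved for a representative, and values
  at other indices are irrelevant. The fields \<open>F\<^sub>i\<close> are realized inside \<open>'k\<close>: \<open>F\<^sub>i\<^sub>+\<^sub>1\<close> is the image of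
  \<open>F\<^sub>i[y]\<close> under evaluation at a root \<open>zee i\<close> of \<open>psi i\<close>, so it is a copy of \<open>F\<^sub>i[y]/(\<psi>\<^sub>i)\<close> in which
  \<open>zee i\<close> is the class of \<open>y\<close>. The root is an arbitrary part of the data.
\<close>

record (overloaded) ('a, 'k) type_data =
  phi :: "nat \<Rightarrow> 'a poly"
  lam :: "nat \<Rightarrow> rat"
  psi :: "nat \<Rightarrow> 'k poly"
  zee :: "nat \<Rightarrow> 'k"
  ell :: "nat \<Rightarrow> int"
  ell' :: "nat \<Rightarrow> int"

primrec residue_field ::
  "('a::field, 'k::field) padic_data \<Rightarrow> ('a, 'k) type_data \<Rightarrow> nat \<Rightarrow> 'k set" where
  "residue_field D T 0 = red D ` int_ring D"
| "residue_field D T (Suc i) = (\<lambda>g. poly g (zee T i)) ` polys_over (residue_field D T i)"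

abbreviation e_of :: "('a::zero, 'k::zero) type_data \<Rightarrow> nat \<Rightarrow> int" where
  "e_of T i \<equiv> slope_den (lam T i)"

abbreviation h_of :: "('a::zero, 'k::zero) type_data \<Rightarrow> nat \<Rightarrow> int" where
  "h_of T i \<equiv> slope_num (lam T i)"

text \<open>The valuation takes integer values on nonzero elements of the field, so \<open>floor\<close> only converts types.\<close>

definition gauss_val :: "('a::field, 'k) padic_data \<Rightarrow> 'a poly \<Rightarrow> int" where
  "gauss_val D P = Min ((\<lambda>j. \<lfloor>real_of_ereal (valn D (coeff P j))\<rfloor>) ` {j. coeff P j \<noteq> 0})"

definition reduce :: "('a::field, 'k::field) padic_data \<Rightarrow> 'a poly \<Rightarrow> 'k poly" where
  "reduce D P = map_poly (red D) P"

text \<open>\<open>v\<^sub>i\<close> for \<open>i \<ge> 1\<close>.\<close>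

fun val :: "('a::field, 'k::field) padic_data \<Rightarrow> ('a, 'k) type_data \<Rightarrow> nat \<Rightarrow> 'a poly \<Rightarrow> int" where
  "val D T (Suc 0) = gauss_val D"
| "val D T (Suc (Suc i)) = (\<lambda>P. \<lfloor>of_int (e_of T (Suc i)) *
     intercept (of_rat (lam T (Suc i)))
       (segment (val D T (Suc i)) (phi T (Suc i)) (lam T (Suc i)) P)\<rfloor>)"

text \<open>
  The residual coefficients of order \<open>i \<ge> 1\<close>. In order 1 the class of a polynomial in
  \<open>\<O>[x]/(\<pi>, \<phi>\<^sub>1)\<close> is the value of its reduction at \<open>zee 0\<close>. The integer division in higher order is
  exact.
\<close>

fun coeff_class ::
  "('a::field, 'k::field) padic_data \<Rightarrow> ('a, 'k) type_data \<Rightarrow> nat \<Rightarrow> 'a poly \<Rightarrow> int \<Rightarrow> 'k" where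
  "coeff_class D T (Suc 0) =
     (\<lambda>a u. poly (reduce D (smult (inverse (unif D powi u)) a)) (zee T 0))"
| "coeff_class D T (Suc (Suc i)) =
     (\<lambda>a u. let j = Suc i; V = val D T j;
                s = \<lfloor>init_absc (segment V (phi T j) (lam T j) a)\<rfloor>
            in zee T j powi ((s - ell T j * u) div e_of T j) *
               poly (residual_poly V (coeff_class D T (Suc i)) (phi T j) (lam T j) a) (zee T j))"

definition newton ::
  "('a::field, 'k::field) padic_data \<Rightarrow> ('a, 'k) type_data \<Rightarrow> nat \<Rightarrow> 'a poly \<Rightarrow> polygon" where
  "newton D T i P = newton_polygon (val D T i) (phi T i) P"

definition newton_minus ::
  "('a::field, 'k::field) padic_data \<Rightarrow> ('a, 'k) type_data \<Rightarrow> nat \<Rightarrow> 'a poly \<Rightarrow> polygon" where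
  "newton_minus D T i P = principal_part (newton D T i P)"

definition residual ::
  "('a::field, 'k::field) padic_data \<Rightarrow> ('a, 'k) type_data \<Rightarrow> nat \<Rightarrow> rat \<Rightarrow> 'a poly \<Rightarrow> 'k poly" where
  "residual D T i \<mu> P = residual_poly (val D T i) (coeff_class D T i) (phi T i) \<mu> P"

text \<open>\<open>\<omega>\<^sub>i\<close> for \<open>i \<ge> 1\<close>.\<close>

definition omega ::
  "('a::field, 'k::field) padic_data \<Rightarrow> ('a, 'k) type_data \<Rightarrow> nat \<Rightarrow> 'a poly \<Rightarrow> nat" where
  "omega D T i P =
     (if i = 1 then ord_at (psi T 0)
                      (reduce D (smult (inverse (unif D powi gauss_val D P)) P))
      else ord_at (psi T (i - 1)) (residual D T (i - 1) (lam T (i - 1)) P))"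

text \<open>Types of order \<open>n \<ge> 1\<close>. The degree of \<open>phi i\<close> is \<open>m\<^sub>i\<close>, the degree of \<open>psi i\<close> is \<open>f\<^sub>i\<close>.\<close>

definition is_type :: "('a::field, 'k::field) padic_data \<Rightarrow> nat \<Rightarrow> ('a, 'k) type_data \<Rightarrow> bool" where
  "is_type D n T \<longleftrightarrow>
     1 \<le> n \<and>
     (\<forall>i\<in>{1..n}. phi T i \<in> polys_over (int_ring D) \<and> monic (phi T i) \<and> lam T i < 0 \<and>
        ell T i * h_of T i - ell' T i * e_of T i = 1) \<and>
     reduce D (phi T 1) = psi T 0 \<and>
     (\<forall>i\<in>{1..<n}.
        slopes (newton D T i (phi T (i + 1))) = {ereal (of_rat (lam T i))} \<and>
        sim_over (residue_field D T i) (residual D T i (lam T i) (phi T (i + 1))) (psi T i) \<and>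
        int (degree (phi T (i + 1))) = int (degree (phi T i)) * e_of T i * int (degree (psi T i))) \<and>
     (\<forall>i\<in>{0..n}. monic (psi T i) \<and> irreducible_over (residue_field D T i) (psi T i) \<and>
        poly (psi T i) (zee T i) = 0) \<and>
     psi T n \<noteq> [:0, 1:]"

definition has_type ::
  "('a::field, 'k::field) padic_data \<Rightarrow> nat \<Rightarrow> ('a, 'k) type_data \<Rightarrow> 'a poly \<Rightarrow> bool" where
  "has_type D n T P \<longleftrightarrow>
     P \<in> polys_over (int_ring D) \<and> monic P \<and>
     (\<exists>a\<ge>1. P - phi T 1 ^ a \<in> polys_over (max_ideal D)) \<and>
     (\<forall>i\<in>{1..n}. slopes (newton D T i P) = {ereal (of_rat (lam T i))} \<and>
        (\<exists>a\<ge>1. sim_over (residue_field D T i) (residual D T i (lam T i) P) (psi T i ^ a)))"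

definition is_representative ::
  "('a::field, 'k::field) padic_data \<Rightarrow> nat \<Rightarrow> ('a, 'k) type_data \<Rightarrow> 'a poly \<Rightarrow> bool" where
  "is_representative D n T Q \<longleftrightarrow> has_type D n T Q \<and>
     sim_over (residue_field D T n) (residual D T n (lam T n) Q) (psi T n)"

definition type_part ::
  "('a::field, 'k::field) padic_data \<Rightarrow> nat \<Rightarrow> ('a, 'k) type_data \<Rightarrow> 'a poly \<Rightarrow> 'a poly" where
  "type_part D n T P = (THE G.
     let divisor = (\<lambda>H. has_type D n T H \<and> (\<exists>Q\<in>polys_over (int_ring D). P = H * Q))
     in divisor G \<and> (\<forall>H. divisor H \<longrightarrow> degree H \<le> degree G))"

end

theory Submission
  imports Defs
begin

text \<open>
  Each \<open>v\<^sub>i\<close> is a valuation on \<open>K[x]\<close>, and the residual coefficients of order \<open>i\<close> describe a graded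
  homomorphism from its graded ring to \<open>F\<^sub>i\<close> that kills \<open>\<phi>\<^sub>i\<close> and no nonzero polynomial of smaller
  degree. These properties alone yield, for every negative slope, the next valuation and a graded
  homomorphism to Laurent polynomials over \<open>F\<^sub>i\<close>; its multiplicativity is the additivity of sides and the
  multiplicativity of residual polynomials, and evaluation at a root of \<open>\<psi>\<^sub>i\<close> passes to order \<open>i + 1\<close>.

  Completeness enters only through the fact that conjugate elements have equal valuation. Let \<open>G\<close> be
  the minimal polynomial of \<open>\<theta>\<close> and \<open>H\<close> that of \<open>\<phi>\<^sub>i(\<theta>)\<close>. Then \<open>G\<close> divides \<open>H(\<phi>\<^sub>i(x))\<close>, whose
  \<open>\<phi>\<^sub>i\<close>-adic coefficients are the constants \<open>coeff H j\<close>. As all roots of \<open>H\<close> have the same valuation,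
  its Newton polygon of order \<open>i\<close> is a single side with slope determined by \<open>v(\<phi>\<^sub>i(\<theta>))\<close>, and the
  polygon of \<open>G\<close> is part of it. If \<open>v(\<phi>\<^sub>i(\<theta>))\<close> is large, the leading term dominates in order
  \<open>i - 1\<close>, so that \<open>G\<close> is there of the shape demanded by the type. The factors \<open>F\<^sub>i\<close> collect the minimal
  polynomials of the roots of \<open>f\<close> according to these slopes.
\<close>

section \<open>Polynomials with coefficients in a subring\<close>

text \<open>No Hensel lifting occurs: f is split into minimal polynomials at once, and these only
  have to be sorted. That conjugates have equal valuation rests on a bound
  \<open>nn \<beta> ^ n \<le> C * nn \<alpha> ^ n\<close> with \<open>C\<close> independent of
  \<open>n\<close>, which comes from the completeness of finite-dimensional spaces. The obstacle in
  the graded part is the normalization of residual coefficients: they carry powers of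
  \<open>zee\<close> that depend on Bezout coefficients. An initial form of degree \<open>u\<close>
  is therefore kept as a Laurent polynomial with exponents \<open>(j - l * u) div e\<close>, for
  which multiplicativity needs no correction. It is represented by its values at nonzero points of
  the algebraically closed field \<open>'k\<close>, which are infinitely many although the residue
  fields are finite. Whether a minimal polynomial belongs to the part of f of the given type is
  decided by one equation, the vanishing of its class \<open>Ci (Suc n) G (Vi (Suc n) G)\<close>.
  Its slope is \<open>Vr \<phi>r - Em n * rv (poly \<phi>r \<theta>)\<close>, where
  \<open>Em n\<close> is the product of the \<open>e_of T k\<close> and arises as the factor between
  the valuation of order \<open>Suc n\<close> and v on constants.\<close>

definition is_subring :: "'a::comm_ring_1 set \<Rightarrow> bool" where
  "is_subring A \<longleftrightarrow> 0 \<in> A \<and> 1 \<in> A \<and> (\<forall>x\<in>A. \<forall>y\<in>A. x - y \<in> A \<and> x * y \<in> A)"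

lemma is_subfield_imp_subring: "is_subfield A \<Longrightarrow> is_subring A"
  by (auto simp: is_subfield_def is_subring_def)

lemma subring_0: "is_subring A \<Longrightarrow> 0 \<in> A"
  and subring_1: "is_subring A \<Longrightarrow> 1 \<in> A"
  and subring_diff: "is_subring A \<Longrightarrow> x \<in> A \<Longrightarrow> y \<in> A \<Longrightarrow> x - y \<in> A"
  and subring_mult: "is_subring A \<Longrightarrow> x \<in> A \<Longrightarrow> y \<in> A \<Longrightarrow> x * y \<in> A"
  by (auto simp: is_subring_def)

lemma subring_uminus: "is_subring A \<Longrightarrow> x \<in> A \<Longrightarrow> - x \<in> A"
  using subring_diff[of A 0 x] by (simp add: subring_0)

lemma subring_add: "is_subring A \<Longrightarrow> x \<in> A \<Longrightarrow> y \<in> A \<Longrightarrow> x + y \<in> A"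
  using subring_diff[of A x "- y"] by (simp add: subring_uminus)

lemma subring_sum: "is_subring A \<Longrightarrow> (\<And>i. i \<in> I \<Longrightarrow> f i \<in> A) \<Longrightarrow> sum f I \<in> A"
  by (induction I rule: infinite_finite_induct) (auto simp: subring_0 intro: subring_add)

lemma subring_power: "is_subring A \<Longrightarrow> x \<in> A \<Longrightarrow> x ^ n \<in> A"
  by (induction n) (auto simp: subring_1 intro: subring_mult)

lemma subfield_inverse: "is_subfield A \<Longrightarrow> x \<in> A \<Longrightarrow> inverse x \<in> A"
  by (auto simp: is_subfield_def)

lemma subfield_power_int: "is_subfield A \<Longrightarrow> x \<in> A \<Longrightarrow> x powi n \<in> A"
  by (auto simp: power_int_def intro!: subring_power subfield_inverse is_subfield_imp_subring)

lemma is_subring_polys_over: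
  assumes A: "is_subring A"
  shows "is_subring (polys_over A)"
proof -
  have "coeff (p * q) n \<in> A" if "p \<in> polys_over A" "q \<in> polys_over A" for p q n
    unfolding coeff_mult using that
    by (intro subring_sum[OF A] subring_mult[OF A]) (auto simp: polys_over_def)
  moreover have "coeff 1 n \<in> A" for n
    using A by (cases n) (auto simp: subring_0 subring_1)
  ultimately show ?thesis
    unfolding is_subring_def using A by (auto simp: polys_over_def subring_0 subring_diff)
qed

lemmas polys_over_add = subring_add[OF is_subring_polys_over]
  and polys_over_mult = subring_mult[OF is_subring_polys_over]
  and polys_over_diff = subring_diff[OF is_subring_polys_over]
  and polys_over_uminus = subring_uminus[OF is_subring_polys_over]
  and polys_over_sum = subring_sum[OF is_subring_polys_over]
  and polys_over_power = subring_power[OF is_subring_polys_over]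
  and polys_over_0 = subring_0[OF is_subring_polys_over]
  and polys_over_1 = subring_1[OF is_subring_polys_over]

lemma polys_over_coeff: "p \<in> polys_over A \<Longrightarrow> coeff p n \<in> A"
  by (auto simp: polys_over_def)

lemma polys_over_mono: "A \<subseteq> B \<Longrightarrow> p \<in> polys_over A \<Longrightarrow> p \<in> polys_over B"
  by (auto simp: polys_over_def)

lemma polys_over_pCons_iff: "pCons a p \<in> polys_over A \<longleftrightarrow> a \<in> A \<and> p \<in> polys_over A"
proof -
  have "(\<forall>n. coeff (pCons a p) n \<in> A) \<longleftrightarrow> a \<in> A \<and> (\<forall>n. coeff p n \<in> A)"
    by (metis coeff_pCons_0 coeff_pCons_Suc not0_implies_Suc)
  thus ?thesis by (simp add: polys_over_def)
qed

lemma polys_over_const: "is_subring A \<Longrightarrow> a \<in> A \<Longrightarrow> [:a:] \<in> polys_over A"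
  by (simp add: polys_over_pCons_iff polys_over_0)

lemma polys_over_monom: "is_subring A \<Longrightarrow> a \<in> A \<Longrightarrow> monom a n \<in> polys_over A"
  by (auto simp: polys_over_def coeff_monom subring_0)

lemma polys_over_smult: "is_subring A \<Longrightarrow> a \<in> A \<Longrightarrow> p \<in> polys_over A \<Longrightarrow> smult a p \<in> polys_over A"
  by (auto simp: polys_over_def subring_mult)

lemma polys_over_pcompose:
  assumes A: "is_subring A" and "p \<in> polys_over A" "q \<in> polys_over A"
  shows "pcompose p q \<in> polys_over A"
  using assms(2)
proof (induction p)
  case 0
  thus ?case by simp
next
  case (pCons a p)
  hence "a \<in> A" "p \<in> polys_over A" by (simp_all add: polys_over_pCons_iff)
  thus ?case using pCons.IH assms(3) unfolding pcompose_pCons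
    by (intro polys_over_add[OF A] polys_over_mult[OF A] polys_over_const[OF A])
qed

text \<open>Long division by a monic polynomial never divides coefficients: each step subtracts a
  monomial multiple whose coefficient is the leading coefficient of the current dividend. Hence
  division in the ambient polynomial ring stays inside \<open>A\<close>, for \<open>K\<close> as
  well as for \<open>\<O>\<close>.\<close>

lemma polys_over_div_mod_aux:
  assumes A: "is_subring A" and B: "B \<in> polys_over A" "monic B" and P: "P \<in> polys_over A"
  shows "P div B \<in> polys_over A \<and> P mod B \<in> polys_over A"
  using P
proof (induction "degree P" arbitrary: P rule: less_induct)
  case less
  have B0: "B \<noteq> 0" using B(2) by (auto simp: monic_def)
  show ?case
  proof (cases "degree P < degree B \<or> P = 0")
    case True
    hence "P div B = 0" "P mod B = P"
      by (auto simp: div_poly_less mod_poly_less)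
    thus ?thesis using less.prems by (simp add: polys_over_0[OF A])
  next
    case False
    define T where "T = monom (lead_coeff P) (degree P - degree B)"
    define P' where "P' = P - T * B"
    have T: "T \<in> polys_over A"
      unfolding T_def using less.prems by (intro polys_over_monom[OF A] polys_over_coeff)
    have P'A: "P' \<in> polys_over A"
      unfolding P'_def using less.prems T B by (intro polys_over_diff[OF A] polys_over_mult[OF A])
    have P_eq: "P = P' + T * B" by (simp add: P'_def)
    have degT: "degree T = degree P - degree B"
      unfolding T_def using False by (intro degree_monom_eq) auto
    have T0: "T \<noteq> 0" using False by (auto simp: T_def monom_eq_0_iff)
    have degTB: "degree (T * B) = degree P"
      using False T0 B0 by (simp add: degree_mult_eq degT)
    have lc: "lead_coeff (T * B) = lead_coeff P"
      using B(2) degT by (simp add: lead_coeff_mult T_def monic_def)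
    have "P' = 0 \<or> degree P' < degree P"
    proof -
      have "coeff P' (degree P) = 0" using lc degTB by (simp add: P'_def)
      moreover have "degree P' \<le> degree P" unfolding P'_def
        using degTB by (intro degree_diff_le) auto
      ultimately show ?thesis
        by (metis le_neq_implies_less leading_coeff_0_iff)
    qed
    hence IH: "P' div B \<in> polys_over A \<and> P' mod B \<in> polys_over A"
    proof
      assume "P' = 0"
      thus ?thesis by (simp add: polys_over_0[OF A])
    next
      assume "degree P' < degree P"
      thus ?thesis by (rule less.hyps[OF _ P'A])
    qed
    have "P div B = T + P' div B" "P mod B = P' mod B"
      using B0 by (auto simp: P_eq)
    thus ?thesis using IH T by (auto intro: polys_over_add[OF A])
  qed
qed

lemmas polys_over_div = conjunct1[OF polys_over_div_mod_aux]
  and polys_over_mod = conjunct2[OF polys_over_div_mod_aux]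

lemma monic_mult: "monic p \<Longrightarrow> monic q \<Longrightarrow> monic (p * q)" for p q :: "'a::idom poly"
  by (simp add: monic_def lead_coeff_mult)

lemma monic_power: "monic p \<Longrightarrow> monic (p ^ n)" for p :: "'a::idom poly"
  by (simp add: monic_def lead_coeff_power)

lemma monic_nonzero: "monic p \<Longrightarrow> p \<noteq> 0" for p :: "'a::idom poly"
  by (auto simp: monic_def)

lemma monic_factor: "monic p \<Longrightarrow> monic (p * q) \<Longrightarrow> monic q" for p q :: "'a::idom poly"
  by (simp add: monic_def lead_coeff_mult)

lemma monic_degree_0: "monic p \<Longrightarrow> degree p = 0 \<Longrightarrow> p = 1" for p :: "'a::idom poly"
  by (metis degree_0_id lead_coeff_1 monic_def one_pCons)

section \<open>Minimal polynomials over a subfield\<close>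

text \<open>Least degree takes the place of irreducibility, because the property is used in the form
  that a nonzero polynomial over \<open>K\<close> of smaller degree does not vanish at
  \<open>\<theta>\<close>.\<close>

definition minimal_poly :: "'a::field set \<Rightarrow> 'a poly \<Rightarrow> 'a \<Rightarrow> bool" where
  "minimal_poly K G \<theta> \<longleftrightarrow> G \<in> polys_over K \<and> monic G \<and> poly G \<theta> = 0 \<and>
     (\<forall>P\<in>polys_over K. P \<noteq> 0 \<longrightarrow> poly P \<theta> = 0 \<longrightarrow> degree G \<le> degree P)"

lemma minimal_poly_degree_pos: "minimal_poly K G \<theta> \<Longrightarrow> 0 < degree G"
  using monic_degree_0[of G] by (cases "degree G = 0") (auto simp: minimal_poly_def)

lemma minimal_poly_dvd:
  assumes K: "is_subfield K" and G: "minimal_poly K G \<theta>" and P: "P \<in> polys_over K" "poly P \<theta> = 0"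
  shows "G dvd P" "P = G * (P div G)" "P div G \<in> polys_over K"
proof -
  have R: "is_subring K" using K by (rule is_subfield_imp_subring)
  have G': "G \<in> polys_over K" "monic G" "poly G \<theta> = 0" using G by (auto simp: minimal_poly_def)
  have "poly (P mod G) \<theta> = 0"
    using P(2) G'(3) by (metis minus_mult_div_eq_mod mult_eq_0_iff poly_diff poly_mult diff_0_right)
  hence "P mod G = 0"
    using G polys_over_mod[OF R G'(1,2) P(1)] degree_mod_less[of G P] minimal_poly_degree_pos[OF G]
    by (force simp: minimal_poly_def)
  thus "G dvd P" "P = G * (P div G)" by (auto simp: mod_eq_0_iff_dvd)
  show "P div G \<in> polys_over K" by (rule polys_over_div[OF R G'(1,2) P(1)])
qed

lemma minimal_poly_exists:
  assumes K: "is_subfield K" and P: "P \<in> polys_over K" "P \<noteq> 0" "poly P \<theta> = 0"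
  obtains G where "minimal_poly K G \<theta>"
proof -
  have R: "is_subring K" using K by (rule is_subfield_imp_subring)
  define good where "good = (\<lambda>P. P \<in> polys_over K \<and> P \<noteq> 0 \<and> poly P \<theta> = 0)"
  obtain G where G: "good G" "\<And>P. good P \<Longrightarrow> degree G \<le> degree P"
    using ex_has_least_nat[of good P degree] P by (auto simp: good_def)
  define G' where "G' = smult (inverse (lead_coeff G)) G"
  have "minimal_poly K G' \<theta>"
    using G polys_over_smult[OF R subfield_inverse[OF K polys_over_coeff[of G K]]]
    by (auto simp: minimal_poly_def good_def G'_def monic_def)
  thus thesis by (rule that)
qed

text \<open>Write \<open>G = H * Q\<close> with \<open>H\<close> minimal for
  \<open>\<theta>'\<close>. As \<open>\<theta>\<close> is a root of one of the factors and
  \<open>G\<close> has least degree for \<open>\<theta>\<close>, the factor \<open>Q\<close> must be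
  constant.\<close>

lemma minimal_poly_root:
  assumes K: "is_subfield K" and G: "minimal_poly K G \<theta>" and \<theta>': "poly G \<theta>' = 0"
  shows "minimal_poly K G \<theta>'"
proof -
  have G': "G \<in> polys_over K" "monic G" "poly G \<theta> = 0" using G by (auto simp: minimal_poly_def)
  obtain H where H: "minimal_poly K H \<theta>'"
    using minimal_poly_exists[OF K G'(1) monic_nonzero[OF G'(2)] \<theta>'] .
  have H': "H \<in> polys_over K" "monic H" using H by (auto simp: minimal_poly_def)
  define Q where "Q = G div H"
  have Q: "G = H * Q" "Q \<in> polys_over K"
    using minimal_poly_dvd[OF K H G'(1) \<theta>'] by (auto simp: Q_def)
  have Qm: "monic Q" using Q(1) G'(2) H'(2) monic_factor by metis
  have deg: "degree G = degree H + degree Q"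
    unfolding Q(1) using H' Qm by (simp add: degree_mult_eq monic_nonzero)
  have min: "degree G \<le> degree P" if "P \<in> polys_over K" "P \<noteq> 0" "poly P \<theta> = 0" for P
    using G that by (auto simp: minimal_poly_def)
  have "poly H \<theta> = 0 \<or> poly Q \<theta> = 0" using G'(3) Q(1) by simp
  hence "degree Q = 0"
    using min[OF H'(1)] min[OF Q(2)] H'(2) Qm deg minimal_poly_degree_pos[OF H]
    by (auto simp: monic_nonzero)
  hence "Q = 1" using Qm monic_degree_0 by blast
  thus ?thesis using H Q(1) by simp
qed

lemma irreducible_over_minimal_poly:
  assumes K: "is_subfield K" and \<psi>: "irreducible_over K \<psi>" "monic \<psi>" "poly \<psi> z = 0"
  shows "minimal_poly K \<psi> z"
proof -
  have \<psi>': "\<psi> \<in> polys_over K" "\<psi> \<noteq> 0" using \<psi> by (auto simp: irreducible_over_def)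
  obtain G where G: "minimal_poly K G z" using minimal_poly_exists[OF K \<psi>' \<psi>(3)] .
  have G': "G \<in> polys_over K" "monic G" using G by (auto simp: minimal_poly_def)
  define Q where "Q = \<psi> div G"
  have Q: "\<psi> = G * Q" "Q \<in> polys_over K"
    using minimal_poly_dvd[OF K G \<psi>'(1) \<psi>(3)] by (auto simp: Q_def)
  have "monic Q" using Q(1) \<psi>(2) G'(2) monic_factor by metis
  moreover have "degree Q = 0"
    using \<psi>(1) Q G'(1) minimal_poly_degree_pos[OF G] unfolding irreducible_over_def by (metis not_less_zero)
  ultimately have "Q = 1" by (simp add: monic_degree_0)
  thus ?thesis using Q G by simp
qed

text \<open>By descent on the degree of the polynomial: the remainder of the minimal polynomial is a multiple of the element.\<close>

lemma minimal_poly_inverse: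
  assumes K: "is_subfield K" and G: "minimal_poly K G z"
    and "g \<in> polys_over K" "g \<noteq> 0" "degree g < degree G"
  shows "\<exists>q\<in>polys_over K. poly g z * poly q z = 1"
  using assms(3-)
proof (induction "degree g" arbitrary: g rule: less_induct)
  case less
  have R: "is_subring K" using K by (rule is_subfield_imp_subring)
  have G': "G \<in> polys_over K" "monic G" "poly G z = 0" using G by (auto simp: minimal_poly_def)
  have gz: "poly g z \<noteq> 0" using G less.prems by (force simp: minimal_poly_def)
  define c where "c = lead_coeff g"
  have c: "c \<in> K" "c \<noteq> 0" using less.prems by (auto simp: c_def polys_over_def)
  define g1 where "g1 = smult (inverse c) g"
  have g1: "g1 \<in> polys_over K" "monic g1" "degree g1 = degree g"
    using c less.prems polys_over_smult[OF R subfield_inverse[OF K c(1)]]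
    by (auto simp: g1_def monic_def c_def)
  have g1z: "poly g1 z = inverse c * poly g z" by (simp add: g1_def)
  define q where "q = G div g1"
  define r where "r = G mod g1"
  have qr: "q \<in> polys_over K" "r \<in> polys_over K"
    using polys_over_div[OF R g1(1,2) G'(1)] polys_over_mod[OF R g1(1,2) G'(1)]
    by (auto simp: q_def r_def)
  have eq: "G = g1 * q + r" by (simp add: q_def r_def)
  show ?case
  proof (cases "degree g = 0")
    case True
    then obtain b where "g = [:b:]" by (metis degree_0_id)
    hence "g = [:c:]" by (simp add: c_def)
    moreover have "[:inverse c:] \<in> polys_over K"
      using c K by (intro polys_over_const[OF R] subfield_inverse)
    ultimately show ?thesis using c by (intro bexI[of _ "[:inverse c:]"]) auto
  next
    case False
    have r0: "r \<noteq> 0"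
    proof
      assume "r = 0"
      hence Geq: "G = g1 * q" using eq by simp
      hence "poly q z = 0" using G'(3) gz c by (simp add: g1z)
      moreover have "q \<noteq> 0" "degree q < degree G"
        using Geq monic_nonzero[OF G'(2)] False g1(3) by (auto simp: degree_mult_eq)
      ultimately show False using G qr(1) by (force simp: minimal_poly_def)
    qed
    have dr: "degree r < degree g"
      using degree_mod_less'[of g1 G] r0 g1(2,3) by (auto simp: r_def monic_nonzero)
    obtain s where s: "s \<in> polys_over K" "poly r z * poly s z = 1"
      using less.hyps[OF dr qr(2) r0] less.prems dr by auto
    have "poly r z = - (poly g1 z * poly q z)"
      using arg_cong[OF eq, of "\<lambda>p. poly p z"] G'(3) by (simp add: eq_neg_iff_add_eq_0 add.commute)
    hence "poly g z * poly (smult (- inverse c) (q * s)) z = 1"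
      using s(2) by (simp add: g1z algebra_simps)
    moreover have "smult (- inverse c) (q * s) \<in> polys_over K"
      using c K qr s by (intro polys_over_smult[OF R] subring_uminus[OF R] subfield_inverse polys_over_mult[OF R])
    ultimately show ?thesis by blast
  qed
qed

text \<open>Every value is the value of a remainder modulo \<open>G\<close>, and nonzero remainders
  have inverses of the same kind. This keeps each field in the tower of residue fields a subfield of
  \<open>'k\<close>.\<close>

lemma is_subfield_extension:
  assumes K: "is_subfield K" and G: "minimal_poly K G z"
  shows "is_subfield ((\<lambda>g. poly g z) ` polys_over K)"
proof -
  have R: "is_subring K" using K by (rule is_subfield_imp_subring)
  have G': "G \<in> polys_over K" "monic G" "poly G z = 0" using G by (auto simp: minimal_poly_def)
  let ?E = "(\<lambda>g. poly g z) ` polys_over K"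
  have inv: "inverse (poly g z) \<in> ?E" if g: "g \<in> polys_over K" for g
  proof (cases "poly g z = 0")
    case True
    thus ?thesis using polys_over_0[OF R] by (force intro!: image_eqI[of _ _ 0])
  next
    case False
    have eq: "poly g z = poly (g mod G) z"
      using arg_cong[OF div_mult_mod_eq[of g G], of "\<lambda>p. poly p z"] G'(3)
      by (metis add_0 mult_zero_right poly_add poly_mult)
    have "g mod G \<noteq> 0" using False eq by auto
    moreover have "degree (g mod G) < degree G"
      using calculation degree_mod_less'[of G g] monic_nonzero[OF G'(2)] by auto
    moreover have "g mod G \<in> polys_over K" by (rule polys_over_mod[OF R G'(1,2) g])
    ultimately obtain q where q: "q \<in> polys_over K" "poly (g mod G) z * poly q z = 1"
      using minimal_poly_inverse[OF K G] by blast
    hence "inverse (poly g z) = poly q z"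
      using eq by (metis inverse_unique)
    thus ?thesis using q by auto
  qed
  have "poly 0 z \<in> ?E" "poly 1 z \<in> ?E" using polys_over_0[OF R] polys_over_1[OF R] by blast+
  moreover have "poly p z - poly q z \<in> ?E" "poly p z * poly q z \<in> ?E"
    if "p \<in> polys_over K" "q \<in> polys_over K" for p q
    using polys_over_diff[OF R that] polys_over_mult[OF R that] by (auto simp flip: poly_diff poly_mult)
  ultimately show ?thesis unfolding is_subfield_def using inv by auto
qed

text \<open>Induction on the exponent: \<open>z\<close> is a root of one of the two factors, from
  which one copy of \<open>\<psi>\<close> is split off. It transfers the shape of a residual
  polynomial from a product to its factors without a theory of unique factorization over
  \<open>K\<close>.\<close>

lemma factor_of_minimal_power:
  assumes K: "is_subfield K" and \<psi>: "minimal_poly K \<psi> z"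
    and "P \<in> polys_over K" "Q \<in> polys_over K" "P * Q = smult c (\<psi> ^ n)" "c \<in> K" "c \<noteq> 0"
  shows "\<exists>a. sim_over K P (\<psi> ^ a)"
  using assms(3-)
proof (induction n arbitrary: P Q)
  case 0
  have nz: "P * Q \<noteq> 0" "degree (P * Q) = 0" using 0(3,5) by simp_all
  hence "degree P = 0" by (auto simp: degree_mult_eq)
  then obtain b where b: "P = [:b:]" by (metis degree_0_id)
  have "b \<noteq> 0" using 0(3,5) b by auto
  moreover have "b \<in> K" using 0(1) b by (simp add: polys_over_pCons_iff)
  ultimately show ?case by (intro exI[of _ 0]) (auto simp: sim_over_def b intro!: bexI[of _ b])
next
  case (Suc n)
  have \<psi>0: "\<psi> \<noteq> 0" "poly \<psi> z = 0" using \<psi> by (auto simp: minimal_poly_def monic_nonzero)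
  have "poly P z * poly Q z = 0"
    using arg_cong[OF Suc.prems(3), of "\<lambda>p. poly p z"] \<psi>0 by simp
  hence "poly P z = 0 \<or> poly Q z = 0" by simp
  thus ?case
  proof
    assume "poly P z = 0"
    note d = minimal_poly_dvd[OF K \<psi> Suc.prems(1) this]
    have "\<psi> * ((P div \<psi>) * Q) = \<psi> * smult c (\<psi> ^ n)"
      using Suc.prems(3) d(2) by (metis mult.assoc mult_smult_right power_Suc)
    hence "(P div \<psi>) * Q = smult c (\<psi> ^ n)" using \<psi>0(1) mult_left_cancel by blast
    then obtain a where "sim_over K (P div \<psi>) (\<psi> ^ a)"
      using Suc.IH[OF d(3) Suc.prems(2) _ Suc.prems(4,5)] by blast
    then obtain b where "b \<in> K" "b \<noteq> 0" "P div \<psi> = smult b (\<psi> ^ a)" by (auto simp: sim_over_def)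
    hence "sim_over K P (\<psi> ^ Suc a)" using d(2) by (auto simp: sim_over_def intro!: bexI[of _ b])
    thus ?thesis ..
  next
    assume "poly Q z = 0"
    note d = minimal_poly_dvd[OF K \<psi> Suc.prems(2) this]
    have "\<psi> * (P * (Q div \<psi>)) = \<psi> * smult c (\<psi> ^ n)"
      using Suc.prems(3) d(2) by (metis mult.left_commute mult_smult_right power_Suc)
    hence "P * (Q div \<psi>) = smult c (\<psi> ^ n)" using \<psi>0(1) mult_left_cancel by blast
    thus ?thesis using Suc.IH[OF Suc.prems(1) d(3) _ Suc.prems(4,5)] by blast
  qed
qed

section \<open>Adic developments\<close>

lemma adic_add: "adic \<phi> (P + Q) j = adic \<phi> P j + adic \<phi> Q j"
  by (simp add: adic_def poly_div_add_left poly_mod_add_left)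

lemma adic_zero [simp]: "adic \<phi> 0 j = 0"
  by (simp add: adic_def)

lemma adic_0: "adic \<phi> P 0 = P mod \<phi>"
  by (simp add: adic_def)

lemma adic_Suc: "adic \<phi> P (Suc j) = adic \<phi> (P div \<phi>) j"
  by (simp add: adic_def poly_div_mult_right)

lemma adic_less_0: "P \<noteq> 0 \<Longrightarrow> degree P < degree \<phi> \<Longrightarrow> adic \<phi> P j = (if j = 0 then P else 0)"
  by (cases j) (auto simp: adic_0 adic_Suc div_poly_less mod_poly_less)

lemma adic_mult_Suc: "\<phi> \<noteq> 0 \<Longrightarrow> adic \<phi> (\<phi> * P) (Suc j) = adic \<phi> P j"
  by (simp add: adic_Suc)

lemma adic_monomial:
  assumes "0 < degree \<phi>" "degree a < degree \<phi> "
  shows "adic \<phi> (a * \<phi> ^ j) k = (if k = j then a else 0)"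
proof (induction j arbitrary: k)
  case 0
  show ?case using assms by (cases "a = 0") (auto simp: adic_less_0)
next
  case (Suc j)
  have "\<phi> \<noteq> 0" using assms by auto
  moreover have eq: "a * \<phi> ^ Suc j = \<phi> * (a * \<phi> ^ j)" by simp
  ultimately show ?case unfolding eq using Suc by (cases k) (simp_all add: adic_mult_Suc adic_0)
qed

lemma adic_polys_over:
  assumes A: "is_subring A" and \<phi>: "\<phi> \<in> polys_over A" "monic \<phi>" and P: "P \<in> polys_over A"
  shows "adic \<phi> P j \<in> polys_over A"
  unfolding adic_def
  by (intro polys_over_mod[OF A \<phi>] polys_over_div[OF A polys_over_power[OF A \<phi>(1)] monic_power[OF \<phi>(2)]] P)

lemma degree_adic: "0 < degree \<phi> \<Longrightarrow> degree (adic \<phi> P j) < degree \<phi>"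
  unfolding adic_def by (metis degree_0 degree_mod_less not_less_zero)

lemma adic_eq_0:
  assumes "degree P < j * degree \<phi>" "0 < degree \<phi>"
  shows "adic \<phi> P j = 0"
proof -
  have "\<phi> \<noteq> 0" using assms by auto
  hence "degree (\<phi> ^ j) = j * degree \<phi>" by (simp add: degree_power_eq)
  thus ?thesis using assms by (simp add: adic_def div_poly_less)
qed

lemma adic_nonzero_degree:
  assumes "adic \<phi> P j \<noteq> 0" "0 < degree \<phi>" shows "j * degree \<phi> \<le> degree P"
  using adic_eq_0[of P j \<phi>] assms by force

lemma adic_sum_eq:
  assumes "0 < degree \<phi>"
  shows "degree P < n * degree \<phi> \<Longrightarrow> P = (\<Sum>j<n. adic \<phi> P j * \<phi> ^ j)"
proof (induction n arbitrary: P)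
  case (Suc n)
  have \<phi>0: "\<phi> \<noteq> 0" using assms by auto
  show ?case
  proof (cases "P div \<phi> = 0")
    case True
    have "(\<Sum>j<Suc n. adic \<phi> P j * \<phi> ^ j) = adic \<phi> P 0"
      using True by (subst sum.lessThan_Suc_shift) (simp add: adic_Suc)
    thus ?thesis using True by (metis adic_0 mod_eq_self_iff_div_eq_0)
  next
    case False
    hence "P div \<phi> \<noteq> 0" by simp
    have "P = \<phi> * (P div \<phi>) + P mod \<phi>" by simp
    have "degree P = degree \<phi> + degree (P div \<phi>)"
    proof -
      have "degree (P mod \<phi>) < degree \<phi>" using assms \<phi>0 degree_mod_less[of \<phi> P] by auto
      hence "degree (P mod \<phi>) < degree (\<phi> * (P div \<phi>))" using False \<phi>0 by (simp add: degree_mult_eq)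
      hence "degree (\<phi> * (P div \<phi>) + P mod \<phi>) = degree (\<phi> * (P div \<phi>))"
        by (rule degree_add_eq_left)
      thus ?thesis using False \<phi>0 by (simp add: degree_mult_eq)
    qed
    hence "degree (P div \<phi>) < n * degree \<phi>" using Suc.prems assms by simp
    hence "P div \<phi> = (\<Sum>j<n. adic \<phi> P (Suc j) * \<phi> ^ j)" unfolding adic_Suc by (rule Suc.IH)
    hence "P = P mod \<phi> + \<phi> * (\<Sum>j<n. adic \<phi> P (Suc j) * \<phi> ^ j)"
      by (metis mod_mult_div_eq)
    thus ?thesis
      by (subst sum.lessThan_Suc_shift) (simp add: adic_0 sum_distrib_left mult_ac)
  qed
qed simp

lemma adic_sum_degree:
  assumes "0 < degree \<phi>"
  shows "P = (\<Sum>j\<le>degree P. adic \<phi> P j * \<phi> ^ j)"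
proof -
  have "degree P < Suc (degree P) * degree \<phi>" using assms by (cases "degree \<phi>") auto
  from adic_sum_eq[OF assms this] show ?thesis by (simp add: lessThan_Suc_atMost)
qed

lemma adic_exists_nonzero:
  assumes "0 < degree \<phi>" "P \<noteq> 0"
  shows "\<exists>j. adic \<phi> P j \<noteq> 0"
  using adic_sum_degree[OF assms(1), of P] assms(2) by (metis (no_types, lifting) mult_zero_left sum.neutral)

lemma adic_finite:
  assumes "0 < degree \<phi>" shows "finite {j. adic \<phi> P j \<noteq> 0}"
proof (rule finite_subset)
  show "{j. adic \<phi> P j \<noteq> 0} \<subseteq> {..degree P}"
  proof
    fix j assume "j \<in> {j. adic \<phi> P j \<noteq> 0}"
    hence "j * degree \<phi> \<le> degree P" using adic_nonzero_degree assms by auto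
    thus "j \<in> {..degree P}" using assms by (cases "degree \<phi>") auto
  qed
qed auto

text \<open>Division by the monic \<open>\<phi>\<close> keeps the leading coefficient 1 and lowers
  the degree by that of \<open>\<phi>\<close>, so 1 remains after \<open>b\<close> divisions. This
  fixes the last point of the Newton polygon of a monic polynomial.\<close>

lemma adic_top:
  assumes "0 < degree \<phi>" "monic \<phi>" "monic P" "degree P = b * degree \<phi>"
  shows "adic \<phi> P b = 1"
  using assms(3,4)
proof (induction b arbitrary: P)
  case 0
  hence "P = 1" by (simp add: monic_degree_0)
  thus ?case using assms by (simp add: adic_0 mod_poly_less)
next
  case (Suc b)
  have \<phi>0: "\<phi> \<noteq> 0" using assms by auto
  have deg: "degree (P mod \<phi>) < degree \<phi>" using assms(1) \<phi>0 degree_mod_less[of \<phi> P] by auto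
  have "P div \<phi> \<noteq> 0" using Suc.prems \<phi>0 by (auto simp: div_poly_eq_0_iff monic_nonzero)
  hence deg2: "degree (P mod \<phi>) < degree (\<phi> * (P div \<phi>))" using \<phi>0 deg by (simp add: degree_mult_eq)
  have eq: "P = \<phi> * (P div \<phi>) + P mod \<phi>" by simp
  have degP: "degree P = degree (\<phi> * (P div \<phi>))"
    using degree_add_eq_left[OF deg2] eq by simp
  hence "lead_coeff P = lead_coeff (\<phi> * (P div \<phi>))"
    using lead_coeff_add_le[of "P mod \<phi>" "\<phi> * (P div \<phi>)"] eq deg2 by (metis add.commute)
  hence "monic (P div \<phi>)" using Suc.prems assms(2) by (simp add: monic_def lead_coeff_mult)
  moreover have "degree (P div \<phi>) = b * degree \<phi>"
    using degP Suc.prems \<phi>0 \<open>P div \<phi> \<noteq> 0\<close> by (simp add: degree_mult_eq)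
  ultimately show ?case using Suc.IH by (simp add: adic_Suc)
qed

text \<open>Constants have smaller degree than \<open>\<phi>\<close>, so the Horner scheme of the
  composition already is its adic development.\<close>

lemma adic_pcompose:
  assumes "0 < degree \<phi>"
  shows "adic \<phi> (pcompose H \<phi>) j = [:coeff H j:]"
proof (induction H arbitrary: j)
  case (pCons a H)
  have \<phi>0: "\<phi> \<noteq> 0" using assms by auto
  show ?case
  proof (cases j)
    case 0
    thus ?thesis using assms by (simp add: pcompose_pCons adic_0 poly_mod_add_left mod_poly_less)
  next
    case (Suc k)
    thus ?thesis using assms \<phi>0 pCons.IH
      by (simp add: pcompose_pCons adic_Suc poly_div_add_left div_poly_less)
  qed
qed simp

text \<open>\<open>ord_at\<close> is a maximum, so the set of exponents must first be bounded; the
  degree of \<open>P\<close> does this.\<close>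

lemma ord_at_eq_0_iff:
  assumes "0 < degree \<phi>" "P \<noteq> 0"
  shows "ord_at \<phi> P = 0 \<longleftrightarrow> \<not> \<phi> dvd P"
proof -
  have bound: "n \<le> degree P" if "\<phi> ^ n dvd P" for n
  proof -
    have "n * degree \<phi> \<le> degree P"
      using dvd_imp_degree_le[OF that assms(2)] assms by (subst (asm) degree_power_eq) auto
    thus ?thesis using assms(1) by (cases "degree \<phi>") auto
  qed
  hence fin: "finite {n. \<phi> ^ n dvd P}" unfolding finite_nat_set_iff_bounded_le by auto
  have ne: "0 \<in> {n. \<phi> ^ n dvd P}" by simp
  show ?thesis
  proof
    assume "ord_at \<phi> P = 0"
    hence "\<And>n. \<phi> ^ n dvd P \<Longrightarrow> n \<le> 0" using Max_ge[OF fin] by (auto simp: ord_at_def)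
    from this[of 1] show "\<not> \<phi> dvd P" by auto
  next
    assume nd: "\<not> \<phi> dvd P"
    have "n = 0" if "\<phi> ^ n dvd P" for n
      using that nd dvd_trans[of \<phi> "\<phi> ^ n" P] by (cases n) auto
    thus "ord_at \<phi> P = 0" using Max_in[OF fin] ne unfolding ord_at_def by blast
  qed
qed

lemma ord_at_eqI:
  assumes "0 < degree \<phi>" "P \<noteq> 0" "\<phi> ^ n dvd P" "\<not> \<phi> ^ Suc n dvd P"
  shows "ord_at \<phi> P = n"
proof -
  have le: "k \<le> n" if "\<phi> ^ k dvd P" for k
    using that assms(4) power_le_dvd[of \<phi> k P "Suc n"] by (meson not_less_eq_eq)
  hence "finite {n. \<phi> ^ n dvd P}" unfolding finite_nat_set_iff_bounded_le by auto
  thus ?thesis unfolding ord_at_def using le assms(3) by (intro Max_eqI) auto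
qed

section \<open>Lower hulls of finite graphs\<close>

definition graph_points :: "nat set \<Rightarrow> (nat \<Rightarrow> real) \<Rightarrow> (real \<times> real) set" where
  "graph_points J u = (\<lambda>j. (real j, u j)) ` J"

text \<open>The abscissae of the graph points on the supporting line of slope \<open>\<mu>\<close>.
  Faces of the hull are computed through this finite set.\<close>

definition min_indices :: "real \<Rightarrow> nat set \<Rightarrow> (nat \<Rightarrow> real) \<Rightarrow> nat set" where
  "min_indices \<mu> J u = {j \<in> J. \<forall>k\<in>J. u j - \<mu> * real j \<le> u k - \<mu> * real k}"

lemma min_indices_le: "j \<in> min_indices \<mu> J u \<Longrightarrow> k \<in> J \<Longrightarrow> u j - \<mu> * real j \<le> u k - \<mu> * real k"
  and min_indices_subset: "min_indices \<mu> J u \<subseteq> J"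
  by (auto simp: min_indices_def)

lemma min_indices_eq:
  "i \<in> min_indices \<mu> J u \<Longrightarrow> j \<in> min_indices \<mu> J u \<Longrightarrow> u i - \<mu> * real i = u j - \<mu> * real j"
  by (intro antisym) (auto simp: min_indices_def)

lemma min_indicesI:
  "i \<in> min_indices \<mu> J u \<Longrightarrow> j \<in> J \<Longrightarrow> u j - \<mu> * real j = u i - \<mu> * real i \<Longrightarrow> j \<in> min_indices \<mu> J u"
  by (auto simp: min_indices_def)

lemma finite_min_indices: "finite J \<Longrightarrow> finite (min_indices \<mu> J u)"
  using min_indices_subset finite_subset by metis

lemma min_indices_nonempty:
  assumes "finite J" "J \<noteq> {}" shows "min_indices \<mu> J u \<noteq> {}"
proof -
  obtain j where "is_arg_min (\<lambda>j. u j - \<mu> * real j) (\<lambda>j. j \<in> J) j"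
    using ex_is_arg_min_if_finite[OF assms] by blast
  hence "j \<in> min_indices \<mu> J u" by (force simp: min_indices_def is_arg_min_linorder)
  thus ?thesis by blast
qed

lemma face_iff:
  "(x, y) \<in> face \<mu> A \<longleftrightarrow> (x, y) \<in> A \<and> (\<forall>x' y'. (x', y') \<in> A \<longrightarrow> y - \<mu> * x \<le> y' - \<mu> * x')"
  by (auto simp: face_def)

lemma first_vertex_iff:
  "(x, y) \<in> first_vertex A \<longleftrightarrow> (x, y) \<in> A \<and> (\<forall>x' y'. (x', y') \<in> A \<longrightarrow> x \<le> x')"
  by (auto simp: first_vertex_def)

lemma lower_hull_iff:
  "(x, y) \<in> lower_hull A \<longleftrightarrow> (x, y) \<in> convex hull A \<and> (\<forall>y'. (x, y') \<in> convex hull A \<longrightarrow> y \<le> y')"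
  by (auto simp: lower_hull_def)

text \<open>A linear inequality cuts out a convex half plane. All bounds for points of the hull are
  obtained by checking such an inequality on the graph points alone.\<close>

lemma hull_graph_ge:
  assumes "(x, y) \<in> convex hull (graph_points J u)" "\<And>j. j \<in> J \<Longrightarrow> c \<le> a * real j + b * u j"
  shows "c \<le> a * x + b * y"
proof -
  have "{p :: real \<times> real. c \<le> a * fst p + b * snd p} = {p. inner (a, b) p \<ge> c}"
    by (auto simp: inner_prod_def)
  hence "convex {p :: real \<times> real. c \<le> a * fst p + b * snd p}" by (simp add: convex_halfspace_ge)
  moreover have "graph_points J u \<subseteq> {p. c \<le> a * fst p + b * snd p}"
    using assms(2) by (auto simp: graph_points_def)
  ultimately have "convex hull (graph_points J u) \<subseteq> {p. c \<le> a * fst p + b * snd p}"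
    by (intro hull_minimal)
  thus ?thesis using assms(1) by auto
qed

lemma graph_point_in_hull: "j \<in> J \<Longrightarrow> (real j, u j) \<in> convex hull (graph_points J u)"
  by (rule hull_inc) (auto simp: graph_points_def)

lemma hull_ge_min:
  assumes "(x, y) \<in> convex hull (graph_points J u)" "i \<in> min_indices \<mu> J u"
  shows "u i - \<mu> * real i \<le> y - \<mu> * x"
  using hull_graph_ge[OF assms(1), of "u i - \<mu> * real i" "- \<mu>" 1] min_indices_le[OF assms(2)] by simp

lemma lower_hull_on_line:
  assumes "(x, y) \<in> convex hull (graph_points J u)" "i \<in> min_indices \<mu> J u"
    "y - \<mu> * x = u i - \<mu> * real i"
  shows "(x, y) \<in> lower_hull (graph_points J u)"
  unfolding lower_hull_def using assms(1,3) hull_ge_min[OF _ assms(2)] by force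

lemma lower_hull_graph_point:
  assumes "i \<in> min_indices \<mu> J u"
  shows "(real i, u i) \<in> lower_hull (graph_points J u)"
  using lower_hull_on_line[OF graph_point_in_hull assms] min_indices_subset assms by blast

lemma face_lower_hull_iff:
  assumes "i \<in> min_indices \<mu> J u"
  shows "(x, y) \<in> face \<mu> (lower_hull (graph_points J u)) \<longleftrightarrow>
    (x, y) \<in> convex hull (graph_points J u) \<and> y - \<mu> * x = u i - \<mu> * real i"
proof
  assume f: "(x, y) \<in> face \<mu> (lower_hull (graph_points J u))"
  hence h: "(x, y) \<in> convex hull (graph_points J u)" by (auto simp: face_iff lower_hull_iff)
  have "y - \<mu> * x \<le> u i - \<mu> * real i"
    using f lower_hull_graph_point[OF assms] by (force simp: face_iff)
  thus "(x, y) \<in> convex hull (graph_points J u) \<and> y - \<mu> * x = u i - \<mu> * real i"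
    using h hull_ge_min[OF h assms] by simp
next
  assume h: "(x, y) \<in> convex hull (graph_points J u) \<and> y - \<mu> * x = u i - \<mu> * real i"
  hence "(x, y) \<in> lower_hull (graph_points J u)" using lower_hull_on_line assms by blast
  thus "(x, y) \<in> face \<mu> (lower_hull (graph_points J u))"
    using h hull_ge_min[OF _ assms] by (force simp: face_iff lower_hull_iff)
qed

text \<open>The extreme abscissae of a face are found by tilting its supporting line by a small amount.\<close>

lemma face_lower_hull:
  assumes J: "finite J" and i: "i \<in> min_indices \<mu> J u"
  shows "face \<mu> (lower_hull (graph_points J u)) =
    {(x, y). real (Min (min_indices \<mu> J u)) \<le> x \<and> x \<le> real (Max (min_indices \<mu> J u)) \<and>
             y = u i - \<mu> * real i + \<mu> * x}" (is "?F = ?S")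
proof -
  let ?I = "min_indices \<mu> J u"
  define M where "M = u i - \<mu> * real i"
  define lo where "lo = Min ?I"
  define hi where "hi = Max ?I"
  have fin: "finite ?I" "?I \<noteq> {}" using J finite_min_indices i by auto
  have lohi: "lo \<in> ?I" "hi \<in> ?I" "\<And>j. j \<in> ?I \<Longrightarrow> lo \<le> j \<and> j \<le> hi"
    using fin by (auto simp: lo_def hi_def)
  have M: "u j - \<mu> * real j = M" if "j \<in> ?I" for j using min_indices_eq[OF that i] by (simp add: M_def)
  have gap: "0 < u j - \<mu> * real j - M" if "j \<in> J" "j \<notin> ?I" for j
    using min_indices_le[OF i that(1)] min_indicesI[OF i that(1)] that(2) by (force simp: M_def)
  have ge: "0 \<le> u j - \<mu> * real j - M" if "j \<in> J" for j
    using min_indices_le[OF i that] by (simp add: M_def)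
  \<comment> \<open>The sum is one tilt that works for all points off the line simultaneously. For
    indices on the line the denominator is 0, so their quotient is 0 by convention and does no
    harm.\<close>
  have tilt: "w j \<le> (\<Sum>k\<in>J. w k / (u k - \<mu> * real k - M)) * (u j - \<mu> * real j - M)"
    if "j \<in> J" "j \<notin> ?I" "\<And>k. 0 \<le> w k" for w :: "nat \<Rightarrow> real" and j
  proof -
    have "w j / (u j - \<mu> * real j - M) \<le> (\<Sum>k\<in>J. w k / (u k - \<mu> * real k - M))"
      using that ge J by (intro member_le_sum) auto
    thus ?thesis using gap[OF that(1,2)] by (simp add: pos_divide_le_eq)
  qed
  show ?thesis
  proof (intro equalityI subrelI)
    fix x y assume xy: "(x, y) \<in> ?F"
    hence h: "(x, y) \<in> convex hull (graph_points J u)" and y: "y - \<mu> * x = M"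
      using face_lower_hull_iff[OF i] by (auto simp: M_def)
    define t where "t = (\<Sum>k\<in>J. real lo / (u k - \<mu> * real k - M))"
    have "real lo + t * M \<le> (1 - t * \<mu>) * real j + t * u j" if "j \<in> J" for j
    proof (cases "j \<in> ?I")
      case True
      have "u j = M + \<mu> * real j" using M[OF True] by simp
      thus ?thesis using lohi(3)[OF True] by (simp add: algebra_simps)
    next
      case False
      have "real lo \<le> t * (u j - \<mu> * real j - M)"
        unfolding t_def using tilt[OF that False, of "\<lambda>_. real lo"] by simp
      thus ?thesis by (simp add: algebra_simps)
    qed
    from hull_graph_ge[OF h this] have "real lo + t * M \<le> (1 - t * \<mu>) * x + t * y" .
    moreover have "y = M + \<mu> * x" using y by simp
    ultimately have lo: "real lo \<le> x" by (simp add: algebra_simps)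
    define s where "s = (\<Sum>k\<in>J. real k / (u k - \<mu> * real k - M))"
    have "- real hi + s * M \<le> (- 1 - s * \<mu>) * real j + s * u j" if "j \<in> J" for j
    proof (cases "j \<in> ?I")
      case True
      have "u j = M + \<mu> * real j" using M[OF True] by simp
      thus ?thesis using lohi(3)[OF True] by (simp add: algebra_simps)
    next
      case False
      have "real j \<le> s * (u j - \<mu> * real j - M)"
        unfolding s_def using tilt[OF that False, of real] by simp
      thus ?thesis by (simp add: algebra_simps)
    qed
    from hull_graph_ge[OF h this] have "- real hi + s * M \<le> (- 1 - s * \<mu>) * x + s * y" .
    moreover have "y = M + \<mu> * x" using y by simp
    ultimately have hi: "x \<le> real hi" by (simp add: algebra_simps)
    show "(x, y) \<in> ?S" using lo hi y by (auto simp: lo_def hi_def M_def)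
  next
    fix x y assume "(x, y) \<in> ?S"
    hence x: "real lo \<le> x" "x \<le> real hi" and y: "y = M + \<mu> * x" by (auto simp: lo_def hi_def M_def)
    have ulo: "u lo = M + \<mu> * real lo" and uhi: "u hi = M + \<mu> * real hi" using M lohi by force+
    have inh: "(real lo, u lo) \<in> convex hull (graph_points J u)"
              "(real hi, u hi) \<in> convex hull (graph_points J u)"
      using graph_point_in_hull lohi min_indices_subset by blast+
    have "(x, y) \<in> convex hull (graph_points J u)"
    proof (cases "lo = hi")
      case True
      thus ?thesis using x y ulo inh by auto
    next
      case False
      hence lt: "real lo < real hi" using lohi(3)[OF lohi(2)] by simp
      define s where "s = (x - real lo) / (real hi - real lo)"
      have s: "0 \<le> s" "s \<le> 1" using x lt by (auto simp: s_def)
      have "(1 - s) *\<^sub>R (real lo, u lo) + s *\<^sub>R (real hi, u hi) \<in> convex hull (graph_points J u)"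
        using convexD[OF convex_convex_hull inh, of "1 - s" s] s by simp
      moreover have sx: "(1 - s) * real lo + s * real hi = x"
      proof -
        have "s * (real hi - real lo) = x - real lo" using lt by (simp add: s_def)
        thus ?thesis by (simp add: algebra_simps)
      qed
      moreover have "(1 - s) * u lo + s * u hi = y"
      proof -
        have "(1 - s) * u lo + s * u hi = M + \<mu> * ((1 - s) * real lo + s * real hi)"
          by (simp add: ulo uhi algebra_simps)
        thus ?thesis by (simp add: sx y)
      qed
      ultimately show ?thesis by simp
    qed
    thus "(x, y) \<in> ?F" using y face_lower_hull_iff[OF i] by (simp add: M_def)
  qed
qed

lemma fst_face_lower_hull:
  assumes "finite J" "J \<noteq> {}"
  shows "fst ` face \<mu> (lower_hull (graph_points J u)) =
    {real (Min (min_indices \<mu> J u))..real (Max (min_indices \<mu> J u))}"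
proof -
  obtain i where i: "i \<in> min_indices \<mu> J u" using min_indices_nonempty[OF assms] by blast
  show ?thesis unfolding face_lower_hull[OF assms(1) i] by (force simp: image_iff)
qed

lemma Min_min_indices_le_Max:
  assumes "finite J" "J \<noteq> {}"
  shows "Min (min_indices \<mu> J u) \<le> Max (min_indices \<mu> J u)"
  using min_indices_nonempty[OF assms] finite_min_indices[OF assms(1)] by (meson Max_ge Min_in)

lemma init_absc_face:
  assumes "finite J" "J \<noteq> {}"
  shows "init_absc (face \<mu> (lower_hull (graph_points J u))) = real (Min (min_indices \<mu> J u))"
  using Min_min_indices_le_Max[OF assms] by (simp add: init_absc_def fst_face_lower_hull[OF assms])

lemma seg_length_face:
  assumes "finite J" "J \<noteq> {}"
  shows "seg_length (face \<mu> (lower_hull (graph_points J u))) =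
    real (Max (min_indices \<mu> J u)) - real (Min (min_indices \<mu> J u))"
  using Min_min_indices_le_Max[OF assms, of \<mu> u] by (simp add: seg_length_def fst_face_lower_hull[OF assms])

lemma intercept_face:
  assumes "finite J" "i \<in> min_indices \<mu> J u"
  shows "intercept \<mu> (face \<mu> (lower_hull (graph_points J u))) = u i - \<mu> * real i"
  unfolding intercept_def
proof (rule the_equality)
  show "\<forall>(x, y)\<in>face \<mu> (lower_hull (graph_points J u)). y = u i - \<mu> * real i + \<mu> * x"
    unfolding face_lower_hull[OF assms] by auto
next
  fix c assume c: "\<forall>(x, y)\<in>face \<mu> (lower_hull (graph_points J u)). y = c + \<mu> * x"
  have "i \<in> J" using assms(2) min_indices_subset by blast
  hence "(real i, u i) \<in> face \<mu> (lower_hull (graph_points J u))"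
    using face_lower_hull_iff[OF assms(2)] graph_point_in_hull by force
  thus "c = u i - \<mu> * real i" using c by force
qed

lemma face_nonempty:
  assumes "finite J" "J \<noteq> {}"
  shows "face \<mu> (lower_hull (graph_points J u)) \<noteq> {}"
  using fst_face_lower_hull[OF assms, of \<mu> u] Min_min_indices_le_Max[OF assms, of \<mu> u] by auto

lemma finite_slopes_iff:
  assumes "finite J" "J \<noteq> {}" "fin N = lower_hull (graph_points J u)"
  shows "\<mu> \<in> finite_slopes N \<longleftrightarrow> Min (min_indices \<mu> J u) < Max (min_indices \<mu> J u)"
  by (simp add: finite_slopes_def assms(3) seg_length_face[OF assms(1,2)])

lemma finite_slopesI:
  assumes "finite J" "fin N = lower_hull (graph_points J u)"
    "i \<in> min_indices \<mu> J u" "j \<in> min_indices \<mu> J u" "i < j"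
  shows "\<mu> \<in> finite_slopes N"
proof -
  have "J \<noteq> {}" using assms(3) min_indices_subset by blast
  moreover have "Min (min_indices \<mu> J u) \<le> i" "j \<le> Max (min_indices \<mu> J u)"
    using assms finite_min_indices by auto
  ultimately show ?thesis using assms finite_slopes_iff[of J N u \<mu>] by auto
qed

text \<open>The line is turned upwards about \<open>p\<close> until it first meets a later point:
  \<open>\<nu>\<close> is the least slope from \<open>p\<close> to a point on its right. Points on
  the left stay above the line, since the slope has only increased.\<close>

lemma min_indices_rotate_right:
  assumes J: "finite J" and p: "p \<in> J" and q: "q \<in> J" "p < q"
    and left: "\<And>k. k \<in> J \<Longrightarrow> k < p \<Longrightarrow> u p - \<mu> * real p \<le> u k - \<mu> * real k"
    and right: "\<And>k. k \<in> J \<Longrightarrow> p < k \<Longrightarrow> u p - \<mu> * real p \<le> u k - \<mu> * real k"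
  obtains \<nu> r where "\<mu> \<le> \<nu>" "\<nu> \<le> (u q - u p) / (real q - real p)"
    "p \<in> min_indices \<nu> J u" "r \<in> min_indices \<nu> J u" "p < r"
proof -
  define sl where "sl = (\<lambda>k. (u k - u p) / (real k - real p))"
  define Q where "Q = {k \<in> J. p < k}"
  have Q: "finite Q" "Q \<noteq> {}" using J q by (auto simp: Q_def)
  obtain r where r: "r \<in> Q" "\<And>k. k \<in> Q \<Longrightarrow> sl r \<le> sl k"
    using ex_is_arg_min_if_finite[OF Q, of sl] by (auto simp: is_arg_min_linorder)
  have sl_eq: "sl k * (real k - real p) = u k - u p" if "k \<in> Q" for k
    using that by (simp add: sl_def Q_def)
  have "\<mu> * (real r - real p) \<le> sl r * (real r - real p)"
    using right[of r] r(1) sl_eq[OF r(1)] by (simp add: Q_def algebra_simps)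
  hence 1: "\<mu> \<le> sl r" using r(1) by (simp add: Q_def)
  have 2: "sl r \<le> (u q - u p) / (real q - real p)" using r(2)[of q] q by (simp add: Q_def sl_def)
  have pmin: "u p - sl r * real p \<le> u k - sl r * real k" if k: "k \<in> J" for k
  proof -
    consider "k < p" | "k = p" | "p < k" by linarith
    thus ?thesis
    proof cases
      case 1
      have "sl r * (real k - real p) \<le> \<mu> * (real k - real p)"
        using \<open>\<mu> \<le> sl r\<close> 1 by (intro mult_right_mono_neg) auto
      thus ?thesis using left[OF k 1] by (simp add: algebra_simps)
    next
      case 3
      hence "sl r * (real k - real p) \<le> sl k * (real k - real p)"
        using r(2)[of k] k by (intro mult_right_mono) (auto simp: Q_def)
      thus ?thesis using sl_eq[of k] k 3 by (simp add: Q_def algebra_simps)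
    qed simp
  qed
  hence 3: "p \<in> min_indices (sl r) J u" using p by (simp add: min_indices_def)
  have "u r - sl r * real r = u p - sl r * real p" using sl_eq[OF r(1)] by (simp add: algebra_simps)
  hence "r \<in> min_indices (sl r) J u" using min_indicesI[OF 3, of r] r(1) by (simp add: Q_def)
  thus thesis using that[OF 1 2 3] r(1) by (simp add: Q_def)
qed

text \<open>The mirror image: the line is turned about \<open>p\<close> to the greatest slope from
  an earlier point to \<open>p\<close>. It only becomes steeper downwards, so a negative slope stays
  negative.\<close>

lemma min_indices_rotate_left:
  assumes J: "finite J" and q: "q \<in> J" "q < p" and p: "p \<in> min_indices \<mu> J u"
  obtains \<nu> r where "\<nu> \<le> \<mu>" "p \<in> min_indices \<nu> J u" "r \<in> min_indices \<nu> J u" "r < p"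
proof -
  define sl where "sl = (\<lambda>k. (u p - u k) / (real p - real k))"
  define Q where "Q = {k \<in> J. k < p}"
  have Q: "finite Q" "Q \<noteq> {}" using J q by (auto simp: Q_def)
  obtain r where r: "r \<in> Q" "\<And>k. k \<in> Q \<Longrightarrow> sl k \<le> sl r"
    using ex_is_arg_min_if_finite[OF Q, of "\<lambda>k. - sl k"] by (auto simp: is_arg_min_linorder)
  have pJ: "p \<in> J" using p min_indices_subset by blast
  note pm = min_indices_le[OF p]
  have sl_eq: "sl k * (real p - real k) = u p - u k" if "k \<in> Q" for k
    using that by (simp add: sl_def Q_def)
  have "sl r * (real p - real r) \<le> \<mu> * (real p - real r)"
    using pm[of r] r(1) sl_eq[OF r(1)] by (simp add: Q_def algebra_simps)
  hence 1: "sl r \<le> \<mu>" using r(1) by (simp add: Q_def)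
  have "u p - sl r * real p \<le> u k - sl r * real k" if k: "k \<in> J" for k
  proof -
    consider "p < k" | "k = p" | "k < p" by linarith
    thus ?thesis
    proof cases
      case 1
      have "sl r * (real k - real p) \<le> \<mu> * (real k - real p)"
        using \<open>sl r \<le> \<mu>\<close> 1 by (intro mult_right_mono) auto
      thus ?thesis using pm[OF k] by (simp add: algebra_simps)
    next
      case 3
      hence "sl k * (real p - real k) \<le> sl r * (real p - real k)"
        using r(2)[of k] k by (intro mult_right_mono) (auto simp: Q_def)
      thus ?thesis using sl_eq[of k] k 3 by (simp add: Q_def algebra_simps)
    qed simp
  qed
  hence 3: "p \<in> min_indices (sl r) J u" using pJ by (simp add: min_indices_def)
  have "u r - sl r * real r = u p - sl r * real p" using sl_eq[OF r(1)] by (simp add: algebra_simps)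
  hence "r \<in> min_indices (sl r) J u" using min_indicesI[OF 3, of r] r(1) by (simp add: Q_def)
  thus thesis using that[OF 1 3] r(1) by (simp add: Q_def)
qed

lemma Min_in_min_indices:
  assumes "finite J" "J \<noteq> {}"
  obtains \<mu> where "\<mu> < 0" "Min J \<in> min_indices \<mu> J u"
proof -
  define p where "p = Min J"
  have p: "p \<in> J" "\<And>k. k \<in> J \<Longrightarrow> p \<le> k" using assms by (auto simp: p_def)
  \<comment> \<open>Distinct abscissae differ by at least 1, so a descent steeper than all
    differences of ordinates supports the hull at its first point; \<open>S\<close> bounds these
    differences.\<close>
  define S where "S = (\<Sum>k\<in>J. \<bar>u k - u p\<bar>)"
  have S0: "0 \<le> S" unfolding S_def by (intro sum_nonneg) auto
  have "u p - (- (1 + S)) * real p \<le> u k - (- (1 + S)) * real k" if k: "k \<in> J" for k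
  proof (cases "k = p")
    case False
    hence "1 \<le> real k - real p" using p(2)[OF k] by simp
    hence "(1 + S) * 1 \<le> (1 + S) * (real k - real p)" using S0 by (intro mult_left_mono) auto
    moreover have "\<bar>u k - u p\<bar> \<le> S" unfolding S_def using k assms by (intro member_le_sum) auto
    ultimately show ?thesis by (simp add: algebra_simps)
  qed simp
  hence "p \<in> min_indices (- (1 + S)) J u" using p(1) unfolding min_indices_def by blast
  thus thesis using that[of "- (1 + S)"] S0 by (simp add: p_def)
qed

lemma first_vertex_lower_hull:
  assumes "finite J" "J \<noteq> {}"
  shows "first_vertex (lower_hull (graph_points J u)) = {(real (Min J), u (Min J))}"
proof -
  obtain \<mu> where \<mu>: "Min J \<in> min_indices \<mu> J u" using Min_in_min_indices[OF assms] .
  have v: "(real (Min J), u (Min J)) \<in> lower_hull (graph_points J u)"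
    by (rule lower_hull_graph_point[OF \<mu>])
  have ge: "real (Min J) \<le> x" if "(x, y) \<in> convex hull (graph_points J u)" for x y
    using hull_graph_ge[OF that, of "real (Min J)" 1 0] assms by simp
  show ?thesis
  proof (intro equalityI subsetI)
    fix q assume "q \<in> first_vertex (lower_hull (graph_points J u))"
    then obtain x y where q: "q = (x, y)" "(x, y) \<in> lower_hull (graph_points J u)"
       "\<forall>(x', y') \<in> lower_hull (graph_points J u). x \<le> x'"
      by (auto simp: first_vertex_def)
    have "x = real (Min J)"
      using q(2,3) v ge by (intro antisym) (auto simp: lower_hull_def)
    hence "y = u (Min J)" using q(2) v by (auto simp: lower_hull_def intro: antisym)
    thus "q \<in> {(real (Min J), u (Min J))}" using q(1) \<open>x = real (Min J)\<close> by simp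
  next
    fix q assume "q \<in> {(real (Min J), u (Min J))}"
    thus "q \<in> first_vertex (lower_hull (graph_points J u))"
      using v ge by (auto simp: first_vertex_def lower_hull_def)
  qed
qed

section \<open>The principal part of the polygon of a finite graph\<close>

locale graph_polygon =
  fixes J :: "nat set" and u :: "nat \<Rightarrow> real" and N :: polygon
  assumes J: "finite J" "J \<noteq> {}" and fin_N: "fin N = lower_hull (graph_points J u)"
begin

lemma principal_subset: "fin (principal_part N) \<subseteq> fin N"
  by (auto simp: principal_part_def face_def first_vertex_def)

text \<open>The principal part is a union of sides, so the supporting line at \<open>i\<close> must
  be turned into one containing a side of negative slope. If there is a point to the left, turning
  to the left does it. Otherwise \<open>i\<close> is the first point, and the line is turned to the
  right if some side is negative; if none is, the principal part is the first vertex.\<close>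

lemma vertex_in_principal:
  assumes \<mu>: "\<mu> < 0" and i: "i \<in> min_indices \<mu> J u"
  shows "(real i, u i) \<in> fin (principal_part N)"
proof -
  have iJ: "i \<in> J" using i min_indices_subset by blast
  have in_face: "(real i, u i) \<in> face \<nu> (fin N)" if "i \<in> min_indices \<nu> J u" for \<nu>
    unfolding fin_N using face_lower_hull_iff[OF that] graph_point_in_hull[OF iJ] by simp
  have princ: "(real i, u i) \<in> fin (principal_part N)"
    if "i \<in> min_indices \<nu> J u" "\<nu> \<in> finite_slopes N" "\<nu> < 0" for \<nu>
    using that in_face[of \<nu>] by (auto simp: principal_part_def)
  show ?thesis
  proof (cases "\<exists>q\<in>J. q < i")
    case True
    then obtain q where "q \<in> J" "q < i" by blast
    from min_indices_rotate_left[OF J(1) this i] obtain \<nu> r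
      where "\<nu> \<le> \<mu>" "i \<in> min_indices \<nu> J u" "r \<in> min_indices \<nu> J u" "r < i" .
    thus ?thesis using princ[of \<nu>] finite_slopesI[OF J(1) fin_N, of r \<nu> i] \<mu> by simp
  next
    case False
    hence iMin: "i = Min J" using J iJ by (intro antisym) (auto simp: not_less)
    show ?thesis
    proof (cases "\<exists>\<nu>\<in>finite_slopes N. \<nu> < 0")
      case True
      then obtain \<nu> where \<nu>: "\<nu> \<in> finite_slopes N" "\<nu> < 0" by blast
      define q where "q = Max (min_indices \<nu> J u)"
      have q: "q \<in> min_indices \<nu> J u"
        unfolding q_def by (intro Max_in finite_min_indices min_indices_nonempty J)
      have "Min (min_indices \<nu> J u) < q" using \<nu> finite_slopes_iff[OF J fin_N] by (simp add: q_def)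
      moreover have "i \<le> Min (min_indices \<nu> J u)"
        using iMin J min_indices_subset[of \<nu> J u] min_indices_nonempty[OF J, of \<nu> u]
        by (simp add: Min_antimono)
      ultimately have iq: "i < q" by simp
      have qJ: "q \<in> J" using q min_indices_subset by blast
      \<comment> \<open>The chord from the first point to the end \<open>q\<close> of a known
        negative side has slope at most \<open>\<nu>\<close>, which keeps the turned line
        negative.\<close>
      have "u q - \<nu> * real q \<le> u i - \<nu> * real i" by (rule min_indices_le[OF q iJ])
      hence "u q - u i \<le> \<nu> * (real q - real i)" by (simp add: algebra_simps)
      hence sl: "(u q - u i) / (real q - real i) \<le> \<nu>" using iq by (simp add: pos_divide_le_eq)
      obtain \<rho> r where "\<mu> \<le> \<rho>" and \<rho>: "\<rho> \<le> (u q - u i) / (real q - real i)"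
        "i \<in> min_indices \<rho> J u" "r \<in> min_indices \<rho> J u" "i < r"
        using min_indices_rotate_right[OF J(1) iJ qJ iq, of u \<mu>] min_indices_le[OF i] by metis
      thus ?thesis using princ[of \<rho>] finite_slopesI[OF J(1) fin_N \<rho>(2,3,4)] sl \<nu> by simp
    next
      case False
      thus ?thesis using first_vertex_lower_hull[OF J, of u] by (simp add: principal_part_def fin_N iMin)
    qed
  qed
qed

lemma face_subset_principal:
  assumes \<mu>: "\<mu> < 0"
  shows "face \<mu> (fin N) \<subseteq> fin (principal_part N)"
proof (cases "\<mu> \<in> finite_slopes N")
  case True
  thus ?thesis using \<mu> by (auto simp: principal_part_def)
next
  case False
  obtain i where i: "i \<in> min_indices \<mu> J u" using min_indices_nonempty[OF J] by blast
  have "Min (min_indices \<mu> J u) = Max (min_indices \<mu> J u)"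
    using False finite_slopes_iff[OF J fin_N] Min_min_indices_le_Max[OF J, of \<mu> u] by simp
  moreover have "Min (min_indices \<mu> J u) \<le> i" "i \<le> Max (min_indices \<mu> J u)"
    using i finite_min_indices[OF J(1)] by auto
  ultimately have "face \<mu> (fin N) \<subseteq> {(real i, u i)}"
    unfolding fin_N face_lower_hull[OF J(1) i] by auto
  thus ?thesis using vertex_in_principal[OF \<mu> i] by blast
qed

text \<open>\<open>segment\<close> is defined on the principal part; for negative slopes this allows
  it to be computed on the full hull instead.\<close>

lemma face_principal:
  assumes \<mu>: "\<mu> < 0"
  shows "face \<mu> (fin (principal_part N)) = face \<mu> (fin N)"
proof -
  obtain a b where ab: "(a, b) \<in> face \<mu> (fin N)"
    using face_nonempty[OF J, of \<mu> u] by (auto simp: fin_N)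
  show ?thesis
  proof (intro equalityI subrelI)
    fix x y assume xy: "(x, y) \<in> face \<mu> (fin (principal_part N))"
    have "(a, b) \<in> fin (principal_part N)" using ab face_subset_principal[OF \<mu>] by blast
    hence "y - \<mu> * x \<le> b - \<mu> * a" using xy by (force simp: face_iff)
    moreover have "(x, y) \<in> fin N" using xy principal_subset by (auto simp: face_iff)
    ultimately show "(x, y) \<in> face \<mu> (fin N)" using ab by (force simp: face_iff)
  next
    fix x y assume xy: "(x, y) \<in> face \<mu> (fin N)"
    hence "(x, y) \<in> fin (principal_part N)" using face_subset_principal[OF \<mu>] by blast
    thus "(x, y) \<in> face \<mu> (fin (principal_part N))"
      using xy principal_subset by (force simp: face_iff)
  qed
qed

text \<open>The delicate point is that truncation creates no face of slope
  \<open>\<mu> \<ge> 0\<close> and positive length: two of its points would contradict the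
  supporting line of negative slope through the right-hand one.\<close>

lemma finite_slopes_principal:
  "finite_slopes (principal_part N) = {\<mu> \<in> finite_slopes N. \<mu> < 0}"
proof (intro equalityI subsetI)
  fix \<mu> assume \<mu>: "\<mu> \<in> finite_slopes (principal_part N)"
  have "\<mu> < 0"
  proof (rule ccontr)
    assume "\<not> \<mu> < 0"
    hence \<mu>0: "0 \<le> \<mu>" by simp
    let ?P = "fin (principal_part N)"
    let ?S = "fst ` face \<mu> ?P"
    have no: False if "(x, y) \<in> face \<mu> ?P" "(x', y') \<in> face \<mu> ?P" "x < x'" for x y x' y'
    proof -
      have e: "y - \<mu> * x = y' - \<mu> * x'" using that(1,2) by (force simp: face_iff)
      have P: "(x, y) \<in> ?P" "(x', y') \<in> ?P" using that by (auto simp: face_iff)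
      show False
      proof (cases "\<exists>\<nu>\<in>finite_slopes N. \<nu> < 0")
        case True
        then obtain \<nu> where \<nu>: "\<nu> < 0" "(x', y') \<in> face \<nu> (fin N)" using P(2)
          by (auto simp: principal_part_def)
        moreover have "(x, y) \<in> fin N" using P principal_subset by blast
        ultimately have "y' - \<nu> * x' \<le> y - \<nu> * x" by (auto simp: face_iff)
        moreover have "\<nu> * (x' - x) < 0" using \<nu>(1) that(3) by (simp add: mult_neg_pos)
        moreover have "0 \<le> \<mu> * (x' - x)" using \<mu>0 that(3) by simp
        ultimately show False using e by (simp add: algebra_simps)
      next
        case False
        hence "?P = {(real (Min J), u (Min J))}"
          using first_vertex_lower_hull[OF J, of u] by (simp add: principal_part_def fin_N)
        thus False using P that(3) by auto
      qed
    qed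
    \<comment> \<open>Length is a difference of \<open>Sup\<close> and \<open>Inf\<close>, which
      gives no information for an empty face. So it must also be shown that the minimum is
      attained.\<close>
    have "?S \<noteq> {}"
    proof
      assume e: "?S = {}"
      obtain m where m: "m < 0" "Min J \<in> min_indices m J u" using Min_in_min_indices[OF J] .
      show False
      proof (cases "\<exists>\<nu>\<in>finite_slopes N. \<nu> < 0")
        case False
        hence "?P = {(real (Min J), u (Min J))}"
          using first_vertex_lower_hull[OF J, of u] by (simp add: principal_part_def fin_N)
        hence "(real (Min J), u (Min J)) \<in> face \<mu> ?P" by (simp add: face_iff)
        thus False using e by blast
      next
        case True
        \<comment> \<open>The leftmost of the lowest points, where the principal part ends. All
          other principal points are at least as high and lie to its left, so it minimizes
          \<open>y - \<mu> * x\<close> for every \<open>\<mu> \<ge> 0\<close>.\<close>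
        define p where "p = Min (min_indices 0 J u)"
        have I0: "finite (min_indices 0 J u)" "min_indices 0 J u \<noteq> {}"
          using finite_min_indices[OF J(1)] min_indices_nonempty[OF J] by auto
        have p: "p \<in> min_indices 0 J u" using I0 by (simp add: p_def)
        hence pJ: "p \<in> J" using min_indices_subset by blast
        have "\<exists>\<nu><0. p \<in> min_indices \<nu> J u"
        proof (cases "p = Min J")
          case True
          thus ?thesis using m by blast
        next
          case False
          hence "Min J < p" "Min J \<in> J" using J pJ by (auto simp: order.strict_iff_order)
          from min_indices_rotate_left[OF J(1) this(2,1) p] obtain \<nu> r
            where r: "\<nu> \<le> 0" "p \<in> min_indices \<nu> J u" "r \<in> min_indices \<nu> J u" "r < p" .
          have "\<nu> \<noteq> 0"
          proof
            assume "\<nu> = 0"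
            hence "p \<le> r" using r(3) I0 by (simp add: p_def)
            thus False using r(4) by simp
          qed
          thus ?thesis using r by (intro exI[of _ \<nu>]) auto
        qed
        then obtain \<nu> where "\<nu> < 0" "p \<in> min_indices \<nu> J u" by blast
        hence pP: "(real p, u p) \<in> ?P" by (rule vertex_in_principal)
        have "u p - \<mu> * real p \<le> y - \<mu> * x" if xy: "(x, y) \<in> ?P" for x y
        proof -
          obtain \<nu> where \<nu>: "\<nu> < 0" "(x, y) \<in> face \<nu> (fin N)"
            using xy True by (auto simp: principal_part_def)
          have "(real p, u p) \<in> fin N" using pP principal_subset by blast
          hence 1: "y - \<nu> * x \<le> u p - \<nu> * real p" using \<nu>(2) by (auto simp: face_iff)
          have "(x, y) \<in> convex hull (graph_points J u)"
            using \<nu>(2) by (auto simp: face_def fin_N lower_hull_def)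
          from hull_ge_min[OF this p] have 2: "u p \<le> y" by simp
          have "\<nu> * (real p - x) \<le> 0" using 1 2 by (simp add: algebra_simps)
          hence "x \<le> real p" using \<nu>(1) by (simp add: mult_le_0_iff)
          hence "\<mu> * x \<le> \<mu> * real p" using \<mu>0 by (intro mult_left_mono) auto
          thus ?thesis using 2 by simp
        qed
        hence "(real p, u p) \<in> face \<mu> ?P" using pP by (auto simp: face_iff)
        thus False using e by blast
      qed
    qed
    then obtain x where x: "x \<in> ?S" by blast
    have "?S = {x}"
    proof -
      have "x' = x" if "x' \<in> ?S" for x'
        using x that no by (metis (no_types, lifting) imageE linorder_neqE_linordered_idom prod.collapse)
      thus ?thesis using x by blast
    qed
    thus False using \<mu> by (simp add: finite_slopes_def seg_length_def)
  qed
  moreover from this have "\<mu> \<in> finite_slopes N" using \<mu> by (simp add: finite_slopes_def face_principal)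
  ultimately show "\<mu> \<in> {\<mu> \<in> finite_slopes N. \<mu> < 0}" by simp
qed (simp add: finite_slopes_def face_principal)

text \<open>Between the ends of the face the lower hull is the face itself, so lying on the polygon
  means lying on the supporting line. This decides which residual coefficients are 0.\<close>

lemma point_in_principal_iff:
  assumes \<mu>: "\<mu> < 0" and j: "j \<in> J" "Min (min_indices \<mu> J u) \<le> j" "j \<le> Max (min_indices \<mu> J u)"
  shows "(real j, u j) \<in> fin (principal_part N) \<longleftrightarrow> j \<in> min_indices \<mu> J u"
proof
  assume "(real j, u j) \<in> fin (principal_part N)"
  hence h: "(real j, u j) \<in> lower_hull (graph_points J u)" using principal_subset fin_N by auto
  obtain i where i: "i \<in> min_indices \<mu> J u" using min_indices_nonempty[OF J] by blast
  have "(real j, u i - \<mu> * real i + \<mu> * real j) \<in> face \<mu> (lower_hull (graph_points J u))"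
    unfolding face_lower_hull[OF J(1) i] using j by simp
  hence "u j \<le> u i - \<mu> * real i + \<mu> * real j" using h by (auto simp: face_iff lower_hull_iff)
  hence "u j - \<mu> * real j = u i - \<mu> * real i" using min_indices_le[OF i j(1)] by simp
  thus "j \<in> min_indices \<mu> J u" using min_indicesI[OF i j(1)] by simp
qed (rule vertex_in_principal[OF \<mu>])

lemma first_vertex_principal:
  "first_vertex (fin (principal_part N)) = {(real (Min J), u (Min J))}"
proof -
  obtain \<mu> where \<mu>: "\<mu> < 0" "Min J \<in> min_indices \<mu> J u" using Min_in_min_indices[OF J] .
  have v: "(real (Min J), u (Min J)) \<in> fin (principal_part N)" by (rule vertex_in_principal[OF \<mu>])
  have ge: "real (Min J) \<le> x" if "(x, y) \<in> fin N" for x y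
  proof -
    have "(x, y) \<in> convex hull (graph_points J u)" using that by (simp add: fin_N lower_hull_iff)
    from hull_graph_ge[OF this, of "real (Min J)" 1 0] show ?thesis using J by simp
  qed
  have eq: "y = u (Min J)" if "(real (Min J), y) \<in> fin N" for y
    using that v principal_subset by (force simp: fin_N lower_hull_iff)
  show ?thesis
  proof (intro equalityI subrelI)
    fix x y assume xy: "(x, y) \<in> first_vertex (fin (principal_part N))"
    hence N: "(x, y) \<in> fin N" using principal_subset by (auto simp: first_vertex_iff)
    have "x \<le> real (Min J)" using xy v by (auto simp: first_vertex_iff)
    hence "x = real (Min J)" using ge[OF N] by simp
    thus "(x, y) \<in> {(real (Min J), u (Min J))}" using eq N by simp
  next
    fix x y assume "(x, y) \<in> {(real (Min J), u (Min J))}"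
    thus "(x, y) \<in> first_vertex (fin (principal_part N))"
      using v ge principal_subset by (auto simp: first_vertex_iff)
  qed
qed

text \<open>The whole hull projects between the extreme abscissae; if both extreme points are on one
  supporting line, the segment joining them is the entire lower boundary.\<close>

lemma one_sided_fin:
  assumes "Min J \<in> min_indices \<mu> J u" "Max J \<in> min_indices \<mu> J u"
  shows "fin N = face \<mu> (fin N)"
proof (intro equalityI subrelI)
  let ?I = "min_indices \<mu> J u"
  have I: "finite ?I" "?I \<subseteq> J" using finite_min_indices[OF J(1)] min_indices_subset by auto
  have MinI: "Min ?I = Min J"
    using I assms J by (intro Min_eqI) auto
  have MaxI: "Max ?I = Max J"
    using I assms J by (intro Max_eqI) auto
  fix x y assume xy: "(x, y) \<in> fin N"
  hence h: "(x, y) \<in> convex hull (graph_points J u)" by (simp add: fin_N lower_hull_def)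
  have "real (Min J) \<le> 1 * x + 0 * y" using J by (intro hull_graph_ge[OF h]) simp
  moreover have "- real (Max J) \<le> - 1 * x + 0 * y" using J by (intro hull_graph_ge[OF h]) simp
  ultimately have "(x, u (Min J) - \<mu> * real (Min J) + \<mu> * x) \<in> face \<mu> (lower_hull (graph_points J u))"
    unfolding face_lower_hull[OF J(1) assms(1)] MinI MaxI by simp
  hence "y \<le> u (Min J) - \<mu> * real (Min J) + \<mu> * x"
    using xy by (auto simp: fin_N lower_hull_def face_def)
  hence "y - \<mu> * x = u (Min J) - \<mu> * real (Min J)" using hull_ge_min[OF h assms(1)] by simp
  thus "(x, y) \<in> face \<mu> (fin N)" unfolding fin_N using face_lower_hull_iff[OF assms(1)] h by simp
qed (auto simp: face_def)

lemma one_sided_slopes: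
  assumes "Min J \<in> min_indices \<mu> J u" "Max J \<in> min_indices \<mu> J u" "Min J < Max J"
  shows "finite_slopes N = {\<mu>}"
proof (intro equalityI subsetI)
  fix \<nu> assume "\<nu> \<in> finite_slopes N"
  hence lt: "Min (min_indices \<nu> J u) < Max (min_indices \<nu> J u)" using finite_slopes_iff[OF J fin_N] by simp
  define a where "a = Min (min_indices \<nu> J u)"
  define b where "b = Max (min_indices \<nu> J u)"
  have ab: "a \<in> min_indices \<nu> J u" "b \<in> min_indices \<nu> J u"
    using finite_min_indices[OF J(1)] min_indices_nonempty[OF J] by (auto simp: a_def b_def)
  have abJ: "a \<in> J" "b \<in> J" using ab min_indices_subset by blast+
  have lt': "Min J \<le> a" "a < b" "b \<le> Max J" using lt abJ J by (auto simp: a_def b_def)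
  have MJ: "Min J \<in> J" "Max J \<in> J" using J by auto
  have "\<nu> = \<mu>"
  proof (rule ccontr)
    assume "\<nu> \<noteq> \<mu>"
    have 3: "u b - \<nu> * real b \<le> u (Min J) - \<nu> * real (Min J)" "u a - \<nu> * real a \<le> u (Max J) - \<nu> * real (Max J)"
      using min_indices_le ab MJ by blast+
    have 4: "u (Max J) - \<mu> * real (Max J) \<le> u a - \<mu> * real a" "u (Min J) - \<mu> * real (Min J) \<le> u b - \<mu> * real b"
      using min_indices_le assms abJ by blast+
    have 5: "(\<nu> - \<mu>) * (real (Max J) - real a) \<le> 0" using 3(2) 4(1) by (simp add: algebra_simps)
    have 6: "(\<nu> - \<mu>) * (real (Min J) - real b) \<le> 0" using 3(1) 4(2) by (simp add: algebra_simps)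
    have "real a < real (Max J)" "real (Min J) < real b" using lt' by auto
    thus False using 5 6 \<open>\<nu> \<noteq> \<mu>\<close> by (simp add: mult_le_0_iff)
  qed
  thus "\<nu> \<in> {\<mu>}" by simp
next
  fix \<nu> assume "\<nu> \<in> {\<mu>}"
  thus "\<nu> \<in> finite_slopes N" using finite_slopesI[OF J(1) fin_N assms] by simp
qed

text \<open>A point beyond an end of the only side would allow the line to be turned about this end,
  giving a second slope or a longer side.\<close>

lemma one_sided_converse:
  assumes "finite_slopes N = {\<mu>}"
  shows "Min J \<in> min_indices \<mu> J u" "Max J \<in> min_indices \<mu> J u" "Min J < Max J"
proof -
  let ?I = "min_indices \<mu> J u"
  have fin: "finite ?I" "?I \<noteq> {}" using finite_min_indices[OF J(1)] min_indices_nonempty[OF J] by auto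
  define a where "a = Min ?I"
  define b where "b = Max ?I"
  have ab: "a \<in> ?I" "b \<in> ?I" "\<And>j. j \<in> ?I \<Longrightarrow> a \<le> j \<and> j \<le> b" using fin by (auto simp: a_def b_def)
  have abJ: "a \<in> J" "b \<in> J" using ab min_indices_subset by blast+
  have "a < b" using assms finite_slopes_iff[OF J fin_N, of \<mu>] by (simp add: a_def b_def)
  have "a \<le> q" if "q \<in> J" for q
  proof (rule ccontr)
    assume "\<not> a \<le> q"
    hence "q < a" by simp
    from min_indices_rotate_left[OF J(1) \<open>q \<in> J\<close> this ab(1)] obtain \<nu> r
      where r: "a \<in> min_indices \<nu> J u" "r \<in> min_indices \<nu> J u" "r < a" by metis
    hence "\<nu> = \<mu>" using finite_slopesI[OF J(1) fin_N r(2,1,3)] assms by simp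
    thus False using r ab(3)[of r] by simp
  qed
  hence a: "a = Min J" using J abJ by (intro Min_eqI[symmetric]) auto
  have "q \<le> b" if "q \<in> J" for q
  proof (rule ccontr)
    assume "\<not> q \<le> b"
    hence "b < q" by simp
    from min_indices_rotate_right[OF J(1) abJ(2) \<open>q \<in> J\<close> this, of u \<mu>] obtain \<nu> r
      where r: "b \<in> min_indices \<nu> J u" "r \<in> min_indices \<nu> J u" "b < r" using min_indices_le[OF ab(2)] by metis
    hence "\<nu> = \<mu>" using finite_slopesI[OF J(1) fin_N r] assms by simp
    thus False using r ab(3)[of r] by simp
  qed
  hence b: "b = Max J" using J abJ by (intro Max_eqI[symmetric]) auto
  show "Min J \<in> ?I" "Max J \<in> ?I" "Min J < Max J" using ab a b \<open>a < b\<close> by auto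
qed

end

section \<open>Graded valuations and key polynomials\<close>

lemma infinite_alg_closed: "infinite (UNIV :: 'k::alg_closed_field set)"
proof
  assume fin: "finite (UNIV :: 'k set)"
  define p where "p = (\<Prod>a\<in>(UNIV :: 'k set). [:- a, 1:])"
  have "degree p = card (UNIV :: 'k set)" by (simp add: p_def degree_prod_eq_sum_degree)
  hence "0 < degree p" using fin by (simp add: card_gt_0_iff)
  hence "0 < degree (p + 1)" by (simp add: degree_add_eq_left)
  then obtain x where "poly (p + 1) x = 0" using alg_closed_imp_poly_has_root by blast
  moreover have "poly p x = 0"
    using fin by (auto simp: p_def poly_prod intro!: bexI[of _ x] exI[of _ x])
  ultimately show False by simp
qed

lemma exists_nonroot:
  assumes "p \<noteq> (0 :: 'k::alg_closed_field poly)"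
  obtains z where "z \<noteq> 0" "poly p z \<noteq> 0"
proof -
  have "finite {z. poly ([:0, 1:] * p) z = 0}" using assms by (intro poly_roots_finite) auto
  hence "{z. poly ([:0, 1:] * p) z = 0} \<noteq> UNIV" using infinite_alg_closed by metis
  thus thesis using that by auto
qed

text \<open>Evaluation takes place in \<open>'k\<close> and not in a residue field, since a finite
  field has too few points to separate polynomials.\<close>

lemma poly_eqI_nonzero_points:
  assumes "\<And>z. z \<noteq> 0 \<Longrightarrow> poly p z = poly q z"
  shows "p = (q :: 'k::alg_closed_field poly)"
proof (rule ccontr)
  assume "p \<noteq> q"
  then obtain z where "z \<noteq> 0" "poly (p - q) z \<noteq> 0" using exists_nonroot[of "p - q"] by auto
  thus False using assms[of z] by simp
qed

text \<open>As the constant coefficients do not vanish, \<open>a\<close> and \<open>b\<close> are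
  the orders at 0 of the same Laurent polynomial. It is therefore enough to treat
  \<open>a \<le> b\<close> and to see that the difference is 0.\<close>

lemma laurent_unique:
  fixes p q :: "'k::alg_closed_field poly"
  assumes "coeff p 0 \<noteq> 0" "coeff q 0 \<noteq> 0"
    and eq: "\<And>z. z \<noteq> 0 \<Longrightarrow> z powi a * poly p z = z powi b * poly q z"
  shows "a = b \<and> p = q"
proof -
  have main: "a = b \<and> p = q"
    if "coeff p 0 \<noteq> 0" "a \<le> b" "\<And>z. z \<noteq> 0 \<Longrightarrow> z powi a * poly p z = z powi b * poly q z"
    for p q :: "'k poly" and a b
  proof -
    define n where "n = nat (b - a)"
    have b: "b = a + int n" using that(2) by (simp add: n_def)
    have "p = monom 1 n * q"
    proof (rule poly_eqI_nonzero_points)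
      fix z :: 'k assume z: "z \<noteq> 0"
      have "z powi a * poly p z = z powi a * (z ^ n * poly q z)"
        using that(3)[OF z] z by (simp add: b power_int_add mult.assoc)
      thus "poly p z = poly (monom 1 n * q) z" using z by (simp add: poly_monom)
    qed
    moreover from this have "n = 0" using that(1) by (cases n) (auto simp: coeff_mult coeff_monom)
    ultimately show ?thesis using b by simp
  qed
  show ?thesis
  proof (cases "a \<le> b")
    case True
    thus ?thesis using main[OF assms(1) True eq] by blast
  next
    case False
    hence "b \<le> a" by simp
    from main[OF assms(2) this eq[symmetric]] show ?thesis by blast
  qed
qed

text \<open>An integer-valued \<open>V\<close> says nothing about 0, so 0 is put into every step of
  the filtration explicitly.\<close>

definition val_ge :: "('a::field poly \<Rightarrow> int) \<Rightarrow> int \<Rightarrow> 'a poly \<Rightarrow> bool" where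
  "val_ge V u P \<longleftrightarrow> P = 0 \<or> u \<le> V P"

text \<open>The image of \<open>P\<close> in the piece of degree \<open>u\<close>; it is additive
  only on polynomials of value at least \<open>u\<close>.\<close>

definition graded_part ::
  "('a::field poly \<Rightarrow> int) \<Rightarrow> ('a poly \<Rightarrow> int \<Rightarrow> 'k::field) \<Rightarrow> int \<Rightarrow> 'a poly \<Rightarrow> 'k" where
  "graded_part V C u P = (if P \<noteq> 0 \<and> V P = u then C P u else 0)"

text \<open>
  \<open>V\<close> is a valuation on the polynomials over \<open>K\<close>, and \<open>C P (V P)\<close> is the image of the initial form
  of \<open>P\<close> under a graded homomorphism to \<open>F\<close>.
\<close>

locale graded_val =
  fixes K :: "'a::field set" and F :: "'k::alg_closed_field set"
    and V :: "'a poly \<Rightarrow> int" and C :: "'a poly \<Rightarrow> int \<Rightarrow> 'k"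
  assumes K: "is_subfield K" and F: "is_subfield F"
    and ge_add: "\<And>P Q u. P \<in> polys_over K \<Longrightarrow> Q \<in> polys_over K \<Longrightarrow> val_ge V u P \<Longrightarrow> val_ge V u Q \<Longrightarrow>
      val_ge V u (P + Q)"
    and gr_add: "\<And>P Q u. P \<in> polys_over K \<Longrightarrow> Q \<in> polys_over K \<Longrightarrow> val_ge V u P \<Longrightarrow> val_ge V u Q \<Longrightarrow>
      graded_part V C u (P + Q) = graded_part V C u P + graded_part V C u Q"
    and V_mult: "\<And>P Q. P \<in> polys_over K \<Longrightarrow> Q \<in> polys_over K \<Longrightarrow> P \<noteq> 0 \<Longrightarrow> Q \<noteq> 0 \<Longrightarrow>
      V (P * Q) = V P + V Q"
    and C_mult: "\<And>P Q. P \<in> polys_over K \<Longrightarrow> Q \<in> polys_over K \<Longrightarrow> P \<noteq> 0 \<Longrightarrow> Q \<noteq> 0 \<Longrightarrow>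
      C (P * Q) (V P + V Q) = C P (V P) * C Q (V Q)"
    and C_F: "\<And>P. P \<in> polys_over K \<Longrightarrow> P \<noteq> 0 \<Longrightarrow> C P (V P) \<in> F"
begin

abbreviation "gr \<equiv> graded_part V C"

lemmas KR = is_subfield_imp_subring[OF K]
  and FR = is_subfield_imp_subring[OF F]

lemma V_1: "V 1 = 0"
  using V_mult[of 1 1] polys_over_1[OF KR] by simp

lemma V_minus: assumes "P \<in> polys_over K" shows "V (- P) = V P"
proof (cases "P = 0")
  case False
  have m: "- 1 \<in> polys_over K" using polys_over_uminus[OF KR polys_over_1[OF KR]] .
  have "V (- 1) = 0" using V_mult[OF m m] V_1 by simp
  thus ?thesis using V_mult[OF m assms] False by simp
qed simp

lemma ge_minus: "P \<in> polys_over K \<Longrightarrow> val_ge V u (- P) = val_ge V u P"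
  by (auto simp: val_ge_def V_minus)

lemma ge_diff:
  "P \<in> polys_over K \<Longrightarrow> Q \<in> polys_over K \<Longrightarrow> val_ge V u P \<Longrightarrow> val_ge V u Q \<Longrightarrow> val_ge V u (P - Q)"
  using ge_add[of P "- Q" u] ge_minus polys_over_uminus[OF KR] by simp

lemma V_power: "P \<in> polys_over K \<Longrightarrow> P \<noteq> 0 \<Longrightarrow> V (P ^ n) = int n * V P"
proof (induction n)
  case (Suc n)
  thus ?case using V_mult[OF Suc.prems(1) polys_over_power[OF KR Suc.prems(1)]] by (simp add: algebra_simps)
qed (simp add: V_1)

lemma gr_nonzero_iff: "P \<in> polys_over K \<Longrightarrow> gr u P \<noteq> 0 \<longleftrightarrow> P \<noteq> 0 \<and> V P = u \<and> C P u \<noteq> 0"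
  by (auto simp: graded_part_def)

lemma gr_eq_0: "val_ge V (u + 1) P \<Longrightarrow> gr u P = 0"
  by (auto simp: graded_part_def val_ge_def)

lemma ge_gr_sum:
  "(\<And>i. i \<in> I \<Longrightarrow> f i \<in> polys_over K) \<Longrightarrow> (\<And>i. i \<in> I \<Longrightarrow> val_ge V u (f i)) \<Longrightarrow>
   val_ge V u (sum f I) \<and> gr u (sum f I) = (\<Sum>i\<in>I. gr u (f i))"
proof (induction I rule: infinite_finite_induct)
  case (insert i I)
  hence IH: "val_ge V u (sum f I)" "gr u (sum f I) = (\<Sum>i\<in>I. gr u (f i))" by auto
  have s: "sum f I \<in> polys_over K" using insert.prems by (intro polys_over_sum[OF KR]) auto
  show ?case using insert IH ge_add[OF _ s _ IH(1)] gr_add[OF _ s _ IH(1)] by simp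
qed (auto simp: val_ge_def graded_part_def)

lemma C_prod_eq_0_iff:
  "P \<in> polys_over K \<Longrightarrow> Q \<in> polys_over K \<Longrightarrow> P \<noteq> 0 \<Longrightarrow> Q \<noteq> 0 \<Longrightarrow>
   C (P * Q) (V (P * Q)) = 0 \<longleftrightarrow> C P (V P) = 0 \<or> C Q (V Q) = 0"
  by (simp add: V_mult C_mult)

text \<open>A summand of greater value is 0 in the piece of degree \<open>V P\<close>, so the
  initial form is unchanged. This makes precise that a leading term dominates.\<close>

lemma C_add_higher:
  assumes "P \<in> polys_over K" "Q \<in> polys_over K" "P \<noteq> 0" "val_ge V (V P + 1) Q"
  shows "P + Q \<noteq> 0" "V (P + Q) = V P" "C (P + Q) (V P) = C P (V P)"
proof -
  have ge: "val_ge V (V P) P" "val_ge V (V P) Q" using assms(4) by (auto simp: val_ge_def)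
  show nz: "P + Q \<noteq> 0"
  proof
    assume "P + Q = 0"
    hence "Q = - P" by (simp add: eq_neg_iff_add_eq_0 add.commute)
    thus False using assms by (auto simp: val_ge_def V_minus)
  qed
  have "\<not> val_ge V (V P + 1) (P + Q)"
  proof
    assume "val_ge V (V P + 1) (P + Q)"
    from ge_diff[OF polys_over_add[OF KR assms(1,2)] assms(2) this assms(4)]
    show False using assms(3) by (auto simp: val_ge_def)
  qed
  thus V: "V (P + Q) = V P" using ge_add[OF assms(1,2) ge] nz by (auto simp: val_ge_def)
  have "gr (V P) (P + Q) = gr (V P) P"
    using gr_add[OF assms(1,2) ge] gr_eq_0[OF assms(4)] by simp
  thus "C (P + Q) (V P) = C P (V P)" using nz V assms(3) by (simp add: graded_part_def)
qed

end

text \<open>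
  The constant \<open>\<kappa>\<close> arises because residual coefficients are normalized by the ordinate of \<open>a * \<phi> ^ j\<close>
  instead of that of \<open>a\<close>.
\<close>

locale key_poly = graded_val K F V C
  for K :: "'a::field set" and F :: "'k::alg_closed_field set" and V C +
  fixes \<phi> :: "'a poly" and \<kappa> :: 'k
  assumes \<phi>_K: "\<phi> \<in> polys_over K" and \<phi>_monic: "monic \<phi>" and \<phi>_deg: "0 < degree \<phi>"
    and C_\<phi>: "C \<phi> (V \<phi>) = 0"
    and C_nonzero: "\<And>a. a \<in> polys_over K \<Longrightarrow> a \<noteq> 0 \<Longrightarrow> degree a < degree \<phi> \<Longrightarrow> C a (V a) \<noteq> 0"
    and C_shift: "\<And>a j. a \<in> polys_over K \<Longrightarrow> a \<noteq> 0 \<Longrightarrow> degree a < degree \<phi> \<Longrightarrow>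
      C a (V a + int j * V \<phi>) = \<kappa> ^ j * C a (V a)"
    and \<kappa>: "\<kappa> \<in> F" "\<kappa> \<noteq> 0"
begin

lemma \<phi>_nz: "\<phi> \<noteq> 0" using \<phi>_deg by auto

lemma co_K: "P \<in> polys_over K \<Longrightarrow> adic \<phi> P j \<in> polys_over K"
  by (rule adic_polys_over[OF KR \<phi>_K \<phi>_monic])

lemma co_deg: "degree (adic \<phi> P j) < degree \<phi>"
  by (rule degree_adic[OF \<phi>_deg])

lemma \<phi>_power_K: "\<phi> ^ j \<in> polys_over K"
  by (rule polys_over_power[OF KR \<phi>_K])

lemma V_term:
  "a \<in> polys_over K \<Longrightarrow> a \<noteq> 0 \<Longrightarrow> V (a * \<phi> ^ j) = V a + int j * V \<phi>"
  using V_mult[OF _ \<phi>_power_K] V_power[OF \<phi>_K \<phi>_nz] \<phi>_nz by simp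

lemma gr_mult_\<phi>: "q \<in> polys_over K \<Longrightarrow> gr u (q * \<phi>) = 0"
  using C_mult[OF _ \<phi>_K] V_mult[OF _ \<phi>_K] \<phi>_nz C_\<phi> by (auto simp: graded_part_def)

text \<open>Suppose the remainder \<open>c\<close> had value below \<open>u\<close>. In degree
  \<open>V c\<close> both \<open>P\<close> and the multiple of \<open>\<phi>\<close> have image 0,
  but the image of \<open>c\<close> is nonzero because its degree is small. So division by
  \<open>\<phi>\<close> lowers no value.\<close>

lemma ge_div_mod:
  assumes P: "P \<in> polys_over K" and u: "val_ge V u P"
  shows "val_ge V u (P mod \<phi>)" "val_ge V u (P div \<phi> * \<phi>)"
proof -
  define q where "q = P div \<phi>"
  define c where "c = P mod \<phi>"
  have eq: "P = q * \<phi> + c" by (simp add: q_def c_def)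
  have K': "q \<in> polys_over K" "c \<in> polys_over K" "q * \<phi> \<in> polys_over K"
    using polys_over_div[OF KR \<phi>_K \<phi>_monic P] polys_over_mod[OF KR \<phi>_K \<phi>_monic P]
      polys_over_mult[OF KR _ \<phi>_K] by (auto simp: q_def c_def)
  have degc: "degree c < degree \<phi>"
    using degree_mod_less[of \<phi> P] \<phi>_nz \<phi>_deg by (auto simp: c_def)
  show c: "val_ge V u (P mod \<phi>)"
  proof (rule ccontr)
    assume "\<not> val_ge V u (P mod \<phi>)"
    hence c0: "c \<noteq> 0" and lt: "V c < u" by (auto simp: val_ge_def c_def)
    have P1: "val_ge V (V c + 1) P" using u lt by (auto simp: val_ge_def)
    have "q * \<phi> = P - c" using eq by simp
    hence "val_ge V (V c) (q * \<phi>)"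
      using ge_diff[OF P K'(2), of "V c"] P1 by (auto simp: val_ge_def)
    from gr_add[OF K'(3) K'(2) this] have "gr (V c) P = gr (V c) (q * \<phi>) + gr (V c) c"
      by (simp add: val_ge_def flip: eq)
    hence "gr (V c) c = 0" using gr_eq_0[OF P1] gr_mult_\<phi>[OF K'(1)] by simp
    thus False using C_nonzero[OF K'(2) c0 degc] c0 by (simp add: graded_part_def)
  qed
  have "q * \<phi> = P - c" using eq by simp
  thus "val_ge V u (P div \<phi> * \<phi>)" using ge_diff[OF P K'(2) u] c by (simp add: q_def c_def)
qed

end

section \<open>The graded ring belonging to one slope\<close>

locale slope_data = key_poly K F V C \<phi> \<kappa>
  for K :: "'a::field set" and F :: "'k::alg_closed_field set" and V C \<phi> \<kappa> +
  fixes h e l l' :: int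
  assumes h: "0 < h" and e: "0 < e" and bezout: "l * h - l' * e = 1"
begin

text \<open>For \<open>deg a < deg \<phi>\<close> this is \<open>e\<close> times the ordinate at the
  origin of the line of slope -h/e through the point of \<open>a * \<phi> ^ j\<close>.\<close>

definition wt :: "nat \<Rightarrow> 'a poly \<Rightarrow> int" where
  "wt j a = e * (V a + int j * V \<phi>) + h * int j"

definition slope_ge :: "int \<Rightarrow> 'a poly \<Rightarrow> bool" where
  "slope_ge u P \<longleftrightarrow> (\<forall>j. adic \<phi> P j \<noteq> 0 \<longrightarrow> u \<le> wt j (adic \<phi> P j))"

text \<open>\<open>u - h * j\<close> is divisible by \<open>e\<close> for every weight
  \<open>u\<close> occurring at the abscissa \<open>j\<close>. By the Bezout relation the exponent
  \<open>(j - l * u) div e\<close> is then an exact quotient, and exponents add up when degrees and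
  abscissae do.\<close>

definition term_part :: "'k \<Rightarrow> int \<Rightarrow> nat \<Rightarrow> 'a poly \<Rightarrow> 'k" where
  "term_part z u j a = (if e dvd u - h * int j
     then gr ((u - h * int j) div e - int j * V \<phi>) a * \<kappa> ^ j * z powi ((int j - l * u) div e) else 0)"

text \<open>The degree \<open>u\<close> part of \<open>P\<close> in the graded ring of the slope, as a Laurent polynomial evaluated at \<open>z\<close>.\<close>

definition slope_part :: "'k \<Rightarrow> int \<Rightarrow> 'a poly \<Rightarrow> 'k" where
  "slope_part z u P = (\<Sum>j\<le>degree P. term_part z u j (adic \<phi> P j))"

lemma term_part_0 [simp]: "term_part z u j 0 = 0"
  by (simp add: term_part_def graded_part_def)

lemma slope_part_eq:
  assumes "finite J" "\<And>j. adic \<phi> P j \<noteq> 0 \<Longrightarrow> j \<in> J"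
  shows "slope_part z u P = (\<Sum>j\<in>J. term_part z u j (adic \<phi> P j))"
proof -
  have sub: "{j. adic \<phi> P j \<noteq> 0} \<subseteq> {..degree P}"
  proof
    fix j assume "j \<in> {j. adic \<phi> P j \<noteq> 0}"
    hence "j * degree \<phi> \<le> degree P" using adic_nonzero_degree \<phi>_deg by blast
    thus "j \<in> {..degree P}" using \<phi>_deg by (cases "degree \<phi>") auto
  qed
  have "slope_part z u P = (\<Sum>j\<in>{j. adic \<phi> P j \<noteq> 0}. term_part z u j (adic \<phi> P j))"
    unfolding slope_part_def by (rule sum.mono_neutral_right) (use sub in auto)
  also have "\<dots> = (\<Sum>j\<in>J. term_part z u j (adic \<phi> P j))"
    by (rule sum.mono_neutral_left) (use assms in auto)
  finally show ?thesis .
qed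

lemma wt_ge_iff:
  assumes "e dvd u - h * int j" "a \<noteq> 0"
  shows "u \<le> wt j a \<longleftrightarrow> (u - h * int j) div e - int j * V \<phi> \<le> V a"
proof -
  obtain c where c: "u - h * int j = e * c" using assms(1) by blast
  hence u: "u = e * c + h * int j" by simp
  have "u \<le> wt j a \<longleftrightarrow> e * c \<le> e * (V a + int j * V \<phi>)" unfolding u by (simp add: wt_def)
  also have "\<dots> \<longleftrightarrow> c \<le> V a + int j * V \<phi>" using e by simp
  finally show ?thesis using c e by auto
qed

lemma wt_eq_iff:
  assumes "e dvd u - h * int j"
  shows "u = wt j a \<longleftrightarrow> (u - h * int j) div e - int j * V \<phi> = V a"
proof -
  obtain c where c: "u - h * int j = e * c" using assms(1) by blast
  hence "u = wt j a \<longleftrightarrow> e * c = e * (V a + int j * V \<phi>)" by (auto simp: wt_def)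
  also have "\<dots> \<longleftrightarrow> c = V a + int j * V \<phi>" using e by simp
  finally show ?thesis using c e by auto
qed

lemma term_part_altdef:
  "term_part z u j a =
    (if a \<noteq> 0 \<and> wt j a = u then C a (V a) * \<kappa> ^ j * z powi ((int j - l * u) div e) else 0)"
proof (cases "e dvd u - h * int j")
  case True
  thus ?thesis using wt_eq_iff[OF True, of a] by (auto simp: term_part_def graded_part_def)
next
  case False
  moreover have "e dvd wt j a - h * int j" by (simp add: wt_def)
  ultimately show ?thesis by (auto simp: term_part_def)
qed

lemma term_part_add:
  assumes "a \<in> polys_over K" "b \<in> polys_over K" "a \<noteq> 0 \<Longrightarrow> u \<le> wt j a" "b \<noteq> 0 \<Longrightarrow> u \<le> wt j b"
  shows "term_part z u j (a + b) = term_part z u j a + term_part z u j b"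
    and "a + b \<noteq> 0 \<Longrightarrow> u \<le> wt j (a + b)"
proof -
  show "term_part z u j (a + b) = term_part z u j a + term_part z u j b"
  proof (cases "e dvd u - h * int j")
    case True
    hence "val_ge V ((u - h * int j) div e - int j * V \<phi>) a" "val_ge V ((u - h * int j) div e - int j * V \<phi>) b"
      using assms(3,4) wt_ge_iff[OF True] by (auto simp: val_ge_def)
    thus ?thesis using True gr_add[OF assms(1,2)] by (simp add: term_part_def algebra_simps)
  qed (simp add: term_part_def)
  assume nz: "a + b \<noteq> 0"
  show "u \<le> wt j (a + b)"
  proof (cases "a = 0 \<or> b = 0")
    case True
    thus ?thesis using assms(3,4) nz by auto
  next
    case False
    define t where "t = min (V a) (V b)"
    have "val_ge V t (a + b)" using ge_add[OF assms(1,2)] by (simp add: val_ge_def t_def)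
    hence "t \<le> V (a + b)" using nz by (simp add: val_ge_def)
    hence "e * (t + int j * V \<phi>) + h * int j \<le> wt j (a + b)" using e by (simp add: wt_def)
    moreover have "u \<le> e * (t + int j * V \<phi>) + h * int j"
      using assms(3,4) False by (simp add: t_def wt_def min_def)
    ultimately show ?thesis by simp
  qed
qed

lemma slope_add:
  assumes "P \<in> polys_over K" "Q \<in> polys_over K" "slope_ge u P" "slope_ge u Q"
  shows "slope_ge u (P + Q)" "slope_part z u (P + Q) = slope_part z u P + slope_part z u Q"
proof -
  note t = term_part_add[OF co_K[OF assms(1)] co_K[OF assms(2)]]
  show "slope_ge u (P + Q)"
    using assms(3,4) t(2) by (auto simp: slope_ge_def adic_add)
  define J where "J = {j. adic \<phi> P j \<noteq> 0} \<union> {j. adic \<phi> Q j \<noteq> 0}"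
  have J: "finite J" unfolding J_def using adic_finite[OF \<phi>_deg] by auto
  have "slope_part z u (P + Q) = (\<Sum>j\<in>J. term_part z u j (adic \<phi> (P + Q) j))"
    using J by (rule slope_part_eq) (auto simp: J_def adic_add)
  also have "\<dots> = (\<Sum>j\<in>J. term_part z u j (adic \<phi> P j) + term_part z u j (adic \<phi> Q j))"
    unfolding adic_add using assms(3,4) by (intro sum.cong refl t(1)) (auto simp: slope_ge_def)
  also have "\<dots> = slope_part z u P + slope_part z u Q"
    unfolding sum.distrib using slope_part_eq[OF J, of P] slope_part_eq[OF J, of Q]
    by (simp add: J_def)
  finally show "slope_part z u (P + Q) = slope_part z u P + slope_part z u Q" .
qed

lemma slope_0: "slope_ge u 0" "slope_part z u 0 = 0"
  by (simp_all add: slope_ge_def slope_part_def)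

lemma slope_sum:
  assumes "\<And>i. i \<in> I \<Longrightarrow> f i \<in> polys_over K" "\<And>i. i \<in> I \<Longrightarrow> slope_ge u (f i)"
  shows "slope_ge u (sum f I) \<and> slope_part z u (sum f I) = (\<Sum>i\<in>I. slope_part z u (f i))"
  using assms
proof (induction I rule: infinite_finite_induct)
  case (insert i I)
  have "sum f I \<in> polys_over K" using insert.prems by (intro polys_over_sum[OF KR]) auto
  thus ?case using insert slope_add[of "f i" "sum f I" u] by simp
qed (auto simp: slope_0)

lemma slope_part_eq_0:
  assumes "slope_ge (u + 1) P" shows "slope_part z u P = 0"
  unfolding slope_part_def using assms
  by (intro sum.neutral) (force simp: term_part_altdef slope_ge_def)

lemma slope_ge_mono: "slope_ge u P \<Longrightarrow> v \<le> u \<Longrightarrow> slope_ge v P"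
  by (force simp: slope_ge_def)

lemma slope_monomial:
  assumes "degree a < degree \<phi>"
  shows "slope_ge u (a * \<phi> ^ j) \<longleftrightarrow> (a \<noteq> 0 \<longrightarrow> u \<le> wt j a)"
    "slope_part z u (a * \<phi> ^ j) = term_part z u j a"
proof -
  note ad = adic_monomial[OF \<phi>_deg assms]
  show "slope_ge u (a * \<phi> ^ j) \<longleftrightarrow> (a \<noteq> 0 \<longrightarrow> u \<le> wt j a)" by (auto simp: slope_ge_def ad)
  have "slope_part z u (a * \<phi> ^ j) = (\<Sum>k\<in>{j}. term_part z u k (adic \<phi> (a * \<phi> ^ j) k))"
    by (rule slope_part_eq) (auto simp: ad split: if_splits)
  thus "slope_part z u (a * \<phi> ^ j) = term_part z u j a" by (simp add: ad)
qed

text \<open>Modulo \<open>e\<close> the weight is \<open>h * j\<close> and \<open>l * h\<close> is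
  1.\<close>

lemma e_dvd_wt: "e dvd int j - l * wt j a"
proof -
  have "int j - l * wt j a = e * (- l * (V a + int j * V \<phi>) - l' * int j) + int j * (1 - (l * h - l' * e))"
    by (simp add: wt_def algebra_simps)
  also have "\<dots> = e * (- l * (V a + int j * V \<phi>) - l' * int j)" using bezout by simp
  finally show ?thesis by simp
qed

text \<open>Write \<open>a * b = q * \<phi> + c\<close>. The class of \<open>a * b\<close> is that
  of \<open>c\<close>, as multiples of \<open>\<phi>\<close> are killed. The term of
  \<open>q\<close> stands one place further to the right with no loss of value, which on a negative
  slope raises its weight by at least \<open>h\<close>, so it disappears in the degree
  considered.\<close>

lemma slope_mult_monomials:
  assumes z: "z \<noteq> 0" and a: "a \<in> polys_over K" "degree a < degree \<phi>" "a \<noteq> 0"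
    and b: "b \<in> polys_over K" "degree b < degree \<phi>" "b \<noteq> 0"
  shows "slope_ge (wt j a + wt k b) ((a * \<phi> ^ j) * (b * \<phi> ^ k))"
    and "slope_part z (wt j a + wt k b) ((a * \<phi> ^ j) * (b * \<phi> ^ k)) =
      term_part z (wt j a) j a * term_part z (wt k b) k b"
proof -
  define u where "u = wt j a + wt k b"
  define q where "q = (a * b) div \<phi>"
  define c where "c = (a * b) mod \<phi>"
  have abK: "a * b \<in> polys_over K" by (rule polys_over_mult[OF KR a(1) b(1)])
  have K': "q \<in> polys_over K" "c \<in> polys_over K"
    using polys_over_div[OF KR \<phi>_K \<phi>_monic abK] polys_over_mod[OF KR \<phi>_K \<phi>_monic abK]
    by (auto simp: q_def c_def)
  have ab0: "a * b \<noteq> 0" using a b by simp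
  have Vab: "V (a * b) = V a + V b" using V_mult a b by simp
  have degc: "degree c < degree \<phi>" using degree_mod_less[of \<phi> "a * b"] \<phi>_nz \<phi>_deg by (auto simp: c_def)
  have degq: "degree q < degree \<phi>"
  proof (cases "q = 0")
    case False
    have "q * \<phi> = a * b - c" by (simp add: q_def c_def minus_mod_eq_div_mult)
    hence "degree (q * \<phi>) \<le> max (degree (a * b)) (degree c)" by (metis degree_diff_le_max)
    also have "degree (a * b) = degree a + degree b" using a b by (simp add: degree_mult_eq)
    finally have "degree q + degree \<phi> \<le> max (degree a + degree b) (degree c)"
      using False \<phi>_nz by (simp add: degree_mult_eq)
    thus ?thesis using a(2) b(2) degc by linarith
  qed (use \<phi>_deg in simp)
  have ge: "val_ge V (V (a * b)) c" "val_ge V (V (a * b)) (q * \<phi>)"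
    using ge_div_mod[OF abK, of "V (a * b)"] by (auto simp: val_ge_def c_def q_def)
  have abeq: "a * b = q * \<phi> + c" by (simp add: q_def c_def)
  have grc: "gr (V (a * b)) c = C a (V a) * C b (V b)"
  proof -
    have "gr (V (a * b)) (a * b) = gr (V (a * b)) (q * \<phi>) + gr (V (a * b)) c"
      using gr_add[OF polys_over_mult[OF KR K'(1) \<phi>_K] K'(2) ge(2,1)] by (simp flip: abeq)
    moreover have "gr (V (a * b)) (a * b) = C a (V a) * C b (V b)"
      using ab0 C_mult[OF a(1) b(1) a(3) b(3)] by (simp add: graded_part_def Vab)
    ultimately show ?thesis using gr_mult_\<phi>[OF K'(1)] by simp
  qed
  \<comment> \<open>The product of two nonzero classes is nonzero, and the piece of that degree sees
    it only through \<open>c\<close>; hence \<open>c\<close> is nonzero and has exactly this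
    value.\<close>
  have c0: "c \<noteq> 0" and Vc: "V c = V a + V b" and Cc: "C c (V c) = C a (V a) * C b (V b)"
    using grc C_nonzero a b unfolding graded_part_def by (auto simp: Vab split: if_splits)
  have eq: "(a * \<phi> ^ j) * (b * \<phi> ^ k) = c * \<phi> ^ (j + k) + q * \<phi> ^ (Suc (j + k))"
  proof -
    have "(a * \<phi> ^ j) * (b * \<phi> ^ k) = (a * b) * \<phi> ^ (j + k)" by (simp add: power_add mult_ac)
    thus ?thesis unfolding abeq by (simp add: algebra_simps)
  qed
  have wtc: "wt (j + k) c = u" by (simp add: wt_def u_def Vc algebra_simps)
  have wtq: "u + 1 \<le> wt (Suc (j + k)) q" if "q \<noteq> 0"
  proof -
    have "V (a * b) \<le> V q + V \<phi>"
      using ge(2) V_mult[OF K'(1) \<phi>_K that \<phi>_nz] that \<phi>_nz by (auto simp: val_ge_def)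
    hence "e * (V a + V b + (int j + int k) * V \<phi>) \<le> e * (V q + V \<phi> + (int j + int k) * V \<phi>)"
      using e by (intro mult_left_mono) (auto simp: Vab)
    thus ?thesis using h by (simp add: wt_def u_def algebra_simps)
  qed
  have g1: "slope_ge u (c * \<phi> ^ (j + k))" by (simp add: slope_monomial[OF degc] wtc)
  have g2: "slope_ge (u + 1) (q * \<phi> ^ Suc (j + k))" unfolding slope_monomial(1)[OF degq] using wtq by blast
  have mK: "c * \<phi> ^ (j + k) \<in> polys_over K" "q * \<phi> ^ Suc (j + k) \<in> polys_over K"
    using polys_over_mult[OF KR _ \<phi>_power_K] K' by blast+
  note add = slope_add[OF mK g1 slope_ge_mono[OF g2]]
  show "slope_ge (wt j a + wt k b) ((a * \<phi> ^ j) * (b * \<phi> ^ k))"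
    unfolding eq using add(1) by (simp add: u_def)
  have "slope_part z u ((a * \<phi> ^ j) * (b * \<phi> ^ k)) = term_part z u (j + k) c"
    unfolding eq using add(2)[of z] slope_part_eq_0[OF g2] by (simp add: slope_monomial[OF degc])
  also have "\<dots> = C a (V a) * C b (V b) * \<kappa> ^ (j + k) * z powi ((int (j + k) - l * u) div e)"
    by (simp add: term_part_altdef c0 wtc Cc)
  also have "(int (j + k) - l * u) div e = (int j - l * wt j a) div e + (int k - l * wt k b) div e"
  proof -
    have "int (j + k) - l * u = (int j - l * wt j a) + (int k - l * wt k b)"
      by (simp add: u_def algebra_simps)
    thus ?thesis using e_dvd_wt[of j a] by (simp only: div_plus_div_distrib_dvd_left)
  qed
  also have "C a (V a) * C b (V b) * \<kappa> ^ (j + k) * z powi \<dots> =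
     term_part z (wt j a) j a * term_part z (wt k b) k b"
    using z a b by (simp add: term_part_altdef power_int_add power_add)
  finally show "slope_part z (wt j a + wt k b) ((a * \<phi> ^ j) * (b * \<phi> ^ k)) =
      term_part z (wt j a) j a * term_part z (wt k b) k b" by (simp add: u_def)
qed

lemma slope_mult_terms:
  assumes z: "z \<noteq> 0" and a: "a \<in> polys_over K" "degree a < degree \<phi>"
    and b: "b \<in> polys_over K" "degree b < degree \<phi>"
    and u: "a \<noteq> 0 \<Longrightarrow> u \<le> wt j a" and v: "b \<noteq> 0 \<Longrightarrow> v \<le> wt k b"
  shows "slope_ge (u + v) ((a * \<phi> ^ j) * (b * \<phi> ^ k))"
    and "slope_part z (u + v) ((a * \<phi> ^ j) * (b * \<phi> ^ k)) = term_part z u j a * term_part z v k b"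
proof -
  have "slope_ge (u + v) ((a * \<phi> ^ j) * (b * \<phi> ^ k)) \<and>
    slope_part z (u + v) ((a * \<phi> ^ j) * (b * \<phi> ^ k)) = term_part z u j a * term_part z v k b"
  proof (cases "a = 0 \<or> b = 0")
    case True
    thus ?thesis by (auto simp: slope_0)
  next
    case False
    note m = slope_mult_monomials[OF z a, of b j k] 
    have ge: "slope_ge (wt j a + wt k b) ((a * \<phi> ^ j) * (b * \<phi> ^ k))" using m b False by blast
    show ?thesis
    proof (cases "u = wt j a \<and> v = wt k b")
      case True
      thus ?thesis using m b False by blast
    next
      case F: False
      have "slope_ge (u + v + 1) ((a * \<phi> ^ j) * (b * \<phi> ^ k))"
        by (rule slope_ge_mono[OF ge]) (use F u v False in auto)
      moreover have "term_part z u j a * term_part z v k b = 0"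
        using F by (auto simp: term_part_altdef)
      ultimately show ?thesis using slope_part_eq_0 slope_ge_mono[OF ge] u v False by auto
    qed
  qed
  thus "slope_ge (u + v) ((a * \<phi> ^ j) * (b * \<phi> ^ k))"
    "slope_part z (u + v) ((a * \<phi> ^ j) * (b * \<phi> ^ k)) = term_part z u j a * term_part z v k b" by auto
qed

lemma slope_mult:
  assumes z: "z \<noteq> 0" and P: "P \<in> polys_over K" "slope_ge u P" and Q: "Q \<in> polys_over K" "slope_ge v Q"
  shows "slope_ge (u + v) (P * Q)" "slope_part z (u + v) (P * Q) = slope_part z u P * slope_part z v Q"
proof -
  define f where "f = (\<lambda>(j, k). (adic \<phi> P j * \<phi> ^ j) * (adic \<phi> Q k * \<phi> ^ k))"
  have PQ: "P * Q = (\<Sum>i\<in>{..degree P} \<times> {..degree Q}. f i)"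
    by (subst adic_sum_degree[OF \<phi>_deg, of P], subst adic_sum_degree[OF \<phi>_deg, of Q])
      (simp add: sum_product sum.cartesian_product f_def)
  have fK: "f i \<in> polys_over K" for i
    using co_K[OF P(1)] co_K[OF Q(1)] polys_over_mult[OF KR] \<phi>_power_K
    by (auto simp: f_def split: prod.splits)
  have t: "slope_ge (u + v) (f (j, k)) \<and>
     slope_part z (u + v) (f (j, k)) = term_part z u j (adic \<phi> P j) * term_part z v k (adic \<phi> Q k)" for j k
    unfolding f_def prod.case
    using slope_mult_terms[OF z co_K[OF P(1)] co_deg co_K[OF Q(1)] co_deg] P(2) Q(2)
    by (auto simp: slope_ge_def)
  have ge: "slope_ge (u + v) (f i)" for i using t by (cases i) auto
  note s = slope_sum[of "{..degree P} \<times> {..degree Q}" f "u + v" z, OF fK ge]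
  show "slope_ge (u + v) (P * Q)" using s by (simp add: PQ)
  have "slope_part z (u + v) (P * Q) = (\<Sum>i\<in>{..degree P} \<times> {..degree Q}. slope_part z (u + v) (f i))"
    using s by (simp add: PQ)
  also have "\<dots> = (\<Sum>(j, k)\<in>{..degree P} \<times> {..degree Q}.
      term_part z u j (adic \<phi> P j) * term_part z v k (adic \<phi> Q k))"
    using t by (intro sum.cong) auto
  also have "\<dots> = slope_part z u P * slope_part z v Q"
    by (simp add: slope_part_def sum_product sum.cartesian_product)
  finally show "slope_part z (u + v) (P * Q) = slope_part z u P * slope_part z v Q" .
qed

section \<open>Value, side and residual polynomial for one slope\<close>

definition W :: "'a poly \<Rightarrow> int" where
  "W P = Min ((\<lambda>j. wt j (adic \<phi> P j)) ` {j. adic \<phi> P j \<noteq> 0})"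

definition idx :: "'a poly \<Rightarrow> nat set" where
  "idx P = {j. adic \<phi> P j \<noteq> 0 \<and> wt j (adic \<phi> P j) = W P}"

definition s where "s P = Min (idx P)"
definition L where "L P = Max (idx P)"

text \<open>Together with \<open>W\<close>, \<open>s\<close> and \<open>L\<close> this describes the
  next valuation, the ends of the side and the residual polynomial directly from the development,
  without convex hulls. The identification with the definitions through polygons is made in
  \<open>rat_slope\<close>.\<close>

definition R :: "'a poly \<Rightarrow> 'k poly" where
  "R P = (\<Sum>k\<le>(L P - s P) div nat e. monom
     (let j = s P + k * nat e in if j \<in> idx P then C (adic \<phi> P j) (V (adic \<phi> P j * \<phi> ^ j)) else 0) k)"

lemma W_le: "adic \<phi> P j \<noteq> 0 \<Longrightarrow> W P \<le> wt j (adic \<phi> P j)"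
  unfolding W_def using adic_finite[OF \<phi>_deg] by (intro Min_le) auto

lemma idx_nonempty: assumes "P \<noteq> 0" shows "idx P \<noteq> {}"
proof -
  have "W P \<in> (\<lambda>j. wt j (adic \<phi> P j)) ` {j. adic \<phi> P j \<noteq> 0}"
    unfolding W_def using adic_finite[OF \<phi>_deg] adic_exists_nonzero[OF \<phi>_deg assms] by (intro Min_in) auto
  thus ?thesis by (auto simp: idx_def)
qed

lemma finite_idx: "finite (idx P)"
  by (rule finite_subset[OF _ adic_finite[OF \<phi>_deg, of P]]) (auto simp: idx_def)

lemma s_L:
  assumes "P \<noteq> 0"
  shows "s P \<in> idx P" "L P \<in> idx P" "s P \<le> L P" "\<And>j. j \<in> idx P \<Longrightarrow> s P \<le> j \<and> j \<le> L P"
  using finite_idx idx_nonempty[OF assms] by (auto simp: s_def L_def)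

lemma slope_ge_iff: assumes "P \<noteq> 0" shows "slope_ge u P \<longleftrightarrow> u \<le> W P"
proof
  assume "slope_ge u P"
  thus "u \<le> W P" using s_L(1)[OF assms] by (auto simp: slope_ge_def idx_def)
next
  assume "u \<le> W P"
  thus "slope_ge u P" using W_le by (force simp: slope_ge_def)
qed

lemma idx_cong:
  assumes "i \<in> idx P" "j \<in> idx P" shows "e dvd int j - int i"
proof -
  have "wt i (adic \<phi> P i) = wt j (adic \<phi> P j)" using assms by (simp add: idx_def)
  hence "int j - int i = (int j - l * wt j (adic \<phi> P j)) - (int i - l * wt i (adic \<phi> P i))" by simp
  thus ?thesis using e_dvd_wt by (metis dvd_diff)
qed

lemma e_dvd_W:
  assumes "P \<noteq> 0" shows "e dvd int (s P) - l * W P"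
proof -
  have "wt (s P) (adic \<phi> P (s P)) = W P" using s_L(1)[OF assms] by (simp add: idx_def)
  thus ?thesis using e_dvd_wt[of "s P" "adic \<phi> P (s P)"] by simp
qed

lemma idx_mod:
  assumes "P \<noteq> 0" "j \<in> idx P" shows "j = s P + (j - s P) div nat e * nat e"
proof -
  have le: "s P \<le> j" using s_L[OF assms(1)] assms(2) by auto
  have "e dvd int j - int (s P)" using idx_cong s_L[OF assms(1)] assms(2) by blast
  hence "int (nat e) dvd int (j - s P)" using e le by (simp add: of_nat_diff)
  hence "nat e dvd j - s P" using int_dvd_int_iff by blast
  thus ?thesis using le by simp
qed

lemma slope_part_idx:
  "slope_part z (W P) P = (\<Sum>j\<in>idx P. C (adic \<phi> P j) (V (adic \<phi> P j)) * \<kappa> ^ j * z powi ((int j - l * W P) div e))"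
proof -
  have "slope_part z (W P) P = (\<Sum>j\<in>{j. adic \<phi> P j \<noteq> 0}. term_part z (W P) j (adic \<phi> P j))"
    using adic_finite[OF \<phi>_deg] by (intro slope_part_eq) auto
  also have "\<dots> = (\<Sum>j\<in>idx P. term_part z (W P) j (adic \<phi> P j))"
    using adic_finite[OF \<phi>_deg] by (intro sum.mono_neutral_right) (auto simp: idx_def term_part_altdef)
  also have "\<dots> = (\<Sum>j\<in>idx P. C (adic \<phi> P j) (V (adic \<phi> P j)) * \<kappa> ^ j * z powi ((int j - l * W P) div e))"
    by (intro sum.cong) (auto simp: idx_def term_part_altdef)
  finally show ?thesis .
qed

text \<open>Passing from the ordinate of a term to the value of its coefficient costs the factor
  \<open>\<kappa> ^ j\<close>. The same factor is built into \<open>term_part\<close>, so that both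
  descriptions agree.\<close>

lemma coeff_R:
  assumes P: "P \<in> polys_over K"
  shows "coeff (R P) k = (if k \<le> (L P - s P) div nat e \<and> s P + k * nat e \<in> idx P
     then C (adic \<phi> P (s P + k * nat e)) (V (adic \<phi> P (s P + k * nat e))) * \<kappa> ^ (s P + k * nat e) else 0)"
proof -
  have "C (adic \<phi> P j) (V (adic \<phi> P j * \<phi> ^ j)) = C (adic \<phi> P j) (V (adic \<phi> P j)) * \<kappa> ^ j"
    if "adic \<phi> P j \<noteq> 0" for j
    using C_shift[OF co_K[OF P] that co_deg] V_term[OF co_K[OF P] that] by simp
  hence eq: "R P = (\<Sum>k\<le>(L P - s P) div nat e. monom (if s P + k * nat e \<in> idx P
      then C (adic \<phi> P (s P + k * nat e)) (V (adic \<phi> P (s P + k * nat e))) * \<kappa> ^ (s P + k * nat e)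
      else 0) k)"
    unfolding R_def Let_def by (intro sum.cong refl arg_cong2[of _ _ _ _ monom]) (auto simp: idx_def)
  show ?thesis unfolding eq coeff_sum coeff_monom by simp
qed

lemma coeff_R_nonzero:
  assumes P: "P \<in> polys_over K" "P \<noteq> 0" and j: "j \<in> idx P"
  shows "coeff (R P) ((j - s P) div nat e) \<noteq> 0"
proof -
  have "adic \<phi> P j \<noteq> 0" using j by (simp add: idx_def)
  hence "C (adic \<phi> P j) (V (adic \<phi> P j)) \<noteq> 0" using C_nonzero[OF co_K[OF P(1)] _ co_deg] by blast
  moreover have "s P + (j - s P) div nat e * nat e = j" using idx_mod[OF P(2) j] by simp
  moreover have "(j - s P) div nat e \<le> (L P - s P) div nat e"
    using s_L(4)[OF P(2) j] by (intro div_le_mono) auto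
  ultimately show ?thesis using j \<kappa>(2) by (simp add: coeff_R[OF P(1)])
qed

lemma R_facts:
  assumes P: "P \<in> polys_over K" "P \<noteq> 0"
  shows "coeff (R P) 0 \<noteq> 0" "L P = s P + degree (R P) * nat e" "R P \<in> polys_over F" "R P \<noteq> 0"
proof -
  show c0: "coeff (R P) 0 \<noteq> 0" using coeff_R_nonzero[OF P s_L(1)[OF P(2)]] by simp
  show "R P \<noteq> 0" using c0 by auto
  define d where "d = (L P - s P) div nat e"
  have "coeff (R P) d \<noteq> 0" using coeff_R_nonzero[OF P s_L(2)[OF P(2)]] by (simp add: d_def)
  moreover have "coeff (R P) k = 0" if "k > d" for k using that by (simp add: coeff_R[OF P(1)] d_def)
  ultimately have "degree (R P) = d" by (meson degree_le le_degree antisym)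
  thus "L P = s P + degree (R P) * nat e" using idx_mod[OF P(2) s_L(2)[OF P(2)]] by (simp add: d_def)
  have "coeff (R P) k \<in> F" for k
    using C_F[OF co_K[OF P(1)]] \<kappa>(1)
    by (auto simp: coeff_R[OF P(1)] subring_0[OF FR] idx_def intro!: subring_mult[OF FR] subring_power[OF FR])
  thus "R P \<in> polys_over F" by (simp add: polys_over_def)
qed

text \<open>Abscissae on the side differ by multiples of \<open>e\<close>, and a step by
  \<open>e\<close> raises the exponent by 1. What remains is the power belonging to the initial
  abscissa, which is exactly the twist in the residual coefficients of the next order.\<close>

lemma slope_part_W:
  assumes z: "z \<noteq> 0" and P: "P \<in> polys_over K" "P \<noteq> 0"
  shows "slope_part z (W P) P = z powi ((int (s P) - l * W P) div e) * poly (R P) z"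
proof -
  define d where "d = (L P - s P) div nat e"
  define g where "g = (\<lambda>k. s P + k * nat e)"
  have e0: "nat e > 0" using e by simp
  have dvd: "e dvd int (s P) - l * W P" by (rule e_dvd_W[OF P(2)])
  define f where "f = (\<lambda>j. C (adic \<phi> P j) (V (adic \<phi> P j)) * \<kappa> ^ j)"
  have inj: "inj_on g X" for X using e0 by (auto simp: inj_on_def g_def)
  have sub: "idx P \<subseteq> g ` {..d}"
  proof
    fix j assume j: "j \<in> idx P"
    have "j = g ((j - s P) div nat e)" using idx_mod[OF P(2) j] by (simp add: g_def)
    moreover have "(j - s P) div nat e \<le> d" unfolding d_def
      using s_L(4)[OF P(2) j] by (intro div_le_mono) auto
    ultimately show "j \<in> g ` {..d}" by blast
  qed
  have ex: "(int (g k) - l * W P) div e = (int (s P) - l * W P) div e + int k" for k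
  proof -
    have "int (g k) - l * W P = (int (s P) - l * W P) + int k * e" using e by (simp add: g_def)
    hence "(int (g k) - l * W P) div e = ((int (s P) - l * W P) + int k * e) div e" by (simp only:)
    also have "\<dots> = int k + (int (s P) - l * W P) div e" by (rule div_mult_self1) (use e in simp)
    finally show ?thesis by simp
  qed
  have "slope_part z (W P) P = (\<Sum>j\<in>idx P. f j * z powi ((int j - l * W P) div e))"
    by (simp add: slope_part_idx f_def)
  also have "\<dots> = (\<Sum>j\<in>g ` {..d}. (if j \<in> idx P then f j else 0) * z powi ((int j - l * W P) div e))"
    by (rule sum.mono_neutral_cong_left) (use sub in auto)
  also have "\<dots> = (\<Sum>k\<le>d. (if g k \<in> idx P then f (g k) else 0) * z powi ((int (g k) - l * W P) div e))"
    by (simp add: sum.reindex[OF inj])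
  also have "\<dots> = (\<Sum>k\<le>d. coeff (R P) k * (z powi ((int (s P) - l * W P) div e) * z ^ k))"
  proof (intro sum.cong refl)
    fix k assume "k \<in> {..d}"
    hence "coeff (R P) k = (if g k \<in> idx P then f (g k) else 0)"
      by (simp add: coeff_R[OF P(1)] f_def g_def d_def)
    moreover have "z powi ((int (g k) - l * W P) div e) = z powi ((int (s P) - l * W P) div e) * z ^ k"
      unfolding ex using z by (simp add: power_int_add)
    ultimately show "(if g k \<in> idx P then f (g k) else 0) * z powi ((int (g k) - l * W P) div e) =
      coeff (R P) k * (z powi ((int (s P) - l * W P) div e) * z ^ k)" by simp
  qed
  also have "\<dots> = z powi ((int (s P) - l * W P) div e) * (\<Sum>k\<le>d. coeff (R P) k * z ^ k)"
    unfolding sum_distrib_left by (intro sum.cong refl) (simp add: mult_ac)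
  also have "(\<Sum>k\<le>d. coeff (R P) k * z ^ k) = poly (R P) z"
  proof -
    have "degree (R P) \<le> d"
      using R_facts(2)[OF P] e0 by (simp add: d_def)
    thus ?thesis
      unfolding poly_altdef by (intro sum.mono_neutral_right) (auto simp: coeff_eq_0)
  qed
  finally show ?thesis .
qed

lemma W_eqI:
  assumes P: "P \<noteq> 0" and "slope_ge u P" "slope_part z u P \<noteq> 0"
  shows "W P = u"
proof -
  have "u \<le> W P" using slope_ge_iff[OF P] assms(2) by simp
  moreover have "\<not> u + 1 \<le> W P" using slope_part_eq_0 slope_ge_iff[OF P] assms(3) by blast
  ultimately show ?thesis by simp
qed

lemma slope_part_W_nonzero:
  assumes "P \<in> polys_over K" "P \<noteq> 0" "z \<noteq> 0"
  shows "slope_part z (W P) P \<noteq> 0 \<longleftrightarrow> poly (R P) z \<noteq> 0"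
  using slope_part_W[OF assms(3,1,2)] assms(3) by simp

lemma residual_eqI:
  assumes P: "P \<in> polys_over K" "P \<noteq> 0" and c: "coeff p 0 \<noteq> 0"
    and eq: "\<And>z. z \<noteq> 0 \<Longrightarrow> slope_part z (W P) P = z powi ((int t - l * W P) div e) * poly p z"
    and t: "e dvd int t - l * W P"
  shows "s P = t" "R P = p"
proof -
  have "(int (s P) - l * W P) div e = (int t - l * W P) div e \<and> R P = p"
  proof (rule laurent_unique[OF R_facts(1)[OF P] c])
    fix z :: 'k assume z: "z \<noteq> 0"
    show "z powi ((int (s P) - l * W P) div e) * poly (R P) z = z powi ((int t - l * W P) div e) * poly p z"
      using slope_part_W[OF z P] eq[OF z] by simp
  qed
  moreover have "e dvd int (s P) - l * W P" by (rule e_dvd_W[OF P(2)])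
  ultimately show "s P = t" "R P = p" using t e by (auto elim!: dvdE)
qed

text \<open>At a point \<open>z\<close> where neither residual polynomial vanishes, the product of
  the two parts is nonzero; this excludes a larger weight of \<open>P * Q\<close>. Comparison of
  Laurent polynomials then separates initial abscissa and residual polynomial.\<close>

lemma W_mult:
  assumes P: "P \<in> polys_over K" "P \<noteq> 0" and Q: "Q \<in> polys_over K" "Q \<noteq> 0"
  shows "W (P * Q) = W P + W Q" "s (P * Q) = s P + s Q" "R (P * Q) = R P * R Q" "L (P * Q) = L P + L Q"
proof -
  have PQ: "P * Q \<in> polys_over K" "P * Q \<noteq> 0" using polys_over_mult[OF KR P(1) Q(1)] P Q by auto
  have ge: "slope_ge (W P) P" "slope_ge (W Q) Q" using slope_ge_iff P Q by auto
  note m = slope_mult[OF _ P(1) ge(1) Q(1) ge(2)]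
  have nz: "R P * R Q \<noteq> 0" using R_facts(4)[OF P] R_facts(4)[OF Q] by simp
  obtain z where z: "z \<noteq> 0" "poly (R P * R Q) z \<noteq> 0" using exists_nonroot[OF nz] .
  have "slope_part z (W P + W Q) (P * Q) \<noteq> 0"
    using m(2)[OF z(1)] slope_part_W_nonzero[OF P z(1)] slope_part_W_nonzero[OF Q z(1)] z(2) by simp
  thus W: "W (P * Q) = W P + W Q" using W_eqI[OF PQ(2) m(1)[OF z(1)]] by simp
  have d: "e dvd int (s P) - l * W P" "e dvd int (s Q) - l * W Q"
    using e_dvd_W P Q by auto
  have split: "int (s P + s Q) - l * W (P * Q) = (int (s P) - l * W P) + (int (s Q) - l * W Q)"
    by (simp add: W algebra_simps)
  have "s (P * Q) = s P + s Q \<and> R (P * Q) = R P * R Q"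
  proof (rule conjI)
    have c0: "coeff (R P * R Q) 0 \<noteq> 0" using R_facts(1)[OF P] R_facts(1)[OF Q] by (simp add: coeff_mult)
    have eq: "slope_part z (W (P * Q)) (P * Q) =
      z powi ((int (s P + s Q) - l * W (P * Q)) div e) * poly (R P * R Q) z" if z: "z \<noteq> 0" for z
      unfolding split using m(2)[OF z] slope_part_W[OF z P] slope_part_W[OF z Q] d z
      by (simp add: W div_plus_div_distrib_dvd_left power_int_add)
    have dvd: "e dvd int (s P + s Q) - l * W (P * Q)" unfolding split using d by (rule dvd_add)
    show "s (P * Q) = s P + s Q" "R (P * Q) = R P * R Q"
      using residual_eqI[OF PQ c0 eq dvd] by blast+
  qed
  thus sR: "s (P * Q) = s P + s Q" "R (P * Q) = R P * R Q" by auto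
  show "L (P * Q) = L P + L Q"
    using R_facts(2)[OF P] R_facts(2)[OF Q] R_facts(2)[OF PQ] R_facts(4)[OF P] R_facts(4)[OF Q]
    by (simp add: sR degree_mult_eq algebra_simps)
qed

lemma W_add_higher:
  assumes P: "P \<in> polys_over K" "P \<noteq> 0" and Q: "Q \<in> polys_over K" "slope_ge (W P + 1) Q"
    and PQ: "P + Q \<noteq> 0"
  shows "W (P + Q) = W P" "s (P + Q) = s P" "R (P + Q) = R P" "L (P + Q) = L P"
proof -
  have PQK: "P + Q \<in> polys_over K" using polys_over_add[OF KR P(1) Q(1)] .
  have ge: "slope_ge (W P) P" "slope_ge (W P) Q" using slope_ge_iff P slope_ge_mono[OF Q(2)] by auto
  note a = slope_add[OF P(1) Q(1) ge]
  have sp: "slope_part z (W P) (P + Q) = slope_part z (W P) P" for z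
    using a(2)[of z] slope_part_eq_0[OF Q(2)] by simp
  obtain z where "z \<noteq> 0" "poly (R P) z \<noteq> 0" using exists_nonroot[OF R_facts(4)[OF P]] .
  hence "slope_part z (W P) (P + Q) \<noteq> 0" using sp slope_part_W_nonzero[OF P] by simp
  thus W: "W (P + Q) = W P" using W_eqI[OF PQ a(1)] by simp
  have dvd: "e dvd int (s P) - l * W (P + Q)"
    unfolding W by (rule e_dvd_W[OF P(2)])
  have "slope_part z (W (P + Q)) (P + Q) = z powi ((int (s P) - l * W (P + Q)) div e) * poly (R P) z"
    if "z \<noteq> 0" for z using slope_part_W[OF that P] sp[of z] by (simp add: W)
  from residual_eqI[OF PQK PQ R_facts(1)[OF P] this dvd]
  show sR: "s (P + Q) = s P" "R (P + Q) = R P" by blast+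
  show "L (P + Q) = L P" using R_facts(2)[OF P] R_facts(2)[OF PQK PQ] sR by simp
qed

lemma L_degree: "P \<noteq> 0 \<Longrightarrow> L P * degree \<phi> \<le> degree P"
  using s_L(2)[of P] by (intro adic_nonzero_degree[OF _ \<phi>_deg]) (auto simp: idx_def)

lemma W_const:
  assumes "b \<in> K" "b \<noteq> 0"
  shows "W [:b:] = e * V [:b:]"
proof -
  have "adic \<phi> [:b:] j = (if j = 0 then [:b:] else 0)" for j
    using adic_less_0[of "[:b:]" \<phi>] \<phi>_deg assms by simp
  hence "(\<lambda>j. wt j (adic \<phi> [:b:] j)) ` {j. adic \<phi> [:b:] j \<noteq> 0} = {wt 0 [:b:]}" using assms by auto
  thus ?thesis by (simp add: W_def wt_def)
qed

lemma s_0: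
  assumes "P \<noteq> 0" "s P = 0" shows "e dvd W P"
proof -
  have "e * V (adic \<phi> P 0) = W P" using s_L(1)[OF assms(1)] assms(2) by (simp add: idx_def wt_def)
  thus ?thesis by (metis dvd_triv_left)
qed

text \<open>Evaluation of the Laurent polynomials at a root \<open>z\<close> of
  \<open>\<psi>\<close> turns the graded ring of the slope into the next graded homomorphism. It
  kills \<open>\<phi>'\<close> because \<open>R \<phi>'\<close> is a multiple of
  \<open>\<psi>\<close>.\<close>

theorem next_key_poly:
  assumes V': "\<And>P. P \<in> polys_over K \<Longrightarrow> P \<noteq> 0 \<Longrightarrow> V' P = W P"
    and C': "\<And>P u. P \<in> polys_over K \<Longrightarrow> P \<noteq> 0 \<Longrightarrow>
      C' P u = z powi ((int (s P) - l * u) div e) * poly (R P) z"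
    and \<psi>: "minimal_poly F \<psi> z" and F': "F' = (\<lambda>g. poly g z) ` polys_over F"
    and \<phi>': "\<phi>' \<in> polys_over K" "monic \<phi>'" "s \<phi>' = 0" "sim_over F (R \<phi>') \<psi>"
      "degree \<phi>' = degree \<phi> * nat e * degree \<psi>"
  shows "z \<noteq> 0" "\<exists>\<kappa>'. key_poly K F' V' C' \<phi>' \<kappa>'"
proof -
  have \<phi>'0: "\<phi>' \<noteq> 0" using \<phi>'(2) by (rule monic_nonzero)
  have \<psi>z: "poly \<psi> z = 0" using \<psi> by (simp add: minimal_poly_def)
  obtain c where c: "c \<in> F" "c \<noteq> 0" "R \<phi>' = smult c \<psi>" using \<phi>'(4) by (auto simp: sim_over_def)
  \<comment> \<open>The constant coefficient of \<open>R \<phi>'\<close> comes from the initial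
    point of the side and is nonzero, so 0 is not a root of \<open>\<psi>\<close>.\<close>
  show z: "z \<noteq> 0"
  proof
    assume "z = 0"
    hence "coeff \<psi> 0 = 0" using \<psi>z by (simp add: poly_0_coeff_0)
    thus False using R_facts(1)[OF \<phi>'(1) \<phi>'0] c(3) by simp
  qed
  have F'f: "is_subfield F'" unfolding F' by (rule is_subfield_extension[OF F \<psi>])
  have F'R: "is_subring F'" by (rule is_subfield_imp_subring[OF F'f])
  have zF': "z \<in> F'" unfolding F'
    by (rule image_eqI[of _ _ "monom 1 1"]) (auto simp: poly_monom intro: polys_over_monom[OF FR subring_1[OF FR]])
  have RF': "poly (R P) z \<in> F'" if "P \<in> polys_over K" "P \<noteq> 0" for P
    unfolding F' using R_facts(3)[OF that] by blast
  have ge: "val_ge V' u P \<longleftrightarrow> slope_ge u P" if "P \<in> polys_over K" for u P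
    using that slope_ge_iff[of P u] V'[of P] by (cases "P = 0") (auto simp: val_ge_def slope_0)
  have CW: "C' P (W P) = slope_part z (W P) P" if "P \<in> polys_over K" "P \<noteq> 0" for P
    using C'[OF that] slope_part_W[OF z that] by simp
  have gr': "graded_part V' C' u P = slope_part z u P" if P: "P \<in> polys_over K" "slope_ge u P" for u P
  proof (cases "P = 0")
    case True
    thus ?thesis by (simp add: graded_part_def slope_0)
  next
    case False
    show ?thesis
    proof (cases "W P = u")
      case True
      thus ?thesis using False CW[OF P(1)] V'[OF P(1)] by (simp add: graded_part_def)
    next
      case F: False
      hence "slope_ge (u + 1) P" using P(2) slope_ge_iff[OF False] by simp
      thus ?thesis using F V'[OF P(1)] slope_part_eq_0 by (auto simp: graded_part_def)
    qed
  qed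
  have eW: "e dvd W \<phi>'" using s_0[OF \<phi>'0 \<phi>'(3)] .
  \<comment> \<open>Raising \<open>u\<close> by \<open>W \<phi>'\<close> changes the exponent
    \<open>(s - l * u) div e\<close> by \<open>- (l * W \<phi>') div e\<close>. The quotient is
    exact: the side of \<open>\<phi>'\<close> starts at abscissa 0, whose weight is a multiple of
    \<open>e\<close>.\<close>
  define \<kappa>' where "\<kappa>' = z powi (- (l * W \<phi>') div e)"
  have "key_poly K F' V' C' \<phi>' \<kappa>'"
  proof unfold_locales
    show "is_subfield K" by (rule K)
    show "is_subfield F'" by (rule F'f)
    show "\<phi>' \<in> polys_over K" "monic \<phi>'" by fact+
    fix P Q assume P: "P \<in> polys_over K" and Q: "Q \<in> polys_over K"
    have PQ: "P + Q \<in> polys_over K" by (rule polys_over_add[OF KR P Q])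
    show "val_ge V' u (P + Q)" if "val_ge V' u P" "val_ge V' u Q" for u
      using that slope_add(1)[OF P Q] by (simp add: ge P Q PQ)
    show "graded_part V' C' u (P + Q) = graded_part V' C' u P + graded_part V' C' u Q"
      if "val_ge V' u P" "val_ge V' u Q" for u
      using that slope_add[OF P Q] by (simp add: ge gr' P Q PQ)
    assume nz: "P \<noteq> 0" "Q \<noteq> 0"
    have PQ: "P * Q \<in> polys_over K" "P * Q \<noteq> 0" using polys_over_mult[OF KR P Q] nz by auto
    show "V' (P * Q) = V' P + V' Q" using V' P Q nz PQ W_mult(1)[OF P nz(1) Q nz(2)] by simp
    show "C' (P * Q) (V' P + V' Q) = C' P (V' P) * C' Q (V' Q)"
      using CW[OF PQ] CW[OF P nz(1)] CW[OF Q nz(2)] V' P Q nz W_mult(1)[OF P nz(1) Q nz(2)]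
        slope_mult(2)[OF z P _ Q] slope_ge_iff by simp
  next
    fix P assume P: "P \<in> polys_over K" "P \<noteq> 0"
    show "C' P (V' P) \<in> F'"
      unfolding C'[OF P] by (intro subring_mult[OF F'R] subfield_power_int[OF F'f] zF' RF' P)
  next
    have "0 < degree \<psi>" using minimal_poly_degree_pos[OF \<psi>] .
    thus "0 < degree \<phi>'" using \<phi>'(5) \<phi>_deg e by simp
    show "C' \<phi>' (V' \<phi>') = 0" using C'[OF \<phi>'(1) \<phi>'0] c(3) \<psi>z by simp
  next
    fix a assume a: "a \<in> polys_over K" "a \<noteq> 0" "degree a < degree \<phi>'"
    \<comment> \<open>A polynomial of smaller degree has too short a side for a residual polynomial
      of degree \<open>degree \<psi>\<close>, so minimality of \<open>\<psi>\<close> keeps its value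
      at \<open>z\<close> away from 0.\<close>
    have "L a * degree \<phi> < degree \<phi> * nat e * degree \<psi>" using L_degree[OF a(2)] a(3) \<phi>'(5) by linarith
    hence "L a * degree \<phi> < (nat e * degree \<psi>) * degree \<phi>" by (simp add: mult_ac)
    hence "L a < nat e * degree \<psi>" using mult_less_cancel2 by blast
    hence "degree (R a) * nat e < degree \<psi> * nat e" using R_facts(2)[OF a(1,2)]
      by (simp only: mult.commute[of "nat e"])
    hence "degree (R a) < degree \<psi>" using mult_less_cancel2 by blast
    hence "poly (R a) z \<noteq> 0"
      using \<psi> R_facts(3,4)[OF a(1,2)] by (force simp: minimal_poly_def)
    thus "C' a (V' a) \<noteq> 0" using C'[OF a(1,2)] z by simp
    fix j
    obtain d where d: "W \<phi>' = e * d" using eW by blast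
    have "(int (s a) - l * (V' a + int j * V' \<phi>')) div e = (int (s a) - l * V' a) div e + int j * (- (l * W \<phi>') div e)"
    proof -
      have "- (l * W \<phi>') = - (l * d) * e" by (simp add: d)
      hence 1: "- (l * W \<phi>') div e = - (l * d)" using e by (metis nonzero_mult_div_cancel_right less_irrefl)
      have "int (s a) - l * (V' a + int j * V' \<phi>') = (int (s a) - l * V' a) + (- (int j * l * d)) * e"
        using V'[OF \<phi>'(1) \<phi>'0] by (simp add: d algebra_simps)
      hence "(int (s a) - l * (V' a + int j * V' \<phi>')) div e =
          ((int (s a) - l * V' a) + (- (int j * l * d)) * e) div e" by (simp only:)
      also have "\<dots> = - (int j * l * d) + (int (s a) - l * V' a) div e"
        by (rule div_mult_self1) (use e in simp)
      finally have "(int (s a) - l * (V' a + int j * V' \<phi>')) div e = (int (s a) - l * V' a) div e - int j * l * d"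
        by simp
      thus ?thesis by (simp add: 1)
    qed
    thus "C' a (V' a + int j * V' \<phi>') = \<kappa>' ^ j * C' a (V' a)"
      using C'[OF a(1,2)] z by (simp add: \<kappa>'_def power_int_add power_int_power' mult_ac)
  next
    show "\<kappa>' \<in> F'" unfolding \<kappa>'_def by (rule subfield_power_int[OF F'f zF'])
    show "\<kappa>' \<noteq> 0" using z by (simp add: \<kappa>'_def)
  qed
  thus "\<exists>\<kappa>'. key_poly K F' V' C' \<phi>' \<kappa>'" ..
qed

end

section \<open>Complete valued fields\<close>

locale abs_value =
  fixes nn :: "'a::field \<Rightarrow> real"
  assumes nn_nonneg: "0 \<le> nn x" and nn_0_iff: "nn x = 0 \<longleftrightarrow> x = 0"
    and nn_mult: "nn (x * y) = nn x * nn y" and nn_add: "nn (x + y) \<le> max (nn x) (nn y)"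
begin

lemma nn_0 [simp]: "nn 0 = 0" by (simp add: nn_0_iff)

lemma nn_1 [simp]: "nn 1 = 1"
proof -
  have "nn 1 = nn 1 * nn 1" using nn_mult[of 1 1] by simp
  moreover have "nn 1 \<noteq> 0" by (simp add: nn_0_iff)
  ultimately show ?thesis by simp
qed

lemma nn_minus [simp]: "nn (- x) = nn x"
proof -
  have "nn (- 1) * nn (- 1) = 1" using nn_mult[of "- 1" "- 1"] by simp
  hence "(nn (- 1))\<^sup>2 = 1\<^sup>2" by (simp add: power2_eq_square)
  hence "nn (- 1) = 1" using nn_nonneg[of "- 1"] power2_eq_imp_eq[of "nn (- 1)" 1] by simp
  thus ?thesis using nn_mult[of "- 1" x] by simp
qed

lemma nn_diff: "nn (x - y) \<le> max (nn x) (nn y)"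
  using nn_add[of x "- y"] by simp

lemma nn_diff_commute: "nn (x - y) = nn (y - x)"
  using nn_minus[of "x - y"] by simp

lemma nn_power: "nn (x ^ n) = nn x ^ n"
  by (induction n) (auto simp: nn_mult)

lemma nn_pos: "x \<noteq> 0 \<Longrightarrow> 0 < nn x"
  using nn_nonneg[of x] nn_0_iff[of x] by linarith

lemma nn_add_le: "nn x \<le> B \<Longrightarrow> nn y \<le> B \<Longrightarrow> nn (x + y) \<le> B"
  using nn_add[of x y] by linarith

lemma nn_diff_le: "nn x \<le> B \<Longrightarrow> nn y \<le> B \<Longrightarrow> nn (x - y) \<le> B"
  using nn_diff[of x y] by linarith

lemma nn_add_less: "nn x < B \<Longrightarrow> nn y < B \<Longrightarrow> nn (x + y) < B"
  using nn_add[of x y] by linarith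

lemma nn_sum_le: "0 \<le> B \<Longrightarrow> (\<And>i. i \<in> I \<Longrightarrow> nn (f i) \<le> B) \<Longrightarrow> nn (sum f I) \<le> B"
  by (induction I rule: infinite_finite_induct) (auto intro: nn_add_le)

section \<open>Completeness of finite-dimensional spaces\<close>

definition nCauchy :: "(nat \<Rightarrow> 'a) \<Rightarrow> bool" where
  "nCauchy X \<longleftrightarrow> (\<forall>\<epsilon>>0. \<exists>N. \<forall>m\<ge>N. \<forall>n\<ge>N. nn (X m - X n) < \<epsilon>)"

definition nconv :: "(nat \<Rightarrow> 'a) \<Rightarrow> 'a \<Rightarrow> bool" where
  "nconv X x \<longleftrightarrow> (\<forall>\<epsilon>>0. \<exists>N. \<forall>n\<ge>N. nn (X n - x) < \<epsilon>)"

definition ncomplete :: "'a set \<Rightarrow> bool" where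
  "ncomplete A \<longleftrightarrow> (\<forall>X. (\<forall>n. X n \<in> A) \<longrightarrow> nCauchy X \<longrightarrow> (\<exists>x\<in>A. nconv X x))"

lemma nconv_unique: assumes "nconv X x" "nconv X y" shows "x = y"
proof (rule ccontr)
  assume "x \<noteq> y"
  hence p: "0 < nn (x - y)" by (simp add: nn_pos)
  obtain N1 N2 where N: "\<forall>n\<ge>N1. nn (X n - x) < nn (x - y)" "\<forall>n\<ge>N2. nn (X n - y) < nn (x - y)"
    using assms p unfolding nconv_def by meson
  define n where "n = max N1 N2"
  have "nn (x - X n) < nn (x - y)" "nn (X n - y) < nn (x - y)"
    using N by (auto simp: n_def nn_diff_commute[of x])
  from nn_add_less[OF this] show False by simp
qed

lemma nconv_add: assumes "nconv X x" "nconv Y y" shows "nconv (\<lambda>n. X n + Y n) (x + y)"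
  unfolding nconv_def
proof (intro allI impI)
  fix \<epsilon> :: real assume "0 < \<epsilon>"
  then obtain N1 N2 where N: "\<forall>n\<ge>N1. nn (X n - x) < \<epsilon>" "\<forall>n\<ge>N2. nn (Y n - y) < \<epsilon>"
    using assms unfolding nconv_def by meson
  have "nn (X n + Y n - (x + y)) < \<epsilon>" if "n \<ge> max N1 N2" for n
    using nn_add_less[of "X n - x" \<epsilon> "Y n - y"] N that by (simp add: algebra_simps)
  thus "\<exists>N. \<forall>n\<ge>N. nn (X n + Y n - (x + y)) < \<epsilon>" by blast
qed

lemma nconv_mult_right: assumes "nconv X x" shows "nconv (\<lambda>n. X n * c) (x * c)"
proof (cases "c = 0")
  case False
  show ?thesis unfolding nconv_def
  proof (intro allI impI)
    fix \<epsilon> :: real assume "0 < \<epsilon>"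
    hence "0 < \<epsilon> / nn c" using nn_pos[OF False] by simp
    then obtain N where N: "\<forall>n\<ge>N. nn (X n - x) < \<epsilon> / nn c" using assms unfolding nconv_def by meson
    have "nn (X n * c - x * c) < \<epsilon>" if "n \<ge> N" for n
    proof -
      have "nn (X n * c - x * c) = nn (X n - x) * nn c" by (simp flip: nn_mult add: algebra_simps)
      thus ?thesis using N that nn_pos[OF False] by (simp add: pos_less_divide_eq)
    qed
    thus "\<exists>N. \<forall>n\<ge>N. nn (X n * c - x * c) < \<epsilon>" by blast
  qed
qed (simp add: nconv_def)

definition subspace_over :: "'a set \<Rightarrow> 'a set \<Rightarrow> bool" where
  "subspace_over A U \<longleftrightarrow> 0 \<in> U \<and> (\<forall>x\<in>U. \<forall>y\<in>U. x + y \<in> U) \<and> (\<forall>c\<in>A. \<forall>x\<in>U. c * x \<in> U)"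

definition add_line :: "'a set \<Rightarrow> 'a \<Rightarrow> 'a set \<Rightarrow> 'a set" where
  "add_line A b U = {c * b + w | c w. c \<in> A \<and> w \<in> U}"

text \<open>The distance from \<open>b\<close> to \<open>U\<close> is positive, since otherwise a
  sequence in \<open>U\<close> would converge to \<open>b\<close>, and \<open>U\<close> contains its
  limits. Dividing by \<open>c\<close> turns this distance into a bound for the coordinate along
  \<open>b\<close>.\<close>

lemma complete_line_bound:
  assumes A: "is_subfield A" and U: "subspace_over A U" "ncomplete U" and b: "b \<notin> U"
  obtains d where "0 < d" "\<And>c w. c \<in> A \<Longrightarrow> w \<in> U \<Longrightarrow> nn c \<le> d * nn (c * b + w)"
proof -
  have AR: "is_subring A" using A by (rule is_subfield_imp_subring)
  have "\<exists>d>0. \<forall>w\<in>U. d \<le> nn (b + w)"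
  proof (rule ccontr)
    assume "\<not> ?thesis"
    hence "\<forall>d>0. \<exists>w\<in>U. nn (b + w) < d" by (meson not_le)
    hence "\<forall>n. \<exists>w\<in>U. nn (b + w) < 1 / real (Suc n)" by simp
    then obtain w where w: "\<And>n. w n \<in> U" "\<And>n. nn (b + w n) < 1 / real (Suc n)" by metis
    define x where "x = (\<lambda>n. (- 1) * w n)"
    have xU: "x n \<in> U" for n
      using U(1) w(1) subring_uminus[OF AR subring_1[OF AR]] by (auto simp: x_def subspace_over_def)
    have xb: "nn (x n - b) < 1 / real (Suc n)" for n
    proof -
      have "x n - b = - (b + w n)" by (simp add: x_def)
      hence "nn (x n - b) = nn (b + w n)" by (simp only: nn_minus)
      thus ?thesis using w(2)[of n] by simp
    qed
    have conv: "nconv x b" unfolding nconv_def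
    proof (intro allI impI)
      fix \<epsilon> :: real assume "0 < \<epsilon>"
      then obtain N where N: "1 / real (Suc N) < \<epsilon>" using nat_approx_posE by blast
      have "nn (x n - b) < \<epsilon>" if "n \<ge> N" for n
      proof -
        have "1 / real (Suc n) \<le> 1 / real (Suc N)" using that by (simp add: frac_le)
        thus ?thesis using xb[of n] N by linarith
      qed
      thus "\<exists>N. \<forall>n\<ge>N. nn (x n - b) < \<epsilon>" by blast
    qed
    have "nCauchy x" unfolding nCauchy_def
    proof (intro allI impI)
      fix \<epsilon> :: real assume "0 < \<epsilon>"
      then obtain N where N: "\<forall>n\<ge>N. nn (x n - b) < \<epsilon>" using conv unfolding nconv_def by blast
      have "nn (x m - x n) < \<epsilon>" if "m \<ge> N" "n \<ge> N" for m n
        using nn_add_less[of "x m - b" \<epsilon> "b - x n"] N that by (simp add: nn_diff_commute[of b])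
      thus "\<exists>N. \<forall>m\<ge>N. \<forall>n\<ge>N. nn (x m - x n) < \<epsilon>" by blast
    qed
    then obtain y where "y \<in> U" "nconv x y" using U(2) xU unfolding ncomplete_def by blast
    thus False using nconv_unique[OF conv] b by blast
  qed
  then obtain d where d: "0 < d" "\<And>w. w \<in> U \<Longrightarrow> d \<le> nn (b + w)" by blast
  show thesis
  proof (rule that[of "1 / d"])
    fix c w assume cw: "c \<in> A" "w \<in> U"
    show "nn c \<le> 1 / d * nn (c * b + w)"
    proof (cases "c = 0")
      case False
      have "inverse c * w \<in> U" using U(1) cw subfield_inverse[OF A] by (auto simp: subspace_over_def)
      hence "d \<le> nn (b + inverse c * w)" by (rule d)
      hence "nn c * d \<le> nn c * nn (b + inverse c * w)" by (intro mult_left_mono nn_nonneg)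
      also have "\<dots> = nn (c * (b + inverse c * w))" by (simp only: nn_mult)
      also have "c * (b + inverse c * w) = c * b + w"
        using False by (simp add: distrib_left flip: mult.assoc)
      finally show ?thesis using d(1) by (simp add: pos_le_divide_eq)
    qed (use d(1) nn_nonneg in simp)
  qed (use d in auto)
qed

lemma complete_add_line:
  assumes A: "is_subfield A" "ncomplete A" and U: "subspace_over A U" "ncomplete U"
  shows "ncomplete (add_line A b U)" "subspace_over A (add_line A b U)"
proof -
  have AR: "is_subring A" using A(1) by (rule is_subfield_imp_subring)
  have U': "0 \<in> U" "\<And>x y. x \<in> U \<Longrightarrow> y \<in> U \<Longrightarrow> x + y \<in> U" "\<And>c x. c \<in> A \<Longrightarrow> x \<in> U \<Longrightarrow> c * x \<in> U"
    using U(1) by (auto simp: subspace_over_def)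
  have Udiff: "x - y \<in> U" if "x \<in> U" "y \<in> U" for x y
    using U'(2)[OF that(1) U'(3)[OF subring_uminus[OF AR subring_1[OF AR]] that(2)]] by simp
  show "subspace_over A (add_line A b U)"
    unfolding subspace_over_def
  proof (intro conjI ballI)
    show "0 \<in> add_line A b U" using U'(1) subring_0[OF AR] unfolding add_line_def by force
  next
    fix x y assume "x \<in> add_line A b U" "y \<in> add_line A b U"
    then obtain c w c' w' where "c \<in> A" "w \<in> U" "x = c * b + w" "c' \<in> A" "w' \<in> U" "y = c' * b + w'"
      unfolding add_line_def by blast
    moreover from this have "x + y = (c + c') * b + (w + w')" by (simp add: algebra_simps)
    ultimately show "x + y \<in> add_line A b U"
      unfolding add_line_def using U'(2) subring_add[OF AR] by blast
  next
    fix a x assume a: "a \<in> A" and "x \<in> add_line A b U"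
    then obtain c w where "c \<in> A" "w \<in> U" "x = c * b + w" unfolding add_line_def by blast
    moreover from this have "a * x = (a * c) * b + a * w" by (simp add: algebra_simps)
    ultimately show "a * x \<in> add_line A b U"
      unfolding add_line_def using a U'(3) subring_mult[OF AR] by blast
  qed
  show "ncomplete (add_line A b U)"
  proof (cases "b \<in> U")
    case True
    have "add_line A b U = U"
    proof (intro equalityI subsetI)
      fix x assume "x \<in> U"
      thus "x \<in> add_line A b U" unfolding add_line_def using subring_0[OF AR] by force
    qed (use True U' in \<open>auto simp: add_line_def\<close>)
    thus ?thesis using U by simp
  next
    case False
    obtain d where d: "0 < d" "\<And>c w. c \<in> A \<Longrightarrow> w \<in> U \<Longrightarrow> nn c \<le> d * nn (c * b + w)"
      using complete_line_bound[OF A(1) U False] by blast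
    show ?thesis unfolding ncomplete_def
    proof (intro allI impI)
      fix X assume X: "\<forall>n. X n \<in> add_line A b U" "nCauchy X"
      have "\<forall>n. \<exists>c w. c \<in> A \<and> w \<in> U \<and> X n = c * b + w" using X(1) unfolding add_line_def by blast
      then obtain c w where cw: "\<And>n. c n \<in> A" "\<And>n. w n \<in> U" "\<And>n. X n = c n * b + w n" by metis
      have cC: "nn (c m - c n) \<le> d * nn (X m - X n)" for m n
      proof -
        have "X m - X n = (c m - c n) * b + (w m - w n)" by (simp add: cw(3) algebra_simps)
        thus ?thesis using d(2)[OF subring_diff[OF AR cw(1) cw(1)] Udiff[OF cw(2) cw(2)], of m n m n] by simp
      qed
      have "nCauchy c" unfolding nCauchy_def
      proof (intro allI impI)
        fix \<epsilon> :: real assume "0 < \<epsilon>"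
        hence "0 < \<epsilon> / d" using d(1) by simp
        then obtain N where N: "\<forall>m\<ge>N. \<forall>n\<ge>N. nn (X m - X n) < \<epsilon> / d" using X(2) unfolding nCauchy_def by blast
        have "nn (c m - c n) < \<epsilon>" if "m \<ge> N" "n \<ge> N" for m n
        proof -
          have "d * nn (X m - X n) < \<epsilon>" using N that d(1) by (simp add: pos_less_divide_eq mult.commute)
          thus ?thesis using cC[of m n] by linarith
        qed
        thus "\<exists>N. \<forall>m\<ge>N. \<forall>n\<ge>N. nn (c m - c n) < \<epsilon>" by blast
      qed
      then obtain c0 where c0: "c0 \<in> A" "nconv c c0" using A(2) cw(1) unfolding ncomplete_def by blast
      have "nCauchy w" unfolding nCauchy_def
      proof (intro allI impI)
        fix \<epsilon> :: real assume \<epsilon>: "0 < \<epsilon>"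
        \<comment> \<open>One part controls \<open>X m - X n\<close>, the other the multiple of
          \<open>b\<close>, whose coefficient is at most \<open>d\<close> times as large. Adding 1
          to \<open>nn b\<close> avoids a separate case \<open>b = 0\<close>.\<close>
        define \<delta> where "\<delta> = min \<epsilon> (\<epsilon> / (d * (nn b + 1)))"
        have nb: "0 < nn b + 1" using nn_nonneg[of b] by simp
        have \<delta>0: "0 < \<delta>" unfolding \<delta>_def using d(1) nb \<epsilon> by simp
        then obtain N where N: "\<forall>m\<ge>N. \<forall>n\<ge>N. nn (X m - X n) < \<delta>"
          using X(2) unfolding nCauchy_def by blast
        have "nn (w m - w n) < \<epsilon>" if mn: "m \<ge> N" "n \<ge> N" for m n
        proof -
          have x: "nn (X m - X n) < \<delta>" using N mn by blast
          have "nn ((c m - c n) * b) \<le> nn (c m - c n) * (nn b + 1)"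
            unfolding nn_mult using nn_nonneg by (intro mult_left_mono) auto
          also have "\<dots> \<le> (d * nn (X m - X n)) * (nn b + 1)"
            using cC[of m n] nb by (intro mult_right_mono) auto
          also have "\<dots> < (d * \<delta>) * (nn b + 1)"
            using x d(1) nb by (intro mult_strict_right_mono mult_strict_left_mono) auto
          also have "\<dots> \<le> \<epsilon>"
          proof -
            have "\<delta> \<le> \<epsilon> / (d * (nn b + 1))" by (simp add: \<delta>_def)
            thus ?thesis using d(1) nb by (simp add: pos_le_divide_eq mult_ac)
          qed
          finally have "nn (- ((c m - c n) * b)) < \<epsilon>" by simp
          moreover have "nn (X m - X n) < \<epsilon>" using x by (simp add: \<delta>_def)
          ultimately have "nn (X m - X n + - ((c m - c n) * b)) < \<epsilon>" by (intro nn_add_less)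
          moreover have "X m - X n + - ((c m - c n) * b) = w m - w n" by (simp add: cw(3) algebra_simps)
          ultimately show ?thesis by simp
        qed
        thus "\<exists>N. \<forall>m\<ge>N. \<forall>n\<ge>N. nn (w m - w n) < \<epsilon>" by blast
      qed
      then obtain w0 where w0: "w0 \<in> U" "nconv w w0" using U(2) cw(2) unfolding ncomplete_def by blast
      have "nconv (\<lambda>n. c n * b + w n) (c0 * b + w0)" by (intro nconv_add nconv_mult_right c0 w0)
      hence "nconv X (c0 * b + w0)" by (simp flip: cw(3))
      moreover have "c0 * b + w0 \<in> add_line A b U" unfolding add_line_def using c0 w0 by blast
      ultimately show "\<exists>x\<in>add_line A b U. nconv X x" by blast
    qed
  qed
qed

definition span_over :: "'a set \<Rightarrow> 'a set \<Rightarrow> 'a set" where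
  "span_over A B = {\<Sum>b\<in>B. c b * b | c. \<forall>b\<in>B. c b \<in> A}"

lemma ncomplete_singleton: "ncomplete {0}"
  unfolding ncomplete_def nconv_def by auto

text \<open>The statement is about subspaces of a span and not about the span, because the
  generators of the field over \<open>qp D\<close> need not lie in the field. They need not be
  independent either.\<close>

lemma subspace_of_span_complete:
  assumes A: "is_subfield A" "ncomplete A" and "finite B" "subspace_over A U" "U \<subseteq> span_over A B"
  shows "ncomplete U"
  using assms(3-)
proof (induction B arbitrary: U)
  case empty
  hence "U = {0}" by (auto simp: span_over_def subspace_over_def)
  thus ?case using ncomplete_singleton by simp
next
  case (insert b B)
  have AR: "is_subring A" using A(1) by (rule is_subfield_imp_subring)
  have U': "0 \<in> U" "\<And>x y. x \<in> U \<Longrightarrow> y \<in> U \<Longrightarrow> x + y \<in> U" "\<And>c x. c \<in> A \<Longrightarrow> x \<in> U \<Longrightarrow> c * x \<in> U"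
    using insert.prems(1) by (auto simp: subspace_over_def)
  have split: "\<exists>c w. c \<in> A \<and> w \<in> span_over A B \<and> u = c * b + w" if u: "u \<in> U" for u
  proof -
    have "u \<in> span_over A (insert b B)" using insert.prems(2) u by blast
    then obtain c where c: "\<forall>x\<in>insert b B. c x \<in> A" "u = (\<Sum>x\<in>insert b B. c x * x)"
      unfolding span_over_def by blast
    have "u = c b * b + (\<Sum>x\<in>B. c x * x)" using c(2) insert.hyps by simp
    thus ?thesis using c(1) unfolding span_over_def by blast
  qed
  have span: "subspace_over A (span_over A B)"
    unfolding subspace_over_def
  proof (intro conjI ballI)
    show "0 \<in> span_over A B" unfolding span_over_def
      using subring_0[OF AR] by (auto intro!: exI[of _ "\<lambda>_. 0"])
    fix x y assume "x \<in> span_over A B" "y \<in> span_over A B"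
    then obtain c d where "\<forall>b\<in>B. c b \<in> A" "x = (\<Sum>b\<in>B. c b * b)" "\<forall>b\<in>B. d b \<in> A" "y = (\<Sum>b\<in>B. d b * b)"
      unfolding span_over_def by blast
    thus "x + y \<in> span_over A B" unfolding span_over_def
      by (auto intro!: exI[of _ "\<lambda>b. c b + d b"] subring_add[OF AR] simp: sum.distrib algebra_simps)
  next
    fix a x assume "a \<in> A" "x \<in> span_over A B"
    moreover from this obtain c where "\<forall>b\<in>B. c b \<in> A" "x = (\<Sum>b\<in>B. c b * b)" unfolding span_over_def by blast
    ultimately show "a * x \<in> span_over A B" unfolding span_over_def
      by (auto intro!: exI[of _ "\<lambda>b. a * c b"] subring_mult[OF AR] simp: sum_distrib_left mult.assoc)
  qed
  define U0 where "U0 = U \<inter> span_over A B"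
  have U0: "subspace_over A U0" using insert.prems(1) span by (auto simp: U0_def subspace_over_def)
  have U0c: "ncomplete U0" by (rule insert.IH[OF U0]) (auto simp: U0_def)
  show ?case
  proof (cases "U \<subseteq> span_over A B")
    case True
    hence "U0 = U" by (auto simp: U0_def)
    thus ?thesis using U0c by simp
  next
    case False
    then obtain u where u: "u \<in> U" "u \<notin> span_over A B" by blast
    obtain c w where cw: "c \<in> A" "w \<in> span_over A B" "u = c * b + w" using split[OF u(1)] by blast
    have c0: "c \<noteq> 0" using u(2) cw by auto
    \<comment> \<open>Scaled so that its coordinate at \<open>b\<close> is 1; subtracting multiples
      of \<open>v\<close> then moves all of \<open>U\<close> into the smaller span.\<close>
    define v where "v = inverse c * u"
    define w' where "w' = inverse c * w"
    have ci: "inverse c \<in> A" using cw(1) by (rule subfield_inverse[OF A(1)])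
    have v: "v \<in> U" "v = b + w'" "w' \<in> span_over A B"
      using U'(3)[OF ci u(1)] span ci cw c0 by (auto simp: v_def w'_def subspace_over_def algebra_simps)
    have "U = add_line A v U0"
    proof (intro equalityI subsetI)
      fix x assume x: "x \<in> U"
      obtain a y where ay: "a \<in> A" "y \<in> span_over A B" "x = a * b + y" using split[OF x] by blast
      have ma: "- a \<in> A" using subring_uminus[OF AR ay(1)] .
      have eq: "x + (- a) * v = y + (- a) * w'" by (simp add: ay(3) v(2) algebra_simps)
      have "x + (- a) * v \<in> U" using U'(2)[OF x U'(3)[OF ma v(1)]] .
      moreover have "y + (- a) * w' \<in> span_over A B" using span ay(2) v(3) ma unfolding subspace_over_def by blast
      ultimately have "x + (- a) * v \<in> U0" using eq by (simp add: U0_def)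
      moreover have "x = a * v + (x + (- a) * v)" by simp
      ultimately show "x \<in> add_line A v U0" unfolding add_line_def using ay(1) by blast
    next
      fix x assume "x \<in> add_line A v U0"
      thus "x \<in> U" unfolding add_line_def U0_def using U' v(1) by blast
    qed
    thus ?thesis using complete_add_line(1)[OF A U0 U0c, of v] by simp
  qed
qed

text \<open>The values of polynomials of degree below \<open>j\<close> form a complete space, built
  up one power of \<open>\<alpha>\<close> at a time. Each new power lies outside, since a relation
  would be a polynomial of degree less than \<open>degree H\<close> vanishing at
  \<open>\<alpha>\<close>.\<close>

lemma minimal_poly_coeff_bound:
  assumes K: "is_subfield K" "ncomplete K" and H: "minimal_poly K H \<alpha>"
  shows "\<exists>C>0. \<forall>g\<in>polys_over K. degree g < degree H \<longrightarrow> (\<forall>i. nn (coeff g i) \<le> C * nn (poly g \<alpha>))"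
proof -
  have KR: "is_subring K" using K(1) by (rule is_subfield_imp_subring)
  define P where "P = (\<lambda>j. {g \<in> polys_over K. \<forall>i\<ge>j. coeff g i = 0})"
  have "j \<le> degree H \<Longrightarrow> ncomplete ((\<lambda>g. poly g \<alpha>) ` P j) \<and> subspace_over K ((\<lambda>g. poly g \<alpha>) ` P j) \<and>
     (\<exists>C>0. \<forall>g\<in>P j. \<forall>i. nn (coeff g i) \<le> C * nn (poly g \<alpha>))" for j
  proof (induction j)
    case 0
    have "P 0 = {0}" using polys_over_0[OF KR] by (auto simp: P_def poly_eq_iff)
    hence "(\<lambda>g. poly g \<alpha>) ` P 0 = {0}" "\<forall>g\<in>P 0. \<forall>i. nn (coeff g i) \<le> 1 * nn (poly g \<alpha>)" by auto
    moreover have "subspace_over K {0}" by (simp add: subspace_over_def)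
    ultimately show ?case using ncomplete_singleton zero_less_one by metis
  next
    case (Suc j)
    define U where "U = (\<lambda>g. poly g \<alpha>) ` P j"
    have IH: "ncomplete U" "subspace_over K U" using Suc by (auto simp: U_def)
    obtain C where C: "0 < C" "\<And>g i. g \<in> P j \<Longrightarrow> nn (coeff g i) \<le> C * nn (poly g \<alpha>)"
      using Suc by auto
    have split: "\<exists>c g'. c \<in> K \<and> g' \<in> P j \<and> g = monom c j + g' \<and> coeff g j = c" if g: "g \<in> P (Suc j)" for g
    proof -
      define g' where "g' = g - monom (coeff g j) j"
      have "g' \<in> polys_over K" unfolding g'_def using g
        by (intro polys_over_diff[OF KR] polys_over_monom[OF KR] polys_over_coeff) (auto simp: P_def)
      moreover have "coeff g' i = 0" if "i \<ge> j" for i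
        using g that by (cases "i = j") (auto simp: g'_def P_def)
      ultimately have "g' \<in> P j" by (simp add: P_def)
      moreover have "g = monom (coeff g j) j + g'" by (simp add: g'_def)
      moreover have "coeff g j \<in> K" using g by (simp add: P_def polys_over_coeff)
      ultimately show ?thesis by blast
    qed
    have notin: "\<alpha> ^ j \<notin> U"
    proof
      assume "\<alpha> ^ j \<in> U"
      then obtain g where g: "g \<in> P j" "\<alpha> ^ j = poly g \<alpha>" by (auto simp: U_def)
      define q where "q = monom 1 j - g"
      have "q \<in> polys_over K" unfolding q_def using g
        by (intro polys_over_diff[OF KR] polys_over_monom[OF KR] subring_1[OF KR]) (auto simp: P_def)
      moreover have cq: "coeff q j = 1" using g by (simp add: q_def P_def)
      hence "q \<noteq> 0" by auto
      moreover have "poly q \<alpha> = 0" using g by (simp add: q_def poly_monom)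
      moreover have "degree q \<le> j" using g by (intro degree_le) (auto simp: q_def P_def)
      ultimately show False using H Suc.prems unfolding minimal_poly_def by (metis Suc_le_lessD leD order_trans)
    qed
    have eq: "(\<lambda>g. poly g \<alpha>) ` P (Suc j) = add_line K (\<alpha> ^ j) U"
    proof (intro equalityI subsetI)
      fix x assume "x \<in> (\<lambda>g. poly g \<alpha>) ` P (Suc j)"
      then obtain g where g: "g \<in> P (Suc j)" "x = poly g \<alpha>" by blast
      obtain c g' where "c \<in> K" "g' \<in> P j" "g = monom c j + g'" using split[OF g(1)] by blast
      thus "x \<in> add_line K (\<alpha> ^ j) U" using g(2) unfolding add_line_def U_def by (auto simp: poly_monom)
    next
      fix x assume "x \<in> add_line K (\<alpha> ^ j) U"
      then obtain c g where cg: "c \<in> K" "g \<in> P j" "x = c * \<alpha> ^ j + poly g \<alpha>" unfolding add_line_def U_def by blast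
      have "monom c j + g \<in> P (Suc j)"
        using cg polys_over_add[OF KR polys_over_monom[OF KR cg(1)]] by (auto simp: P_def)
      moreover have "x = poly (monom c j + g) \<alpha>" using cg by (simp add: poly_monom)
      ultimately show "x \<in> (\<lambda>g. poly g \<alpha>) ` P (Suc j)" by blast
    qed
    obtain d where d: "0 < d" "\<And>c w. c \<in> K \<Longrightarrow> w \<in> U \<Longrightarrow> nn c \<le> d * nn (c * \<alpha> ^ j + w)"
      using complete_line_bound[OF K(1) IH(2,1) notin] by blast
    \<comment> \<open>\<open>d\<close> bounds the coefficient at \<open>j\<close>. The remaining
      polynomial has the value \<open>poly g \<alpha> - c * \<alpha> ^ j\<close>, at most
      \<open>1 + d * nn (\<alpha> ^ j)\<close> times that of \<open>g\<close>, and \<open>C\<close>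
      bounds its coefficients.\<close>
    define C' where "C' = d + C * (1 + d * nn (\<alpha> ^ j))"
    have M0: "0 \<le> d * nn (\<alpha> ^ j)" using d(1) nn_nonneg by simp
    have C'0: "0 < C'" unfolding C'_def using d(1) C(1) M0 by (simp add: add_pos_nonneg)
    have bound: "nn (coeff g i) \<le> C' * nn (poly g \<alpha>)" if g: "g \<in> P (Suc j)" for g i
    proof -
      obtain c g' where cg: "c \<in> K" "g' \<in> P j" "g = monom c j + g'" "coeff g j = c" using split[OF g] by blast
      have pg: "poly g \<alpha> = c * \<alpha> ^ j + poly g' \<alpha>" by (simp add: cg(3) poly_monom)
      have c: "nn c \<le> d * nn (poly g \<alpha>)" using d(2)[OF cg(1), of "poly g' \<alpha>"] cg(2) by (simp add: U_def pg)
      have g0: "0 \<le> nn (poly g \<alpha>)" by (rule nn_nonneg)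
      show ?thesis
      proof (cases "i = j")
        case True
        have "d * nn (poly g \<alpha>) \<le> C' * nn (poly g \<alpha>)"
          using C(1) M0 g0 by (intro mult_right_mono) (auto simp: C'_def)
        thus ?thesis using c True cg(4) by simp
      next
        case False
        have "nn (c * \<alpha> ^ j) \<le> d * nn (poly g \<alpha>) * nn (\<alpha> ^ j)"
          using c nn_nonneg by (simp add: nn_mult mult_right_mono)
        also have "\<dots> \<le> (1 + d * nn (\<alpha> ^ j)) * nn (poly g \<alpha>)" using g0 by (simp add: algebra_simps)
        finally have 1: "nn (c * \<alpha> ^ j) \<le> (1 + d * nn (\<alpha> ^ j)) * nn (poly g \<alpha>)" .
        have 2: "nn (poly g \<alpha>) \<le> (1 + d * nn (\<alpha> ^ j)) * nn (poly g \<alpha>)"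
          using mult_right_mono[OF _ g0, of 1 "1 + d * nn (\<alpha> ^ j)"] M0 by simp
        have "nn (poly g' \<alpha>) \<le> (1 + d * nn (\<alpha> ^ j)) * nn (poly g \<alpha>)"
          using nn_diff_le[OF 2 1] by (simp add: pg)
        hence "C * nn (poly g' \<alpha>) \<le> C * ((1 + d * nn (\<alpha> ^ j)) * nn (poly g \<alpha>))"
          using C(1) by (intro mult_left_mono) auto
        moreover have "coeff g i = coeff g' i" using False by (simp add: cg(3))
        moreover have "C * ((1 + d * nn (\<alpha> ^ j)) * nn (poly g \<alpha>)) \<le> C' * nn (poly g \<alpha>)"
          using d(1) g0 by (simp add: C'_def algebra_simps)
        ultimately show ?thesis using C(2)[OF cg(2), of i] by (metis order_trans)
      qed
    qed
    show ?case unfolding eq using complete_add_line[OF K IH(2,1)] bound C'0 by blast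
  qed
  from this[of "degree H"] obtain C where C: "C > 0" "\<And>g i. g \<in> P (degree H) \<Longrightarrow> nn (coeff g i) \<le> C * nn (poly g \<alpha>)"
    by auto
  have "g \<in> P (degree H)" if "g \<in> polys_over K" "degree g < degree H" for g
    using that by (auto simp: P_def coeff_eq_0)
  thus ?thesis using C by blast
qed

lemma minimal_poly_conjugate_bound:
  assumes K: "is_subfield K" "ncomplete K" and H: "minimal_poly K H \<alpha>"
  shows "\<exists>C>0. \<forall>g\<in>polys_over K. degree g < degree H \<longrightarrow> nn (poly g \<beta>) \<le> C * nn (poly g \<alpha>)"
proof -
  obtain C where C: "0 < C" "\<And>g i. g \<in> polys_over K \<Longrightarrow> degree g < degree H \<Longrightarrow> nn (coeff g i) \<le> C * nn (poly g \<alpha>)"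
    using minimal_poly_coeff_bound[OF K H] by blast
  define M where "M = (max 1 (nn \<beta>)) ^ degree H"
  have M: "nn (\<beta> ^ i) \<le> M" if "i \<le> degree H" for i
  proof -
    have "nn (\<beta> ^ i) \<le> (max 1 (nn \<beta>)) ^ i" unfolding nn_power by (intro power_mono nn_nonneg) simp
    also have "\<dots> \<le> M" unfolding M_def using that by (intro power_increasing) auto
    finally show ?thesis .
  qed
  have M0: "0 < M" unfolding M_def by simp
  have "nn (poly g \<beta>) \<le> (C * M) * nn (poly g \<alpha>)" if g: "g \<in> polys_over K" "degree g < degree H" for g
  proof -
    have "nn (coeff g i * \<beta> ^ i) \<le> (C * M) * nn (poly g \<alpha>)" if "i \<le> degree g" for i
    proof -
      have "nn (coeff g i) * nn (\<beta> ^ i) \<le> (C * nn (poly g \<alpha>)) * M"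
        using C(2)[OF g] M[of i] that g(2) nn_nonneg C(1) by (intro mult_mono) auto
      thus ?thesis by (simp add: nn_mult mult_ac)
    qed
    thus ?thesis unfolding poly_altdef[of g \<beta>]
      using C(1) M0 nn_nonneg by (intro nn_sum_le) auto
  qed
  thus ?thesis using C(1) M0 by (intro exI[of _ "C * M"]) auto
qed

text \<open>The bound is applied to all powers, reduced modulo \<open>H\<close> to stay below its
  degree. As the constant does not depend on the exponent, a strict inequality between the absolute
  values would be amplified without limit. Exchanging the two roots gives equality.\<close>

theorem conjugates_nn_eq:
  assumes K: "is_subfield K" "ncomplete K" and H: "minimal_poly K H \<alpha>" and \<beta>: "poly H \<beta> = 0"
  shows "nn \<alpha> = nn \<beta>"
proof -
  have KR: "is_subring K" using K(1) by (rule is_subfield_imp_subring)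
  have le: "nn b \<le> nn a" if Ha: "minimal_poly K H a" and Hb: "poly H b = 0" for a b
  proof -
    have H': "H \<in> polys_over K" "monic H" "poly H a = 0" using Ha by (auto simp: minimal_poly_def)
    obtain C where C: "0 < C" "\<And>g. g \<in> polys_over K \<Longrightarrow> degree g < degree H \<Longrightarrow> nn (poly g b) \<le> C * nn (poly g a)"
      using minimal_poly_conjugate_bound[OF K Ha] by blast
    have pw: "nn b ^ n \<le> C * nn a ^ n" for n
    proof -
      define g where "g = monom 1 n mod H"
      have gK: "g \<in> polys_over K" unfolding g_def
        by (intro polys_over_mod[OF KR H'(1,2)] polys_over_monom[OF KR] subring_1[OF KR])
      have "degree g < degree H" unfolding g_def
        using degree_mod_less[of H] minimal_poly_degree_pos[OF Ha] monic_nonzero[OF H'(2)] by (metis degree_0)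
      moreover have "poly g x = x ^ n" if "poly H x = 0" for x
      proof -
        have "monom 1 n = H * (monom 1 n div H) + g" by (simp add: g_def)
        hence "poly (monom 1 n) x = poly H x * poly (monom 1 n div H) x + poly g x"
          by (metis poly_add poly_mult)
        thus ?thesis using that by (simp add: poly_monom)
      qed
      ultimately show ?thesis using C(2)[OF gK] H'(3) Hb by (simp add: nn_power)
    qed
    show ?thesis
    proof (rule ccontr)
      assume "\<not> nn b \<le> nn a"
      hence lt: "nn a < nn b" by simp
      show False
      proof (cases "nn a = 0")
        case True
        thus False using pw[of 1] lt by simp
      next
        case False
        hence a: "0 < nn a" using nn_nonneg[of a] by simp
        have "1 < nn b / nn a" using lt a by (simp add: pos_less_divide_eq)
        then obtain n where "C < (nn b / nn a) ^ n" using real_arch_pow by blast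
        hence "C * nn a ^ n < nn b ^ n" using a by (simp add: power_divide pos_less_divide_eq)
        thus False using pw[of n] by simp
      qed
    qed
  qed
  have "minimal_poly K H \<beta>" using minimal_poly_root[OF K(1) H \<beta>] .
  moreover have "poly H \<alpha> = 0" using H by (simp add: minimal_poly_def)
  ultimately show ?thesis using le[OF H \<beta>] le[of \<beta> \<alpha>] by (intro antisym) auto
qed

end

section \<open>The base field and the Gauss valuation\<close>

locale padic =
  fixes p :: nat and D :: "('a::{alg_closed_field,field_char_0}, 'k::alg_closed_field) padic_data"
  assumes setting: "padic_setting p D"
begin

abbreviation "K \<equiv> fld D"

text \<open>\<open>rv 0\<close> is 0 by convention and does not express the infinite valuation, so 0
  is always treated apart.\<close>

definition rv :: "'a \<Rightarrow> real" where "rv x = real_of_ereal (valn D x)"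

definition vi :: "'a \<Rightarrow> int" where "vi x = \<lfloor>rv x\<rfloor>"

lemma valuation: "is_valuation (valn D)"
  and qp: "is_padic_numbers p (valn D) (qp D)"
  and algebraic_qp: "\<forall>x. \<exists>P\<in>polys_over (qp D). P \<noteq> 0 \<and> poly P x = 0"
  and K: "is_subfield K" and qp_K: "qp D \<subseteq> K"
  and K_finite: "\<exists>B. finite B \<and> (\<forall>x\<in>K. \<exists>c. (\<forall>b\<in>B. c b \<in> qp D) \<and> x = (\<Sum>b\<in>B. c b * b))"
  and valn_K: "valn D ` (K - {0}) = range (\<lambda>k::int. ereal (of_int k))"
  and unif: "unif D \<in> K" "valn D (unif D) = 1"
  and red_1: "red D 1 = 1"
  and red_hom: "\<forall>x\<in>int_ring D. \<forall>y\<in>int_ring D.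
        red D (x + y) = red D x + red D y \<and> red D (x * y) = red D x * red D y"
  and red_ker: "\<forall>x\<in>int_ring D. red D x = 0 \<longleftrightarrow> x \<in> max_ideal D"
  by (rule setting[unfolded padic_setting_def, THEN conjunct2, THEN conjunct1]
    setting[unfolded padic_setting_def, THEN conjunct2, THEN conjunct2, THEN conjunct1]
    setting[unfolded padic_setting_def, THEN conjunct2, THEN conjunct2, THEN conjunct2, THEN conjunct1]
    setting[unfolded padic_setting_def, THEN conjunct2, THEN conjunct2, THEN conjunct2, THEN conjunct2, THEN conjunct1]
    setting[unfolded padic_setting_def, THEN conjunct2, THEN conjunct2, THEN conjunct2, THEN conjunct2, THEN conjunct2, THEN conjunct1]
    setting[unfolded padic_setting_def, THEN conjunct2, THEN conjunct2, THEN conjunct2, THEN conjunct2, THEN conjunct2, THEN conjunct2, THEN conjunct1]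
    setting[unfolded padic_setting_def, THEN conjunct2, THEN conjunct2, THEN conjunct2, THEN conjunct2, THEN conjunct2, THEN conjunct2, THEN conjunct2, THEN conjunct1]
    setting[unfolded padic_setting_def, THEN conjunct2, THEN conjunct2, THEN conjunct2, THEN conjunct2, THEN conjunct2, THEN conjunct2, THEN conjunct2, THEN conjunct2, THEN conjunct1]
    setting[unfolded padic_setting_def, THEN conjunct2, THEN conjunct2, THEN conjunct2, THEN conjunct2, THEN conjunct2, THEN conjunct2, THEN conjunct2, THEN conjunct2, THEN conjunct2, THEN conjunct1]
    setting[unfolded padic_setting_def, THEN conjunct2, THEN conjunct2, THEN conjunct2, THEN conjunct2, THEN conjunct2, THEN conjunct2, THEN conjunct2, THEN conjunct2, THEN conjunct2, THEN conjunct2, THEN conjunct1]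
    setting[unfolded padic_setting_def, THEN conjunct2, THEN conjunct2, THEN conjunct2, THEN conjunct2, THEN conjunct2, THEN conjunct2, THEN conjunct2, THEN conjunct2, THEN conjunct2, THEN conjunct2, THEN conjunct2, THEN conjunct1]
    setting[unfolded padic_setting_def, THEN conjunct2, THEN conjunct2, THEN conjunct2, THEN conjunct2, THEN conjunct2, THEN conjunct2, THEN conjunct2, THEN conjunct2, THEN conjunct2, THEN conjunct2, THEN conjunct2, THEN conjunct2])+

lemma KR: "is_subring K"
  by (rule is_subfield_imp_subring[OF K])

lemma valn_0: "valn D x = \<infinity> \<longleftrightarrow> x = 0"
  using valuation by (simp add: is_valuation_def)

lemma valn_eq: "x \<noteq> 0 \<Longrightarrow> valn D x = ereal (rv x)"
  using valuation unfolding is_valuation_def rv_def by (metis real_of_ereal.simps(1))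

lemma rv_mult: "x \<noteq> 0 \<Longrightarrow> y \<noteq> 0 \<Longrightarrow> rv (x * y) = rv x + rv y"
proof -
  assume nz: "x \<noteq> 0" "y \<noteq> 0"
  have "valn D (x * y) = valn D x + valn D y" using valuation by (simp add: is_valuation_def)
  thus ?thesis using nz by (simp add: valn_eq)
qed

lemma rv_add: "x \<noteq> 0 \<Longrightarrow> y \<noteq> 0 \<Longrightarrow> x + y \<noteq> 0 \<Longrightarrow> min (rv x) (rv y) \<le> rv (x + y)"
proof -
  assume nz: "x \<noteq> 0" "y \<noteq> 0" "x + y \<noteq> 0"
  have "min (valn D x) (valn D y) \<le> valn D (x + y)" using valuation by (simp add: is_valuation_def)
  thus ?thesis using nz by (simp add: valn_eq min_def split: if_splits)
qed

lemma rv_1: "rv 1 = 0"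
  using rv_mult[of 1 1] by simp

lemma rv_inverse: "x \<noteq> 0 \<Longrightarrow> rv (inverse x) = - rv x"
  using rv_mult[of x "inverse x"] rv_1 by simp

lemma rv_power: "x \<noteq> 0 \<Longrightarrow> rv (x ^ n) = real n * rv x"
  by (induction n) (auto simp: rv_1 rv_mult algebra_simps)

lemma rv_powi: "x \<noteq> 0 \<Longrightarrow> rv (x powi n) = of_int n * rv x"
  by (cases "n \<ge> 0") (auto simp: power_int_def rv_power rv_inverse)

lemma rv_K: assumes "x \<in> K" "x \<noteq> 0" shows "rv x = of_int (vi x)"
proof -
  have "valn D x \<in> range (\<lambda>k::int. ereal (of_int k))" using assms valn_K by blast
  thus ?thesis by (auto simp: vi_def rv_def)
qed

lemma vi_mult: assumes "x \<in> K" "x \<noteq> 0" "y \<in> K" "y \<noteq> 0" shows "vi (x * y) = vi x + vi y"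
proof -
  have "real_of_int (vi (x * y)) = real_of_int (vi x) + real_of_int (vi y)"
    using rv_mult[OF assms(2,4)] rv_K[OF assms(1,2)] rv_K[OF assms(3,4)]
      rv_K[OF subring_mult[OF KR assms(1,3)]] assms by simp
  thus ?thesis by linarith
qed

text \<open>The base 2 is arbitrary; any base greater than 1 gives the same comparisons.\<close>

definition nn :: "'a \<Rightarrow> real" where "nn x = (if x = 0 then 0 else 2 powr (- rv x))"

sublocale abs_value nn
proof
  fix x y
  show "0 \<le> nn x" "nn x = 0 \<longleftrightarrow> x = 0" by (auto simp: nn_def)
  show "nn (x * y) = nn x * nn y" by (auto simp: nn_def rv_mult powr_add[symmetric])
  show "nn (x + y) \<le> max (nn x) (nn y)"
  proof (cases "x = 0 \<or> y = 0 \<or> x + y = 0")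
    case False
    hence "min (rv x) (rv y) \<le> rv (x + y)" using rv_add by blast
    hence "rv x \<le> rv (x + y) \<or> rv y \<le> rv (x + y)" by linarith
    thus ?thesis using False by (auto simp: nn_def le_max_iff_disj)
  qed (auto simp: nn_def le_max_iff_disj)
qed

lemma nn_less_iff: "nn x < 2 powr (- M) \<longleftrightarrow> ereal M < valn D x"
proof (cases "x = 0")
  case True
  hence "valn D x = \<infinity>" using valn_0 by simp
  thus ?thesis using True by (simp add: nn_def)
qed (simp add: nn_def valn_eq)

lemma exists_powr: assumes "0 < (\<epsilon>::real)" obtains M where "2 powr (- M) = \<epsilon>"
  using assms by (intro that[of "- log 2 \<epsilon>"]) simp

lemma qp_complete: "is_subfield (qp D)" "ncomplete (qp D)"
proof -
  show "is_subfield (qp D)" using qp unfolding is_padic_numbers_def by (elim conjE)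
  note q = qp[unfolded is_padic_numbers_def, THEN conjunct2, THEN conjunct2, THEN conjunct2, THEN conjunct2]
  show "ncomplete (qp D)" unfolding ncomplete_def
  proof (intro allI impI)
    fix X assume X: "\<forall>n. X n \<in> qp D" "nCauchy X"
    have "\<forall>M::real. \<exists>n0. \<forall>m\<ge>n0. \<forall>n\<ge>n0. ereal M < valn D (X m - X n)"
    proof
      fix M :: real
      have "(0::real) < 2 powr (- M)" by simp
      thus "\<exists>n0. \<forall>m\<ge>n0. \<forall>n\<ge>n0. ereal M < valn D (X m - X n)"
        using X(2) unfolding nCauchy_def nn_less_iff[symmetric] by blast
    qed
    with q[rule_format, of X] X(1) obtain x
      where x: "x \<in> qp D" "\<forall>M::real. \<exists>n0. \<forall>n\<ge>n0. ereal M < valn D (X n - x)"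
      by blast
    have "nconv X x" unfolding nconv_def
    proof (intro allI impI)
      fix \<epsilon> :: real assume "0 < \<epsilon>"
      then obtain M where M: "2 powr (- M) = \<epsilon>" using exists_powr by blast
      show "\<exists>N. \<forall>n\<ge>N. nn (X n - x) < \<epsilon>" using x(2) unfolding M[symmetric] nn_less_iff by blast
    qed
    thus "\<exists>x\<in>qp D. nconv X x" using x(1) by blast
  qed
qed

lemma K_complete: "ncomplete K"
proof -
  obtain B where B: "finite B" "\<forall>x\<in>K. \<exists>c. (\<forall>b\<in>B. c b \<in> qp D) \<and> x = (\<Sum>b\<in>B. c b * b)"
    using K_finite by blast
  have "subspace_over (qp D) K"
    using subring_0[OF KR] subring_add[OF KR] subring_mult[OF KR] qp_K unfolding subspace_over_def by blast
  moreover have "K \<subseteq> span_over (qp D) B" using B(2) unfolding span_over_def by blast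
  ultimately show ?thesis using subspace_of_span_complete[OF qp_complete B(1)] by blast
qed

lemma algebraic: obtains G where "minimal_poly K G \<theta>"
proof -
  obtain P where P: "P \<in> polys_over (qp D)" "P \<noteq> 0" "poly P \<theta> = 0"
    using algebraic_qp by blast
  have "P \<in> polys_over K" using P(1) polys_over_mono[OF qp_K] by blast
  thus thesis using minimal_poly_exists[OF K _ P(2,3)] that by blast
qed

lemma conjugates_rv:
  assumes "minimal_poly K H \<alpha>" "poly H \<beta> = 0"
  shows "\<alpha> = 0 \<longleftrightarrow> \<beta> = 0" "rv \<alpha> = rv \<beta>"
proof -
  have eq: "nn \<alpha> = nn \<beta>" by (rule conjugates_nn_eq[OF K K_complete assms])
  show *: "\<alpha> = 0 \<longleftrightarrow> \<beta> = 0" using eq nn_0_iff by metis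
  show "rv \<alpha> = rv \<beta>" using * eq powr_inj[of 2 "- rv \<alpha>" "- rv \<beta>"] by (cases "\<alpha> = 0") (auto simp: nn_def)
qed

section \<open>Coefficients of a minimal polynomial\<close>

lemma nn_coeff_prod_roots:
  assumes "\<And>a. a \<in># A \<Longrightarrow> nn a = \<rho>" "0 \<le> \<rho>"
  shows "nn (coeff (\<Prod>x\<in>#A. [:-x, 1:]) 0) = \<rho> ^ size A \<and>
    (\<forall>j\<le>size A. nn (coeff (\<Prod>x\<in>#A. [:-x, 1:]) j) \<le> \<rho> ^ (size A - j)) \<and>
    (\<forall>j>size A. coeff (\<Prod>x\<in>#A. [:-x, 1:]) j = 0)"
  using assms(1)
proof (induction A)
  case (add a A)
  define P where "P = (\<Prod>x\<in>#A. [:-x, 1:])"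
  define n where "n = size A"
  have IH: "nn (coeff P 0) = \<rho> ^ n" "\<And>j. j \<le> n \<Longrightarrow> nn (coeff P j) \<le> \<rho> ^ (n - j)" "\<And>j. j > n \<Longrightarrow> coeff P j = 0"
    using add by (auto simp: P_def n_def)
  have a: "nn a = \<rho>" using add by simp
  have c0: "coeff ([:- a, 1:] * P) 0 = - a * coeff P 0" by simp
  have cS: "coeff ([:- a, 1:] * P) (Suc j) = coeff P j - a * coeff P (Suc j)" for j by simp
  have 1: "nn (coeff ([:- a, 1:] * P) 0) = \<rho> ^ Suc n" unfolding c0 by (simp add: nn_mult a IH(1))
  have 2: "nn (coeff ([:- a, 1:] * P) j) \<le> \<rho> ^ (Suc n - j)" if j: "j \<le> Suc n" for j
  proof (cases j)
    case 0
    thus ?thesis using 1 by simp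
  next
    case (Suc i)
    have "nn (a * coeff P (Suc i)) \<le> \<rho> ^ (n - i)"
    proof (cases "Suc i \<le> n")
      case True
      have "nn (a * coeff P (Suc i)) \<le> \<rho> * \<rho> ^ (n - Suc i)"
        unfolding nn_mult a using IH(2)[OF True] assms(2) by (intro mult_left_mono) auto
      thus ?thesis using True by (metis Suc_diff_Suc Suc_le_lessD power_Suc)
    next
      case False
      thus ?thesis using IH(3)[of "Suc i"] assms(2) by simp
    qed
    moreover have "nn (coeff P i) \<le> \<rho> ^ (n - i)" using IH(2)[of i] j Suc by simp
    ultimately show ?thesis unfolding Suc cS by (simp add: nn_diff_le)
  qed
  have 3: "coeff ([:- a, 1:] * P) j = 0" if "j > Suc n" for j
    using that IH(3) by (cases j) auto
  show ?case using 1 2 3 by (simp add: P_def n_def)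
qed auto

text \<open>Up to sign the coefficients are the elementary symmetric functions of conjugates of
  equal value. The polygon of \<open>H\<close> with respect to x is thus a single segment ending at
  \<open>(degree H, 0)\<close>.\<close>

lemma minimal_poly_coeff_rv:
  assumes H: "minimal_poly K H \<alpha>" and \<alpha>: "\<alpha> \<noteq> 0"
  shows "coeff H 0 \<noteq> 0" "rv (coeff H 0) = real (degree H) * rv \<alpha>"
    "\<And>j. coeff H j \<noteq> 0 \<Longrightarrow> (real (degree H) - real j) * rv \<alpha> \<le> rv (coeff H j)"
proof -
  have H': "monic H" using H by (simp add: minimal_poly_def)
  obtain A where A: "size A = degree H" "H = smult (lead_coeff H) (\<Prod>x\<in>#A. [:-x, 1:])"
    using alg_closed_imp_factorization[OF monic_nonzero[OF H']] by blast
  have HA: "H = (\<Prod>x\<in>#A. [:-x, 1:])" using A(2) H' by (simp add: monic_def)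
  have "nn a = nn \<alpha>" if "a \<in># A" for a
  proof -
    have "poly H a = 0" unfolding HA using that
      by (subst poly_prod_mset) (force simp: prod_mset_zero_iff)
    thus ?thesis using conjugates_nn_eq[OF K K_complete H] by simp
  qed
  note c = nn_coeff_prod_roots[of A "nn \<alpha>", OF this nn_nonneg, folded HA, unfolded A(1)]
  have n0: "0 < nn \<alpha>" using nn_pos[OF \<alpha>] .
  show h0: "coeff H 0 \<noteq> 0"
  proof
    assume "coeff H 0 = 0"
    hence "nn \<alpha> ^ degree H = 0" using c by simp
    thus False using n0 by simp
  qed
  have nnpow: "nn \<alpha> ^ m = 2 powr (- (real m * rv \<alpha>))" for m
    using \<alpha> by (simp add: nn_def powr_power mult.commute)
  show "rv (coeff H 0) = real (degree H) * rv \<alpha>"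
  proof -
    have "nn (coeff H 0) = 2 powr (- (real (degree H) * rv \<alpha>))" using c nnpow by simp
    thus ?thesis using h0 powr_inj[of 2 "- rv (coeff H 0)" "- (real (degree H) * rv \<alpha>)"]
      by (simp add: nn_def)
  qed
  fix j assume j: "coeff H j \<noteq> 0"
  hence jle: "j \<le> degree H" by (rule le_degree)
  hence "nn (coeff H j) \<le> 2 powr (- (real (degree H - j) * rv \<alpha>))" using c nnpow by metis
  hence "real (degree H - j) * rv \<alpha> \<le> rv (coeff H j)" using j by (simp add: nn_def)
  thus "(real (degree H) - real j) * rv \<alpha> \<le> rv (coeff H j)" using jle by (simp add: of_nat_diff)
qed

section \<open>Integers and reduction\<close>

abbreviation "\<O> \<equiv> int_ring D"

lemma O_iff: "x \<in> \<O> \<longleftrightarrow> x \<in> K \<and> (x \<noteq> 0 \<longrightarrow> 0 \<le> vi x)"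
proof (cases "x = 0")
  case True
  thus ?thesis using valn_0[of x] subring_0[OF KR] by (simp add: int_ring_def)
next
  case False
  show ?thesis
  proof (cases "x \<in> K")
    case True
    thus ?thesis using False rv_K[OF True False] by (simp add: int_ring_def valn_eq)
  qed (simp add: int_ring_def)
qed

lemma m_iff: "x \<in> max_ideal D \<longleftrightarrow> x \<in> K \<and> (x \<noteq> 0 \<longrightarrow> 0 < vi x)"
proof (cases "x = 0")
  case True
  thus ?thesis using valn_0[of x] subring_0[OF KR] by (simp add: max_ideal_def)
next
  case False
  show ?thesis
  proof (cases "x \<in> K")
    case True
    thus ?thesis using False rv_K[OF True False] by (simp add: max_ideal_def valn_eq)
  qed (simp add: max_ideal_def)
qed

lemma OR: "is_subring \<O>"
proof -
  have val: "0 \<le> valn D (x - y)" if "0 \<le> valn D x" "0 \<le> valn D y" for x y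
  proof -
    have "nn z \<le> 1 \<longleftrightarrow> 0 \<le> valn D z" for z
    proof (cases "z = 0")
      case True
      thus ?thesis using valn_0[of z] by simp
    next
      case False
      thus ?thesis using powr_le_cancel_iff[of 2 "- rv z" 0] by (simp add: nn_def valn_eq)
    qed
    thus ?thesis using that nn_diff_le by metis
  qed
  have "valn D (x * y) = valn D x + valn D y" for x y using valuation by (simp add: is_valuation_def)
  hence "x * y \<in> \<O>" if "x \<in> \<O>" "y \<in> \<O>" for x y
    using that subring_mult[OF KR] by (auto simp: int_ring_def)
  moreover have "x - y \<in> \<O>" if "x \<in> \<O>" "y \<in> \<O>" for x y
    using that val subring_diff[OF KR] by (auto simp: int_ring_def)
  moreover have "0 \<in> \<O>" "1 \<in> \<O>" using subring_0[OF KR] subring_1[OF KR] rv_1 by (auto simp: O_iff vi_def)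
  ultimately show ?thesis by (auto simp: is_subring_def)
qed

lemma O_K: "\<O> \<subseteq> K" by (auto simp: int_ring_def)

lemma OK_poly: "P \<in> polys_over \<O> \<Longrightarrow> P \<in> polys_over K"
  using polys_over_mono[OF O_K] .

lemma red_add: "x \<in> \<O> \<Longrightarrow> y \<in> \<O> \<Longrightarrow> red D (x + y) = red D x + red D y"
  and red_mult: "x \<in> \<O> \<Longrightarrow> y \<in> \<O> \<Longrightarrow> red D (x * y) = red D x * red D y"
  and red_eq_0_iff: "x \<in> \<O> \<Longrightarrow> red D x = 0 \<longleftrightarrow> x \<in> max_ideal D"
  using red_hom red_ker by blast+

lemma red_0: "red D 0 = 0"
  using red_eq_0_iff[of 0] subring_0[OF OR] by (auto simp: m_iff subring_0[OF KR])

lemma red_sum: "(\<And>i. i \<in> I \<Longrightarrow> f i \<in> \<O>) \<Longrightarrow> red D (sum f I) = (\<Sum>i\<in>I. red D (f i))"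
proof (induction I rule: infinite_finite_induct)
  case (insert i I)
  thus ?case using red_add[of "f i" "sum f I"] subring_sum[OF OR, of I f] by auto
qed (auto simp: red_0)

lemma coeff_reduce: "coeff (reduce D P) n = red D (coeff P n)"
  by (simp add: reduce_def coeff_map_poly red_0)

lemma reduce_add:
  "P \<in> polys_over \<O> \<Longrightarrow> Q \<in> polys_over \<O> \<Longrightarrow> reduce D (P + Q) = reduce D P + reduce D Q"
  by (simp add: poly_eq_iff coeff_reduce red_add polys_over_coeff)

lemma reduce_mult:
  assumes "P \<in> polys_over \<O>" "Q \<in> polys_over \<O>"
  shows "reduce D (P * Q) = reduce D P * reduce D Q"
proof (rule poly_eqI)
  fix n
  have "red D (coeff (P * Q) n) = (\<Sum>i\<le>n. red D (coeff P i * coeff Q (n - i)))"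
    unfolding coeff_mult using assms by (intro red_sum subring_mult[OF OR] polys_over_coeff)
  thus "coeff (reduce D (P * Q)) n = coeff (reduce D P * reduce D Q) n"
    using assms by (simp add: coeff_reduce coeff_mult red_mult polys_over_coeff)
qed

lemma reduce_1: "reduce D 1 = 1"
proof (rule poly_eqI)
  fix n show "coeff (reduce D 1) n = coeff 1 n"
    by (cases n) (auto simp: coeff_reduce red_0 red_1)
qed

lemma reduce_power: "P \<in> polys_over \<O> \<Longrightarrow> reduce D (P ^ n) = reduce D P ^ n"
proof (induction n)
  case (Suc n)
  thus ?case using polys_over_power[OF OR Suc.prems] by (simp add: reduce_mult)
qed (simp add: reduce_1)

lemma reduce_monic:
  assumes "monic P" shows "monic (reduce D P)" "degree (reduce D P) = degree P"
proof -
  have "coeff (reduce D P) (degree P) = 1" using assms by (simp add: coeff_reduce monic_def red_1)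
  moreover have "coeff (reduce D P) n = 0" if "n > degree P" for n
    using that by (simp add: coeff_reduce red_0 coeff_eq_0)
  ultimately show "degree (reduce D P) = degree P"
    by (metis degree_le le_degree order_antisym zero_neq_one)
  thus "monic (reduce D P)" using \<open>coeff (reduce D P) (degree P) = 1\<close> by (simp add: monic_def)
qed

abbreviation "F0 \<equiv> red D ` \<O>"

lemma reduce_F0: "P \<in> polys_over \<O> \<Longrightarrow> reduce D P \<in> polys_over F0"
  by (auto simp: polys_over_def coeff_reduce)

lemma F0: "is_subfield F0"
proof -
  have neg: "red D (- y) = - red D y" if "y \<in> \<O>" for y
    using red_add[of y "- y"] that subring_uminus[OF OR that] red_0 by (simp add: eq_neg_iff_add_eq_0 add.commute)
  have diff: "red D x - red D y \<in> F0" if "x \<in> \<O>" "y \<in> \<O>" for x y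
    using red_add[of x "- y"] neg[OF that(2)] that subring_uminus[OF OR] subring_diff[OF OR that]
    by (intro image_eqI[of _ _ "x - y"]) auto
  have mul: "red D x * red D y \<in> F0" if "x \<in> \<O>" "y \<in> \<O>" for x y
    using red_mult[OF that] subring_mult[OF OR that] by (intro image_eqI[of _ _ "x * y"]) auto
  have inv: "inverse (red D x) \<in> F0" if x: "x \<in> \<O>" for x
  proof (cases "red D x = 0")
    case True
    thus ?thesis using red_0 subring_0[OF OR] by (intro image_eqI[of _ _ 0]) auto
  next
    case False
    hence nz: "x \<noteq> 0" "vi x = 0" and xK: "x \<in> K"
      using x red_eq_0_iff[OF x] red_0 by (auto simp: O_iff m_iff)
    have iK: "inverse x \<in> K" using subfield_inverse[OF K xK] .
    have "vi 1 = 0" using rv_1 by (simp add: vi_def)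
    hence "vi (inverse x) = 0" using vi_mult[OF xK nz(1) iK] nz by simp
    hence iO: "inverse x \<in> \<O>" using iK by (simp add: O_iff)
    have "red D x * red D (inverse x) = 1" using red_mult[OF x iO] nz red_1 by simp
    hence "inverse (red D x) = red D (inverse x)" by (rule inverse_unique)
    thus ?thesis using iO by blast
  qed
  have "red D 0 \<in> F0" "red D 1 \<in> F0" using subring_0[OF OR] subring_1[OF OR] by blast+
  thus ?thesis unfolding is_subfield_def using diff mul inv red_0 red_1 by auto
qed

section \<open>The Gauss valuation\<close>

abbreviation "\<pi> \<equiv> unif D"

lemma \<pi>: "\<pi> \<in> K" "\<pi> \<noteq> 0" "rv \<pi> = 1"
proof -
  show "\<pi> \<in> K" "\<pi> \<noteq> 0" using unif valn_0[of \<pi>] by auto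
  show "rv \<pi> = 1" using unif by (simp add: rv_def)
qed

lemma \<pi>_powi: "\<pi> powi u \<in> K" "\<pi> powi u \<noteq> 0" "vi (inverse (\<pi> powi u)) = - u"
proof -
  show "\<pi> powi u \<in> K" using subfield_power_int[OF K \<pi>(1)] .
  show nz: "\<pi> powi u \<noteq> 0" using \<pi>(2) by simp
  have "rv (inverse (\<pi> powi u)) = of_int (- u)" using rv_inverse[OF nz] rv_powi[OF \<pi>(2)] \<pi>(3) by simp
  thus "vi (inverse (\<pi> powi u)) = - u" by (simp add: vi_def)
qed

text \<open>After division by the power \<open>u\<close> of the uniformizer, value at least
  \<open>u\<close> becomes integrality and value greater than \<open>u\<close> becomes zero
  reduction.\<close>

definition scale :: "int \<Rightarrow> 'a poly \<Rightarrow> 'a poly" where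
  "scale u P = smult (inverse (\<pi> powi u)) P"

lemma vi_scale: "b \<in> K \<Longrightarrow> b \<noteq> 0 \<Longrightarrow> vi (inverse (\<pi> powi u) * b) = vi b - u"
  using vi_mult[OF subfield_inverse[OF K \<pi>_powi(1)] _, of u b] \<pi>_powi by simp

lemma scale_K: "b \<in> K \<Longrightarrow> inverse (\<pi> powi u) * b \<in> K"
  using subring_mult[OF KR subfield_inverse[OF K \<pi>_powi(1)]] .

lemma scale_coeff_O: "b \<in> K \<Longrightarrow> inverse (\<pi> powi u) * b \<in> \<O> \<longleftrightarrow> (b \<noteq> 0 \<longrightarrow> u \<le> vi b)"
  using vi_scale[of b u] scale_K[of b u] \<pi>_powi(2)[of u] by (auto simp: O_iff)

lemma scale_coeff_m: "b \<in> K \<Longrightarrow> inverse (\<pi> powi u) * b \<in> max_ideal D \<longleftrightarrow> (b \<noteq> 0 \<longrightarrow> u + 1 \<le> vi b)"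
  using vi_scale[of b u] scale_K[of b u] \<pi>_powi(2)[of u] by (auto simp: m_iff)

lemma gauss_ge_iff:
  "val_ge (gauss_val D) u P \<longleftrightarrow> (\<forall>j. coeff P j \<noteq> 0 \<longrightarrow> u \<le> vi (coeff P j))"
proof (cases "P = 0")
  case False
  have "{j. coeff P j \<noteq> 0} \<subseteq> {..degree P}" using le_degree by auto
  hence "finite {j. coeff P j \<noteq> 0}" using finite_subset by blast
  moreover have "{j. coeff P j \<noteq> 0} \<noteq> {}" using False by (auto simp: poly_eq_iff)
  ultimately show ?thesis using False
    unfolding val_ge_def gauss_val_def by (subst Min_ge_iff) (auto simp: vi_def rv_def)
qed (simp add: val_ge_def)

lemma gauss_ge_scale: "P \<in> polys_over K \<Longrightarrow> val_ge (gauss_val D) u P \<longleftrightarrow> scale u P \<in> polys_over \<O>"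
  using scale_coeff_O by (auto simp: gauss_ge_iff scale_def polys_over_def)

lemma reduce_scale_0:
  assumes P: "P \<in> polys_over K" and u: "val_ge (gauss_val D) u P"
  shows "reduce D (scale u P) = 0 \<longleftrightarrow> val_ge (gauss_val D) (u + 1) P"
proof -
  have "reduce D (scale u P) = 0 \<longleftrightarrow> (\<forall>j. red D (coeff (scale u P) j) = 0)"
    by (simp add: poly_eq_iff coeff_reduce)
  also have "\<dots> \<longleftrightarrow> (\<forall>j. coeff (scale u P) j \<in> max_ideal D)"
    using u gauss_ge_scale[OF P] red_eq_0_iff by (simp add: polys_over_def)
  also have "\<dots> \<longleftrightarrow> val_ge (gauss_val D) (u + 1) P"
    using P scale_coeff_m by (auto simp: gauss_ge_iff scale_def polys_over_def)
  finally show ?thesis .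
qed

lemma scale_add: "scale u (P + Q) = scale u P + scale u Q"
  by (simp add: scale_def smult_add_right)

lemma scale_mult: "scale (u + v) (P * Q) = scale u P * scale v Q"
  using \<pi>(2) by (simp add: scale_def power_int_add mult_ac)

lemma val_ge_self: "val_ge V (V P) P" by (simp add: val_ge_def)

lemma gauss_add:
  assumes "P \<in> polys_over K" "Q \<in> polys_over K" "val_ge (gauss_val D) u P" "val_ge (gauss_val D) u Q"
  shows "val_ge (gauss_val D) u (P + Q)"
  using assms gauss_ge_scale polys_over_add[OF KR assms(1,2)] polys_over_add[OF OR]
  by (simp add: scale_add)

text \<open>The lemma of Gauss: after scaling, both reductions are nonzero, and so is their product
  because polynomials over a field have no zero divisors.\<close>

lemma gauss_mult:
  assumes "P \<in> polys_over K" "Q \<in> polys_over K" "P \<noteq> 0" "Q \<noteq> 0"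
  shows "gauss_val D (P * Q) = gauss_val D P + gauss_val D Q"
proof -
  let ?V = "gauss_val D"
  let ?u = "?V P" and ?v = "?V Q"
  have PQ: "P * Q \<in> polys_over K" "P * Q \<noteq> 0" using polys_over_mult[OF KR] assms by auto
  have sO: "scale ?u P \<in> polys_over \<O>" "scale ?v Q \<in> polys_over \<O>"
    using gauss_ge_scale val_ge_self assms by blast+
  hence ge: "val_ge ?V (?u + ?v) (P * Q)"
    using gauss_ge_scale[OF PQ(1)] polys_over_mult[OF OR] by (simp add: scale_mult)
  have "reduce D (scale ?u P) \<noteq> 0" "reduce D (scale ?v Q) \<noteq> 0"
    using reduce_scale_0 val_ge_self assms by (auto simp: val_ge_def)
  hence "reduce D (scale (?u + ?v) (P * Q)) \<noteq> 0" using reduce_mult[OF sO] by (simp add: scale_mult)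
  hence "\<not> val_ge ?V (?u + ?v + 1) (P * Q)" using reduce_scale_0[OF PQ(1) ge] by simp
  thus ?thesis using ge PQ(2) by (simp add: val_ge_def)
qed

lemma gauss_nonneg_iff: "P \<in> polys_over K \<Longrightarrow> P \<in> polys_over \<O> \<longleftrightarrow> val_ge (gauss_val D) 0 P"
  using gauss_ge_scale[of P 0] by (simp add: scale_def)

lemma gauss_monic:
  assumes "P \<in> polys_over \<O>" "monic P" shows "gauss_val D P = 0"
proof -
  have PK: "P \<in> polys_over K" using assms OK_poly by blast
  have "reduce D (scale 0 P) = reduce D P" by (simp add: scale_def)
  moreover have "reduce D P \<noteq> 0" using reduce_monic(1)[OF assms(2)] monic_nonzero by blast
  ultimately have "\<not> val_ge (gauss_val D) 1 P"
    using reduce_scale_0[OF PK, of 0] gauss_nonneg_iff[OF PK] assms(1) by simp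
  thus ?thesis using gauss_nonneg_iff[OF PK] assms monic_nonzero by (auto simp: val_ge_def)
qed

lemma gauss_monic_le:
  assumes "P \<in> polys_over K" "monic P" shows "gauss_val D P \<le> 0"
proof -
  have "val_ge (gauss_val D) (gauss_val D P) P" by (rule val_ge_self)
  hence "gauss_val D P \<le> vi (coeff P (degree P))"
    using assms(2) unfolding gauss_ge_iff monic_def by (metis zero_neq_one)
  thus ?thesis using assms(2) rv_1 by (simp add: monic_def vi_def)
qed

text \<open>A leading coefficient 1 forces a Gauss value at most 0. The two values add up to 0, so
  both are 0.\<close>

lemma monic_factor_integral:
  assumes "G \<in> polys_over K" "X \<in> polys_over K" "monic G" "monic X" "G * X \<in> polys_over \<O>"
  shows "G \<in> polys_over \<O>" "X \<in> polys_over \<O>"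
proof -
  have "gauss_val D G + gauss_val D X = 0"
    using gauss_mult[OF assms(1,2)] gauss_monic[OF assms(5) monic_mult] assms monic_nonzero by metis
  hence "gauss_val D G = 0" "gauss_val D X = 0" using gauss_monic_le[OF assms(1,3)] gauss_monic_le[OF assms(2,4)] by linarith+
  thus "G \<in> polys_over \<O>" "X \<in> polys_over \<O>" using gauss_nonneg_iff assms by (auto simp: val_ge_def)
qed

lemma gauss_const: "b \<noteq> 0 \<Longrightarrow> gauss_val D [:b:] = vi b"
proof -
  assume b: "b \<noteq> 0"
  have "{j. coeff [:b:] j \<noteq> 0} = {0}" using b by (auto simp: coeff_pCons' split: if_splits)
  thus ?thesis by (simp add: gauss_val_def vi_def rv_def)
qed

lemma coeff_class_1: "coeff_class D T (Suc 0) a u = poly (reduce D (scale u a)) (zee T 0)"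
  by (simp add: scale_def)

lemma graded_part_gauss:
  assumes "P \<in> polys_over K" "val_ge (gauss_val D) u P"
  shows "graded_part (gauss_val D) (coeff_class D T (Suc 0)) u P = poly (reduce D (scale u P)) (zee T 0)"
proof (cases "P \<noteq> 0 \<and> gauss_val D P = u")
  case True
  thus ?thesis unfolding graded_part_def coeff_class_1 by simp
next
  case False
  hence "val_ge (gauss_val D) (u + 1) P" using assms(2) by (auto simp: val_ge_def)
  hence "reduce D (scale u P) = 0" using reduce_scale_0[OF assms] by simp
  thus ?thesis using False by (auto simp: graded_part_def)
qed

text \<open>The initial form is the reduction of the scaled polynomial, evaluated at a root of the
  reduction of \<open>\<phi>\<close>. The constant is 1 because a monic integral polynomial has
  value 0.\<close>

theorem first_key_poly:
  assumes \<phi>: "\<phi> \<in> polys_over \<O>" "monic \<phi>" and \<psi>: "minimal_poly F0 (reduce D \<phi>) (zee T 0)"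
  shows "key_poly K ((\<lambda>g. poly g (zee T 0)) ` polys_over F0) (gauss_val D) (coeff_class D T (Suc 0)) \<phi> 1"
proof -
  let ?z = "zee T 0" and ?V = "gauss_val D" and ?C = "coeff_class D T (Suc 0)"
  let ?F = "(\<lambda>g. poly g ?z) ` polys_over F0"
  have sO: "scale (?V P) P \<in> polys_over \<O>" if "P \<in> polys_over K" for P
    using gauss_ge_scale[OF that] val_ge_self by blast
  have V\<phi>: "?V \<phi> = 0" by (rule gauss_monic[OF \<phi>])
  show ?thesis
  proof unfold_locales
    show "is_subfield K" by (rule K)
    show F: "is_subfield ?F" by (rule is_subfield_extension[OF F0 \<psi>])
    show "\<phi> \<in> polys_over K" using OK_poly \<phi> by blast
    show "monic \<phi>" by fact
    show "(1::'k) \<in> ?F" using F by (simp add: is_subfield_def)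
    show "(1::'k) \<noteq> 0" by simp
    show "0 < degree \<phi>" using minimal_poly_degree_pos[OF \<psi>] reduce_monic(2)[OF \<phi>(2)] by simp
    show "?C \<phi> (?V \<phi>) = 0" using \<psi> unfolding coeff_class_1 V\<phi> by (simp add: scale_def minimal_poly_def)
  next
    fix P Q u assume P: "P \<in> polys_over K" and Q: "Q \<in> polys_over K"
      and ge: "val_ge ?V u P" "val_ge ?V u Q"
    show PQ: "val_ge ?V u (P + Q)" by (rule gauss_add[OF P Q ge])
    show "graded_part ?V ?C u (P + Q) = graded_part ?V ?C u P + graded_part ?V ?C u Q"
      unfolding graded_part_gauss[OF P ge(1)] graded_part_gauss[OF Q ge(2)]
        graded_part_gauss[OF polys_over_add[OF KR P Q] PQ]
      using reduce_add ge gauss_ge_scale P Q by (simp add: scale_add)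
  next
    fix P Q assume PQ: "P \<in> polys_over K" "Q \<in> polys_over K" "P \<noteq> 0" "Q \<noteq> 0"
    show "?V (P * Q) = ?V P + ?V Q" by (rule gauss_mult[OF PQ])
    show "?C (P * Q) (?V P + ?V Q) = ?C P (?V P) * ?C Q (?V Q)"
      unfolding coeff_class_1 scale_mult using reduce_mult[OF sO[OF PQ(1)] sO[OF PQ(2)]] by simp
  next
    fix P assume "P \<in> polys_over K" "P \<noteq> 0"
    thus "?C P (?V P) \<in> ?F" unfolding coeff_class_1 using reduce_F0[OF sO] by blast
  next
    fix a assume a: "a \<in> polys_over K" "a \<noteq> 0" "degree a < degree \<phi>"
    have "reduce D (scale (?V a) a) \<noteq> 0"
      using reduce_scale_0[OF a(1) val_ge_self] a(2) by (simp add: val_ge_def)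
    moreover have "degree (reduce D (scale (?V a) a)) \<le> degree a"
      by (intro degree_le) (auto simp: coeff_reduce scale_def coeff_eq_0 red_0)
    hence "degree (reduce D (scale (?V a) a)) < degree (reduce D \<phi>)"
      using a(3) reduce_monic(2)[OF \<phi>(2)] by simp
    ultimately show "?C a (?V a) \<noteq> 0"
      unfolding coeff_class_1 using \<psi> reduce_F0[OF sO[OF a(1)]] by (force simp: minimal_poly_def)
    show "?C a (?V a + int j * ?V \<phi>) = 1 ^ j * ?C a (?V a)" for j by (simp add: V\<phi>)
  qed
qed

end

section \<open>Newton polygons and residual polynomials of one order\<close>

context key_poly
begin

definition pts :: "'a poly \<Rightarrow> nat set" where "pts P = {j. adic \<phi> P j \<noteq> 0}"

definition ords :: "'a poly \<Rightarrow> nat \<Rightarrow> real" where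
  "ords P j = real_of_int (V (adic \<phi> P j * \<phi> ^ j))"

lemma pts_finite: "finite (pts P)"
  unfolding pts_def by (rule adic_finite[OF \<phi>_deg])

lemma pts_nonempty: "P \<noteq> 0 \<Longrightarrow> pts P \<noteq> {}"
  using adic_exists_nonzero[OF \<phi>_deg] by (auto simp: pts_def)

lemma newton_graph_polygon:
  assumes "P \<noteq> 0" shows "graph_polygon (pts P) (ords P) (newton_polygon V \<phi> P)"
proof
  show "finite (pts P)" by (rule pts_finite)
  show "pts P \<noteq> {}" using pts_nonempty[OF assms] .
  have "{(real j, real_of_int (V (adic \<phi> P j * \<phi> ^ j))) | j. adic \<phi> P j \<noteq> 0} = graph_points (pts P) (ords P)"
    by (auto simp: graph_points_def pts_def ords_def)
  thus "fin (newton_polygon V \<phi> P) = lower_hull (graph_points (pts P) (ords P))"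
    by (simp add: newton_polygon_def)
qed

lemma inf_len_newton: "inf_len (newton_polygon V \<phi> P) = ord_at \<phi> P"
  by (simp add: newton_polygon_def)

lemma ord_at_0_iff: "P \<noteq> 0 \<Longrightarrow> ord_at \<phi> P = 0 \<longleftrightarrow> 0 \<in> pts P"
  by (simp add: ord_at_eq_0_iff[OF \<phi>_deg] pts_def adic_0 mod_eq_0_iff_dvd)

lemma pts_le: "j \<in> pts P \<Longrightarrow> j * degree \<phi> \<le> degree P"
  unfolding pts_def using adic_nonzero_degree[OF _ \<phi>_deg] by blast

lemma Max_pts:
  assumes "monic P" "degree P = b * degree \<phi>"
  shows "Max (pts P) = b" "b \<in> pts P"
proof -
  show b: "b \<in> pts P" using adic_top[OF \<phi>_deg \<phi>_monic assms] by (simp add: pts_def)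
  have "j \<le> b" if "j \<in> pts P" for j
  proof -
    have "j * degree \<phi> \<le> b * degree \<phi>" using pts_le[OF that] assms(2) by simp
    thus ?thesis using \<phi>_deg by simp
  qed
  thus "Max (pts P) = b" using b pts_finite by (intro Max_eqI) auto
qed

end

lemma slope_quotient:
  assumes "q < 0"
  shows "0 < slope_num q" "0 < slope_den q" "coprime (slope_num q) (slope_den q)"
    "(of_rat q :: real) = - (real_of_int (slope_num q) / real_of_int (slope_den q))"
proof -
  obtain a b where ab: "quotient_of q = (a, b)" by (cases "quotient_of q") auto
  have b: "0 < b" using quotient_of_denom_pos[OF ab] .
  have q: "q = of_int a / of_int b" using quotient_of_div[OF ab] .
  have "a < 0" using assms b unfolding q by (simp add: divide_less_0_iff)
  thus "0 < slope_num q" by (simp add: slope_num_def ab)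
  show "0 < slope_den q" using b by (simp add: slope_den_def ab)
  show "coprime (slope_num q) (slope_den q)"
    using quotient_of_coprime[OF ab] by (simp add: slope_num_def slope_den_def ab)
  show "(of_rat q :: real) = - (real_of_int (slope_num q) / real_of_int (slope_den q))"
    unfolding slope_num_def slope_den_def ab by (simp add: q of_rat_divide)
qed

locale rat_slope = slope_data K F V C \<phi> \<kappa> "slope_num q" "slope_den q" l l'
  for K :: "'a::field set" and F :: "'k::alg_closed_field set" and V C \<phi> \<kappa> q l l' +
  assumes neg: "q < 0"
begin

abbreviation "\<mu> \<equiv> (of_rat q :: real)"
abbreviation "h \<equiv> slope_num q"
abbreviation "e \<equiv> slope_den q"

lemma \<mu>: "\<mu> = - (real_of_int h / real_of_int e)" "\<mu> < 0"
  using slope_quotient[OF neg] neg by auto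

lemma ords_wt:
  assumes "P \<in> polys_over K" "j \<in> pts P"
  shows "ords P j - \<mu> * real j = real_of_int (wt j (adic \<phi> P j)) / real_of_int e"
  using assms V_term[OF co_K[OF assms(1)], of j j] e
  by (simp add: ords_def pts_def wt_def \<mu>(1) field_simps)

text \<open>The weight is \<open>e\<close> times the intercept of the line through the point, so
  minimal weight and minimal intercept select the same indices.\<close>

lemma min_indices_idx:
  assumes P: "P \<in> polys_over K" "P \<noteq> 0"
  shows "min_indices \<mu> (pts P) (ords P) = idx P"
proof -
  have "min_indices \<mu> (pts P) (ords P) =
      {j \<in> pts P. \<forall>k\<in>pts P. wt j (adic \<phi> P j) \<le> wt k (adic \<phi> P k)}"
    unfolding min_indices_def using ords_wt[OF P(1)] e
    by (intro Collect_cong conj_cong refl ball_cong) (simp add: divide_le_cancel)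
  also have "\<dots> = idx P"
  proof (intro equalityI subsetI)
    fix j assume j: "j \<in> {j \<in> pts P. \<forall>k\<in>pts P. wt j (adic \<phi> P j) \<le> wt k (adic \<phi> P k)}"
    have "s P \<in> pts P" "wt (s P) (adic \<phi> P (s P)) = W P"
      using s_L(1)[OF P(2)] by (auto simp: idx_def pts_def)
    hence "wt j (adic \<phi> P j) \<le> W P" using j by auto
    thus "j \<in> idx P" using j W_le[of P j] by (auto simp: idx_def pts_def)
  qed (auto simp: idx_def pts_def W_le)
  finally show ?thesis .
qed

context
  fixes P assumes P: "P \<in> polys_over K" "P \<noteq> 0"
begin

interpretation N: graph_polygon "pts P" "ords P" "newton_polygon V \<phi> P"
  by (rule newton_graph_polygon[OF P(2)])

lemma segment_eq: "segment V \<phi> q P = face \<mu> (lower_hull (graph_points (pts P) (ords P)))"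
  unfolding segment_def N.face_principal[OF \<mu>(2)] N.fin_N ..

lemma init_absc_segment: "init_absc (segment V \<phi> q P) = real (s P)"
  unfolding segment_eq init_absc_face[OF N.J] min_indices_idx[OF P] s_def ..

lemma seg_length_segment: "seg_length (segment V \<phi> q P) = real (L P - s P)"
  unfolding segment_eq seg_length_face[OF N.J] min_indices_idx[OF P] using s_L(3)[OF P(2)]
  by (simp add: s_def L_def of_nat_diff)

lemma val_eq: "\<lfloor>of_int e * intercept \<mu> (segment V \<phi> q P)\<rfloor> = W P"
proof -
  have i: "s P \<in> min_indices \<mu> (pts P) (ords P)" unfolding min_indices_idx[OF P] by (rule s_L(1)[OF P(2)])
  have "s P \<in> pts P" "wt (s P) (adic \<phi> P (s P)) = W P" using s_L(1)[OF P(2)] by (auto simp: idx_def pts_def)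
  hence "intercept \<mu> (segment V \<phi> q P) = real_of_int (W P) / real_of_int e"
    unfolding segment_eq intercept_face[OF N.J(1) i] using ords_wt[OF P(1)] by simp
  thus ?thesis using e by simp
qed

text \<open>Between \<open>s P\<close> and \<open>L P\<close> the principal polygon coincides with
  the side, so the rule that points strictly above the polygon give 0 becomes membership in
  \<open>idx P\<close>.\<close>

lemma residual_poly_eq: "residual_poly V C \<phi> q P = R P"
proof -
  have fl: "nat \<lfloor>real (L P - s P) / real (nat e)\<rfloor> = (L P - s P) div nat e"
    by (simp add: floor_divide_of_nat_eq)
  show ?thesis
    unfolding residual_poly_def R_def Let_def init_absc_segment seg_length_segment fl
  proof (simp only: floor_of_nat nat_int, intro sum.cong refl arg_cong2[of _ _ _ _ monom])
    fix k assume k: "k \<in> {..(L P - s P) div nat e}"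
    define j where "j = s P + k * nat e"
    have "k * nat e \<le> (L P - s P) div nat e * nat e" using k by simp
    also have "\<dots> \<le> L P - s P" by simp
    finally have j: "s P \<le> j" "j \<le> L P" using s_L(3)[OF P(2)] by (auto simp: j_def)
    have iff: "(adic \<phi> P j \<noteq> 0 \<and> (real j, real_of_int (V (adic \<phi> P j * \<phi> ^ j))) \<in>
        fin (principal_part (newton_polygon V \<phi> P))) \<longleftrightarrow> j \<in> idx P"
    proof (cases "j \<in> pts P")
      case True
      have "(real j, ords P j) \<in> fin (principal_part (newton_polygon V \<phi> P)) \<longleftrightarrow> j \<in> idx P"
        using N.point_in_principal_iff[OF \<mu>(2) True] j unfolding min_indices_idx[OF P]
        by (simp add: s_def L_def)
      thus ?thesis using True by (simp add: pts_def ords_def)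
    qed (auto simp: pts_def idx_def)
    show "residual_coeff V C \<phi> P (s P + k * nat e) =
        (if s P + k * nat e \<in> idx P
         then C (adic \<phi> P (s P + k * nat e)) (V (adic \<phi> P (s P + k * nat e) * \<phi> ^ (s P + k * nat e))) else 0)"
      unfolding j_def[symmetric] residual_coeff_def Let_def iff ..
  qed
qed

lemma slope_in_principal_iff:
  "\<mu> \<in> finite_slopes (principal_part (newton_polygon V \<phi> P)) \<longleftrightarrow> s P < L P"
  unfolding N.finite_slopes_principal using \<mu>(2) finite_slopes_iff[OF N.J N.fin_N, of \<mu>]
  by (simp add: min_indices_idx[OF P] s_def L_def)

lemma face_principal_eq:
  "face \<mu> (fin (principal_part (newton_polygon V \<phi> P))) =
    {(x, y). real (s P) \<le> x \<and> x \<le> real (L P) \<and> y = ords P (s P) - \<mu> * real (s P) + \<mu> * x}"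
proof -
  have i: "s P \<in> min_indices \<mu> (pts P) (ords P)" unfolding min_indices_idx[OF P] by (rule s_L(1)[OF P(2)])
  show ?thesis unfolding N.face_principal[OF \<mu>(2)] N.fin_N face_lower_hull[OF N.J(1) i]
    min_indices_idx[OF P] by (simp add: s_def L_def)
qed

text \<open>Without an infinite side the development starts at abscissa 0, and for a monic
  polynomial whose degree is a multiple of \<open>degree \<phi>\<close> it ends at \<open>b\<close>.
  A polygon with a single side must join these two points.\<close>

lemma slopes_single_imp:
  assumes sl: "slopes (newton_polygon V \<phi> P) = {ereal \<mu>}"
    and mon: "monic P" "degree P = b * degree \<phi>"
  shows "s P = 0" "L P = b" "0 < b"
proof -
  have "inf_len (newton_polygon V \<phi> P) = 0" "finite_slopes (newton_polygon V \<phi> P) = {\<mu>}"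
    using sl by (auto simp: slopes_def split: if_splits)
  hence 0: "0 \<in> pts P" and fs: "finite_slopes (newton_polygon V \<phi> P) = {\<mu>}"
    using ord_at_0_iff[OF P(2)] by (auto simp: inf_len_newton)
  note c = N.one_sided_converse[OF fs]
  have Min0: "Min (pts P) = 0" using 0 pts_finite by (meson Min_le le_zero_eq)
  have Maxb: "Max (pts P) = b" by (rule Max_pts[OF mon])
  have i: "0 \<in> idx P" "b \<in> idx P" using c(1,2) unfolding min_indices_idx[OF P] Min0 Maxb .
  show "s P = 0" using s_L(4)[OF P(2) i(1)] by simp
  have "L P \<in> pts P" using s_L(2)[OF P(2)] by (simp add: idx_def pts_def)
  hence "L P \<le> b" using Maxb pts_finite by (metis Max_ge)
  thus "L P = b" using s_L(4)[OF P(2) i(2)] by simp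
  show "0 < b" using c(3) by (simp add: Min0 Maxb)
qed

lemma one_sided_newton:
  assumes mon: "monic P" and s0: "s P = 0" and L: "L P * degree \<phi> = degree P"
  shows "inf_len (newton_polygon V \<phi> P) = 0"
    "fin (newton_polygon V \<phi> P) = {(x, y). 0 \<le> x \<and> x \<le> real (L P) \<and> y = ords P 0 + \<mu> * x}"
    "0 < L P \<Longrightarrow> slopes (newton_polygon V \<phi> P) = {ereal \<mu>}"
proof -
  have "s P \<in> pts P" using s_L(1)[OF P(2)] by (simp add: idx_def pts_def)
  hence 0: "0 \<in> pts P" by (simp add: s0)
  thus il: "inf_len (newton_polygon V \<phi> P) = 0" using ord_at_0_iff[OF P(2)] by (simp add: inf_len_newton)
  have Min0: "Min (pts P) = 0" using 0 pts_finite by (meson Min_le le_zero_eq)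
  have MaxL: "Max (pts P) = L P" by (rule Max_pts[OF mon L[symmetric]])
  have i: "Min (pts P) \<in> min_indices \<mu> (pts P) (ords P)" "Max (pts P) \<in> min_indices \<mu> (pts P) (ords P)"
    unfolding min_indices_idx[OF P] Min0 MaxL using s_L(1,2)[OF P(2)] by (auto simp: s0)
  have Min_idx: "Min (idx P) = 0" "Max (idx P) = L P" using s0 by (auto simp: s_def L_def)
  show "fin (newton_polygon V \<phi> P) = {(x, y). 0 \<le> x \<and> x \<le> real (L P) \<and> y = ords P 0 + \<mu> * x}"
    by (subst N.one_sided_fin[OF i], unfold N.fin_N face_lower_hull[OF N.J(1) i(1)])
      (simp add: min_indices_idx[OF P] Min_idx Min0)
  assume "0 < L P"
  hence "finite_slopes (newton_polygon V \<phi> P) = {\<mu>}"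
    using N.one_sided_slopes[OF i] by (simp add: Min0 MaxL)
  thus "slopes (newton_polygon V \<phi> P) = {ereal \<mu>}" by (simp add: slopes_def il)
qed

end

end

section \<open>Pure polynomials\<close>

context slope_data
begin

text \<open>For monic \<open>P\<close>: the whole Newton polygon is one side of the given slope.\<close>

definition pure :: "'a poly \<Rightarrow> bool" where
  "pure P \<longleftrightarrow> s P = 0 \<and> L P * degree \<phi> = degree P"

text \<open>\<open>s\<close> and \<open>L\<close> are additive, \<open>s\<close> is nonnegative, and
  \<open>L P * degree \<phi>\<close> never exceeds the degree. Equality for the product therefore
  forces equality for both factors.\<close>

lemma pure_mult_iff:
  assumes P: "P \<in> polys_over K" "P \<noteq> 0" and Q: "Q \<in> polys_over K" "Q \<noteq> 0"
  shows "pure (P * Q) \<longleftrightarrow> pure P \<and> pure Q"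
proof -
  have "degree (P * Q) = degree P + degree Q" using P Q by (simp add: degree_mult_eq)
  moreover have "L P * degree \<phi> \<le> degree P" "L Q * degree \<phi> \<le> degree Q" using L_degree P Q by auto
  ultimately show ?thesis unfolding pure_def using W_mult[OF P Q] by (auto simp: algebra_simps)
qed

lemma pure_degree_R:
  assumes "P \<in> polys_over K" "P \<noteq> 0" "pure P"
  shows "degree P = degree \<phi> * nat e * degree (R P)"
proof -
  have "L P * degree \<phi> = degree P" "L P = degree (R P) * nat e"
    using R_facts(2)[OF assms(1,2)] assms(3) by (auto simp: pure_def)
  thus ?thesis by (simp add: mult_ac)
qed

lemma pure_1: "pure 1" "L 1 = 0" "R 1 \<noteq> 0" "degree (R 1) = 0"
proof -
  have 1: "1 \<in> polys_over K" "(1::'a poly) \<noteq> 0" using polys_over_1[OF KR] by auto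
  have "L 1 = 0" using W_mult(4)[OF 1 1] by simp
  thus "pure 1" "L 1 = 0" using s_L(3)[OF 1(2)] by (simp_all add: pure_def)
  show "R 1 \<noteq> 0" by (rule R_facts(4)[OF 1])
  show "degree (R 1) = 0" using R_facts(2)[OF 1] \<open>L 1 = 0\<close> e by simp
qed

text \<open>The last coefficient is 1, and on a line of negative slope all other points are higher
  than the last one. So \<open>P\<close> has the initial form of \<open>\<phi> ^ b\<close>, which is
  killed.\<close>

lemma pure_C_eq_0:
  assumes P: "P \<in> polys_over K" "monic P" "pure P" "0 < degree P"
  shows "C P (V P) = 0"
proof -
  define b where "b = L P"
  have P0: "P \<noteq> 0" using P(2) by (rule monic_nonzero)
  have deg: "degree P = b * degree \<phi>" using P(3) by (simp add: pure_def b_def)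
  hence b: "0 < b" using P(4) by simp
  have top: "adic \<phi> P b = 1" by (rule adic_top[OF \<phi>_deg \<phi>_monic P(2) deg])
  have "degree P < Suc b * degree \<phi>" using deg \<phi>_deg by simp
  from adic_sum_eq[OF \<phi>_deg this] have Peq: "P = (\<Sum>j<b. adic \<phi> P j * \<phi> ^ j) + \<phi> ^ b" by (simp add: top)
  define Y where "Y = (\<Sum>j<b. adic \<phi> P j * \<phi> ^ j)"
  have YK: "Y \<in> polys_over K" unfolding Y_def
    by (intro polys_over_sum[OF KR] polys_over_mult[OF KR] co_K[OF P(1)] \<phi>_power_K)
  have V\<phi>b: "V (\<phi> ^ b) = int b * V \<phi>" using V_power[OF \<phi>_K \<phi>_nz] .
  have Wb: "W P = e * (int b * V \<phi>) + h * int b"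
    using s_L(2)[OF P0] unfolding b_def[symmetric] idx_def by (simp add: top wt_def V_1)
  have "val_ge V (V (\<phi> ^ b) + 1) (adic \<phi> P j * \<phi> ^ j)" if j: "j < b" for j
  proof (cases "adic \<phi> P j = 0")
    case False
    have "W P \<le> wt j (adic \<phi> P j)" by (rule W_le[OF False])
    hence "e * (int b * V \<phi>) + h * (int b - int j) \<le> e * (V (adic \<phi> P j) + int j * V \<phi>)"
      by (simp add: Wb wt_def algebra_simps)
    moreover have "0 < h * (int b - int j)" using h j by simp
    ultimately have "e * (int b * V \<phi>) < e * (V (adic \<phi> P j) + int j * V \<phi>)" by linarith
    hence "int b * V \<phi> < V (adic \<phi> P j) + int j * V \<phi>" using e by simp
    thus ?thesis using V_term[OF co_K[OF P(1)] False, of j] V\<phi>b by (simp add: val_ge_def)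
  qed (simp add: val_ge_def)
  hence Yge: "val_ge V (V (\<phi> ^ b) + 1) Y" unfolding Y_def
    by (intro conjunct1[OF ge_gr_sum] polys_over_mult[OF KR] co_K[OF P(1)] \<phi>_power_K) auto
  have PY: "P = \<phi> ^ b + Y" unfolding Y_def by (subst add.commute) (rule Peq)
  have "V P = V (\<phi> ^ b)" "C P (V (\<phi> ^ b)) = C (\<phi> ^ b) (V (\<phi> ^ b))"
    using C_add_higher(2,3)[OF \<phi>_power_K YK _ Yge] \<phi>_nz unfolding PY by auto
  moreover have "C (\<phi> ^ b) (V (\<phi> ^ b)) = 0"
  proof -
    obtain n where "b = Suc n" using b by (cases b) auto
    thus ?thesis using C_prod_eq_0_iff[OF \<phi>_K \<phi>_power_K, of n] \<phi>_nz C_\<phi> by simp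
  qed
  ultimately show ?thesis by simp
qed

lemma W_power:
  assumes P: "P \<in> polys_over K" "P \<noteq> 0"
  shows "s (P ^ n) = n * s P" "L (P ^ n) = n * L P" "\<exists>c\<in>F. c \<noteq> 0 \<and> R (P ^ n) = smult c (R P ^ n)"
proof -
  have one: "1 \<in> polys_over K" "(1::'a poly) \<noteq> 0" using polys_over_1[OF KR] by auto
  have "s (P ^ n) = n * s P \<and> L (P ^ n) = n * L P \<and> (\<exists>c\<in>F. c \<noteq> 0 \<and> R (P ^ n) = smult c (R P ^ n))"
  proof (induction n)
    case 0
    obtain c where c: "R 1 = [:c:]" using pure_1(4) by (metis degree_0_id)
    hence "c \<in> F" "c \<noteq> 0" using R_facts(3)[OF one] pure_1(3) by (auto simp: polys_over_pCons_iff)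
    thus ?case using pure_1(1,2) c by (auto simp: pure_def intro!: bexI[of _ c])
  next
    case (Suc n)
    have Pn: "P ^ n \<in> polys_over K" "P ^ n \<noteq> 0" using polys_over_power[OF KR P(1)] P(2) by auto
    show ?case using Suc W_mult[OF P Pn] by (auto intro!: bexI)
  qed
  thus "s (P ^ n) = n * s P" "L (P ^ n) = n * L P" "\<exists>c\<in>F. c \<noteq> 0 \<and> R (P ^ n) = smult c (R P ^ n)" by auto
qed

text \<open>\<open>G * X\<close> differs from \<open>\<phi>' ^ N\<close> only by a term of greater
  value in the next order, hence has the same side and residual polynomial. Purity and the power of
  \<open>\<psi>\<close> then pass to the factor \<open>G\<close>.\<close>

lemma descend:
  assumes V': "\<And>P. P \<in> polys_over K \<Longrightarrow> P \<noteq> 0 \<Longrightarrow> V' P = W P"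
    and \<psi>: "minimal_poly F \<psi> z"
    and \<phi>': "\<phi>' \<in> polys_over K" "monic \<phi>'" "pure \<phi>'" "sim_over F (R \<phi>') \<psi>"
    and Y: "Y \<in> polys_over K" "val_ge V' (V' (\<phi>' ^ N) + 1) Y"
    and GX: "G \<in> polys_over K" "X \<in> polys_over K" "G * X = \<phi>' ^ N + Y" "G * X \<noteq> 0"
      "degree (G * X) = N * degree \<phi>'" "0 < degree G"
  shows "pure G" "\<exists>a\<ge>1. sim_over F (R G) (\<psi> ^ a)"
proof -
  have \<phi>'0: "\<phi>' \<noteq> 0" using \<phi>'(2) by (rule monic_nonzero)
  have PN: "\<phi>' ^ N \<in> polys_over K" "\<phi>' ^ N \<noteq> 0" using polys_over_power[OF KR \<phi>'(1)] \<phi>'0 by auto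
  have Yge: "slope_ge (W (\<phi>' ^ N) + 1) Y"
  proof (cases "Y = 0")
    case False
    thus ?thesis using Y V'[OF PN] V'[OF Y(1)] slope_ge_iff[OF False] by (simp add: val_ge_def)
  qed (simp add: slope_0)
  have nz: "\<phi>' ^ N + Y \<noteq> 0" using GX by simp
  note add = W_add_higher[OF PN Y(1) Yge nz, folded GX(3)]
  note pow = W_power[OF \<phi>'(1) \<phi>'0, of N]
  have G0: "G \<noteq> 0" and X0: "X \<noteq> 0" using GX(4) by auto
  have "pure (G * X)" using add pow(1,2) \<phi>'(3) GX(5) by (simp add: pure_def mult.assoc)
  thus pG: "pure G" using pure_mult_iff[OF GX(1) G0 GX(2) X0] by simp
  obtain c where c: "c \<in> F" "c \<noteq> 0" "R (\<phi>' ^ N) = smult c (R \<phi>' ^ N)" using pow(3) by blast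
  obtain d where d: "d \<in> F" "d \<noteq> 0" "R \<phi>' = smult d \<psi>" using \<phi>'(4) by (auto simp: sim_over_def)
  have "R G * R X = smult (c * d ^ N) (\<psi> ^ N)"
    using add(3) W_mult(3)[OF GX(1) G0 GX(2) X0] c(3) d(3) by (simp add: smult_power)
  moreover have "c * d ^ N \<in> F" "c * d ^ N \<noteq> 0"
    using c d by (auto intro: subring_mult[OF FR] subring_power[OF FR])
  ultimately obtain a where a: "sim_over F (R G) (\<psi> ^ a)"
    using factor_of_minimal_power[OF F \<psi> R_facts(3)[OF GX(1) G0] R_facts(3)[OF GX(2) X0]] by blast
  have "a \<noteq> 0"
  proof
    assume "a = 0"
    hence "degree (R G) = 0" using a by (auto simp: sim_over_def)
    thus False using pure_degree_R[OF GX(1) G0 pG] GX(6) by simp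
  qed
  thus "\<exists>a\<ge>1. sim_over F (R G) (\<psi> ^ a)" using a by (intro exI[of _ a]) auto
qed

end

section \<open>Values at the roots of a minimal polynomial\<close>

text \<open>\<open>E\<close> is the ratio between \<open>V\<close> and the normalized valuation on
  constants; it becomes the product of the denominators \<open>e_of T k\<close> of all earlier
  slopes.\<close>

locale key_padic = padic p D + key_poly "fld D" F V C \<phi> \<kappa>
  for p and D :: "('a::{alg_closed_field,field_char_0}, 'k::alg_closed_field) padic_data"
    and F V C \<phi> \<kappa> +
  fixes E :: int
  assumes E: "0 < E" and V_const: "\<And>b. b \<in> fld D \<Longrightarrow> b \<noteq> 0 \<Longrightarrow> V [:b:] = E * vi b"
begin

text \<open>\<open>\<phi>\<close> is irreducible over the field: one of two factors would be killed
  together with \<open>\<phi>\<close>, but this cannot happen below the degree of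
  \<open>\<phi>\<close>.\<close>

lemma minimal_eq_\<phi>:
  assumes G: "minimal_poly (fld D) G \<theta>" and "poly \<phi> \<theta> = 0"
  shows "G = \<phi>"
proof -
  note d = minimal_poly_dvd[OF K G \<phi>_K assms(2)]
  define X where "X = \<phi> div G"
  have GX: "\<phi> = G * X" "X \<in> polys_over (fld D)" using d by (auto simp: X_def)
  have G': "G \<in> polys_over (fld D)" "monic G" using G by (auto simp: minimal_poly_def)
  have G0: "G \<noteq> 0" "X \<noteq> 0" using GX \<phi>_nz by auto
  have "C G (V G) = 0 \<or> C X (V X) = 0"
    using C_prod_eq_0_iff[OF G'(1) GX(2) G0] C_\<phi> by (simp flip: GX(1))
  hence "\<not> degree G < degree \<phi> \<or> \<not> degree X < degree \<phi>"
    using C_nonzero[OF G'(1) G0(1)] C_nonzero[OF GX(2) G0(2)] by blast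
  moreover have deg: "degree \<phi> = degree G + degree X" unfolding GX(1) using G0 by (simp add: degree_mult_eq)
  ultimately have "degree X = 0" using minimal_poly_degree_pos[OF G] by linarith
  moreover have "monic X" using GX(1) G'(2) \<phi>_monic monic_factor by metis
  ultimately have "X = 1" by (simp add: monic_degree_0)
  thus ?thesis using GX(1) by simp
qed

context
  fixes G H \<theta>
  assumes G: "minimal_poly (fld D) G \<theta>" and H: "minimal_poly (fld D) H (poly \<phi> \<theta>)"
    and \<alpha>: "poly \<phi> \<theta> \<noteq> 0"
begin

definition "Q = pcompose H \<phi>"
definition "X = Q div G"
private abbreviation "N \<equiv> degree H"
private abbreviation "\<nu> \<equiv> rv (poly \<phi> \<theta>)"

lemma HK: "H \<in> polys_over (fld D)" and H_monic: "monic H"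
  using H by (auto simp: minimal_poly_def)

lemma GK: "G \<in> polys_over (fld D)" and G_monic: "monic G"
  using G by (auto simp: minimal_poly_def)

lemma Q_facts: "Q \<in> polys_over (fld D)" "Q = G * X" "X \<in> polys_over (fld D)" "Q \<noteq> 0" "X \<noteq> 0"
  "degree Q = N * degree \<phi>"
proof -
  show QK: "Q \<in> polys_over (fld D)" unfolding Q_def by (rule polys_over_pcompose[OF KR HK \<phi>_K])
  have "poly Q \<theta> = 0" using H by (simp add: Q_def poly_pcompose minimal_poly_def)
  note d = minimal_poly_dvd[OF K G QK this]
  show "Q = G * X" "X \<in> polys_over (fld D)" using d by (auto simp: X_def)
  show deg: "degree Q = N * degree \<phi>" by (simp add: Q_def degree_pcompose)
  have "0 < degree Q" using deg minimal_poly_degree_pos[OF H] \<phi>_deg by simp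
  thus "Q \<noteq> 0" by auto
  thus "X \<noteq> 0" using \<open>Q = G * X\<close> by auto
qed

lemma Q_sum: "Q = (\<Sum>j\<le>N. [:coeff H j:] * \<phi> ^ j)"
proof -
  have "degree (map_poly (\<lambda>x. [:x:]) H) = N" by (rule degree_map_poly) simp
  thus ?thesis unfolding Q_def pcompose_altdef poly_altdef by (simp add: coeff_map_poly)
qed

lemma adic_Q: "adic \<phi> Q j = [:coeff H j:]"
  unfolding Q_def by (rule adic_pcompose[OF \<phi>_deg])

lemma b0: "coeff H 0 \<noteq> 0" "real_of_int (E * vi (coeff H 0)) = E * (real N * \<nu>)"
proof -
  show nz: "coeff H 0 \<noteq> 0" by (rule minimal_poly_coeff_rv(1)[OF H \<alpha>])
  show "real_of_int (E * vi (coeff H 0)) = E * (real N * \<nu>)"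
    using minimal_poly_coeff_rv(2)[OF H \<alpha>] rv_K[OF polys_over_coeff[OF HK] nz] by simp
qed

lemma bj: assumes "coeff H j \<noteq> 0" shows "E * ((real N - real j) * \<nu>) \<le> real_of_int (E * vi (coeff H j))"
  using minimal_poly_coeff_rv(3)[OF H \<alpha> assms] rv_K[OF polys_over_coeff[OF HK] assms] E
  by (simp add: mult_left_mono)

lemma V_coeff: "coeff H j \<noteq> 0 \<Longrightarrow> V [:coeff H j:] = E * vi (coeff H j)"
  by (rule V_const[OF polys_over_coeff[OF HK]])

lemma vi_top: "vi (coeff H N) = 0" "coeff H N = 1"
  using H_monic rv_1 by (auto simp: monic_def vi_def)

lemma term_K: "[:coeff H j:] * \<phi> ^ j \<in> polys_over (fld D)"
  by (intro polys_over_mult[OF KR] polys_over_const[OF KR] polys_over_coeff[OF HK] \<phi>_power_K)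

lemma V_termH: "coeff H j \<noteq> 0 \<Longrightarrow> V ([:coeff H j:] * \<phi> ^ j) = E * vi (coeff H j) + int j * V \<phi>"
  using V_term[OF polys_over_const[OF KR polys_over_coeff[OF HK]]] V_coeff by simp

text \<open>No term of \<open>H(\<phi>(x))\<close> has smaller value than the constant one, and all
  others are multiples of \<open>\<phi>\<close>. The initial form therefore has the nonzero image of
  a constant, and a factor of it cannot be killed. Read backwards, a killed class forces a large
  value at the root.\<close>

lemma small_value_C:
  assumes le: "E * \<nu> \<le> real_of_int (V \<phi>)"
  shows "C G (V G) \<noteq> 0"
proof -
  define u where "u = V [:coeff H 0:]"
  have u: "u = E * vi (coeff H 0)" using V_coeff b0(1) by (simp add: u_def)
  have ge: "val_ge V u ([:coeff H j:] * \<phi> ^ j)" for j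
  proof (cases "coeff H j = 0")
    case False
    have "real j * (E * \<nu>) \<le> real j * real_of_int (V \<phi>)" using le by (intro mult_left_mono) auto
    hence "real_of_int u \<le> real_of_int (E * vi (coeff H j) + int j * V \<phi>)"
    proof -
      have "real_of_int u = E * (real N * \<nu>)" using b0(2) by (simp add: u)
      also have "\<dots> = E * ((real N - real j) * \<nu>) + real j * (E * \<nu>)" by (simp add: algebra_simps)
      also have "\<dots> \<le> real_of_int (E * vi (coeff H j)) + real j * real_of_int (V \<phi>)"
        using bj[OF False] \<open>real j * (E * \<nu>) \<le> _\<close> by (rule add_mono)
      finally show ?thesis by simp
    qed
    hence "u \<le> E * vi (coeff H j) + int j * V \<phi>" by linarith
    thus ?thesis using V_termH[OF False] by (simp add: val_ge_def)
  qed (simp add: val_ge_def)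
  have "graded_part V C u Q = (\<Sum>j\<le>N. graded_part V C u ([:coeff H j:] * \<phi> ^ j))"
    unfolding Q_sum using ge_gr_sum[of "{..N}" "\<lambda>j. [:coeff H j:] * \<phi> ^ j" u] term_K ge by simp
  also have "\<dots> = (\<Sum>j\<le>N. if j = 0 then graded_part V C u [:coeff H 0:] else 0)"
  proof (intro sum.cong refl)
    fix j
    show "graded_part V C u ([:coeff H j:] * \<phi> ^ j) = (if j = 0 then graded_part V C u [:coeff H 0:] else 0)"
    proof (cases j)
      case (Suc i)
      have "[:coeff H j:] * \<phi> ^ i \<in> polys_over (fld D)"
        by (intro polys_over_mult[OF KR] polys_over_const[OF KR] polys_over_coeff[OF HK] \<phi>_power_K)
      from gr_mult_\<phi>[OF this, of u] show ?thesis by (simp add: Suc mult_ac)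
    qed simp
  qed
  also have "\<dots> = graded_part V C u [:coeff H 0:]" by simp
  also have "\<dots> \<noteq> 0"
    using C_nonzero[OF polys_over_const[OF KR polys_over_coeff[OF HK]], of 0] b0(1) \<phi>_deg
    by (simp add: graded_part_def u_def)
  finally have "C Q (V Q) \<noteq> 0" using gr_nonzero_iff[OF Q_facts(1), of u] by auto
  thus ?thesis
    using C_prod_eq_0_iff[OF GK Q_facts(3) monic_nonzero[OF G_monic] Q_facts(5)] by (simp flip: Q_facts(2))
qed

lemma large_value_lead:
  assumes lt: "real_of_int (V \<phi>) < E * \<nu>"
  shows "\<exists>Y\<in>polys_over (fld D). Q = \<phi> ^ N + Y \<and> val_ge V (V (\<phi> ^ N) + 1) Y"
proof -
  define Y where "Y = (\<Sum>j<N. [:coeff H j:] * \<phi> ^ j)"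
  have YK: "Y \<in> polys_over (fld D)" unfolding Y_def by (intro polys_over_sum[OF KR] term_K)
  have "Q = \<phi> ^ N + Y" unfolding Q_sum Y_def
    by (simp add: vi_top(2) flip: lessThan_Suc_atMost)
  moreover have "val_ge V (V (\<phi> ^ N) + 1) ([:coeff H j:] * \<phi> ^ j)" if "j < N" for j
  proof (cases "coeff H j = 0")
    case False
    have "(real N - real j) * real_of_int (V \<phi>) < (real N - real j) * (E * \<nu>)"
      using lt that by (intro mult_strict_left_mono) auto
    hence "real_of_int (int N * V \<phi>) < real_of_int (E * vi (coeff H j) + int j * V \<phi>)"
      using bj[OF False] by (simp add: algebra_simps)
    hence "int N * V \<phi> < E * vi (coeff H j) + int j * V \<phi>" by linarith
    thus ?thesis using V_termH[OF False] V_power[OF \<phi>_K \<phi>_nz] by (simp add: val_ge_def)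
  qed (simp add: val_ge_def)
  hence "val_ge V (V (\<phi> ^ N) + 1) Y" unfolding Y_def
    using ge_gr_sum[of "{..<N}" "\<lambda>j. [:coeff H j:] * \<phi> ^ j"] term_K by simp
  ultimately show ?thesis using YK by blast
qed

end

end

locale slope_padic = key_padic p D F V C \<phi> \<kappa> E + slope_data "fld D" F V C \<phi> \<kappa> h e l l'
  for p and D :: "('a::{alg_closed_field,field_char_0}, 'k::alg_closed_field) padic_data"
    and F V C \<phi> \<kappa> E h e l l'
begin

context
  fixes G H \<theta>
  assumes G: "minimal_poly (fld D) G \<theta>" and H: "minimal_poly (fld D) H (poly \<phi> \<theta>)"
    and \<alpha>: "poly \<phi> \<theta> \<noteq> 0"
begin

private abbreviation "Q' \<equiv> pcompose H \<phi>"
private abbreviation "X' \<equiv> Q' div G"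
private abbreviation "N' \<equiv> degree H"
private abbreviation "\<nu>' \<equiv> rv (poly \<phi> \<theta>)"

private lemmas Qf = Q_facts[OF G H \<alpha>, unfolded X_def[OF G H \<alpha>] Q_def[OF G H \<alpha>]]
private lemmas aQ = adic_Q[OF G H \<alpha>, unfolded Q_def[OF G H \<alpha>]]

lemma wt_Q: "coeff H j \<noteq> 0 \<Longrightarrow> wt j (adic \<phi> Q' j) = e * (E * vi (coeff H j) + int j * V \<phi>) + h * int j"
  using V_coeff[OF G H \<alpha>] by (simp add: wt_def aQ)

text \<open>The bound is affine in \<open>j\<close> and attained at 0 and at the degree of
  \<open>H\<close>. The sign of its coefficient \<open>h - e * (E * \<nu>' - V \<phi>)\<close> thus
  tells which ends have minimal weight: both if it vanishes, exactly one point otherwise.\<close>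

lemma wt_Q_ge:
  assumes "coeff H j \<noteq> 0"
  shows "e * E * (real N' * \<nu>') + real j * (h - e * (E * \<nu>' - V \<phi>)) \<le> real_of_int (wt j (adic \<phi> Q' j))"
proof -
  have "e * (E * ((real N' - real j) * \<nu>')) \<le> e * real_of_int (E * vi (coeff H j))"
    using bj[OF G H \<alpha> assms] e by (intro mult_left_mono) auto
  thus ?thesis unfolding wt_Q[OF assms] by (simp add: algebra_simps)
qed

lemma wt_Q_0: "real_of_int (wt 0 (adic \<phi> Q' 0)) = e * E * (real N' * \<nu>')"
  unfolding wt_Q[OF b0(1)[OF G H \<alpha>]] using b0(2)[OF G H \<alpha>] by simp

lemma wt_Q_N: "real_of_int (wt N' (adic \<phi> Q' N')) = e * E * (real N' * \<nu>') + real N' * (h - e * (E * \<nu>' - V \<phi>))"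
proof -
  have "coeff H N' \<noteq> 0" using vi_top(2)[OF G H \<alpha>] by simp
  from wt_Q[OF this] show ?thesis by (simp add: vi_top(1)[OF G H \<alpha>] algebra_simps)
qed

lemma idx_Q: "j \<in> idx Q' \<longleftrightarrow> coeff H j \<noteq> 0 \<and> (\<forall>k. coeff H k \<noteq> 0 \<longrightarrow> wt j (adic \<phi> Q' j) \<le> wt k (adic \<phi> Q' k))"
proof -
  have nz: "adic \<phi> Q' j \<noteq> 0 \<longleftrightarrow> coeff H j \<noteq> 0" for j by (simp add: aQ)
  have "s Q' \<in> idx Q'" by (rule s_L(1)[OF Qf(4)])
  hence w: "coeff H (s Q') \<noteq> 0" "wt (s Q') (adic \<phi> Q' (s Q')) = W Q'" by (auto simp: idx_def nz)
  have le: "W Q' \<le> wt k (adic \<phi> Q' k)" if "coeff H k \<noteq> 0" for k using W_le nz that by blast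
  show ?thesis
  proof
    assume "j \<in> idx Q'"
    thus "coeff H j \<noteq> 0 \<and> (\<forall>k. coeff H k \<noteq> 0 \<longrightarrow> wt j (adic \<phi> Q' j) \<le> wt k (adic \<phi> Q' k))"
      using le unfolding idx_def nz by auto
  next
    assume j: "coeff H j \<noteq> 0 \<and> (\<forall>k. coeff H k \<noteq> 0 \<longrightarrow> wt j (adic \<phi> Q' j) \<le> wt k (adic \<phi> Q' k))"
    hence "wt j (adic \<phi> Q' j) \<le> W Q'" using w by metis
    thus "j \<in> idx Q'" using le[of j] j unfolding idx_def nz by auto
  qed
qed

lemma coeff_H: "coeff H 0 \<noteq> 0" "coeff H N' \<noteq> 0" "coeff H j \<noteq> 0 \<Longrightarrow> j \<le> N'" "0 < N'"
  using b0(1)[OF G H \<alpha>] vi_top(2)[OF G H \<alpha>] le_degree minimal_poly_degree_pos[OF H] by auto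

lemma minimal_pure:
  assumes h': "real_of_int h = e * (E * \<nu>' - V \<phi>)"
  shows "pure G" "0 < L G"
proof -
  have i: "0 \<in> idx Q'" "N' \<in> idx Q'"
  proof -
    have "real_of_int (wt 0 (adic \<phi> Q' 0)) \<le> real_of_int (wt k (adic \<phi> Q' k))"
      "real_of_int (wt N' (adic \<phi> Q' N')) \<le> real_of_int (wt k (adic \<phi> Q' k))" if "coeff H k \<noteq> 0" for k
      using wt_Q_ge[OF that] unfolding wt_Q_0 wt_Q_N by (simp_all add: h')
    thus "0 \<in> idx Q'" "N' \<in> idx Q'" unfolding idx_Q using coeff_H(1,2) by auto
  qed
  have "L Q' * degree \<phi> \<le> N' * degree \<phi>" using L_degree[OF Qf(4)] Qf(6) by simp
  hence "L Q' \<le> N'" using \<phi>_deg by simp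
  hence "L Q' = N'" "s Q' = 0" using s_L(4)[OF Qf(4)] i by (auto intro: antisym)
  hence "pure Q'" using Qf(6) by (simp add: pure_def)
  hence "pure (G * (Q' div G))" using Qf(2) by simp
  thus "pure G"
    using pure_mult_iff[OF GK[OF G H \<alpha>] monic_nonzero[OF G_monic[OF G H \<alpha>]] Qf(3,5)] by simp
  hence "L G * degree \<phi> = degree G" by (simp add: pure_def)
  thus "0 < L G" using minimal_poly_degree_pos[OF G] by (cases "L G") auto
qed

lemma minimal_other_slope:
  assumes h': "real_of_int h \<noteq> e * (E * \<nu>' - V \<phi>)"
  shows "degree (R G) = 0"
proof -
  \<comment> \<open>For positive \<open>\<delta>\<close> only the point at 0 has minimal weight, for
    negative \<open>\<delta>\<close> only the last one. In both cases the side of the given slope is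
    a point and its residual polynomial is constant.\<close>
  define \<delta> where "\<delta> = h - e * (E * \<nu>' - V \<phi>)"
  have \<delta>: "\<delta> \<noteq> 0" using h' by (simp add: \<delta>_def)
  have ge: "e * E * (real N' * \<nu>') + real j * \<delta> \<le> real_of_int (wt j (adic \<phi> Q' j))" if "coeff H j \<noteq> 0" for j
    using wt_Q_ge[OF that] by (simp add: \<delta>_def)
  have w0: "real_of_int (wt 0 (adic \<phi> Q' 0)) = e * E * (real N' * \<nu>')" by (rule wt_Q_0)
  have wN: "real_of_int (wt N' (adic \<phi> Q' N')) = e * E * (real N' * \<nu>') + real N' * \<delta>"
    using wt_Q_N by (simp add: \<delta>_def)
  have "\<exists>i. \<forall>j\<in>idx Q'. j = i"
  proof (cases "\<delta> > 0")
    case True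
    have "j = 0" if "j \<in> idx Q'" for j
    proof -
      have j: "coeff H j \<noteq> 0" "wt j (adic \<phi> Q' j) \<le> wt 0 (adic \<phi> Q' 0)"
        using that coeff_H(1) unfolding idx_Q by auto
      hence "real_of_int (wt j (adic \<phi> Q' j)) \<le> real_of_int (wt 0 (adic \<phi> Q' 0))" by linarith
      hence "real j * \<delta> \<le> 0" using ge[OF j(1)] w0 by linarith
      thus ?thesis using True by (simp add: mult_le_0_iff)
    qed
    thus ?thesis by blast
  next
    case False
    hence neg: "\<delta> < 0" using \<delta> by simp
    have "j = N'" if "j \<in> idx Q'" for j
    proof -
      have j: "coeff H j \<noteq> 0" "wt j (adic \<phi> Q' j) \<le> wt N' (adic \<phi> Q' N')"
        using that coeff_H(2) unfolding idx_Q by auto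
      hence "real_of_int (wt j (adic \<phi> Q' j)) \<le> real_of_int (wt N' (adic \<phi> Q' N'))" by linarith
      hence "real j * \<delta> \<le> real N' * \<delta>" using ge[OF j(1)] wN by linarith
      hence "real N' \<le> real j" using neg by simp
      thus ?thesis using coeff_H(3)[OF j(1)] by simp
    qed
    thus ?thesis by blast
  qed
  hence "s Q' = L Q'" using s_L(1,2)[OF Qf(4)] by metis
  hence "degree (R Q') = 0" using R_facts(2)[OF Qf(1,4)] e by simp
  moreover have "R Q' = R G * R X'"
    using W_mult(3)[OF GK[OF G H \<alpha>] monic_nonzero[OF G_monic[OF G H \<alpha>]] Qf(3,5)] Qf(2) by simp
  moreover have "R G \<noteq> 0" "R X' \<noteq> 0"
    using R_facts(4)[OF GK[OF G H \<alpha>] monic_nonzero[OF G_monic[OF G H \<alpha>]]] R_facts(4)[OF Qf(3,5)] by auto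
  ultimately show ?thesis by (simp add: degree_mult_eq)
qed

end

text \<open>\<open>\<phi>\<close> corresponds to the slope \<open>-\<infinity>\<close>, so it must
  not contribute to the residual polynomial of a finite slope.\<close>

lemma R_\<phi>: "degree (R \<phi>) = 0"
proof -
  have ad: "adic \<phi> \<phi> j = (if j = 1 then 1 else 0)" for j
    using adic_monomial[OF \<phi>_deg, of 1 1 j] \<phi>_deg by simp
  hence "idx \<phi> \<subseteq> {1}" by (auto simp: idx_def)
  from subsetD[OF this s_L(1)[OF \<phi>_nz]] subsetD[OF this s_L(2)[OF \<phi>_nz]]
  have "s \<phi> = L \<phi>" by simp
  thus ?thesis using R_facts(2)[OF \<phi>_K \<phi>_nz] e by simp
qed

end

section \<open>The operators of a type\<close>

lemma minimal_sim_degree: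
  "sim_over A P (\<psi> ^ a) \<Longrightarrow> degree P = a * degree \<psi>" for \<psi> :: "'a::field poly"
  by (cases "\<psi> = 0") (auto simp: sim_over_def degree_power_eq power_0_left)

locale type_setting = padic p D
  for p and D :: "('a::{alg_closed_field,field_char_0}, 'k::alg_closed_field) padic_data" +
  fixes T :: "('a, 'k) type_data" and n :: nat
  assumes type: "is_type D n T" and rep: "is_representative D n T (phi T (Suc n))"
begin

abbreviation "Fi \<equiv> residue_field D T"
abbreviation "Vi \<equiv> val D T"
abbreviation "Ci \<equiv> coeff_class D T"

lemma n_pos: "1 \<le> n"
  using type unfolding is_type_def by (elim conjE)

lemma phi_type:
  "i \<in> {1..n} \<Longrightarrow> phi T i \<in> polys_over \<O>" "i \<in> {1..n} \<Longrightarrow> monic (phi T i)"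
  "i \<in> {1..n} \<Longrightarrow> lam T i < 0" "i \<in> {1..n} \<Longrightarrow> ell T i * h_of T i - ell' T i * e_of T i = 1"
  using type unfolding is_type_def by blast+

lemma reduce_phi_1: "reduce D (phi T 1) = psi T 0"
  using type unfolding is_type_def by (elim conjE)

lemma phi_next:
  "i \<in> {1..<n} \<Longrightarrow> slopes (newton D T i (phi T (Suc i))) = {ereal (of_rat (lam T i))}"
  "i \<in> {1..<n} \<Longrightarrow> sim_over (Fi i) (residual D T i (lam T i) (phi T (Suc i))) (psi T i)"
  "i \<in> {1..<n} \<Longrightarrow> int (degree (phi T (Suc i))) = int (degree (phi T i)) * e_of T i * int (degree (psi T i))"
  using type unfolding is_type_def Suc_eq_plus1 by blast+

lemma psi_type:
  "i \<in> {0..n} \<Longrightarrow> monic (psi T i)" "i \<in> {0..n} \<Longrightarrow> irreducible_over (Fi i) (psi T i)"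
  "i \<in> {0..n} \<Longrightarrow> poly (psi T i) (zee T i) = 0"
  using type unfolding is_type_def by blast+

lemma rep_type: "has_type D n T (phi T (Suc n))"
  and rep_sim: "sim_over (Fi n) (residual D T n (lam T n) (phi T (Suc n))) (psi T n)"
  using rep by (auto simp: is_representative_def)

lemma phi_O: "i \<in> {1..Suc n} \<Longrightarrow> phi T i \<in> polys_over \<O>"
  and phi_monic: "i \<in> {1..Suc n} \<Longrightarrow> monic (phi T i)"
proof -
  have "phi T (Suc n) \<in> polys_over \<O>" "monic (phi T (Suc n))"
    using rep_type unfolding has_type_def by blast+
  thus "i \<in> {1..Suc n} \<Longrightarrow> phi T i \<in> polys_over \<O>" "i \<in> {1..Suc n} \<Longrightarrow> monic (phi T i)"
    using phi_type(1,2)[of i] by (cases "i = Suc n"; force)+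
qed

lemma e_pos: "i \<in> {1..n} \<Longrightarrow> 0 < e_of T i"
  using slope_quotient(2)[OF phi_type(3)] .

text \<open>Each step yields only the existence of the constant. Choosing one makes
  \<open>key\<close> a predicate of the order alone, suitable for induction.\<close>

definition kap :: "nat \<Rightarrow> 'k" where
  "kap i = (SOME \<kappa>. key_poly K (Fi i) (Vi i) (Ci i) (phi T i) \<kappa>)"

definition key :: "nat \<Rightarrow> bool" where
  "key i \<longleftrightarrow> key_poly K (Fi i) (Vi i) (Ci i) (phi T i) (kap i)"

lemma keyI: "\<exists>\<kappa>. key_poly K (Fi i) (Vi i) (Ci i) (phi T i) \<kappa> \<Longrightarrow> key i"
  unfolding key_def kap_def by (rule someI_ex)

lemma key_rat_slope:
  assumes "key i" "i \<in> {1..n}"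
  shows "rat_slope K (Fi i) (Vi i) (Ci i) (phi T i) (kap i) (lam T i) (ell T i) (ell' T i)"
proof -
  interpret key_poly K "Fi i" "Vi i" "Ci i" "phi T i" "kap i" using assms(1) by (simp add: key_def)
  show ?thesis
    by unfold_locales
      (use slope_quotient[OF phi_type(3)[OF assms(2)]] phi_type(3,4)[OF assms(2)] in auto)
qed

lemma key_minimal:
  assumes "key i" "i \<in> {1..n}"
  shows "minimal_poly (Fi i) (psi T i) (zee T i)"
proof -
  interpret key_poly K "Fi i" "Vi i" "Ci i" "phi T i" "kap i" using assms(1) by (simp add: key_def)
  show ?thesis using irreducible_over_minimal_poly[OF F psi_type(2,1,3)] assms(2) by simp
qed

lemma minimal_0: "minimal_poly F0 (psi T 0) (zee T 0)"
  using irreducible_over_minimal_poly[OF F0, of "psi T 0"] psi_type[of 0] by simp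

lemma key_1: "key 1"
proof (rule keyI)
  have "key_poly K (Fi 1) (Vi 1) (Ci 1) (phi T 1) 1"
    using first_key_poly[of "phi T 1" T] phi_type(1,2)[of 1] n_pos minimal_0
    unfolding One_nat_def residue_field.simps val.simps reduce_phi_1[unfolded One_nat_def] by simp
  thus "\<exists>\<kappa>. key_poly K (Fi 1) (Vi 1) (Ci 1) (phi T 1) \<kappa>" ..
qed

definition lpure :: "nat \<Rightarrow> 'a poly \<Rightarrow> bool" where
  "lpure i P \<longleftrightarrow> slope_data.pure (Vi i) (phi T i) (h_of T i) (e_of T i) P"

text \<open>The condition of order \<open>i\<close> in \<open>has_type\<close>, with purity in place
  of the condition on slopes because purity is inherited by products and by factors.\<close>

definition level :: "nat \<Rightarrow> 'a poly \<Rightarrow> bool" where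
  "level i P \<longleftrightarrow> lpure i P \<and> (\<exists>a\<ge>1. sim_over (Fi i) (residual D T i (lam T i) P) (psi T i ^ a))"

lemma Vi_Suc:
  assumes "key i" "i \<in> {1..n}" "P \<in> polys_over K" "P \<noteq> 0"
  shows "Vi (Suc i) P = slope_data.W (Vi i) (phi T i) (h_of T i) (e_of T i) P"
proof -
  interpret S: rat_slope K "Fi i" "Vi i" "Ci i" "phi T i" "kap i" "lam T i" "ell T i" "ell' T i"
    by (rule key_rat_slope[OF assms(1,2)])
  obtain j where j: "i = Suc j" using assms(2) by (cases i) auto
  show ?thesis using S.val_eq[OF assms(3,4)] by (simp add: j)
qed

lemma residual_R:
  assumes "key i" "i \<in> {1..n}" "P \<in> polys_over K" "P \<noteq> 0"
  shows "residual D T i (lam T i) P = slope_data.R (Vi i) (Ci i) (phi T i) (h_of T i) (e_of T i) P"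
proof -
  interpret S: rat_slope K "Fi i" "Vi i" "Ci i" "phi T i" "kap i" "lam T i" "ell T i" "ell' T i"
    by (rule key_rat_slope[OF assms(1,2)])
  show ?thesis using S.residual_poly_eq[OF assms(3,4)] by (simp add: residual_def)
qed

lemma Ci_Suc:
  assumes "key i" "i \<in> {1..n}" "P \<in> polys_over K" "P \<noteq> 0"
  shows "Ci (Suc i) P u = zee T i powi
      ((int (slope_data.s (Vi i) (phi T i) (h_of T i) (e_of T i) P) - ell T i * u) div e_of T i) *
      poly (residual D T i (lam T i) P) (zee T i)"
proof -
  interpret S: rat_slope K "Fi i" "Vi i" "Ci i" "phi T i" "kap i" "lam T i" "ell T i" "ell' T i"
    by (rule key_rat_slope[OF assms(1,2)])
  obtain j where j: "i = Suc j" using assms(2) by (cases i) auto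
  show ?thesis using S.init_absc_segment[OF assms(3,4)] by (simp add: j Let_def residual_def)
qed

text \<open>The degree of the next key polynomial is computed from purity. This covers the
  representative, whose degree is not part of its definition.\<close>

lemma key_step:
  assumes key: "key i" and i: "i \<in> {1..n}" and pure: "lpure i (phi T (Suc i))"
    and sim: "sim_over (Fi i) (residual D T i (lam T i) (phi T (Suc i))) (psi T i)"
  shows "key (Suc i)" "zee T i \<noteq> 0"
    "degree (phi T (Suc i)) = degree (phi T i) * nat (e_of T i) * degree (psi T i)"
proof -
  interpret S: rat_slope K "Fi i" "Vi i" "Ci i" "phi T i" "kap i" "lam T i" "ell T i" "ell' T i"
    by (rule key_rat_slope[OF key i])
  have mem: "Suc i \<in> {1..Suc n}" using i by simp
  have \<phi>: "phi T (Suc i) \<in> polys_over K" "monic (phi T (Suc i))" "phi T (Suc i) \<noteq> 0"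
    using OK_poly[OF phi_O[OF mem]] phi_monic[OF mem] monic_nonzero by auto
  have p: "S.pure (phi T (Suc i))" using pure by (simp add: lpure_def)
  have sim': "sim_over (Fi i) (S.R (phi T (Suc i))) (psi T i)" using sim residual_R[OF key i \<phi>(1,3)] by simp
  have "degree (S.R (phi T (Suc i))) = degree (psi T i)"
    using minimal_sim_degree[of "Fi i" _ "psi T i" 1] sim' by simp
  thus deg: "degree (phi T (Suc i)) = degree (phi T i) * nat (e_of T i) * degree (psi T i)"
    using S.pure_degree_R[OF \<phi>(1,3) p] by simp
  have s0: "S.s (phi T (Suc i)) = 0" using p by (simp add: S.pure_def)
  have V: "Vi (Suc i) P = S.W P" if "P \<in> polys_over K" "P \<noteq> 0" for P by (rule Vi_Suc[OF key i that])
  have C: "Ci (Suc i) P u = zee T i powi ((int (S.s P) - ell T i * u) div e_of T i) * poly (S.R P) (zee T i)"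
    if "P \<in> polys_over K" "P \<noteq> 0" for P u
    using Ci_Suc[OF key i that] residual_R[OF key i that] by simp
  have F: "Fi (Suc i) = (\<lambda>g. poly g (zee T i)) ` polys_over (Fi i)" by simp
  note nk = S.next_key_poly[OF V C key_minimal[OF key i] F \<phi>(1,2) s0 sim' deg]
  show "zee T i \<noteq> 0" by (rule nk(1))
  show "key (Suc i)" by (rule keyI[OF nk(2)])
qed

lemma slopes_imp_pure:
  assumes key: "key i" and i: "i \<in> {1..n}" and P: "P \<in> polys_over K" "monic P"
    and deg: "degree P = b * degree (phi T i)"
    and sl: "slopes (newton D T i P) = {ereal (of_rat (lam T i))}"
  shows "lpure i P"
proof -
  interpret S: rat_slope K "Fi i" "Vi i" "Ci i" "phi T i" "kap i" "lam T i" "ell T i" "ell' T i"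
    by (rule key_rat_slope[OF key i])
  note * = S.slopes_single_imp[OF P(1) monic_nonzero[OF P(2)] sl[unfolded newton_def] P(2) deg]
  thus ?thesis unfolding lpure_def S.pure_def using deg by simp
qed

lemma lpure_degree:
  assumes key: "key i" and i: "i \<in> {1..n}" and P: "P \<in> polys_over K" "P \<noteq> 0" "lpure i P"
    and sim: "sim_over (Fi i) (residual D T i (lam T i) P) (psi T i ^ a)"
  shows "degree P = degree (phi T i) * nat (e_of T i) * (a * degree (psi T i))"
proof -
  interpret S: rat_slope K "Fi i" "Vi i" "Ci i" "phi T i" "kap i" "lam T i" "ell T i" "ell' T i"
    by (rule key_rat_slope[OF key i])
  show ?thesis
    using S.pure_degree_R[OF P(1,2)] P(3) minimal_sim_degree[OF sim] residual_R[OF key i P(1,2)]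
    by (simp add: lpure_def)
qed



text \<open>The two claims are interleaved: purity of the next polynomial can be deduced from its
  slopes only once order \<open>i\<close> is understood, and it is needed for order
  \<open>Suc i\<close>. The representative is left out, as its degree is not yet known.\<close>

lemma key_upto_n: "i \<in> {1..n} \<Longrightarrow> key i \<and> (i < n \<longrightarrow> lpure i (phi T (Suc i)))"
proof (induction i)
  case (Suc i)
  have key: "key (Suc i)"
  proof (cases i)
    case 0
    thus ?thesis using key_1 by simp
  next
    case (Suc j)
    hence i: "i \<in> {1..n}" "i \<in> {1..<n}" using \<open>Suc i \<in> {1..n}\<close> by auto
    thus ?thesis using Suc.IH key_step(1)[OF _ i(1) _ phi_next(2)[OF i(2)]] by auto
  qed
  have "lpure (Suc i) (phi T (Suc (Suc i)))" if lt: "Suc i < n"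
  proof -
    have i: "Suc i \<in> {1..<n}" and i': "Suc (Suc i) \<in> {1..Suc n}" using lt by auto
    have "int (degree (phi T (Suc (Suc i)))) = int (nat (e_of T (Suc i)) * degree (psi T (Suc i)) * degree (phi T (Suc i)))"
      using phi_next(3)[OF i] e_pos[of "Suc i"] lt by simp
    hence "degree (phi T (Suc (Suc i))) = nat (e_of T (Suc i)) * degree (psi T (Suc i)) * degree (phi T (Suc i))"
      by linarith
    from slopes_imp_pure[OF key Suc.prems OK_poly[OF phi_O[OF i']] phi_monic[OF i'] this phi_next(1)[OF i]]
    show ?thesis .
  qed
  thus ?case using key by blast
qed simp

section \<open>Polynomials of a given type\<close>

lemma reduce_eq_iff:
  assumes "P \<in> polys_over \<O>" "Q \<in> polys_over \<O>"
  shows "P - Q \<in> polys_over (max_ideal D) \<longleftrightarrow> reduce D P = reduce D Q"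
proof -
  have PQ: "P - Q \<in> polys_over \<O>" by (rule polys_over_diff[OF OR assms])
  have "reduce D P = reduce D Q + reduce D (P - Q)"
    using reduce_add[OF assms(2) PQ] by simp
  hence "reduce D P = reduce D Q \<longleftrightarrow> reduce D (P - Q) = 0" by simp
  also have "\<dots> \<longleftrightarrow> (\<forall>j. red D (coeff (P - Q) j) = 0)" by (simp add: poly_eq_iff coeff_reduce)
  also have "\<dots> \<longleftrightarrow> (\<forall>j. coeff (P - Q) j \<in> max_ideal D)"
    using red_eq_0_iff[OF polys_over_coeff[OF PQ]] by simp
  finally show ?thesis by (simp add: polys_over_def)
qed

lemma phi_1_O: "phi T 1 \<in> polys_over \<O>" "monic (phi T 1)"
  using phi_O[of 1] phi_monic[of 1] by auto

lemma type_reduce_iff: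
  assumes "P \<in> polys_over \<O>"
  shows "(\<exists>a\<ge>1. P - phi T 1 ^ a \<in> polys_over (max_ideal D)) \<longleftrightarrow> (\<exists>a\<ge>1. reduce D P = psi T 0 ^ a)"
  using reduce_eq_iff[OF assms polys_over_power[OF OR phi_1_O(1)]] reduce_power[OF phi_1_O(1)]
  by (simp add: reduce_phi_1[unfolded One_nat_def])

lemma degree_phi_1: "degree (phi T 1) = degree (psi T 0)"
  using reduce_monic(2)[OF phi_1_O(2)] reduce_phi_1 by simp

text \<open>To read purity off the slopes, the degree must be a multiple of that of the key
  polynomial. Each order supplies this for the next one, starting from the reduction being a power
  of \<open>psi T 0\<close>.\<close>

lemma has_type_levels:
  assumes P: "has_type D n T P"
  shows "i \<in> {1..n} \<Longrightarrow> (\<exists>b. degree P = b * degree (phi T i)) \<and> level i P"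
proof (induction i)
  case (Suc i)
  have PO: "P \<in> polys_over \<O>" "monic P" using P unfolding has_type_def by blast+
  have PK: "P \<in> polys_over K" "P \<noteq> 0" using OK_poly[OF PO(1)] monic_nonzero[OF PO(2)] by auto
  have "\<exists>b. degree P = b * degree (phi T (Suc i))"
  proof (cases i)
    case 0
    obtain a where "reduce D P = psi T 0 ^ a"
      using P type_reduce_iff[OF PO(1)] unfolding has_type_def by blast
    hence "degree P = a * degree (psi T 0)"
      using reduce_monic(2)[OF PO(2)] psi_type(1)[of 0] monic_nonzero by (metis atLeastAtMost_iff degree_power_eq le0)
    thus ?thesis using degree_phi_1 0 by auto
  next
    case (Suc j)
    hence i: "i \<in> {1..n}" "i \<in> {1..<n}" "i < n" using \<open>Suc i \<in> {1..n}\<close> by auto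
    have lev: "level i P" using Suc.IH i by blast
    then obtain a where a: "sim_over (Fi i) (residual D T i (lam T i) P) (psi T i ^ a)" by (auto simp: level_def)
    have key: "key i" "lpure i (phi T (Suc i))" using key_upto_n[OF i(1)] i(3) by auto
    have "degree P = degree (phi T i) * nat (e_of T i) * (a * degree (psi T i))"
      using lpure_degree[OF key(1) i(1) PK _ a] lev by (simp add: level_def)
    also have "\<dots> = a * degree (phi T (Suc i))"
      using key_step(3)[OF key(1) i(1) key(2) phi_next(2)[OF i(2)]] by simp
    finally show ?thesis by blast
  qed
  moreover from this obtain b where b: "degree P = b * degree (phi T (Suc i))" by blast
  have "slopes (newton D T (Suc i) P) = {ereal (of_rat (lam T (Suc i)))} \<and>
      (\<exists>a\<ge>1. sim_over (Fi (Suc i)) (residual D T (Suc i) (lam T (Suc i)) P) (psi T (Suc i) ^ a))"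
    using P Suc.prems unfolding has_type_def by blast
  hence "level (Suc i) P"
    using slopes_imp_pure[OF _ Suc.prems PK(1) PO(2) b] key_upto_n[OF Suc.prems] by (simp add: level_def)
  ultimately show ?case by blast
qed simp

lemma phi_next_all:
  assumes i: "i \<in> {1..n}"
  shows "lpure i (phi T (Suc i))" "sim_over (Fi i) (residual D T i (lam T i) (phi T (Suc i))) (psi T i)"
proof -
  have "lpure i (phi T (Suc i)) \<and> sim_over (Fi i) (residual D T i (lam T i) (phi T (Suc i))) (psi T i)"
  proof (cases "i = n")
    case True
    thus ?thesis using has_type_levels[OF rep_type i] rep_sim by (auto simp: level_def)
  next
    case False
    hence "i \<in> {1..<n}" "i < n" using i by auto
    thus ?thesis using key_upto_n[OF i] phi_next(2) by blast
  qed
  thus "lpure i (phi T (Suc i))" "sim_over (Fi i) (residual D T i (lam T i) (phi T (Suc i))) (psi T i)" by auto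
qed

lemma key_all: "i \<in> {1..Suc n} \<Longrightarrow> key i"
proof (cases "i = Suc n")
  case True
  have "n \<in> {1..n}" using n_pos by simp
  thus ?thesis using key_step(1)[OF _ _ phi_next_all] key_upto_n True by blast
qed (use key_upto_n in auto)

definition Em :: "nat \<Rightarrow> int" where "Em i = (\<Prod>k=1..i. e_of T k)"

lemma Em_pos: "i \<le> n \<Longrightarrow> 0 < Em i"
  unfolding Em_def by (intro prod_pos) (auto intro: e_pos)

lemma Vi_const: "i \<le> n \<Longrightarrow> b \<in> K \<Longrightarrow> b \<noteq> 0 \<Longrightarrow> Vi (Suc i) [:b:] = Em i * vi b"
proof (induction i)
  case 0
  thus ?case by (simp add: gauss_const Em_def)
next
  case (Suc i)
  have i: "Suc i \<in> {1..n}" using Suc.prems by simp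
  interpret S: rat_slope K "Fi (Suc i)" "Vi (Suc i)" "Ci (Suc i)" "phi T (Suc i)" "kap (Suc i)"
    "lam T (Suc i)" "ell T (Suc i)" "ell' T (Suc i)"
    using key_rat_slope[OF key_all i] i by simp
  have "Vi (Suc (Suc i)) [:b:] = S.W [:b:]"
    using Vi_Suc[OF key_all i polys_over_const[OF KR Suc.prems(2)]] i Suc.prems by simp
  also have "\<dots> = e_of T (Suc i) * (Em i * vi b)"
    using S.W_const[OF Suc.prems(2,3)] Suc.IH Suc.prems by simp
  finally show ?case by (simp add: Em_def)
qed

lemma key_padic_at:
  assumes "i \<le> n"
  shows "key_padic p D (Fi (Suc i)) (Vi (Suc i)) (Ci (Suc i)) (phi T (Suc i)) (kap (Suc i)) (Em i)"
proof -
  interpret key_poly K "Fi (Suc i)" "Vi (Suc i)" "Ci (Suc i)" "phi T (Suc i)" "kap (Suc i)"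
    using key_all[of "Suc i"] assms by (simp add: key_def)
  show ?thesis by unfold_locales (use Em_pos[OF assms] Vi_const[OF assms] in auto)
qed

lemma has_type_iff:
  assumes P: "P \<in> polys_over \<O>" "monic P"
  shows "has_type D n T P \<longleftrightarrow> (\<exists>a\<ge>1. reduce D P = psi T 0 ^ a) \<and> (\<forall>i\<in>{1..n}. level i P)"
proof
  assume "has_type D n T P"
  thus "(\<exists>a\<ge>1. reduce D P = psi T 0 ^ a) \<and> (\<forall>i\<in>{1..n}. level i P)"
    using has_type_levels type_reduce_iff[OF P(1)] unfolding has_type_def by blast
next
  assume *: "(\<exists>a\<ge>1. reduce D P = psi T 0 ^ a) \<and> (\<forall>i\<in>{1..n}. level i P)"
  have PK: "P \<in> polys_over K" "P \<noteq> 0" using OK_poly[OF P(1)] monic_nonzero[OF P(2)] by auto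
  have "slopes (newton D T i P) = {ereal (of_rat (lam T i))}" if i: "i \<in> {1..n}" for i
  proof -
    have key: "key i" using key_all i by simp
    interpret S: rat_slope K "Fi i" "Vi i" "Ci i" "phi T i" "kap i" "lam T i" "ell T i" "ell' T i"
      by (rule key_rat_slope[OF key i])
    have "level i P" using * i by blast
    then obtain a where a: "1 \<le> a" "lpure i P" "sim_over (Fi i) (residual D T i (lam T i) P) (psi T i ^ a)"
      by (auto simp: level_def)
    have "0 < degree P"
      using lpure_degree[OF key i PK a(2,3)] a(1) e_pos[OF i] S.\<phi>_deg
        minimal_poly_degree_pos[OF key_minimal[OF key i]] by simp
    hence "0 < S.L P" using a(2) by (cases "S.L P") (auto simp: lpure_def S.pure_def)
    thus ?thesis using S.one_sided_newton(3)[OF PK P(2)] a(2)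
      by (simp add: lpure_def S.pure_def newton_def)
  qed
  thus "has_type D n T P"
    using * P type_reduce_iff[OF P(1)] unfolding has_type_def level_def by blast
qed

lemma level_mult:
  assumes i: "i \<in> {1..n}" and P: "P \<in> polys_over K" "P \<noteq> 0" "level i P"
    and Q: "Q \<in> polys_over K" "Q \<noteq> 0" "level i Q"
  shows "level i (P * Q)"
proof -
  have key: "key i" using key_all i by simp
  interpret S: rat_slope K "Fi i" "Vi i" "Ci i" "phi T i" "kap i" "lam T i" "ell T i" "ell' T i"
    by (rule key_rat_slope[OF key i])
  have PQ: "P * Q \<in> polys_over K" "P * Q \<noteq> 0" using polys_over_mult[OF KR P(1) Q(1)] P(2) Q(2) by auto
  obtain a b c d where
    a: "1 \<le> a" "c \<in> Fi i" "c \<noteq> 0" "S.R P = smult c (psi T i ^ a)" and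
    b: "1 \<le> b" "d \<in> Fi i" "d \<noteq> 0" "S.R Q = smult d (psi T i ^ b)"
    using P(3) Q(3) residual_R[OF key i P(1,2)] residual_R[OF key i Q(1,2)]
    by (auto simp: level_def sim_over_def)
  have "S.R (P * Q) = smult (c * d) (psi T i ^ (a + b))"
    using S.W_mult(3)[OF P(1,2) Q(1,2)] a(4) b(4) by (simp add: power_add mult.commute)
  moreover have "c * d \<in> Fi i" using a b by (intro subring_mult[OF S.FR])
  ultimately have "sim_over (Fi i) (residual D T i (lam T i) (P * Q)) (psi T i ^ (a + b))"
    unfolding residual_R[OF key i PQ] sim_over_def using a b by (intro bexI[of _ "c * d"]) auto
  moreover have "lpure i (P * Q)"
    using S.pure_mult_iff[OF P(1,2) Q(1,2)] P(3) Q(3) by (simp add: level_def lpure_def)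
  moreover have "1 \<le> a + b" using a(1) by simp
  ultimately show ?thesis unfolding level_def by blast
qed

text \<open>Positive degree is what excludes the exponent 0: a pure polynomial with constant
  residual polynomial is constant.\<close>

lemma level_factor:
  assumes i: "i \<in> {1..n}" and P: "P \<in> polys_over K" "P \<noteq> 0" and Q: "Q \<in> polys_over K" "Q \<noteq> 0"
    and PQ: "level i (P * Q)" and deg: "0 < degree P"
  shows "level i P"
proof -
  have key: "key i" using key_all i by simp
  interpret S: rat_slope K "Fi i" "Vi i" "Ci i" "phi T i" "kap i" "lam T i" "ell T i" "ell' T i"
    by (rule key_rat_slope[OF key i])
  have PQ': "P * Q \<in> polys_over K" "P * Q \<noteq> 0" using polys_over_mult[OF KR P(1) Q(1)] P Q by auto
  have pure: "lpure i P" using PQ S.pure_mult_iff[OF P Q] by (simp add: level_def lpure_def)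
  obtain a c where c: "c \<in> Fi i" "c \<noteq> 0" "S.R P * S.R Q = smult c (psi T i ^ a)"
    using PQ residual_R[OF key i PQ'] S.W_mult(3)[OF P Q] by (auto simp: level_def sim_over_def)
  obtain b where b: "sim_over (Fi i) (S.R P) (psi T i ^ b)"
    using factor_of_minimal_power[OF S.F key_minimal[OF key i] S.R_facts(3)[OF P] S.R_facts(3)[OF Q] c(3,1,2)]
    by blast
  hence b': "sim_over (Fi i) (residual D T i (lam T i) P) (psi T i ^ b)" by (simp add: residual_R[OF key i P])
  have "b \<noteq> 0" using lpure_degree[OF key i P pure b'] deg by (cases b) auto
  hence "1 \<le> b" by simp
  thus ?thesis using pure b' by (auto simp: level_def)
qed

lemma level_n_C:
  assumes P: "P \<in> polys_over K" "P \<noteq> 0" "level n P"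
  shows "Ci (Suc n) P (Vi (Suc n) P) = 0"
proof -
  have n: "n \<in> {1..n}" using n_pos by simp
  obtain a c where a: "1 \<le> a" "residual D T n (lam T n) P = smult c (psi T n ^ a)"
    using P(3) by (auto simp: level_def sim_over_def)
  have "poly (psi T n) (zee T n) = 0" using psi_type(3)[of n] by simp
  hence "poly (residual D T n (lam T n) P) (zee T n) = 0" using a by simp
  thus ?thesis using Ci_Suc[OF key_all n P(1,2)] n by simp
qed

text \<open>One step down the chain: the smallness of \<open>\<phi>\<^sub>i\<^sub>+\<^sub>1\<close> at the roots of \<open>G\<close> forces the shape of \<open>G\<close> in order \<open>i\<close>.\<close>

lemma C_imp_level:
  assumes i: "i \<in> {1..n}" and G: "minimal_poly K G \<theta>" and C0: "Ci (Suc i) G (Vi (Suc i) G) = 0"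
  shows "level i G" "Ci i G (Vi i G) = 0"
proof -
  have key: "key i" using key_all i by simp
  have Sin: "i \<le> n" and mem: "Suc i \<in> {1..Suc n}" using i by auto
  have GK: "G \<in> polys_over K" "monic G" "G \<noteq> 0" using G monic_nonzero by (auto simp: minimal_poly_def)
  have Gdeg: "0 < degree G" by (rule minimal_poly_degree_pos[OF G])
  interpret S: rat_slope K "Fi i" "Vi i" "Ci i" "phi T i" "kap i" "lam T i" "ell T i" "ell' T i"
    by (rule key_rat_slope[OF key i])
  interpret N: key_padic p D "Fi (Suc i)" "Vi (Suc i)" "Ci (Suc i)" "phi T (Suc i)" "kap (Suc i)" "Em i"
    by (rule key_padic_at[OF Sin])
  have \<phi>': "phi T (Suc i) \<in> polys_over K" "monic (phi T (Suc i))" "phi T (Suc i) \<noteq> 0"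
    using OK_poly[OF phi_O[OF mem]] phi_monic[OF mem] monic_nonzero by auto
  show lev: "level i G"
  proof (cases "poly (phi T (Suc i)) \<theta> = 0")
    case True
    hence "G = phi T (Suc i)" by (rule N.minimal_eq_\<phi>[OF G])
    thus ?thesis using phi_next_all[OF i] by (auto simp: level_def intro!: exI[of _ 1])
  next
    case False
    obtain H where H: "minimal_poly K H (poly (phi T (Suc i)) \<theta>)" by (rule algebraic)
    have "\<not> Em i * rv (poly (phi T (Suc i)) \<theta>) \<le> real_of_int (Vi (Suc i) (phi T (Suc i)))"
      using N.small_value_C[OF G H False] C0 by blast
    hence "real_of_int (Vi (Suc i) (phi T (Suc i))) < Em i * rv (poly (phi T (Suc i)) \<theta>)" by simp
    from N.large_value_lead[OF G H False this] obtain Y where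
      Y: "Y \<in> polys_over K" "N.Q H = phi T (Suc i) ^ degree H + Y"
      "val_ge (Vi (Suc i)) (Vi (Suc i) (phi T (Suc i) ^ degree H) + 1) Y" by blast
    note Q = N.Q_facts[OF G H False]
    have sim: "sim_over (Fi i) (S.R (phi T (Suc i))) (psi T i)"
      using phi_next_all(2)[OF i] residual_R[OF key i \<phi>'(1,3)] by simp
    have pure: "S.pure (phi T (Suc i))" using phi_next_all(1)[OF i] by (simp add: lpure_def)
    have V: "Vi (Suc i) P = S.W P" if "P \<in> polys_over K" "P \<noteq> 0" for P by (rule Vi_Suc[OF key i that])
    note d = S.descend[OF V key_minimal[OF key i] \<phi>'(1,2) pure sim Y(1,3) GK(1) Q(3)]
    have "S.pure G \<and> (\<exists>a\<ge>1. sim_over (Fi i) (S.R G) (psi T i ^ a))"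
      using d Q(2,4,6) Y(2) Gdeg by metis
    thus ?thesis by (simp add: level_def lpure_def residual_R[OF key i GK(1,3)])
  qed
  show "Ci i G (Vi i G) = 0"
    using S.pure_C_eq_0[OF GK(1,2) _ Gdeg] lev by (simp add: level_def lpure_def)
qed

text \<open>The last step of the descent. In order 1 the dominance of the leading term says that the
  composed polynomial is congruent to a power of \<open>phi T 1\<close>, and reduction modulo the
  maximal ideal plays the part of the residual polynomial.\<close>

lemma C_1_imp_reduce:
  assumes G: "minimal_poly K G \<theta>" "G \<in> polys_over \<O>" and C0: "Ci 1 G (Vi 1 G) = 0"
  shows "\<exists>a\<ge>1. reduce D G = psi T 0 ^ a"
proof (cases "poly (phi T 1) \<theta> = 0")
  case True
  interpret N: key_padic p D "Fi (Suc 0)" "Vi (Suc 0)" "Ci (Suc 0)" "phi T (Suc 0)" "kap (Suc 0)" "Em 0"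
    by (rule key_padic_at) simp
  have "G = phi T 1" using N.minimal_eq_\<phi>[OF G(1)] True by simp
  thus ?thesis using reduce_phi_1 by (intro exI[of _ 1]) simp
next
  case False
  interpret N: key_padic p D "Fi (Suc 0)" "Vi (Suc 0)" "Ci (Suc 0)" "phi T (Suc 0)" "kap (Suc 0)" "Em 0"
    by (rule key_padic_at) simp
  have GK: "G \<in> polys_over K" "monic G" "G \<noteq> 0" using G monic_nonzero by (auto simp: minimal_poly_def)
  have nz: "poly (phi T (Suc 0)) \<theta> \<noteq> 0" using False by simp
  obtain H where H: "minimal_poly K H (poly (phi T (Suc 0)) \<theta>)" by (rule algebraic)
  have "\<not> Em 0 * rv (poly (phi T (Suc 0)) \<theta>) \<le> real_of_int (Vi (Suc 0) (phi T (Suc 0)))"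
    using N.small_value_C[OF G(1) H nz] C0 unfolding One_nat_def by blast
  hence "real_of_int (Vi (Suc 0) (phi T (Suc 0))) < Em 0 * rv (poly (phi T (Suc 0)) \<theta>)" by simp
  from N.large_value_lead[OF G(1) H nz this] obtain Y where
    Y: "Y \<in> polys_over K" "N.Q H = phi T (Suc 0) ^ degree H + Y"
    "val_ge (Vi (Suc 0)) (Vi (Suc 0) (phi T (Suc 0) ^ degree H) + 1) Y" by blast
  note Q = N.Q_facts[OF G(1) H nz]
  define P where "P = phi T (Suc 0) ^ degree H"
  have PO: "P \<in> polys_over \<O>" "monic P"
    using polys_over_power[OF OR phi_1_O(1)] monic_power[OF phi_1_O(2)] by (auto simp: P_def)
  have VP: "gauss_val D P = 0" by (rule gauss_monic[OF PO])
  have Yge: "val_ge (gauss_val D) 1 Y" using Y(3) VP by (simp flip: P_def)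
  hence Yge0: "val_ge (gauss_val D) 0 Y" by (auto simp: val_ge_def)
  have YO: "Y \<in> polys_over \<O>" using gauss_nonneg_iff[OF Y(1)] Yge0 by simp
  have "reduce D Y = 0" using reduce_scale_0[OF Y(1) Yge0] Yge by (simp add: scale_def)
  moreover have "reduce D (P + Y) = reduce D P + reduce D Y" by (rule reduce_add[OF PO(1) YO])
  moreover have "reduce D P = psi T 0 ^ degree H"
    using reduce_power[OF phi_1_O(1)] reduce_phi_1 by (simp add: P_def)
  ultimately have rQ: "reduce D (N.Q H) = psi T 0 ^ degree H" using Y(2) by (simp flip: P_def)
  have QO: "N.Q H \<in> polys_over \<O>" using polys_over_add[OF OR PO(1) YO] Y(2) by (simp add: P_def)
  have XO: "N.Q H div G \<in> polys_over \<O>" by (rule polys_over_div[OF OR G(2) GK(2) QO])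
  have Qeq: "N.Q H = G * (N.Q H div G)" using Q(2) unfolding N.X_def[OF G(1) H nz] .
  have "reduce D G * reduce D (N.Q H div G) = smult 1 (psi T 0 ^ degree H)"
    using reduce_mult[OF G(2) XO] rQ Qeq by simp
  moreover have "(1::'k) \<in> F0" using F0 by (simp add: is_subfield_def)
  ultimately obtain a where a: "sim_over F0 (reduce D G) (psi T 0 ^ a)"
    using factor_of_minimal_power[OF F0 minimal_0 reduce_F0[OF G(2)] reduce_F0[OF XO]] zero_neq_one by metis
  then obtain c where c: "reduce D G = smult c (psi T 0 ^ a)" by (auto simp: sim_over_def)
  have "monic (reduce D G)" "monic (psi T 0 ^ a)"
    using reduce_monic(1)[OF GK(2)] monic_power[OF psi_type(1)[of 0]] by auto
  hence "c = 1" using c by (auto simp: monic_def split: if_splits)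
  hence eq: "reduce D G = psi T 0 ^ a" using c by simp
  have "a \<noteq> 0"
  proof
    assume "a = 0"
    hence "degree G = 0" using eq reduce_monic(2)[OF GK(2)] by simp
    thus False using minimal_poly_degree_pos[OF G(1)] by simp
  qed
  thus ?thesis using eq by (intro exI[of _ a]) auto
qed

text \<open>A class that vanishes in one order vanishes in the order below, so a single equation at
  the top yields the conditions of all orders.\<close>

lemma C_imp_has_type:
  assumes G: "minimal_poly K G \<theta>" "G \<in> polys_over \<O>" and C0: "Ci (Suc n) G (Vi (Suc n) G) = 0"
  shows "has_type D n T G"
proof -
  have down: "i \<le> n \<Longrightarrow> Ci (Suc (n - i)) G (Vi (Suc (n - i)) G) = 0" for i
  proof (induction i)
    case (Suc i)
    have mem: "n - i \<in> {1..n}" and eq: "Suc (n - Suc i) = n - i" using Suc.prems by auto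
    show ?case using C_imp_level(2)[OF mem G(1)] Suc unfolding eq by simp
  qed (simp add: C0)
  have "level i G" if i: "i \<in> {1..n}" for i
    using C_imp_level(1)[OF i G(1)] down[of "n - i"] i by simp
  moreover have "\<exists>a\<ge>1. reduce D G = psi T 0 ^ a" using C_1_imp_reduce[OF G] down[of n] by simp
  moreover have "monic G" using G(1) by (simp add: minimal_poly_def)
  ultimately show ?thesis using has_type_iff[OF G(2)] by blast
qed

text \<open>The converse direction, stated for factors: every minimal polynomial dividing a
  polynomial of the type satisfies the same equation. This gives the maximality of the part of the
  given type.\<close>

lemma has_type_factor_C:
  assumes H: "has_type D n T (G * X)" and G: "G \<in> polys_over K" "G \<noteq> 0" "0 < degree G"
    and X: "X \<in> polys_over K" "X \<noteq> 0"
  shows "Ci (Suc n) G (Vi (Suc n) G) = 0"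
proof -
  have n: "n \<in> {1..n}" using n_pos by simp
  have "level n (G * X)" using has_type_levels[OF H n] by blast
  from level_n_C[OF G(1,2) level_factor[OF n G(1,2) X this G(3)]] show ?thesis .
qed

lemma has_type_mult:
  assumes "has_type D n T P" "has_type D n T Q" shows "has_type D n T (P * Q)"
proof -
  have O: "P \<in> polys_over \<O>" "Q \<in> polys_over \<O>" and m: "monic P" "monic Q"
    using assms unfolding has_type_def by blast+
  have K': "P \<in> polys_over K" "Q \<in> polys_over K" "P \<noteq> 0" "Q \<noteq> 0"
    using OK_poly O m monic_nonzero by auto
  obtain a b where ab: "1 \<le> a" "reduce D P = psi T 0 ^ a" "1 \<le> b" "reduce D Q = psi T 0 ^ b"
    using assms has_type_iff O m by blast
  have "reduce D (P * Q) = psi T 0 ^ (a + b)" using reduce_mult[OF O] ab by (simp add: power_add)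
  moreover have "1 \<le> a + b" using ab by simp
  moreover have "\<forall>i\<in>{1..n}. level i (P * Q)"
    using level_mult[OF _ K'(1,3) _ K'(2,4)] has_type_levels assms by blast
  ultimately show ?thesis using has_type_iff[OF polys_over_mult[OF OR O] monic_mult[OF m]] by blast
qed

end

section \<open>Products of minimal polynomials\<close>

lemma polys_over_prod_mset:
  "is_subring A \<Longrightarrow> (\<And>G. G \<in># M \<Longrightarrow> G \<in> polys_over A) \<Longrightarrow> prod_mset M \<in> polys_over A"
  by (induction M) (auto simp: polys_over_1 intro: polys_over_mult)

lemma monic_prod_mset: "(\<And>G. G \<in># M \<Longrightarrow> monic G) \<Longrightarrow> monic (prod_mset M)" for M :: "'a::idom poly multiset"
  by (induction M) (auto simp: monic_mult monic_def[of 1])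

lemma poly_prod_mset_eq_0:
  "poly (prod_mset M) x = 0 \<longleftrightarrow> (\<exists>G\<in>#M. poly G x = 0)" for M :: "'a::idom poly multiset"
  by (induction M) auto

lemma prod_mset_filter_split:
  "prod_mset M = prod_mset (filter_mset P M) * prod_mset (filter_mset (\<lambda>x. \<not> P x) M)"
  for M :: "'a::comm_monoid_mult multiset"
  by (induction M) (auto simp: mult_ac)

lemma prod_mset_partition:
  fixes M :: "'b::comm_monoid_mult multiset"
  assumes I: "finite I" and "\<And>x. x \<in># M \<Longrightarrow> \<exists>!i. i \<in> I \<and> \<sigma> x = \<mu> i"
  shows "prod_mset M = (\<Prod>i\<in>I. prod_mset (filter_mset (\<lambda>x. \<sigma> x = \<mu> i) M))"
  using assms(2)
proof (induction M)
  case (add x M)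
  obtain j where j: "j \<in> I" "\<sigma> x = \<mu> j" "\<And>i. i \<in> I \<Longrightarrow> \<sigma> x = \<mu> i \<Longrightarrow> i = j"
    using add.prems[of x] by auto
  have "(\<Prod>i\<in>I. prod_mset (filter_mset (\<lambda>x. \<sigma> x = \<mu> i) (add_mset x M))) =
      (\<Prod>i\<in>I. (if i = j then x else 1) * prod_mset (filter_mset (\<lambda>x. \<sigma> x = \<mu> i) M))"
    using j by (intro prod.cong) auto
  also have "\<dots> = x * (\<Prod>i\<in>I. prod_mset (filter_mset (\<lambda>x. \<sigma> x = \<mu> i) M))"
    using I j(1) by (simp add: prod.distrib)
  finally show ?case using add by simp
qed simp

text \<open>Linear factors of \<open>H\<close> are removed one at a time from \<open>H\<close> and
  \<open>A\<close>, so multiplicities are respected.\<close>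

lemma dvd_of_no_common_root:
  fixes H :: "'a::alg_closed_field poly"
  assumes "H dvd A * B" "H \<noteq> 0" "\<And>x. poly H x = 0 \<Longrightarrow> poly B x \<noteq> 0"
  shows "H dvd A"
  using assms
proof (induction "degree H" arbitrary: H A)
  case 0
  hence "is_unit H" by (simp add: is_unit_iff_degree)
  thus ?case by (rule unit_imp_dvd)
next
  case (Suc m)
  hence "0 < degree H" by simp
  then obtain x where x: "poly H x = 0" using alg_closed_imp_poly_has_root by blast
  have "poly (A * B) x = 0" using Suc.prems(1) x by (metis dvd_trans poly_eq_0_iff_dvd)
  hence "poly A x = 0" using Suc.prems(3)[OF x] by simp
  then obtain A' where A': "A = [:- x, 1:] * A'" using poly_eq_0_iff_dvd by blast
  obtain H' where H': "H = [:- x, 1:] * H'" using x poly_eq_0_iff_dvd by blast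
  have H'0: "H' \<noteq> 0" using H' Suc.prems(2) by auto
  have "degree H = Suc (degree H')" unfolding H' using H'0 by (subst degree_mult_eq) auto
  hence "m = degree H'" using Suc.hyps(2) by simp
  moreover have "[:- x, 1:] * H' dvd [:- x, 1:] * (A' * B)"
    using Suc.prems(1) unfolding A' H' by (simp only: mult.assoc)
  hence "H' dvd A' * B" by (subst (asm) dvd_mult_cancel_left) auto
  moreover have "poly B y \<noteq> 0" if "poly H' y = 0" for y using Suc.prems(3)[of y] that by (simp add: H')
  ultimately have "H' dvd A'" using Suc.hyps(1) H'0 by blast
  thus ?case unfolding A' H' by (rule mult_dvd_mono[OF dvd_refl])
qed

context padic
begin

lemma minimal_poly_factorization:
  assumes "P \<in> polys_over K" "monic P"
  shows "\<exists>M. P = prod_mset M \<and> (\<forall>G\<in>#M. \<exists>\<theta>. minimal_poly K G \<theta>)"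
  using assms
proof (induction "degree P" arbitrary: P rule: less_induct)
  case less
  show ?case
  proof (cases "degree P = 0")
    case True
    hence "P = prod_mset {#}" using less.prems monic_degree_0 by simp
    thus ?thesis by (intro exI[of _ "{#}"]) auto
  next
    case False
    then obtain \<theta> where \<theta>: "poly P \<theta> = 0" using alg_closed_imp_poly_has_root by blast
    obtain G where G: "minimal_poly K G \<theta>" by (rule algebraic)
    note d = minimal_poly_dvd[OF K G less.prems(1) \<theta>]
    define Q where "Q = P div G"
    have PQ: "P = G * Q" "Q \<in> polys_over K" using d by (auto simp: Q_def)
    have "monic G" using G by (simp add: minimal_poly_def)
    hence Q: "monic Q" using PQ(1) less.prems(2) monic_factor by metis
    have "degree P = degree G + degree Q"
      unfolding PQ(1) using Q \<open>monic G\<close> by (intro degree_mult_eq) (auto simp: monic_nonzero)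
    hence "degree Q < degree P" using minimal_poly_degree_pos[OF G] by simp
    from less.hyps[OF this PQ(2) Q] obtain M where
      M: "Q = prod_mset M" "\<forall>G\<in>#M. \<exists>\<theta>. minimal_poly K G \<theta>" by blast
    show ?thesis using M G PQ(1) by (intro exI[of _ "add_mset G M"]) auto
  qed
qed

lemma prod_mset_integral:
  assumes "prod_mset M \<in> polys_over \<O>" "\<And>G. G \<in># M \<Longrightarrow> G \<in> polys_over K" "\<And>G. G \<in># M \<Longrightarrow> monic G"
    and G: "G \<in># M"
  shows "G \<in> polys_over \<O>"
proof -
  obtain M' where M': "M = add_mset G M'" using G by (rule mset_add)
  show ?thesis
    by (rule monic_factor_integral(1)[of G "prod_mset M'"])
      (use assms M' polys_over_prod_mset[OF KR, of M'] monic_prod_mset[of M'] in auto)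
qed

end

section \<open>The slope of a minimal polynomial\<close>

context type_setting
begin

abbreviation "\<phi>r \<equiv> phi T (Suc n)"
abbreviation "Vr \<equiv> Vi (Suc n)"
abbreviation "Cr \<equiv> Ci (Suc n)"

text \<open>Anticipates the slope of the polygon of the minimal polynomial of
  \<open>\<theta>\<close>; it is the value formula of the theorem solved for the slope.\<close>

definition root_slope :: "'a \<Rightarrow> ereal" where
  "root_slope \<theta> = (if poly \<phi>r \<theta> = 0 then -\<infinity> else ereal (real_of_int (Vr \<phi>r) - Em n * rv (poly \<phi>r \<theta>)))"

definition sig :: "'a poly \<Rightarrow> ereal" where
  "sig G = root_slope (SOME \<theta>. poly G \<theta> = 0)"

lemma \<phi>r: "\<phi>r \<in> polys_over \<O>" "\<phi>r \<in> polys_over K" "monic \<phi>r"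
  using phi_O[of "Suc n"] phi_monic[of "Suc n"] OK_poly by auto

text \<open>\<open>G\<close> divides the composition of \<open>H\<close> with
  \<open>\<phi>r\<close>, so the values of \<open>\<phi>r\<close> at two roots of \<open>G\<close>
  are both roots of \<open>H\<close> and hence have equal valuation. The choice of a root in
  \<open>sig\<close> is therefore harmless.\<close>

lemma root_slope_conj:
  assumes G: "minimal_poly K G \<theta>" and \<theta>': "poly G \<theta>' = 0"
  shows "root_slope \<theta>' = root_slope \<theta>"
proof -
  obtain H where H: "minimal_poly K H (poly \<phi>r \<theta>)" by (rule algebraic)
  have HK: "H \<in> polys_over K" "poly H (poly \<phi>r \<theta>) = 0" using H by (auto simp: minimal_poly_def)
  have "pcompose H \<phi>r \<in> polys_over K" by (rule polys_over_pcompose[OF KR HK(1) \<phi>r(2)])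
  moreover have "poly (pcompose H \<phi>r) \<theta> = 0" using HK(2) by (simp add: poly_pcompose)
  ultimately have "G dvd pcompose H \<phi>r" by (rule minimal_poly_dvd(1)[OF K G])
  hence "poly (pcompose H \<phi>r) \<theta>' = 0" using \<theta>' by (auto elim!: dvdE)
  hence "poly H (poly \<phi>r \<theta>') = 0" by (simp add: poly_pcompose)
  from conjugates_rv[OF H this] show ?thesis by (simp add: root_slope_def)
qed

lemma sig_eq: "minimal_poly K G \<theta> \<Longrightarrow> sig G = root_slope \<theta>"
  unfolding sig_def
  by (rule root_slope_conj, assumption, rule someI[of _ \<theta>]) (simp add: minimal_poly_def)

lemma key_padic_r: "key_padic p D (Fi (Suc n)) Vr Cr \<phi>r (kap (Suc n)) (Em n)"
  by (rule key_padic_at) simp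

lemma sig_minus_inf:
  assumes G: "minimal_poly K G \<theta>" shows "sig G = -\<infinity> \<longleftrightarrow> G = \<phi>r"
proof -
  interpret N: key_padic p D "Fi (Suc n)" Vr Cr \<phi>r "kap (Suc n)" "Em n" by (rule key_padic_r)
  show ?thesis
  proof
    assume "sig G = -\<infinity>"
    hence "poly \<phi>r \<theta> = 0" using sig_eq[OF G] by (auto simp: root_slope_def split: if_splits)
    thus "G = \<phi>r" by (rule N.minimal_eq_\<phi>[OF G])
  next
    assume "G = \<phi>r"
    hence "poly \<phi>r \<theta> = 0" using G by (simp add: minimal_poly_def)
    thus "sig G = -\<infinity>" using sig_eq[OF G] by (simp add: root_slope_def)
  qed
qed

lemma C_\<phi>r: "Cr \<phi>r (Vr \<phi>r) = 0"
proof -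
  interpret N: key_padic p D "Fi (Suc n)" Vr Cr \<phi>r "kap (Suc n)" "Em n" by (rule key_padic_r)
  show ?thesis by (rule N.C_\<phi>)
qed

text \<open>A killed class forces the value of \<open>\<phi>r\<close> at the root to be large, which
  is the negativity of the slope. Rationality comes from the value group.\<close>

lemma sig_rational:
  assumes G: "minimal_poly K G \<theta>" and C0: "Cr G (Vr G) = 0"
  shows "sig G = -\<infinity> \<or> (\<exists>q<0. sig G = ereal (of_rat q))"
proof (cases "poly \<phi>r \<theta> = 0")
  case True
  thus ?thesis using sig_eq[OF G] by (simp add: root_slope_def)
next
  case False
  interpret N: key_padic p D "Fi (Suc n)" Vr Cr \<phi>r "kap (Suc n)" "Em n" by (rule key_padic_r)
  obtain H where H: "minimal_poly K H (poly \<phi>r \<theta>)" by (rule algebraic)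
  have "\<not> Em n * rv (poly \<phi>r \<theta>) \<le> real_of_int (Vr \<phi>r)" using N.small_value_C[OF G H False] C0 by blast
  moreover obtain q where "valn D (poly \<phi>r \<theta>) = ereal (of_rat q)"
    using valuation False unfolding is_valuation_def by blast
  hence q: "rv (poly \<phi>r \<theta>) = of_rat q" by (simp add: rv_def)
  define t where "t = of_int (Vr \<phi>r) - of_int (Em n) * q"
  have t: "real_of_rat t = real_of_int (Vr \<phi>r) - Em n * rv (poly \<phi>r \<theta>)"
    by (simp add: t_def q of_rat_diff of_rat_mult)
  ultimately have "real_of_rat t < 0" by simp
  hence "t < 0" by simp
  moreover have "sig G = ereal (of_rat t)" using sig_eq[OF G] False t by (simp add: root_slope_def)
  ultimately show ?thesis by blast
qed

text \<open>In order r no Bezout pair is prescribed, and any one will do: weights, sides and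
  residual polynomials do not involve it.\<close>

lemma rat_slope_r:
  assumes "q < 0"
  obtains l l' where "rat_slope K (Fi (Suc n)) Vr Cr \<phi>r (kap (Suc n)) q l l'"
proof -
  interpret N: key_padic p D "Fi (Suc n)" Vr Cr \<phi>r "kap (Suc n)" "Em n" by (rule key_padic_r)
  note sq = slope_quotient[OF assms]
  obtain u v where "u * slope_num q + v * slope_den q = gcd (slope_num q) (slope_den q)"
    using bezout_int by blast
  hence "u * slope_num q - (- v) * slope_den q = 1" using sq(3) by simp
  hence "rat_slope K (Fi (Suc n)) Vr Cr \<phi>r (kap (Suc n)) q u (- v)"
    by unfold_locales (use sq assms in auto)
  thus thesis by (rule that)
qed

end

locale top_slope = type_setting p D T n +
  rat_slope "fld D" "residue_field D T (Suc n)" "val D T (Suc n)" "coeff_class D T (Suc n)" "phi T (Suc n)" \<kappa> q l l'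
  for p and D :: "('a::{alg_closed_field,field_char_0}, 'k::alg_closed_field) padic_data"
    and T n \<kappa> q l l'
begin

sublocale slope_padic p D "residue_field D T (Suc n)" "val D T (Suc n)" "coeff_class D T (Suc n)"
    "phi T (Suc n)" \<kappa> "Em n" "slope_num q" "slope_den q" l l'
  by unfold_locales (use Em_pos[of n] Vi_const[of n] in auto)

lemma sig_pure:
  assumes G: "minimal_poly (fld D) G \<theta>" and sig: "sig G = ereal \<mu>"
  shows "pure G" "0 < L G" "Cr G (Vr G) = 0"
proof -
  have \<alpha>: "poly \<phi>r \<theta> \<noteq> 0" and eq: "\<mu> = real_of_int (Vr \<phi>r) - Em n * rv (poly \<phi>r \<theta>)"
    using sig sig_eq[OF G] by (auto simp: root_slope_def split: if_splits)
  obtain H where H: "minimal_poly (fld D) H (poly \<phi>r \<theta>)" by (rule algebraic)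
  have "real_of_int h = e * (- \<mu>)" using e \<mu>(1) by (simp add: field_simps)
  hence h': "real_of_int h = e * (Em n * rv (poly \<phi>r \<theta>) - Vr \<phi>r)" by (simp add: eq)
  show pure: "pure G" "0 < L G" using minimal_pure[OF G H \<alpha> h'] .
  have "G \<in> polys_over (fld D)" "monic G" using G by (auto simp: minimal_poly_def)
  thus "Cr G (Vr G) = 0" using pure_C_eq_0 pure(1) minimal_poly_degree_pos[OF G] by blast
qed

lemma sig_other:
  assumes G: "minimal_poly (fld D) G \<theta>" and sig: "sig G \<noteq> ereal \<mu>"
  shows "degree (R G) = 0"
proof (cases "poly \<phi>r \<theta> = 0")
  case True
  hence "G = \<phi>r" by (rule minimal_eq_\<phi>[OF G])
  thus ?thesis using R_\<phi> by simp
next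
  case False
  obtain H where H: "minimal_poly (fld D) H (poly \<phi>r \<theta>)" by (rule algebraic)
  have ne: "\<mu> \<noteq> real_of_int (Vr \<phi>r) - Em n * rv (poly \<phi>r \<theta>)"
    using sig sig_eq[OF G] False by (simp add: root_slope_def)
  have "real_of_int h = e * (- \<mu>)" using e \<mu>(1) by (simp add: field_simps)
  have "real_of_int h \<noteq> e * (Em n * rv (poly \<phi>r \<theta>) - Vr \<phi>r)"
  proof
    assume "real_of_int h = e * (Em n * rv (poly \<phi>r \<theta>) - Vr \<phi>r)"
    hence "real_of_int e * (- \<mu>) = real_of_int e * (Em n * rv (poly \<phi>r \<theta>) - Vr \<phi>r)"
      using \<open>real_of_int h = e * (- \<mu>)\<close> by simp
    moreover have "real_of_int e \<noteq> 0" using e by simp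
    ultimately have "- \<mu> = Em n * rv (poly \<phi>r \<theta>) - Vr \<phi>r" using mult_left_cancel by blast
    thus False using ne by simp
  qed
  from minimal_other_slope[OF G H False this] show ?thesis .
qed

lemma pure_prod_mset:
  assumes "\<And>G. G \<in># M \<Longrightarrow> G \<in> polys_over (fld D) \<and> monic G \<and> pure G"
  shows "pure (prod_mset M)"
  using assms
proof (induction M)
  case (add G M)
  have "prod_mset M \<in> polys_over (fld D)" "prod_mset M \<noteq> 0" "G \<noteq> 0"
    using add.prems polys_over_prod_mset[OF padic.KR[OF padic_axioms], of M] monic_prod_mset[of M] monic_nonzero by auto
  thus ?case using add pure_mult_iff[of G "prod_mset M"] by simp
qed (simp add: pure_1)

lemma constant_prod_mset:
  assumes "\<And>G. G \<in># M \<Longrightarrow> G \<in> polys_over (fld D) \<and> monic G \<and> degree (R G) = 0"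
  shows "degree (R (prod_mset M)) = 0"
  using assms
proof (induction M)
  case (add G M)
  have *: "prod_mset M \<in> polys_over (fld D)" "prod_mset M \<noteq> 0" "G \<noteq> 0" "G \<in> polys_over (fld D)"
    using add.prems polys_over_prod_mset[OF padic.KR[OF padic_axioms], of M] monic_prod_mset[of M] monic_nonzero by auto
  have "degree (R (prod_mset (add_mset G M))) = degree (R G) + degree (R (prod_mset M))"
    using W_mult(3)[OF *(4,3,1,2)] R_facts(4)[OF *(4,3)] R_facts(4)[OF *(1,2)] by (simp add: degree_mult_eq)
  thus ?case using add by simp
qed (simp add: pure_1)

text \<open>The factors of slope \<open>\<mu>\<close> are pure, while all others have constant
  residual polynomial for this slope. They shift the beginning of the side but change neither its
  length nor, up to a constant, its residual polynomial.\<close>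

lemma slope_factor:
  assumes M: "\<And>G. G \<in># M \<Longrightarrow> \<exists>\<theta>. minimal_poly (fld D) G \<theta>"
  defines "P \<equiv> prod_mset (filter_mset (\<lambda>G. sig G = ereal \<mu>) M)"
  shows "translate_of (newton_polygon Vr \<phi>r P) (side (principal_part (newton_polygon Vr \<phi>r (prod_mset M))) (ereal \<mu>))"
    "sim_over (Fi (Suc n)) (residual D T (Suc n) q P) (residual D T (Suc n) q (prod_mset M))"
    "G \<in># M \<Longrightarrow> sig G = ereal \<mu> \<Longrightarrow>
      \<mu> \<in> finite_slopes (principal_part (newton_polygon Vr \<phi>r (prod_mset M)))"
proof -
  have KR': "is_subring (fld D)" using padic.KR[OF padic_axioms] .
  have M': "G \<in> polys_over (fld D)" "monic G" if "G \<in># M" for G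
    using M[OF that] by (auto simp: minimal_poly_def)
  define X where "X = prod_mset (filter_mset (\<lambda>G. sig G \<noteq> ereal \<mu>) M)"
  have PX: "prod_mset M = P * X" unfolding P_def X_def by (rule prod_mset_filter_split)
  have K': "P \<in> polys_over (fld D)" "X \<in> polys_over (fld D)" "prod_mset M \<in> polys_over (fld D)"
    unfolding P_def X_def using M' by (auto intro!: polys_over_prod_mset[OF KR'])
  have mon: "monic P" "monic X" "monic (prod_mset M)"
    unfolding P_def X_def using M' by (auto intro!: monic_prod_mset)
  have nz: "P \<noteq> 0" "X \<noteq> 0" "prod_mset M \<noteq> 0" using mon monic_nonzero by auto
  have pure: "pure P" unfolding P_def
    using M M' sig_pure(1) by (intro pure_prod_mset) fastforce
  have RX0: "degree (R X) = 0" unfolding X_def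
    using M M' sig_other by (intro constant_prod_mset) fastforce
  have RM: "R (prod_mset M) = R P * R X" unfolding PX by (rule W_mult(3)[OF K'(1) nz(1) K'(2) nz(2)])
  obtain c where c: "R X = [:c:]" using RX0 by (metis degree_0_id)
  have c': "c \<in> Fi (Suc n)" "c \<noteq> 0"
    using R_facts(3,4)[OF K'(2) nz(2)] c by (auto simp: polys_over_pCons_iff)
  have degR: "degree (R (prod_mset M)) = degree (R P)" unfolding RM c using c' by simp
  have LP: "L P = degree (R P) * nat e" using R_facts(2)[OF K'(1) nz(1)] pure by (simp add: pure_def)
  have LM: "L (prod_mset M) = s (prod_mset M) + L P" using R_facts(2)[OF K'(3) nz(3)] degR LP by simp
  show "sim_over (Fi (Suc n)) (residual D T (Suc n) q P) (residual D T (Suc n) q (prod_mset M))"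
    unfolding residual_def residual_poly_eq[OF K'(1) nz(1)] residual_poly_eq[OF K'(3) nz(3)] RM c sim_over_def
    using c' subfield_inverse[OF F c'(1)] by (intro bexI[of _ "inverse c"]) auto
  have p: "s P = 0" "L P * degree \<phi>r = degree P" using pure by (auto simp: pure_def)
  note one = one_sided_newton[OF K'(1) nz(1) mon(1) p]
  show "translate_of (newton_polygon Vr \<phi>r P) (side (principal_part (newton_polygon Vr \<phi>r (prod_mset M))) (ereal \<mu>))"
    unfolding translate_of_def side_def
  proof (simp add: one(1), rule exI, rule exI)
    \<comment> \<open>The translation carries the initial point of the side of the product to the
      point of \<open>P\<close> at abscissa 0.\<close>
    let ?a = "real (s (prod_mset M))" and ?b = "ords (prod_mset M) (s (prod_mset M))"
    show "fin (newton_polygon Vr \<phi>r P) = (\<lambda>x. (- ?a, ords P 0 - ?b) + x) `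
        face \<mu> (fin (principal_part (newton_polygon Vr \<phi>r (prod_mset M))))"
      unfolding one(2) face_principal_eq[OF K'(3) nz(3)] LM
    proof (intro equalityI subrelI)
      fix x y assume "(x, y) \<in> {(x, y). 0 \<le> x \<and> x \<le> real (L P) \<and> y = ords P 0 + \<mu> * x}"
      hence xy: "0 \<le> x" "x \<le> real (L P)" "y = ords P 0 + \<mu> * x" by auto
      show "(x, y) \<in> (\<lambda>x. (- ?a, ords P 0 - ?b) + x) `
         {(x, y). ?a \<le> x \<and> x \<le> real (s (prod_mset M) + L P) \<and> y = ?b - \<mu> * ?a + \<mu> * x}"
        by (rule image_eqI[of _ _ "(x + ?a, y - (ords P 0 - ?b))"]) (use xy in \<open>auto simp: algebra_simps\<close>)
    qed (auto simp: algebra_simps)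
  qed
  assume G: "G \<in># M" "sig G = ereal \<mu>"
  obtain \<theta> where \<theta>: "minimal_poly (fld D) G \<theta>" using M[OF G(1)] by blast
  obtain M1 where M1: "filter_mset (\<lambda>G. sig G = ereal \<mu>) M = add_mset G M1"
    using G by (metis (mono_tags) mset_add mem_Collect_eq set_mset_filter)
  have "degree P > 0"
  proof -
    have "G dvd P" unfolding P_def M1 by simp
    thus ?thesis using dvd_imp_degree_le[OF _ nz(1)] minimal_poly_degree_pos[OF \<theta>] by fastforce
  qed
  hence "0 < L P" using p(2) by (cases "L P") auto
  thus "\<mu> \<in> finite_slopes (principal_part (newton_polygon Vr \<phi>r (prod_mset M)))"
    using slope_in_principal_iff[OF K'(3) nz(3)] LM by simp
qed

end

section \<open>The theorem of the polygon\<close>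

context type_setting
begin

lemma key_r: "key_poly K (Fi (Suc n)) Vr Cr \<phi>r (kap (Suc n))"
  using key_all[of "Suc n"] by (simp add: key_def)

text \<open>Slopes of a polygon are real numbers a priori, whereas residual polynomials need a
  rational one; a side joins two points with integer coordinates.\<close>

lemma finite_slope_rational:
  assumes f: "f \<noteq> 0" and x: "x \<in> finite_slopes (principal_part (newton_polygon Vr \<phi>r f))"
  shows "\<exists>q<0. x = of_rat q"
proof -
  interpret N: key_poly K "Fi (Suc n)" Vr Cr \<phi>r "kap (Suc n)" by (rule key_r)
  interpret G: graph_polygon "N.pts f" "N.ords f" "newton_polygon Vr \<phi>r f" by (rule N.newton_graph_polygon[OF f])
  have x: "x < 0" "x \<in> finite_slopes (newton_polygon Vr \<phi>r f)" using x G.finite_slopes_principal by auto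
  define a where "a = Min (min_indices x (N.pts f) (N.ords f))"
  define b where "b = Max (min_indices x (N.pts f) (N.ords f))"
  have "a < b" using x(2) finite_slopes_iff[OF G.J G.fin_N] by (simp add: a_def b_def)
  have "a \<in> min_indices x (N.pts f) (N.ords f)" "b \<in> min_indices x (N.pts f) (N.ords f)"
    using finite_min_indices[OF G.J(1)] min_indices_nonempty[OF G.J] by (auto simp: a_def b_def)
  hence "N.ords f b - N.ords f a = x * (real b - real a)"
    using min_indices_eq by (fastforce simp: algebra_simps)
  hence "x = (N.ords f b - N.ords f a) / (real b - real a)" using \<open>a < b\<close> by (simp add: field_simps)
  also obtain va vb :: int where "N.ords f b = of_int vb" "N.ords f a = of_int va" by (simp add: N.ords_def)
  hence "(N.ords f b - N.ords f a) / (real b - real a) =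
      of_rat ((of_int vb - of_int va) / (of_nat b - of_nat a))"
    by (simp add: of_rat_divide of_rat_diff)
  finally have "x = of_rat ((of_int vb - of_int va) / (of_nat b - of_nat a))" .
  thus ?thesis using x(1) by (intro exI[of _ "(of_int vb - of_int va) / (of_nat b - of_nat a)"]) auto
qed

text \<open>The development of \<open>\<phi>r ^ k\<close> has a single term, so its polygon is an
  infinite side of length \<open>k\<close> ending in one point. It only has to be moved to the first
  vertex of the polygon of \<open>f\<close>.\<close>

lemma infinite_side:
  assumes f: "f = \<phi>r ^ k * X" "X \<noteq> 0" "\<not> \<phi>r dvd X"
  shows "translate_of (newton_polygon Vr \<phi>r (\<phi>r ^ k)) (side (principal_part (newton_polygon Vr \<phi>r f)) (-\<infinity>))"
    "ord_at \<phi>r f = k"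
proof -
  interpret N: key_poly K "Fi (Suc n)" Vr Cr \<phi>r "kap (Suc n)" by (rule key_r)
  have nz: "f \<noteq> 0" "\<phi>r ^ k \<noteq> 0" using f N.\<phi>_nz by auto
  interpret G: graph_polygon "N.pts f" "N.ords f" "newton_polygon Vr \<phi>r f" by (rule N.newton_graph_polygon[OF nz(1)])
  show ord: "ord_at \<phi>r f = k"
  proof (rule ord_at_eqI[OF N.\<phi>_deg nz(1)])
    show "\<phi>r ^ k dvd f" by (simp add: f(1))
    have "\<phi>r ^ Suc k dvd f \<longleftrightarrow> \<phi>r ^ k * \<phi>r dvd \<phi>r ^ k * X" by (simp add: f(1) mult.commute)
    thus "\<not> \<phi>r ^ Suc k dvd f" using f(3) nz(2) by (simp only: dvd_mult_cancel_left) simp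
  qed
  have ord': "ord_at \<phi>r (\<phi>r ^ k) = k"
  proof (rule ord_at_eqI[OF N.\<phi>_deg nz(2)])
    have "\<phi>r ^ Suc k dvd \<phi>r ^ k \<Longrightarrow> Suc k * degree \<phi>r \<le> k * degree \<phi>r"
      using dvd_imp_degree_le[OF _ nz(2), of "\<phi>r ^ Suc k"] N.\<phi>_nz
      by (simp add: degree_power_eq del: power_Suc)
    thus "\<not> \<phi>r ^ Suc k dvd \<phi>r ^ k" using N.\<phi>_deg by auto
  qed simp
  have ad: "adic \<phi>r (\<phi>r ^ k) j = (if j = k then 1 else 0)" for j
    using adic_monomial[OF N.\<phi>_deg, of 1 k j] N.\<phi>_deg by simp
  have fin: "fin (newton_polygon Vr \<phi>r (\<phi>r ^ k)) = {(real k, real_of_int (Vr (\<phi>r ^ k)))}"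
    by (auto simp: newton_polygon_def ad lower_hull_def)
  define v where "v = (real (Min (N.pts f)), N.ords f (Min (N.pts f)))"
  define w where "w = (real k, real_of_int (Vr (\<phi>r ^ k))) - v"
  have "fin (newton_polygon Vr \<phi>r (\<phi>r ^ k)) =
      (\<lambda>q. w + q) ` first_vertex (fin (principal_part (newton_polygon Vr \<phi>r f)))"
    unfolding fin G.first_vertex_principal v_def[symmetric] by (simp add: w_def)
  moreover have "inf_len (newton_polygon Vr \<phi>r (\<phi>r ^ k)) = inf_len (principal_part (newton_polygon Vr \<phi>r f))"
    using ord ord' by (simp add: newton_polygon_def principal_part_def)
  ultimately show "translate_of (newton_polygon Vr \<phi>r (\<phi>r ^ k)) (side (principal_part (newton_polygon Vr \<phi>r f)) (-\<infinity>))"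
    unfolding translate_of_def side_def by (simp del: split_paired_Ex) blast
qed

theorem polygon_factorization:
  assumes f: "f \<in> polys_over \<O>" "monic f" and om: "omega D T (Suc n) f > 0"
    and bij: "bij_betw \<mu> {1..g} (slopes (newton_minus D T (Suc n) f))"
  shows "\<exists>F :: nat \<Rightarrow> 'a poly. type_part D n T f = (\<Prod>i=1..g. F i) \<and>
    (\<forall>i\<in>{1..g}. F i \<in> polys_over \<O> \<and> monic (F i) \<and>
       translate_of (newton D T (Suc n) (F i)) (side (newton_minus D T (Suc n) f) (\<mu> i)) \<and>
       (\<forall>q::rat. \<mu> i = ereal (of_rat q) \<longrightarrow>
          sim_over (Fi (Suc n)) (residual D T (Suc n) q (F i)) (residual D T (Suc n) q f)) \<and>
       (\<forall>\<theta>. poly (F i) \<theta> = 0 \<longrightarrow>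
          valn D (poly \<phi>r \<theta>) = (ereal (of_int (Vr \<phi>r)) + \<bar>\<mu> i\<bar>) / ereal (of_int (Em n))))"
proof -
  interpret N: key_padic p D "Fi (Suc n)" Vr Cr \<phi>r "kap (Suc n)" "Em n" by (rule key_padic_r)
  have fK: "f \<in> polys_over K" "f \<noteq> 0" using OK_poly f monic_nonzero by auto
  obtain M where M: "f = prod_mset M" "\<And>G. G \<in># M \<Longrightarrow> \<exists>\<theta>. minimal_poly K G \<theta>"
    using minimal_poly_factorization[OF fK(1) f(2)] by blast
  have MK: "G \<in> polys_over K" "monic G" if "G \<in># M" for G
    using M(2)[OF that] by (auto simp: minimal_poly_def)
  have MO: "G \<in> polys_over \<O>" if "G \<in># M" for G
    by (rule prod_mset_integral[of M]) (use f M MK that in auto)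
  \<comment> \<open>For the integral minimal polynomials in \<open>M\<close> this equation is
    equivalent to having the type: \<open>C_imp_has_type\<close> gives one direction and
    \<open>has_type_factor_C\<close> the other.\<close>
  define tp where "tp = (\<lambda>G. Cr G (Vr G) = 0)"
  define Mt where "Mt = filter_mset tp M"
  define f' where "f' = prod_mset (filter_mset (\<lambda>G. \<not> tp G) M)"
  define ft where "ft = prod_mset Mt"
  have f_eq: "f = ft * f'" unfolding M(1) ft_def f'_def Mt_def by (rule prod_mset_filter_split)
  have Mt_M: "G \<in># M" "tp G" if "G \<in># Mt" for G using that by (auto simp: Mt_def)
  have f'O: "f' \<in> polys_over \<O>" unfolding f'_def by (rule polys_over_prod_mset[OF OR]) (auto simp: MO)
  have mon: "monic ft" "monic f'" unfolding ft_def f'_def Mt_def using MK by (auto intro!: monic_prod_mset)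
  have type_G: "has_type D n T G" if G: "G \<in># Mt" for G
  proof -
    obtain \<theta> where "minimal_poly K G \<theta>" using M(2)[OF Mt_M(1)[OF G]] by blast
    thus ?thesis using C_imp_has_type MO Mt_M[OF G] by (auto simp: tp_def)
  qed
  \<comment> \<open>The polynomial 1 does not have the type, because all exponents must be positive.
    Positivity of \<open>omega\<close> makes \<open>psi T n\<close> divide the residual polynomial
    of \<open>f\<close>, so the class of \<open>f\<close> vanishes, and by multiplicativity so does
    that of some factor.\<close>
  have "Mt \<noteq> {#}"
  proof
    assume "Mt = {#}"
    have nt: "\<not> tp G" if "G \<in># M" for G
    proof
      assume "tp G"
      hence "G \<in># Mt" using that by (simp add: Mt_def)
      thus False using \<open>Mt = {#}\<close> by simp
    qed
    have n: "n \<in> {1..n}" using n_pos by simp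
    interpret S: rat_slope K "Fi n" "Vi n" "Ci n" "phi T n" "kap n" "lam T n" "ell T n" "ell' T n"
      by (rule key_rat_slope[OF key_all n]) (use n in auto)
    have "0 < ord_at (psi T n) (residual D T n (lam T n) f)" using om n_pos by (simp add: omega_def)
    moreover have "residual D T n (lam T n) f \<noteq> 0"
      using residual_R[OF key_all n fK] n S.R_facts(4)[OF fK] by simp
    moreover have "0 < degree (psi T n)" using minimal_poly_degree_pos[OF key_minimal[OF key_all n]] n by simp
    ultimately have "psi T n dvd residual D T n (lam T n) f" using ord_at_eq_0_iff by (metis less_irrefl)
    hence "poly (residual D T n (lam T n) f) (zee T n) = 0" using psi_type(3)[of n] by (auto elim!: dvdE)
    hence C0: "Cr f (Vr f) = 0" using Ci_Suc[OF key_all n fK] n by simp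
    have "Cr (prod_mset A) (Vr (prod_mset A)) \<noteq> 0" if "A \<subseteq># M" for A
      using that
    proof (induction A)
      case empty
      show ?case using N.C_nonzero[of 1] polys_over_1[OF KR] N.\<phi>_deg by simp
    next
      case (add G A)
      hence GA: "G \<in># M" "A \<subseteq># M" "\<And>G. G \<in># A \<Longrightarrow> G \<in># M"
        by (auto dest: mset_subset_eqD mset_subset_eq_insertD subset_mset.less_imp_le)
      have A: "prod_mset A \<in> polys_over K" "monic (prod_mset A)"
        using MK GA(3) by (auto intro!: polys_over_prod_mset[OF KR] monic_prod_mset)
      show ?case
        using N.C_prod_eq_0_iff[OF MK(1)[OF GA(1)] A(1) monic_nonzero[OF MK(2)[OF GA(1)]] monic_nonzero[OF A(2)]]
          add.IH[OF GA(2)] nt[OF GA(1)] by (simp add: tp_def)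
    qed
    thus False using C0 M(1) by auto
  qed
  have type_prod: "A \<noteq> {#} \<Longrightarrow> (\<And>G. G \<in># A \<Longrightarrow> has_type D n T G) \<Longrightarrow> has_type D n T (prod_mset A)" for A
  proof (induction A)
    case (add G A)
    thus ?case by (cases "A = {#}") (auto intro: has_type_mult)
  qed simp
  have type_ft: "has_type D n T ft" unfolding ft_def using type_prod[OF \<open>Mt \<noteq> {#}\<close> type_G] .
  define divisor where "divisor = (\<lambda>H. has_type D n T H \<and> (\<exists>Q\<in>polys_over \<O>. f = H * Q))"
  have div_ft: "divisor ft" unfolding divisor_def using type_ft f'O f_eq by blast
  \<comment> \<open>A common root of \<open>H\<close> and \<open>f'\<close> would belong to a
    minimal polynomial that divides \<open>H\<close>, hence satisfies \<open>tp\<close>, although it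
    was sorted into \<open>f'\<close>.\<close>
  have max: "H dvd ft" if H: "divisor H" for H
  proof -
    obtain Q where Q: "Q \<in> polys_over \<O>" "f = H * Q" and tH: "has_type D n T H" using H by (auto simp: divisor_def)
    have HO: "H \<in> polys_over \<O>" "monic H" using tH unfolding has_type_def by blast+
    have "poly f' \<theta> \<noteq> 0" if \<theta>: "poly H \<theta> = 0" for \<theta>
    proof
      assume "poly f' \<theta> = 0"
      then obtain G where G: "G \<in># M" "\<not> tp G" "poly G \<theta> = 0" by (auto simp: f'_def poly_prod_mset_eq_0)
      obtain \<theta>' where "minimal_poly K G \<theta>'" using M(2)[OF G(1)] by blast
      hence Gmin: "minimal_poly K G \<theta>" using minimal_poly_root[OF K _ G(3)] by blast
      note d = minimal_poly_dvd[OF K Gmin OK_poly[OF HO(1)] \<theta>]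
      have "H div G \<noteq> 0" using d(2) monic_nonzero[OF HO(2)] by auto
      hence "Cr G (Vr G) = 0"
        using has_type_factor_C[of G "H div G"] tH d(2,3) MK[OF G(1)] monic_nonzero minimal_poly_degree_pos[OF Gmin]
        by metis
      thus False using G(2) by (simp add: tp_def)
    qed
    moreover have "H dvd ft * f'" using Q(2) f_eq by auto
    ultimately show ?thesis using dvd_of_no_common_root[of H ft f'] monic_nonzero[OF HO(2)] by blast
  qed
  have tpart: "type_part D n T f = ft"
    unfolding type_part_def Let_def
  proof (rule the_equality)
    show "(has_type D n T ft \<and> (\<exists>Q\<in>polys_over \<O>. f = ft * Q)) \<and>
      (\<forall>H. has_type D n T H \<and> (\<exists>Q\<in>polys_over \<O>. f = H * Q) \<longrightarrow> degree H \<le> degree ft)"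
      using div_ft max dvd_imp_degree_le[OF _ monic_nonzero[OF mon(1)]] unfolding divisor_def by blast
  next
    fix G assume G: "(has_type D n T G \<and> (\<exists>Q\<in>polys_over \<O>. f = G * Q)) \<and>
      (\<forall>H. has_type D n T H \<and> (\<exists>Q\<in>polys_over \<O>. f = H * Q) \<longrightarrow> degree H \<le> degree G)"
    \<comment> \<open>Maximal degree determines the divisor, as any other candidate divides
      \<open>ft\<close>, has the same degree and is monic. This uniqueness justifies
      \<open>THE\<close> in \<open>type_part\<close>.\<close>
    hence "divisor G" "degree ft \<le> degree G" using div_ft by (auto simp: divisor_def)
    then obtain X where X: "ft = G * X" using max by blast
    have mG: "monic G" using G unfolding has_type_def by blast
    have mX: "monic X" using X mG mon(1) monic_factor by metis
    have "degree ft = degree G + degree X" unfolding X using mG mX by (intro degree_mult_eq) (auto simp: monic_nonzero)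
    hence "degree X = 0" using \<open>degree ft \<le> degree G\<close> by simp
    with mX have "X = 1" by (rule monic_degree_0)
    thus "G = ft" using X by simp
  qed
  have nm: "newton_minus D T (Suc n) f = principal_part (newton_polygon Vr \<phi>r f)"
    by (simp add: newton_minus_def newton_def)
  have slope_q: "translate_of (newton_polygon Vr \<phi>r P) (side (principal_part (newton_polygon Vr \<phi>r f)) (ereal (of_rat q)))"
    "sim_over (Fi (Suc n)) (residual D T (Suc n) q P) (residual D T (Suc n) q f)"
    "\<And>G. G \<in># M \<Longrightarrow> sig G = ereal (of_rat q) \<Longrightarrow> of_rat q \<in> finite_slopes (principal_part (newton_polygon Vr \<phi>r f))"
    if q: "q < 0" and P: "P = prod_mset (filter_mset (\<lambda>G. sig G = ereal (of_rat q)) Mt)" for q P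
  proof -
    obtain l l' where "rat_slope K (Fi (Suc n)) Vr Cr \<phi>r (kap (Suc n)) q l l'" using rat_slope_r[OF q] .
    then interpret S: rat_slope K "Fi (Suc n)" Vr Cr \<phi>r "kap (Suc n)" q l l' .
    interpret top_slope p D T n "kap (Suc n)" q l l' by unfold_locales
    \<comment> \<open>A finite negative slope implies purity and thereby \<open>tp\<close>, so all
      factors of this slope are already among those of the type.\<close>
    have "filter_mset (\<lambda>G. sig G = ereal (of_rat q)) Mt = filter_mset (\<lambda>G. sig G = ereal (of_rat q)) M"
      unfolding Mt_def filter_filter_mset using M(2) sig_pure(3)
      by (intro filter_mset_cong refl) (auto simp: tp_def)
    hence P': "P = prod_mset (filter_mset (\<lambda>G. sig G = ereal (of_rat q)) M)" using P by simp
    show "translate_of (newton_polygon Vr \<phi>r P) (side (principal_part (newton_polygon Vr \<phi>r f)) (ereal (of_rat q)))"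
      "sim_over (Fi (Suc n)) (residual D T (Suc n) q P) (residual D T (Suc n) q f)"
      unfolding P' M(1) using slope_factor(1,2)[OF M(2)] by auto
    show "\<And>G. G \<in># M \<Longrightarrow> sig G = ereal (of_rat q) \<Longrightarrow>
        of_rat q \<in> finite_slopes (principal_part (newton_polygon Vr \<phi>r f))"
      unfolding M(1) using slope_factor(3)[OF M(2)] by auto
  qed
  have inf_part: "filter_mset (\<lambda>G. sig G = -\<infinity>) Mt = replicate_mset (count M \<phi>r) \<phi>r"
  proof -
    have "filter_mset (\<lambda>G. sig G = -\<infinity>) Mt = filter_mset (\<lambda>G. G = \<phi>r) M"
      unfolding Mt_def filter_filter_mset using M(2) sig_minus_inf C_\<phi>r
      by (intro filter_mset_cong refl) (auto simp: tp_def)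
    thus ?thesis by (simp add: filter_eq_replicate_mset)
  qed
  define X where "X = prod_mset (filter_mset (\<lambda>G. G \<noteq> \<phi>r) M)"
  have fX: "f = \<phi>r ^ count M \<phi>r * X"
    using prod_mset_filter_split[of M "\<lambda>G. G = \<phi>r"] by (simp add: M(1) X_def filter_eq_replicate_mset)
  have X0: "X \<noteq> 0" using fX fK by auto
  \<comment> \<open>A root of \<open>\<phi>r\<close> has \<open>\<phi>r\<close> itself as minimal
    polynomial, but every copy of it has been removed from \<open>X\<close>.\<close>
  have ndvd: "\<not> \<phi>r dvd X"
  proof
    assume d: "\<phi>r dvd X"
    obtain \<theta> where \<theta>: "poly \<phi>r \<theta> = 0" using alg_closed_imp_poly_has_root[OF N.\<phi>_deg] by blast
    hence "poly X \<theta> = 0" using d by (auto elim!: dvdE)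
    then obtain G where G: "G \<in># M" "G \<noteq> \<phi>r" "poly G \<theta> = 0" by (auto simp: X_def poly_prod_mset_eq_0)
    obtain \<theta>' where "minimal_poly K G \<theta>'" using M(2)[OF G(1)] by blast
    hence "minimal_poly K G \<theta>" using minimal_poly_root[OF K _ G(3)] by blast
    thus False using N.minimal_eq_\<phi> \<theta> G(2) by blast
  qed
  note inf = infinite_side[OF fX X0 ndvd]
  have sig_slope: "sig G \<in> slopes (newton_minus D T (Suc n) f)" if G: "G \<in># Mt" for G
  proof -
    obtain \<theta> where \<theta>: "minimal_poly K G \<theta>" using M(2)[OF Mt_M(1)[OF G]] by blast
    consider "sig G = -\<infinity>" | q where "q < 0" "sig G = ereal (of_rat q)"
      using sig_rational[OF \<theta>] Mt_M[OF G] by (auto simp: tp_def)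
    thus ?thesis
    proof cases
      case 1
      hence "\<phi>r \<in># M" using sig_minus_inf[OF \<theta>] Mt_M[OF G] by simp
      hence "0 < ord_at \<phi>r f" using inf(2) by simp
      thus ?thesis using 1 by (simp add: slopes_def nm principal_part_def newton_polygon_def)
    next
      case 2
      thus ?thesis using slope_q(3)[OF 2(1) refl] Mt_M(1)[OF G] by (auto simp: slopes_def nm)
    qed
  qed
  define F where "F = (\<lambda>i. prod_mset (filter_mset (\<lambda>G. sig G = \<mu> i) Mt))"
  have "ft = (\<Prod>i=1..g. F i)"
    unfolding ft_def F_def
  proof (rule prod_mset_partition)
    fix G assume "G \<in># Mt"
    hence "sig G \<in> \<mu> ` {1..g}" using sig_slope bij by (simp add: bij_betw_def)
    then obtain i where i: "i \<in> {1..g}" "sig G = \<mu> i" by blast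
    show "\<exists>!i. i \<in> {1..g} \<and> sig G = \<mu> i"
    proof (rule ex1I[of _ i])
      fix j assume j: "j \<in> {1..g} \<and> sig G = \<mu> j"
      have "\<mu> j = \<mu> i" using j i(2) by metis
      from inj_onD[OF bij_betw_imp_inj_on[OF bij] this] show "j = i" using j i(1) by blast
    qed (use i in blast)
  qed simp
  moreover have "F i \<in> polys_over \<O> \<and> monic (F i) \<and>
       translate_of (newton D T (Suc n) (F i)) (side (newton_minus D T (Suc n) f) (\<mu> i)) \<and>
       (\<forall>q::rat. \<mu> i = ereal (of_rat q) \<longrightarrow>
          sim_over (Fi (Suc n)) (residual D T (Suc n) q (F i)) (residual D T (Suc n) q f)) \<and>
       (\<forall>\<theta>. poly (F i) \<theta> = 0 \<longrightarrow>
          valn D (poly \<phi>r \<theta>) = (ereal (of_int (Vr \<phi>r)) + \<bar>\<mu> i\<bar>) / ereal (of_int (Em n)))"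
    if i: "i \<in> {1..g}" for i
  proof (intro conjI allI impI)
    show "F i \<in> polys_over \<O>" "monic (F i)"
      unfolding F_def using MO MK Mt_M by (auto intro!: polys_over_prod_mset[OF OR] monic_prod_mset)
    have \<mu>i: "\<mu> i = -\<infinity> \<or> (\<exists>q<0. \<mu> i = ereal (of_rat q))"
    proof -
      have "\<mu> i \<in> slopes (newton_minus D T (Suc n) f)" using bij i by (auto simp: bij_betw_def)
      thus ?thesis using finite_slope_rational[OF fK(2)] by (auto simp: slopes_def nm split: if_splits)
    qed
    show "translate_of (newton D T (Suc n) (F i)) (side (newton_minus D T (Suc n) f) (\<mu> i))"
      using \<mu>i
    proof
      assume m: "\<mu> i = -\<infinity>"
      hence "F i = \<phi>r ^ count M \<phi>r" unfolding F_def by (simp add: inf_part)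
      thus ?thesis using inf(1) m by (simp add: newton_def nm)
    next
      assume "\<exists>q<0. \<mu> i = ereal (of_rat q)"
      then obtain q where q: "q < 0" "\<mu> i = ereal (of_rat q)" by blast
      have "F i = prod_mset (filter_mset (\<lambda>G. sig G = ereal (of_rat q)) Mt)" by (simp add: F_def q)
      thus ?thesis using slope_q(1)[OF q(1)] q(2) by (simp add: newton_def nm)
    qed
    fix q :: rat assume q: "\<mu> i = ereal (of_rat q)"
    then obtain q' where "q' < 0" "ereal (real_of_rat q) = ereal (real_of_rat q')" using \<mu>i by auto
    hence "q < 0" by simp
    moreover have "F i = prod_mset (filter_mset (\<lambda>G. sig G = ereal (of_rat q)) Mt)" by (simp add: F_def q)
    ultimately show "sim_over (Fi (Suc n)) (residual D T (Suc n) q (F i)) (residual D T (Suc n) q f)"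
      by (rule slope_q(2))
  next
    fix \<theta> assume "poly (F i) \<theta> = 0"
    then obtain G where G: "G \<in># Mt" "sig G = \<mu> i" "poly G \<theta> = 0" by (auto simp: F_def poly_prod_mset_eq_0)
    obtain \<theta>' where "minimal_poly K G \<theta>'" using M(2)[OF Mt_M(1)[OF G(1)]] by blast
    hence Gmin: "minimal_poly K G \<theta>" using minimal_poly_root[OF K _ G(3)] by blast
    have E: "0 < Em n" by (rule Em_pos) simp
    have rs: "\<mu> i = root_slope \<theta>" using sig_eq[OF Gmin] G(2) by simp
    show "valn D (poly \<phi>r \<theta>) = (ereal (of_int (Vr \<phi>r)) + \<bar>\<mu> i\<bar>) / ereal (of_int (Em n))"
    proof (cases "poly \<phi>r \<theta> = 0")
      case True
      hence "\<mu> i = -\<infinity>" "valn D (poly \<phi>r \<theta>) = \<infinity>" using rs valn_0 by (auto simp: root_slope_def)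
      \<comment> \<open>On the side of slope \<open>-\<infinity>\<close> both members of the
        equation are \<open>\<infinity>\<close>.\<close>
      thus ?thesis using E by simp
    next
      case False
      obtain q where "q < 0" "\<mu> i = ereal (of_rat q)"
        using sig_rational[OF Gmin] Mt_M(2)[OF G(1)] rs False G(2) by (auto simp: tp_def root_slope_def)
      moreover have m: "\<mu> i = ereal (real_of_int (Vr \<phi>r) - Em n * rv (poly \<phi>r \<theta>))"
        using rs False by (simp add: root_slope_def)
      \<comment> \<open>The sign resolves the absolute value of the slope, after which the formula
        is the definition of \<open>root_slope\<close> solved for the valuation.\<close>
      ultimately have "real_of_int (Vr \<phi>r) - Em n * rv (poly \<phi>r \<theta>) < 0" by auto
      hence "\<bar>\<mu> i\<bar> = ereal (Em n * rv (poly \<phi>r \<theta>) - Vr \<phi>r)" by (simp add: m)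
      thus ?thesis using E valn_eq[OF False] by simp
    qed
  qed
  ultimately show ?thesis unfolding tpart by (intro exI[of _ F]) blast
qed

end

theorem theorem3p1:
  fixes p r g :: nat
    and D :: "('a::{alg_closed_field,field_char_0}, 'k::alg_closed_field) padic_data"
    and T :: "('a, 'k) type_data"
    and f :: "'a poly"
    and \<mu> :: "nat \<Rightarrow> ereal"
  assumes "padic_setting p D"
    and "2 \<le> r"
    and "is_type D (r - 1) T"
    and "is_representative D (r - 1) T (phi T r)"
    and "f \<in> polys_over (int_ring D)" and "monic f"
    and "omega D T r f > 0"
    and "bij_betw \<mu> {1..g} (slopes (newton_minus D T r f))"
  shows "\<exists>F :: nat \<Rightarrow> 'a poly.
    type_part D (r - 1) T f = (\<Prod>i=1..g. F i) \<and>
    (\<forall>i\<in>{1..g}.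
       F i \<in> polys_over (int_ring D) \<and> monic (F i) \<and>
       translate_of (newton D T r (F i)) (side (newton_minus D T r f) (\<mu> i)) \<and>
       (\<forall>q::rat. \<mu> i = ereal (of_rat q) \<longrightarrow>
          sim_over (residue_field D T r) (residual D T r q (F i)) (residual D T r q f)) \<and>
       (\<forall>\<theta>. poly (F i) \<theta> = 0 \<longrightarrow>
          valn D (poly (phi T r) \<theta>) =
            (ereal (of_int (val D T r (phi T r))) + \<bar>\<mu> i\<bar>)
              / ereal (of_int (\<Prod>k=1..r-1. e_of T k))))"
proof -
  obtain n where r: "r = Suc n" using assms(2) by (cases r) auto
  interpret type_setting p D T n
    by unfold_locales (use assms(1,3,4) in \<open>simp_all add: r\<close>)
  show ?thesis using polygon_factorization[OF assms(5,6), of \<mu> g] assms(7,8) unfolding r Em_def by simp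
qed

end
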